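(* Assume the observation scheme (O) with some sequence $m=m_n$ and the condition (I) on the initial value described in the context, and let $\sigma>0$ be constant. Then the estimator $$\hat\sigma_{n,m}^2=\frac{\sqrt{\pi\vartheta_2}}{m\,n\sqrt{\Delta_n}}\sum_{j=1}^m\sum_{i=1}^n(\Delta_iX)^2(y_j)\exp(y_j\,\vartheta_1/\vartheta_2)$$ obeys, as $n\to\infty$, the central limit theorem $$(m_n\cdot n)^{1/2}\big(\hat\sigma_{n,m_n}^2-\sigma^2\big)\stackrel{d}{\rightarrow}\mathcal N\big(0,\pi\Gamma\sigma^4\big),$$ where $$\Gamma=\frac1\pi\sum_{r=0}^\infty I(r)^2+\frac2\pi,\qquad I(r)=2\sqrt{r+1}-\sqrt{r+2}-\sqrt r$$ (numerically $\Gamma\approx0.75$).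
   Context: Model. Let $\vartheta=(\vartheta_0,\vartheta_1,\vartheta_2)$ with $\vartheta_0,\vartheta_1\in\mathbb R$, $\vartheta_2>0$. For $k\ge1$ put $e_k(y)=\sqrt2\,\sin(\pi k y)\exp(-\tfrac{\vartheta_1}{2\vartheta_2}y)$, $y\in[0,1]$, and $\lambda_k=-\vartheta_0+\tfrac{\vartheta_1^2}{4\vartheta_2}+\pi^2k^2\vartheta_2$; it is assumed that $\lambda_k>0$ for all $k$. The $e_k$ form an orthonormal basis of $H_\vartheta=\{f:[0,1]\to\mathbb R:\|f\|_\vartheta<\infty\}$, $\langle f,g\rangle_\vartheta=\int_0^1e^{y\vartheta_1/\vartheta_2}f(y)g(y)\,dy$, $\|f\|_\vartheta^2=\langle f,f\rangle_\vartheta$. Let $(W^k)_{k\ge1}$ be independent standard Brownian motions and $\xi$ an $H_\vartheta$-valued random variable independent of $(W^k)_{k\ge1}$. $X$ is the (time-space continuous version of the) mild solution of $dX_t(y)=\big(\vartheta_2\partial_y^2X_t(y)+\vartheta_1\partial_yX_t(y)+\vartheta_0X_t(y)\big)dt+\sigma\,dB_t(y)$ on $[0,1]$ with $X_0=\xi$, $X_t(0)=X_t(1)=0$ and cylindrical Brownian motion $B$, that is, $$X_t(y)=\sum_{k\ge1}x_k(t)e_k(y),\qquad x_k(t)=e^{-\lambda_kt}\langle\xi,e_k\rangle_\vartheta+\int_0^te^{-\lambda_k(t-s)}\sigma\,dW^k_s.$$ (O) Observations: $X$ is observed at $(t_i,y_j)\in[0,1]^2$, $t_i=i\Delta_n$,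 $i=0,\dots,n$, $n\Delta_n=1$, $n\to\infty$, and $\delta\le y_1<\dots<y_m\le1-\delta$ for a fixed $\delta>0$; either $m$ is fixed or $m=m_n\to\infty$ with $m_n=\mathcal O(n^\rho)$ for some $\rho\in(0,1/2)$; $m\cdot\min_{2\le j\le m}|y_j-y_{j-1}|$ is bounded from below (by a positive constant), uniformly in $n$. (I) Initial value: (i) either $\mathbb E[\langle\xi,e_k\rangle_\vartheta]=0$ for all $k\ge1$ and $\sup_k\lambda_k\mathbb E[\langle\xi,e_k\rangle_\vartheta^2]<\infty$, or $\mathbb E\big[\sum_{k\ge1}\lambda_k\langle\xi,e_k\rangle_\vartheta^2\big]<\infty$ (the latter is the condition $\mathbb E[\|A_\vartheta^{1/2}\xi\|_\vartheta^2]<\infty$ for the differential operator $A_\vartheta$ with eigenvalues $-\lambda_k$); (ii) $(\langle\xi,e_k\rangle_\vartheta)_{k\ge1}$ are independent. Notation: $\Delta_iX(y)=X_{i\Delta_n}(y)-X_{(i-1)\Delta_n}(y)$, $(\Delta_iX)^2(y)=(\Delta_iX(y))^2$. *)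

theory Defs
  imports "HOL-Probability.Probability" "HOL-Library.Landau_Symbols"
begin

definition eigfun :: "real \<Rightarrow> real \<Rightarrow> nat \<Rightarrow> real \<Rightarrow> real" where
  "eigfun \<theta>1 \<theta>2 k y = sqrt 2 * sin (pi * real k * y) * exp (- (\<theta>1 / (2 * \<theta>2)) * y)"

definition eigval :: "real \<Rightarrow> real \<Rightarrow> real \<Rightarrow> nat \<Rightarrow> real" where
  "eigval \<theta>0 \<theta>1 \<theta>2 k = - \<theta>0 + \<theta>1\<^sup>2 / (4 * \<theta>2) + pi\<^sup>2 * (real k)\<^sup>2 * \<theta>2"

definition H_inner :: "real \<Rightarrow> real \<Rightarrow> (real \<Rightarrow> real) \<Rightarrow> (real \<Rightarrow> real) \<Rightarrow> real" where
  "H_inner \<theta>1 \<theta>2 f g = (LINT y:{0..1}|lborel. exp (y * \<theta>1 / \<theta>2) * f y * g y)"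

definition H_norm :: "real \<Rightarrow> real \<Rightarrow> (real \<Rightarrow> real) \<Rightarrow> real" where
  "H_norm \<theta>1 \<theta>2 f = sqrt (H_inner \<theta>1 \<theta>2 f f)"

text \<open>Functions on $[0,1]$ are represented by functions on the real line whose values outside
  $[0,1]$ are irrelevant; functions that agree almost everywhere on $[0,1]$ are not identified,
  so \<open>H_norm\<close> is a seminorm on \<open>H_space\<close>.\<close>

definition H_space :: "real \<Rightarrow> real \<Rightarrow> (real \<Rightarrow> real) set" where
  "H_space \<theta>1 \<theta>2 = {f. set_borel_measurable lborel {0..1} f \<and>
     set_integrable lborel {0..1} (\<lambda>y. exp (y * \<theta>1 / \<theta>2) * f y * f y)}"

definition H_open :: "real \<Rightarrow> real \<Rightarrow> (real \<Rightarrow> real) set \<Rightarrow> bool" where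
  "H_open \<theta>1 \<theta>2 U \<longleftrightarrow> U \<subseteq> H_space \<theta>1 \<theta>2 \<and>
     (\<forall>f\<in>U. \<exists>\<epsilon>>0. \<forall>g\<in>H_space \<theta>1 \<theta>2. H_norm \<theta>1 \<theta>2 (\<lambda>y. g y - f y) < \<epsilon> \<longrightarrow> g \<in> U)"

definition H_borel :: "real \<Rightarrow> real \<Rightarrow> (real \<Rightarrow> real) measure" where
  "H_borel \<theta>1 \<theta>2 = sigma (H_space \<theta>1 \<theta>2) {U. H_open \<theta>1 \<theta>2 U}"

text \<open>The library's \<open>indep_var\<close> requires both random variables to have values of the same type.\<close>

definition independent_rvs ::
  "'w measure \<Rightarrow> 'a measure \<Rightarrow> ('w \<Rightarrow> 'a) \<Rightarrow> 'b measure \<Rightarrow> ('w \<Rightarrow> 'b) \<Rightarrow> bool" where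
  "independent_rvs M S A T B \<longleftrightarrow> A \<in> measurable M S \<and> B \<in> measurable M T \<and>
     prob_space.indep_set M {A -` U \<inter> space M | U. U \<in> sets S} {B -` V \<inter> space M | V. V \<in> sets T}"

definition brownian_motion :: "'w measure \<Rightarrow> (real \<Rightarrow> 'w \<Rightarrow> real) \<Rightarrow> bool" where
  "brownian_motion M W \<longleftrightarrow>
     (\<forall>t\<ge>0. W t \<in> borel_measurable M) \<and>
     (AE \<omega> in M. W 0 \<omega> = 0) \<and>
     (\<forall>s t. 0 \<le> s \<and> s < t \<longrightarrow>
        distributed M lborel (\<lambda>\<omega>. W t \<omega> - W s \<omega>) (normal_density 0 (sqrt (t - s)))) \<and>
     (\<forall>N (\<tau> :: nat \<Rightarrow> real). 0 \<le> \<tau> 0 \<and> (\<forall>i<N. \<tau> i < \<tau> (Suc i)) \<longrightarrow>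
        prob_space.indep_vars M (\<lambda>_. borel) (\<lambda>i \<omega>. W (\<tau> (Suc i)) \<omega> - W (\<tau> i) \<omega>) {..<N}) \<and>
     (AE \<omega> in M. continuous_on {0..} (\<lambda>t. W t \<omega>))"

definition independent_brownian_motions :: "'w measure \<Rightarrow> (nat \<Rightarrow> real \<Rightarrow> 'w \<Rightarrow> real) \<Rightarrow> bool" where
  "independent_brownian_motions M W \<longleftrightarrow>
     (\<forall>k\<ge>1. brownian_motion M (W k)) \<and>
     prob_space.indep_vars M (\<lambda>_. PiM {0..} (\<lambda>_. borel)) (\<lambda>k \<omega>. \<lambda>t\<in>{0..}. W k t \<omega>) {1..}"

definition step_fun :: "nat \<Rightarrow> (nat \<Rightarrow> real) \<Rightarrow> (nat \<Rightarrow> real) \<Rightarrow> real \<Rightarrow> real" where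
  "step_fun N \<tau> c s = (\<Sum>i<N. c i * indicator {\<tau> i<..\<tau> (Suc i)} s)"

definition step_integral ::
  "(real \<Rightarrow> 'w \<Rightarrow> real) \<Rightarrow> nat \<Rightarrow> (nat \<Rightarrow> real) \<Rightarrow> (nat \<Rightarrow> real) \<Rightarrow> 'w \<Rightarrow> real" where
  "step_integral W N \<tau> c \<omega> = (\<Sum>i<N. c i * (W (\<tau> (Suc i)) \<omega> - W (\<tau> i) \<omega>))"

text \<open>\<open>has_wiener_integral M W f t Z\<close>: the random variable \<open>Z\<close> is (a version of)
  $\int_0^t f(s)\,dW_s$, the $L^2(M)$-limit of the integrals of deterministic step functions that
  approximate \<open>f\<close> in $L^2([0,t])$. By the Ito isometry the limit does not depend on the
  approximating sequence.\<close>

definition has_wiener_integral ::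
  "'w measure \<Rightarrow> (real \<Rightarrow> 'w \<Rightarrow> real) \<Rightarrow> (real \<Rightarrow> real) \<Rightarrow> real \<Rightarrow> ('w \<Rightarrow> real) \<Rightarrow> bool" where
  "has_wiener_integral M W f t Z \<longleftrightarrow> Z \<in> borel_measurable M \<and>
     (\<exists>(N :: nat \<Rightarrow> nat) (\<tau> :: nat \<Rightarrow> nat \<Rightarrow> real) (c :: nat \<Rightarrow> nat \<Rightarrow> real).
        (\<forall>p. \<tau> p 0 = 0 \<and> \<tau> p (N p) = t \<and> (\<forall>i<N p. \<tau> p i \<le> \<tau> p (Suc i))) \<and>
        (\<lambda>p. \<integral>\<^sup>+ s. ennreal ((f s - step_fun (N p) (\<tau> p) (c p) s)\<^sup>2) * indicator {0..t} s \<partial>lborel)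
          \<longlonglongrightarrow> 0 \<and>
        (\<lambda>p. \<integral>\<^sup>+ \<omega>. ennreal ((Z \<omega> - step_integral W (N p) (\<tau> p) (c p) \<omega>)\<^sup>2) \<partial>M)
          \<longlonglongrightarrow> 0)"

text \<open>\<open>Z k t\<close> below is $\int_0^t e^{-\lambda_k(t-s)}\sigma\,dW^k_s$. For each time the eigenfunction
  series converges to $X_t$ in the norm of \<open>H_space\<close>; at time \<open>0\<close> this says $X_0 = \xi$.\<close>

definition continuous_mild_solution ::
  "'w measure \<Rightarrow> real \<Rightarrow> real \<Rightarrow> real \<Rightarrow> real \<Rightarrow> (nat \<Rightarrow> real \<Rightarrow> 'w \<Rightarrow> real) \<Rightarrow>
   ('w \<Rightarrow> real \<Rightarrow> real) \<Rightarrow> (real \<Rightarrow> real \<Rightarrow> 'w \<Rightarrow> real) \<Rightarrow> bool" where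
  "continuous_mild_solution M \<theta>0 \<theta>1 \<theta>2 \<sigma> W \<xi> X \<longleftrightarrow>
     (\<forall>t\<in>{0..1}. \<forall>y\<in>{0..1}. X t y \<in> borel_measurable M) \<and>
     (AE \<omega> in M. continuous_on ({0..1} \<times> {0..1}) (\<lambda>(t, y). X t y \<omega>)) \<and>
     (AE \<omega> in M. \<forall>t\<in>{0..1}. X t 0 \<omega> = 0 \<and> X t 1 \<omega> = 0) \<and>
     (\<exists>Z :: nat \<Rightarrow> real \<Rightarrow> 'w \<Rightarrow> real.
        (\<forall>k\<ge>1. \<forall>t\<in>{0..1}.
           has_wiener_integral M (W k) (\<lambda>s. exp (- eigval \<theta>0 \<theta>1 \<theta>2 k * (t - s)) * \<sigma>) t (Z k t)) \<and>
        (\<forall>t\<in>{0..1}. AE \<omega> in M.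
           (\<lambda>y. X t y \<omega>) \<in> H_space \<theta>1 \<theta>2 \<and>
           (\<lambda>K. H_norm \<theta>1 \<theta>2 (\<lambda>y. X t y \<omega> -
              (\<Sum>k=1..K. (exp (- eigval \<theta>0 \<theta>1 \<theta>2 k * t) * H_inner \<theta>1 \<theta>2 (\<xi> \<omega>) (eigfun \<theta>1 \<theta>2 k)
                          + Z k t \<omega>) * eigfun \<theta>1 \<theta>2 k y))) \<longlonglongrightarrow> 0))"

definition initial_condition ::
  "'w measure \<Rightarrow> real \<Rightarrow> real \<Rightarrow> real \<Rightarrow> ('w \<Rightarrow> real \<Rightarrow> real) \<Rightarrow> bool" where
  "initial_condition M \<theta>0 \<theta>1 \<theta>2 \<xi> \<longleftrightarrow>
    (let a = (\<lambda>k \<omega>. H_inner \<theta>1 \<theta>2 (\<xi> \<omega>) (eigfun \<theta>1 \<theta>2 k)) in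
     (((\<forall>k\<ge>1. (\<integral>\<omega>. a k \<omega> \<partial>M) = 0) \<and>
       (SUP k\<in>{1..}. ennreal (eigval \<theta>0 \<theta>1 \<theta>2 k) * (\<integral>\<^sup>+ \<omega>. ennreal ((a k \<omega>)\<^sup>2) \<partial>M)) < \<infinity>)
      \<or> (\<integral>\<^sup>+ \<omega>. (\<Sum>k. ennreal (eigval \<theta>0 \<theta>1 \<theta>2 (Suc k) * (a (Suc k) \<omega>)\<^sup>2)) \<partial>M) < \<infinity>) \<and>
     prob_space.indep_vars M (\<lambda>_. borel) a {1..})"

text \<open>\<open>y n j\<close>, $1 \le j \le m_n$, are the spatial observation points at stage \<open>n\<close>. The last conjunct
  bounds $m_n \min_{2\le j\le m_n} |y_j - y_{j-1}|$ from below and is void when $m_n = 1$.\<close>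

definition observation_scheme :: "(nat \<Rightarrow> nat) \<Rightarrow> (nat \<Rightarrow> nat \<Rightarrow> real) \<Rightarrow> real \<Rightarrow> bool" where
  "observation_scheme m y \<delta> \<longleftrightarrow>
     0 < \<delta> \<and>
     (\<forall>n\<ge>1. 1 \<le> m n \<and> \<delta> \<le> y n 1 \<and> y n (m n) \<le> 1 - \<delta> \<and> (\<forall>j\<in>{2..m n}. y n (j - 1) < y n j)) \<and>
     ((\<exists>m0. \<forall>n\<ge>1. m n = m0) \<or>
      (filterlim m at_top sequentially \<and>
       (\<exists>\<rho>. 0 < \<rho> \<and> \<rho> < 1/2 \<and> (\<lambda>n. real (m n)) \<in> O(\<lambda>n. real n powr \<rho>)))) \<and>
     (\<exists>c>0. \<forall>n\<ge>1. \<forall>j\<in>{2..m n}. c \<le> real (m n) * \<bar>y n j - y n (j - 1)\<bar>)"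

definition \<Delta> :: "nat \<Rightarrow> real" where
  "\<Delta> n = 1 / real n"

definition increment :: "(real \<Rightarrow> real \<Rightarrow> 'w \<Rightarrow> real) \<Rightarrow> nat \<Rightarrow> nat \<Rightarrow> real \<Rightarrow> 'w \<Rightarrow> real" where
  "increment X n i y \<omega> = X (real i * \<Delta> n) y \<omega> - X (real (i - 1) * \<Delta> n) y \<omega>"

definition vol_estimator ::
  "real \<Rightarrow> real \<Rightarrow> (real \<Rightarrow> real \<Rightarrow> 'w \<Rightarrow> real) \<Rightarrow> nat \<Rightarrow> nat \<Rightarrow> (nat \<Rightarrow> real) \<Rightarrow> 'w \<Rightarrow> real" where
  "vol_estimator \<theta>1 \<theta>2 X n m y \<omega> =
     sqrt (pi * \<theta>2) / (real m * real n * sqrt (\<Delta> n)) *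
     (\<Sum>j=1..m. \<Sum>i=1..n. (increment X n i (y j) \<omega>)\<^sup>2 * exp (y j * \<theta>1 / \<theta>2))"

definition I_coeff :: "nat \<Rightarrow> real" where
  "I_coeff r = 2 * sqrt (real r + 1) - sqrt (real r + 2) - sqrt (real r)"

definition Gamma_const :: real where
  "Gamma_const = 1 / pi * (\<Sum>r. (I_coeff r)\<^sup>2) + 2 / pi"

end

theory Submission
  imports Defs "HOL-Probability.Probability" "HOL-Real_Asymp.Real_Asymp"
begin

text \<open>With the increments at the points $p = (i, j)$ rescaled to $X_p$, the normalised error of the
  estimator is $\sum_p X_p^2 - \sqrt{m n}\,\sigma^2$, and $X_p$ is an $L^2$-limit of sums $G_p + A_p$ of
  a Gaussian part and an independent part that comes from the initial value and is negligible.

  For a centred Gaussian vector with covariance matrix $C$, put $Q = \sum_p (G_p^2 - C_{pp})$,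
  $D = \sum_{p,q} C_{pq} G_p G_q$ and $V = 2 \sum_{p,q} C_{pq}^2$. Integration by parts turns the
  derivative of $w(t) = E \cos(t Q + b)$ into $-2 t\, E[D \cos(t Q + b)]$. The variable $D$ has mean
  $V/2$ and variance at most $R^2 V$ if all absolute row sums of $C$ are at most $R$, so $w$ almost
  solves $w' = -t V w$ and differs from $\cos b \cdot e^{-t^2 V/2}$ by at most $2 t^2 R \sqrt V$.

  It remains to show $R \to 0$, $V \to \pi \Gamma \sigma^4$ and $\sum_p C_{pp} - \sqrt{m n}\,\sigma^2 \to 0$.
  The entries of $C$ are second differences in time of integrated theta series
  $\sum_k e^{-\lambda_k t} \cos(k \theta)$. For $\theta \ne 0$ two summations by parts show that they
  are small; for $\theta = 0$ a comparison with the Gaussian integral gives the limits, a multiple of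
  $I(r)$ at lag $r + 1$.\<close>

section \<open>Quadratic forms in Gaussian variables\<close>

text \<open>The phase \<open>b\<close> lets one real estimate serve both parts of the characteristic
  function: \<open>b = 0\<close> gives the real part and \<open>b = - pi / 2\<close> the imaginary
  part. The growth condition on \<open>m\<close> enters as \<open>m^2 / n\<close> tending to
  \<open>0\<close>: this is the order of the bound on the row sums between different points, and its
  root \<open>m / sqrt n\<close> is the order of the bound on the bias of the trace. Distinct points
  are nearly uncorrelated because \<open>1 - cos \<theta>\<close>, the factor by which the
  summations by parts divide, is at least of order \<open>(lag / m)^2\<close>. A product of two
  sines is half the difference of the cosines at \<open>pi (y - y')\<close> and
  \<open>pi (y + y')\<close>, and \<open>\<delta>\<close> keeps the second angle away from the
  multiples of \<open>2 pi\<close>. Each covariance thus involves a difference of two theta series,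
  in which the mode \<open>0\<close>, whose \<open>lam\<close> may be negative, cancels. At one
  point the covariances, multiplied by \<open>sqrt (m n) / \<sigma>^2\<close>, tend to
  \<open>1\<close> at lag \<open>0\<close> and to \<open>- I(r) / 2\<close> at lag
  \<open>r + 1\<close>; hence the limit \<open>2 (1 + 2 \<Sum> I(r)^2 / 4) \<sigma>^4\<close> of
  \<open>V\<close>.\<close>

lemma integrable_std_normal_poly_bound:
  fixes f :: "real \<Rightarrow> real"
  assumes "f \<in> borel_measurable borel" "\<And>x. \<bar>f x\<bar> \<le> B * (1 + x^4)"
  shows "integrable std_normal_distribution f"
proof (rule Bochner_Integration.integrable_bound)
  show "integrable std_normal_distribution (\<lambda>x. B * (1 + x^4))"
    using integrable_std_normal_distribution_moment[of 0] integrable_std_normal_distribution_moment[of 4]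
    by (intro integrable_mult_right Bochner_Integration.integrable_add) auto
  show "AE x in std_normal_distribution. norm (f x) \<le> norm (B * (1 + x^4))"
    using order_trans[OF assms(2) abs_ge_self] by simp
qed (use assms in simp)

text \<open>Stein's identity: the fundamental theorem of calculus on the whole line for
  \<open>std_normal_density x * f x\<close>, whose derivative is the difference of the two
  integrands. Cubic growth is allowed because \<open>wick\<close> differentiates a product of three
  linear forms; the density still kills the boundary terms.\<close>

lemma gauss_ibp_1d:
  fixes f f' :: "real \<Rightarrow> real"
  assumes d: "\<And>x. (f has_real_derivative f' x) (at x)" and c: "continuous_on UNIV f'"
    and bf: "\<And>x. \<bar>f x\<bar> \<le> B * (1 + \<bar>x\<bar>^3)" and bf': "\<And>x. \<bar>f' x\<bar> \<le> B * (1 + \<bar>x\<bar>^3)"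
  shows "(\<integral>x. x * f x \<partial>std_normal_distribution) = (\<integral>x. f' x \<partial>std_normal_distribution)"
proof -
  let ?n = std_normal_density
  have B0: "0 \<le> B" using bf[of 0] abs_ge_zero[of "f 0"] by simp
  have cf: "continuous_on UNIV f" using d by (meson DERIV_isCont continuous_at_imp_continuous_on)
  have mf [measurable]: "f \<in> borel_measurable borel" "f' \<in> borel_measurable borel"
    using c cf by (auto intro: borel_measurable_continuous_onI)
  have a3: "1 + \<bar>x\<bar>^3 \<le> 2 * (1 + x^4)" for x :: real
  proof -
    have "1 + u^3 \<le> 2 * (1 + u^4)" if "0 \<le> u" for u :: real
    proof -
      define w where "w = u^4"
      have w: "0 \<le> w" by (simp add: w_def)
      have "u^3 \<le> 1 + w"
      proof (cases "u \<le> 1")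
        case True then have "u^3 \<le> 1" using that by (simp add: power_le_one)
        then show ?thesis using w by linarith
      next
        case False then have "u^3 \<le> w" unfolding w_def by (auto intro: power_increasing)
        then show ?thesis by simp
      qed
      then have "1 + u^3 \<le> 2 * (1 + w)" using w by simp
      then show ?thesis by (simp only: w_def)
    qed
    from this[of "\<bar>x\<bar>"] show ?thesis by (simp add: power_even_abs)
  qed
  have a4: "\<bar>x\<bar> * (1 + \<bar>x\<bar>^3) \<le> 2 * (1 + x^4)" for x :: real
  proof -
    have "\<bar>x\<bar> \<le> 1 + x^4"
    proof (cases "\<bar>x\<bar> \<le> 1")
      case True then show ?thesis by (smt (verit) zero_le_even_power even_numeral)
    next
      case False then have "\<bar>x\<bar>^1 \<le> \<bar>x\<bar>^4" by (intro power_increasing) auto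
      then show ?thesis by (auto simp: power_even_abs)
    qed
    moreover have "\<bar>x\<bar> * \<bar>x\<bar>^3 = x^4" by (simp add: power_even_abs flip: power_Suc)
    ultimately show ?thesis by (simp add: distrib_left)
  qed
  have i1: "integrable std_normal_distribution (\<lambda>x. x * f x)"
  proof (rule integrable_std_normal_poly_bound[where B="2*B"])
    fix x show "\<bar>x * f x\<bar> \<le> 2 * B * (1 + x^4)"
      using mult_left_mono[OF bf[of x], of "\<bar>x\<bar>"] mult_left_mono[OF a4[of x] B0] by (simp add: abs_mult algebra_simps)
  qed simp
  have i2: "integrable std_normal_distribution f'"
  proof (rule integrable_std_normal_poly_bound[where B="2*B"])
    fix x show "\<bar>f' x\<bar> \<le> 2 * B * (1 + x^4)"
      using bf'[of x] mult_left_mono[OF a3[of x] B0] by (simp add: algebra_simps)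
  qed simp
  let ?g = "\<lambda>x. ?n x * f' x - ?n x * (x * f x)"
  have ig: "integrable lborel ?g"
    using i1 i2 by (intro Bochner_Integration.integrable_diff) (simp_all add: integrable_density normal_density_nonneg)
  have dn: "(?n has_real_derivative - x * ?n x) (at x)" for x
    unfolding std_normal_density_def by (auto intro!: derivative_eq_intros simp: field_simps)
  have tl: "((\<lambda>x. ?n x * f x) \<longlongrightarrow> 0) F" if "((\<lambda>y::real. (1+\<bar>y\<bar>^3) * (exp (- y\<^sup>2/2))) \<longlongrightarrow> 0) F" for F
  proof (rule Lim_null_comparison)
    have "((\<lambda>y::real. B / sqrt (2*pi) * ((1+\<bar>y\<bar>^3) * (exp (- y\<^sup>2/2)))) \<longlongrightarrow> 0) F"
      by (rule tendsto_mult_right_zero[OF that])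
    then show "((\<lambda>y::real. ?n y * (B * (1+\<bar>y\<bar>^3))) \<longlongrightarrow> 0) F"
      unfolding std_normal_density_def by (simp add: mult_ac)
    show "\<forall>\<^sub>F x in F. norm (?n x * f x) \<le> ?n x * (B * (1 + \<bar>x\<bar>^3))"
      using bf by (intro always_eventually) (auto simp: abs_mult normal_density_nonneg intro!: mult_left_mono)
  qed
  have "(LBINT x=-\<infinity>..\<infinity>. ?g x) = 0 - 0"
  proof (rule interval_integral_FTC_integrable[where F="\<lambda>x. ?n x * f x"])
    fix x
    show "((\<lambda>x. ?n x * f x) has_vector_derivative ?g x) (at x)"
      unfolding has_real_derivative_iff_has_vector_derivative[symmetric]
      by (rule derivative_eq_intros dn d refl)+ (simp add: algebra_simps)
    show "isCont ?g x"
      using c cf by (auto simp: continuous_on_eq_continuous_at std_normal_density_def intro!: continuous_intros)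
  next
    show "set_integrable lborel (einterval (-\<infinity>) \<infinity>) ?g" using ig by (simp add: set_integrable_def)
    have "((\<lambda>y::real. (1+\<bar>y\<bar>^3) * (exp (- y\<^sup>2/2))) \<longlongrightarrow> 0) at_bot" by real_asymp
    from tl[OF this] show "(((\<lambda>x. ?n x * f x) \<circ> real_of_ereal) \<longlongrightarrow> 0) (at_right (-\<infinity>))"
      by (simp add: comp_def at_right_MInf filterlim_filtermap)
    have "((\<lambda>y::real. (1+\<bar>y\<bar>^3) * (exp (- y\<^sup>2/2))) \<longlongrightarrow> 0) at_top" by real_asymp
    from tl[OF this] show "(((\<lambda>x. ?n x * f x) \<circ> real_of_ereal) \<longlongrightarrow> 0) (at_left \<infinity>)"
      by (simp add: comp_def at_left_PInf filterlim_filtermap)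
  qed simp
  then have "(\<integral>x. ?g x \<partial>lborel) = 0" by (simp add: interval_lebesgue_integral_def set_lebesgue_integral_def)
  moreover have "(\<integral>x. ?g x \<partial>lborel) = (\<integral>x. ?n x * f' x \<partial>lborel) - (\<integral>x. ?n x * (x * f x) \<partial>lborel)"
    using i1 i2 by (intro Bochner_Integration.integral_diff) (simp_all add: integrable_density normal_density_nonneg)
  ultimately show ?thesis by (simp add: integral_density normal_density_nonneg)
qed

section \<open>Integration by parts for products of standard normal distributions\<close>

abbreviation gauss_meas :: "'i set \<Rightarrow> ('i \<Rightarrow> real) measure" where
  "gauss_meas I \<equiv> PiM I (\<lambda>_. std_normal_distribution)"

lemma prob_space_std_normal: "prob_space std_normal_distribution"
  by (rule prob_space_normal_density) simp

lemma product_prob_space_std_normal: "product_prob_space (\<lambda>_. std_normal_distribution)"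
  by (simp add: product_prob_space_def product_prob_space_axioms_def product_sigma_finite_def prob_space_std_normal
     prob_space_imp_sigma_finite)

lemma prob_space_gauss_meas: "prob_space (gauss_meas I)"
  using product_prob_space_std_normal by (intro prob_space_PiM prob_space_std_normal)

lemma sets_gauss_meas [measurable_cong]: "sets (gauss_meas I) = sets (PiM I (\<lambda>_. borel))"
  by (intro sets_PiM_cong) auto

text \<open>Stein's identity on every line parallel to the axis \<open>a\<close>, followed by
  Fubini. The growth constant may therefore depend on the other coordinates of
  \<open>x\<close>.\<close>

lemma gauss_ibp:
  fixes F F' :: "('i \<Rightarrow> real) \<Rightarrow> real"
  assumes fin: "finite I" and a: "a \<in> I"
    and i1: "integrable (gauss_meas I) (\<lambda>x. x a * F x)" and i2: "integrable (gauss_meas I) F'"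
    and d: "\<And>x y. ((\<lambda>y. F (x(a:=y))) has_real_derivative F' (x(a:=y))) (at y)"
    and c: "\<And>x. continuous_on UNIV (\<lambda>y. F' (x(a:=y)))"
    and b: "\<And>x. \<exists>B. \<forall>y. \<bar>F (x(a:=y))\<bar> \<le> B * (1 + \<bar>y\<bar>^3) \<and> \<bar>F' (x(a:=y))\<bar> \<le> B * (1 + \<bar>y\<bar>^3)"
  shows "(\<integral>x. x a * F x \<partial>gauss_meas I) = (\<integral>x. F' x \<partial>gauss_meas I)"
proof -
  interpret P: product_prob_space "\<lambda>_::'i. std_normal_distribution" by (rule product_prob_space_std_normal)
  define J where "J = I - {a}"
  have J: "I = insert a J" "finite J" "a \<notin> J" using fin a by (auto simp: J_def)
  have e: "(\<integral>y. (x(a:=y)) a * F (x(a:=y)) \<partial>std_normal_distribution) = (\<integral>y. F' (x(a:=y)) \<partial>std_normal_distribution)" for x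
  proof -
    obtain B where B: "\<And>y. \<bar>F (x(a:=y))\<bar> \<le> B * (1 + \<bar>y\<bar>^3)" "\<And>y. \<bar>F' (x(a:=y))\<bar> \<le> B * (1 + \<bar>y\<bar>^3)"
      using b[of x] by blast
    show ?thesis using gauss_ibp_1d[OF d[of x] c[of x] B] by simp
  qed
  show ?thesis
    unfolding J(1) P.product_integral_insert[OF J(2,3) i1[unfolded J(1)]] P.product_integral_insert[OF J(2,3) i2[unfolded J(1)]] e ..
qed

definition lin :: "'i set \<Rightarrow> ('i \<Rightarrow> real) \<Rightarrow> ('i \<Rightarrow> real) \<Rightarrow> real" where
  "lin I l x = (\<Sum>a\<in>I. l a * x a)"

text \<open>A gauge of size that is at least \<open>1\<close>, so that lower powers are dominated by
  higher ones and every growth condition can be stated with a single power.\<close>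

definition sz :: "'i set \<Rightarrow> ('i \<Rightarrow> real) \<Rightarrow> real" where
  "sz I x = 1 + (\<Sum>a\<in>I. \<bar>x a\<bar>)"

lemma measurable_lin [measurable]: "lin I l \<in> borel_measurable (gauss_meas I)"
  unfolding lin_def by measurable

lemma measurable_sz [measurable]: "sz I \<in> borel_measurable (gauss_meas I)"
  unfolding sz_def by measurable

lemma sz_ge1: "1 \<le> sz I x" unfolding sz_def by (simp add: sum_nonneg)

lemma lin_upd: "finite I \<Longrightarrow> a \<in> I \<Longrightarrow> lin I l (x(a:=y)) = lin I l x + l a * (y - x a)"
  unfolding lin_def by (simp add: sum.remove[of I a] algebra_simps)

lemma lin_bound: "finite I \<Longrightarrow> \<bar>lin I l x\<bar> \<le> (\<Sum>a\<in>I. \<bar>l a\<bar>) * sz I x"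
proof -
  assume f: "finite I"
  have "\<bar>lin I l x\<bar> \<le> (\<Sum>a\<in>I. \<bar>l a\<bar> * \<bar>x a\<bar>)" unfolding lin_def by (rule order_trans[OF sum_abs]) (simp add: abs_mult)
  also have "\<dots> \<le> (\<Sum>a\<in>I. \<bar>l a\<bar> * sz I x)"
  proof (intro sum_mono mult_left_mono)
    fix a assume "a \<in> I"
    then have "\<bar>x a\<bar> \<le> (\<Sum>a\<in>I. \<bar>x a\<bar>)" using f by (intro member_le_sum) auto
    then show "\<bar>x a\<bar> \<le> sz I x" unfolding sz_def by simp
  qed simp
  finally show ?thesis by (simp add: sum_distrib_right)
qed

lemma sz_upd: "finite I \<Longrightarrow> a \<in> I \<Longrightarrow> sz I (x(a:=y)) \<le> sz I x + \<bar>y\<bar>"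
  unfolding sz_def by (simp add: sum.remove[of I a])

lemma sz3_upd: assumes "finite I" "a \<in> I" shows "\<exists>B\<ge>0. \<forall>y. (sz I (x(a:=y)))^3 \<le> B * (1 + \<bar>y\<bar>^3)"
proof (intro exI conjI allI)
  fix y :: real
  have s1: "1 \<le> sz I x" by (rule sz_ge1)
  have "sz I (x(a:=y))^3 \<le> (sz I x + \<bar>y\<bar>)^3" using sz_upd[OF assms] sz_ge1[of I "x(a:=y)"] by (intro power_mono) auto
  also have "\<dots> \<le> (sz I x * (1 + \<bar>y\<bar>))^3" using s1 by (intro power_mono) (auto simp: distrib_left mult_right_mono mult_le_cancel_right1)
  also have "\<dots> = sz I x^3 * (1 + \<bar>y\<bar>)^3" by (rule power_mult_distrib)
  also have "\<dots> \<le> sz I x^3 * (4 * (1 + \<bar>y\<bar>^3))"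
  proof (intro mult_left_mono)
    \<comment> \<open>The right-hand side is
      \<open>4 (1 + \<bar>y\<bar>^3) - (1 + \<bar>y\<bar>)^3\<close> in factored form.\<close>
    have "0 \<le> 3 * (1 + \<bar>y\<bar>) * (1 - \<bar>y\<bar>)^2" by simp
    then show "(1 + \<bar>y\<bar>)^3 \<le> 4 * (1 + \<bar>y\<bar>^3)" by (simp add: power2_eq_square power3_eq_cube algebra_simps)
    show "0 \<le> sz I x^3" using s1 by simp
  qed
  finally show "sz I (x(a:=y))^3 \<le> (4 * sz I x^3) * (1 + \<bar>y\<bar>^3)" by (simp add: algebra_simps)
  show "0 \<le> 4 * sz I x^3" using s1 by simp
qed

lemma integrable_coord4: "a \<in> I \<Longrightarrow> integrable (gauss_meas I) (\<lambda>x. (x a)^4)"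
proof -
  assume a: "a \<in> I"
  have "integrable (distr (gauss_meas I) std_normal_distribution (\<lambda>x. x a)) (\<lambda>y. y^4)"
    using a by (subst distr_PiM_component) (auto intro: prob_space_std_normal integrable_std_normal_distribution_moment)
  then show ?thesis using a by (subst (asm) integrable_distr_eq) auto
qed

lemma integrable_sz4: assumes "finite I" shows "integrable (gauss_meas I) (\<lambda>x. (sz I x)^4)"
proof (rule Bochner_Integration.integrable_bound)
  interpret G: prob_space "gauss_meas I" by (rule prob_space_gauss_meas)
  let ?N = "real (card I)"
  show "integrable (gauss_meas I) (\<lambda>x. 8 * (1 + ?N^3 * (\<Sum>a\<in>I. (x a)^4)))"
    using integrable_coord4 by (intro integrable_mult_right Bochner_Integration.integrable_add Bochner_Integration.integrable_sum) auto
  have "(sz I x)^4 \<le> 8 * (1 + ?N^3 * (\<Sum>a\<in>I. (x a)^4))" for x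
  proof -
    let ?S = "\<Sum>a\<in>I. \<bar>x a\<bar>"
    have a: "(1 + ?S)^2 \<le> 2 * (1 + ?S^2)" using sum_squares_ge_zero[of "1 - ?S" 0] by (simp add: power2_eq_square algebra_simps)
    have "(sz I x)^4 = ((1 + ?S)^2)^2" by (simp add: sz_def)
    also have "\<dots> \<le> (2 * (1 + ?S^2))^2" using a by (intro power_mono) auto
    also have "\<dots> = 4 * (1 + ?S^2)^2" by (simp only: power_mult_distrib) simp
    also have "\<dots> \<le> 4 * (2 * (1 + (?S^2)^2))"
      using sum_squares_ge_zero[of "1 - ?S^2" 0] by (simp add: power2_eq_square algebra_simps)
    also have "(?S^2)^2 \<le> (?N * (\<Sum>a\<in>I. \<bar>x a\<bar>^2))^2"
      using sum_squared_le_sum_of_squares[of "\<lambda>a. \<bar>x a\<bar>" I] assms by (intro power_mono) (auto simp: mult.commute)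
    also have "\<dots> = ?N^2 * (\<Sum>a\<in>I. (x a)^2)^2" by (simp add: power_mult_distrib)
    also have "\<dots> \<le> ?N^2 * (?N * (\<Sum>a\<in>I. ((x a)^2)^2))"
      using sum_squared_le_sum_of_squares[of "\<lambda>a. (x a)^2" I] assms by (intro mult_left_mono) (auto simp: mult.commute)
    also have "\<dots> = ?N^3 * (\<Sum>a\<in>I. (x a)^4)"
      by (simp add: power2_eq_square[of "real _"] power3_eq_cube flip: power_mult)
    finally show ?thesis by simp
  qed
  then show "AE x in gauss_meas I. norm ((sz I x)^4) \<le> norm (8 * (1 + ?N^3 * (\<Sum>a\<in>I. (x a)^4)))"
    by (intro AE_I2) (smt (verit) real_norm_def zero_le_even_power even_numeral)
qed simp

lemma integrable_growth:
  assumes "finite I" "F \<in> borel_measurable (gauss_meas I)" "\<And>x. \<bar>F x\<bar> \<le> c * (sz I x)^4"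
  shows "integrable (gauss_meas I) F"
proof (rule Bochner_Integration.integrable_bound)
  show "integrable (gauss_meas I) (\<lambda>x. c * (sz I x)^4)" using integrable_sz4[OF assms(1)] by simp
  show "AE x in gauss_meas I. norm (F x) \<le> norm (c * (sz I x)^4)"
    by (intro AE_I2) (use order_trans[OF assms(3) abs_ge_self] in simp)
qed (use assms in simp)

text \<open>The coordinate identities, added up with the coefficients of \<open>l\<close>, integrate
  by parts in the direction \<open>l\<close>. A cubic bound leaves room for the extra factor
  \<open>x a\<close>, since fourth powers of \<open>sz\<close> are integrable.\<close>

lemma gauss_ibp_lin:
  assumes fin: "finite I"
    and mF [measurable]: "F \<in> borel_measurable (gauss_meas I)" "\<And>a. a \<in> I \<Longrightarrow> F' a \<in> borel_measurable (gauss_meas I)"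
    and bF: "\<And>x. \<bar>F x\<bar> \<le> c * (sz I x)^3" "\<And>a x. a \<in> I \<Longrightarrow> \<bar>F' a x\<bar> \<le> c * (sz I x)^3"
    and d: "\<And>a x y. a \<in> I \<Longrightarrow> ((\<lambda>y. F (x(a:=y))) has_real_derivative F' a (x(a:=y))) (at y)"
    and cF: "\<And>a x. a \<in> I \<Longrightarrow> continuous_on UNIV (\<lambda>y. F' a (x(a:=y)))"
  shows "(\<integral>x. lin I l x * F x \<partial>gauss_meas I) = (\<integral>x. (\<Sum>a\<in>I. l a * F' a x) \<partial>gauss_meas I)"
proof -
  have s1: "1 \<le> sz I x" for x by (rule sz_ge1)
  have c0: "0 \<le> c"
  proof -
    have "0 \<le> c * sz I (\<lambda>_. 0)^3" using bF(1)[of "\<lambda>_. 0"] by (meson abs_ge_zero order_trans)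
    then show ?thesis by (simp add: sz_def)
  qed
  have i1: "integrable (gauss_meas I) (\<lambda>x. x a * F x)" if "a \<in> I" for a
  proof (rule integrable_growth[OF fin, where c=c])
    fix x
    have "\<bar>x a\<bar> \<le> sz I x" unfolding sz_def using member_le_sum[of a I "\<lambda>a. \<bar>x a\<bar>"] that fin by auto
    then have "\<bar>x a\<bar> * \<bar>F x\<bar> \<le> sz I x * (c * (sz I x)^3)" using bF(1)[of x] s1[of x] by (intro mult_mono) auto
    then show "\<bar>x a * F x\<bar> \<le> c * sz I x ^ 4" by (simp add: abs_mult eval_nat_numeral algebra_simps)
  qed (use that in measurable)
  have i2: "integrable (gauss_meas I) (F' a)" if "a \<in> I" for a
  proof (rule integrable_growth[OF fin, where c=c])
    fix x
    have "sz I x ^ 3 \<le> sz I x ^ 4" using s1[of x] by (intro power_increasing) auto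
    then show "\<bar>F' a x\<bar> \<le> c * sz I x ^ 4" using bF(2)[OF that, of x] c0 by (meson mult_left_mono order_trans)
  qed (use that in measurable)
  have e: "(\<integral>x. x a * F x \<partial>gauss_meas I) = (\<integral>x. F' a x \<partial>gauss_meas I)" if "a \<in> I" for a
  proof (rule gauss_ibp[OF fin that i1[OF that] i2[OF that] d[OF that] cF[OF that]])
    fix x
    from sz3_upd[OF fin that] obtain B where B: "B \<ge> 0" "\<And>y. (sz I (x(a:=y)))^3 \<le> B * (1 + \<bar>y\<bar>^3)" by blast
    show "\<exists>B. \<forall>y. \<bar>F (x(a := y))\<bar> \<le> B * (1 + \<bar>y\<bar> ^ 3) \<and> \<bar>F' a (x(a := y))\<bar> \<le> B * (1 + \<bar>y\<bar> ^ 3)"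
      using order_trans[OF bF(1) mult_left_mono[OF B(2) c0]] order_trans[OF bF(2)[OF that] mult_left_mono[OF B(2) c0]]
      by (intro exI[of _ "c * B"]) (simp add: mult.assoc)
  qed
  have "(\<integral>x. lin I l x * F x \<partial>gauss_meas I) = (\<integral>x. (\<Sum>a\<in>I. l a * (x a * F x)) \<partial>gauss_meas I)"
    unfolding lin_def by (simp add: sum_distrib_right mult.assoc)
  also have "\<dots> = (\<Sum>a\<in>I. l a * (\<integral>x. x a * F x \<partial>gauss_meas I))"
    using i1 by (subst Bochner_Integration.integral_sum) auto
  also have "\<dots> = (\<Sum>a\<in>I. l a * (\<integral>x. F' a x \<partial>gauss_meas I))" using e by simp
  also have "\<dots> = (\<integral>x. (\<Sum>a\<in>I. l a * F' a x) \<partial>gauss_meas I)"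
    using i2 by (subst Bochner_Integration.integral_sum) auto
  finally show ?thesis .
qed

text \<open>The hypothesis is what a second order Taylor estimate of an integrand yields after
  integration; \<open>DERIV_char_part\<close> differentiates under the integral in this way.\<close>

lemma DERIV_quadratic_bound:
  fixes f :: "real \<Rightarrow> real"
  assumes "\<And>h. \<bar>f (t + h) - f t - h * d\<bar> \<le> B * h\<^sup>2"
  shows "(f has_real_derivative d) (at t)"
proof -
  have "((\<lambda>h. (f (t + h) - f t) / h - d) \<longlongrightarrow> 0) (at 0)"
  proof (rule Lim_null_comparison)
    show "((\<lambda>h::real. B * \<bar>h\<bar>) \<longlongrightarrow> 0) (at 0)" by (rule tendsto_eq_intros refl)+ simp
    show "\<forall>\<^sub>F h in at 0. norm ((f (t + h) - f t) / h - d) \<le> B * \<bar>h\<bar>"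
    proof (simp add: eventually_at_filter, intro always_eventually allI impI)
      fix h :: real assume h: "h \<noteq> 0"
      then have "\<bar>(f (t + h) - f t) / h - d\<bar> = \<bar>f (t + h) - f t - h * d\<bar> / \<bar>h\<bar>"
        by (simp add: field_simps flip: abs_divide)
      also have "\<dots> \<le> B * h\<^sup>2 / \<bar>h\<bar>" using assms by (intro divide_right_mono) auto
      also have "\<dots> = B * \<bar>h\<bar>" using h by (simp add: power2_eq_square field_simps flip: abs_mult)
      finally show "\<bar>(f (t + h) - f t) / h - d\<bar> \<le> B * \<bar>h\<bar>" .
    qed
  qed
  then show ?thesis unfolding DERIV_def using LIM_zero_cancel by fastforce
qed

lemma taylor_quadratic:
  fixes g g' g'' :: "real \<Rightarrow> real"
  assumes d: "\<And>x. (g has_real_derivative g' x) (at x)" "\<And>x. (g' has_real_derivative g'' x) (at x)"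
    and B: "\<And>z. \<bar>z - x\<bar> \<le> \<bar>h\<bar> \<Longrightarrow> \<bar>g'' z\<bar> \<le> B"
  shows "\<bar>g (x + h) - g x - h * g' x\<bar> \<le> B * h\<^sup>2 / 2"
proof (cases "h = 0")
  case False
  define df where "df = (\<lambda>m::nat. if m = 0 then g else if m = 1 then g' else g'')"
  have "\<exists>t. (if x + h < x then x + h < t \<and> t < x else x < t \<and> t < x + h) \<and>
    g (x + h) = (\<Sum>m<2. (df m x / fact m) * (x + h - x)^m) + (df 2 t / fact 2) * (x + h - x)^2"
  proof (rule Taylor[where a="x - \<bar>h\<bar>" and b="x + \<bar>h\<bar>"])
    show "\<forall>m t. m < 2 \<and> x - \<bar>h\<bar> \<le> t \<and> t \<le> x + \<bar>h\<bar> \<longrightarrow> (df m has_real_derivative df (Suc m) t) (at t)"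
      using d by (auto simp: df_def less_2_cases_iff)
  qed (use False in \<open>auto simp: df_def\<close>)
  then obtain t where t0: "if x + h < x then x + h < t \<and> t < x else x < t \<and> t < x + h"
    and t1: "g (x + h) = (\<Sum>m<2. (df m x / fact m) * h^m) + (df 2 t / fact 2) * h^2"
    unfolding add_diff_cancel_left' by blast
  have t: "\<bar>t - x\<bar> \<le> \<bar>h\<bar>" using t0 by (auto split: if_splits)
  have "g (x + h) - g x - h * g' x = g'' t / 2 * h\<^sup>2" using t1 by (simp add: df_def numeral_2_eq_2)
  also have "\<bar>\<dots>\<bar> \<le> B / 2 * h\<^sup>2" unfolding abs_mult using B[OF t] by (intro mult_mono) auto
  finally show ?thesis by simp
qed simp

lemma cos_quadratic_bound: "\<bar>cos (x + h) - cos x + h * sin x\<bar> \<le> (h::real)\<^sup>2 / 2"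
proof -
  have "\<bar>cos (x + h) - cos x - h * (- sin x)\<bar> \<le> 1 * h\<^sup>2 / 2"
    by (rule taylor_quadratic[where g''="\<lambda>x. - cos x"]) (auto intro!: derivative_eq_intros)
  then show ?thesis by simp
qed

section \<open>Quadratic functionals of a Gaussian vector\<close>

definition ip :: "'i set \<Rightarrow> ('i \<Rightarrow> real) \<Rightarrow> ('i \<Rightarrow> real) \<Rightarrow> real" where
  "ip I l m = (\<Sum>a\<in>I. l a * m a)"

lemma ip_commute: "ip I l m = ip I m l" by (simp add: ip_def mult.commute)

text \<open>The Gaussian vector is given by linear forms in independent standard normals, so that
  its covariance matrix is a Gram matrix and may be singular.\<close>

locale gauss_quad =
  fixes I :: "'i set" and P :: "'p set" and L :: "'p \<Rightarrow> 'i \<Rightarrow> real"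
  assumes fin: "finite I" "finite P"
begin

abbreviation "\<gamma> \<equiv> gauss_meas I"

definition C :: "'p \<Rightarrow> 'p \<Rightarrow> real" where "C p q = ip I (L p) (L q)"
definition G :: "'p \<Rightarrow> ('i \<Rightarrow> real) \<Rightarrow> real" where "G p = lin I (L p)"
definition Q :: "('i \<Rightarrow> real) \<Rightarrow> real" where "Q x = (\<Sum>p\<in>P. (G p x)\<^sup>2 - C p p)"
definition nrm :: "('i \<Rightarrow> real) \<Rightarrow> real" where "nrm l = (\<Sum>a\<in>I. \<bar>l a\<bar>)"

lemma measurable_GQ [measurable]: "G p \<in> borel_measurable \<gamma>" "Q \<in> borel_measurable \<gamma>"
  unfolding G_def Q_def[abs_def] by measurable

lemma C_commute: "C p q = C q p" by (simp add: C_def ip_commute)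

lemma nrm_nonneg: "0 \<le> nrm l" by (simp add: nrm_def sum_nonneg)
lemma nrm_ge: "a \<in> I \<Longrightarrow> \<bar>l a\<bar> \<le> nrm l"
  unfolding nrm_def using fin by (intro member_le_sum) auto
lemma lin_le_nrm: "\<bar>lin I l x\<bar> \<le> nrm l * sz I x" unfolding nrm_def by (rule lin_bound[OF fin(1)])

lemma sz_pow_mono: "i \<le> j \<Longrightarrow> sz I x ^ i \<le> sz I x ^ j"
  by (intro power_increasing sz_ge1)

lemma DERIV_lin: "a \<in> I \<Longrightarrow> ((\<lambda>y. lin I l (x(a:=y))) has_real_derivative l a) (at y)"
  unfolding lin_upd[OF fin(1)] by (auto intro!: derivative_eq_intros)

lemma DERIV_Q: assumes "a \<in> I"
  shows "((\<lambda>y. Q (x(a:=y))) has_real_derivative (\<Sum>p\<in>P. 2 * L p a * G p (x(a:=y)))) (at y)"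
  unfolding Q_def G_def
  by (rule derivative_eq_intros DERIV_lin assms refl)+ (simp add: mult_ac)

lemma cont_lin: "a \<in> I \<Longrightarrow> continuous_on UNIV (\<lambda>y. lin I l (x(a:=y)))"
  unfolding lin_upd[OF fin(1)] by (intro continuous_intros)

lemma cont_Q: "a \<in> I \<Longrightarrow> continuous_on UNIV (\<lambda>y. Q (x(a:=y)))"
  unfolding Q_def G_def by (intro continuous_intros cont_lin)

text \<open>The gradient of \<open>Q\<close> is \<open>2 \<Sum> G p * L p\<close>; pairing it with
  \<open>l\<close> turns the sum over coordinates into the inner products
  \<open>ip I l (L p)\<close>. The function \<open>h\<close> is constant in
  \<open>second_moment\<close> and a sine in \<open>Q_sin\<close>.\<close>

lemma quad_ibp:
  fixes h h' :: "real \<Rightarrow> real"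
  assumes d: "\<And>z. (h has_real_derivative h' z) (at z)" and ch: "continuous_on UNIV h'"
    and H: "\<And>z. \<bar>h z\<bar> \<le> H" "\<And>z. \<bar>h' z\<bar> \<le> H"
  shows "(\<integral>x. lin I l x * (lin I m x * h (Q x)) \<partial>\<gamma>)
    = ip I l m * (\<integral>x. h (Q x) \<partial>\<gamma>) + (\<Sum>p\<in>P. 2 * ip I l (L p) * (\<integral>x. lin I m x * G p x * h' (Q x) \<partial>\<gamma>))"
proof -
  have H0: "0 \<le> H" using H(1)[of 0] by linarith
  have ch0: "continuous_on UNIV h" using d by (meson DERIV_isCont continuous_at_imp_continuous_on)
  have [measurable]: "h \<in> borel_measurable borel" "h' \<in> borel_measurable borel"
    using ch ch0 by (auto intro: borel_measurable_continuous_onI)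
  let ?F = "\<lambda>x. lin I m x * h (Q x)"
  let ?F' = "\<lambda>a x. m a * h (Q x) + lin I m x * (h' (Q x) * (\<Sum>p\<in>P. 2 * L p a * G p x))"
  let ?c = "nrm m * H + nrm m * (H * (\<Sum>p\<in>P. 2 * nrm (L p) * nrm (L p)))"
  have s0: "0 \<le> sz I x" for x using sz_ge1[of I x] by linarith
  have c0: "0 \<le> nrm m * (H * (\<Sum>p\<in>P. 2 * nrm (L p) * nrm (L p)))"
    by (intro mult_nonneg_nonneg sum_nonneg nrm_nonneg H0) auto
  have b2: "\<bar>lin I m x * G p x * h' (Q x)\<bar> \<le> (nrm m * nrm (L p) * H) * sz I x ^ 2" for x p
  proof -
    have "\<bar>lin I m x\<bar> * \<bar>G p x\<bar> * \<bar>h' (Q x)\<bar> \<le> (nrm m * sz I x) * (nrm (L p) * sz I x) * H"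
      using lin_le_nrm H s0 nrm_nonneg H0 by (intro mult_mono) (auto simp: G_def)
    then show ?thesis by (simp add: abs_mult power2_eq_square mult_ac)
  qed
  have "(\<integral>x. lin I l x * ?F x \<partial>\<gamma>) = (\<integral>x. (\<Sum>a\<in>I. l a * ?F' a x) \<partial>\<gamma>)"
  proof (rule gauss_ibp_lin[OF fin(1), where c="?c"])
    fix x
    have "\<bar>?F x\<bar> \<le> (nrm m * sz I x) * H"
      unfolding abs_mult using lin_le_nrm H s0 nrm_nonneg by (intro mult_mono) auto
    also have "\<dots> = nrm m * H * sz I x ^ 1" by simp
    also have "\<dots> \<le> nrm m * H * sz I x ^ 3" using nrm_nonneg H0 by (intro mult_left_mono sz_pow_mono) auto
    also have "\<dots> \<le> ?c * sz I x ^ 3" using c0 s0 by (intro mult_right_mono) auto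
    finally show "\<bar>?F x\<bar> \<le> ?c * sz I x ^ 3" .
  next
    fix a x assume a: "a \<in> I"
    have "\<bar>m a * h (Q x)\<bar> \<le> nrm m * H" unfolding abs_mult using nrm_ge[OF a] H nrm_nonneg by (intro mult_mono) auto
    also have "\<dots> = nrm m * H * sz I x ^ 0" by simp
    also have "\<dots> \<le> nrm m * H * sz I x ^ 3" using nrm_nonneg H0 by (intro mult_left_mono sz_pow_mono) auto
    finally have 1: "\<bar>m a * h (Q x)\<bar> \<le> nrm m * H * sz I x ^ 3" .
    have "\<bar>\<Sum>p\<in>P. 2 * L p a * G p x\<bar> \<le> (\<Sum>p\<in>P. 2 * nrm (L p) * (nrm (L p) * sz I x))"
    proof (rule order_trans[OF sum_abs], rule sum_mono)
      fix p
      show "\<bar>2 * L p a * G p x\<bar> \<le> 2 * nrm (L p) * (nrm (L p) * sz I x)"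
        unfolding abs_mult G_def using nrm_ge[OF a] lin_le_nrm s0 nrm_nonneg by (intro mult_mono) auto
    qed
    then have "\<bar>lin I m x\<bar> * (\<bar>h' (Q x)\<bar> * \<bar>\<Sum>p\<in>P. 2 * L p a * G p x\<bar>) \<le> (nrm m * sz I x) * (H * (\<Sum>p\<in>P. 2 * nrm (L p) * (nrm (L p) * sz I x)))"
      using lin_le_nrm H s0 nrm_nonneg H0 by (intro mult_mono) auto
    also have "\<dots> = nrm m * (H * (\<Sum>p\<in>P. 2 * nrm (L p) * nrm (L p))) * sz I x ^ 2"
      by (simp add: sum_distrib_right[symmetric] mult.assoc[symmetric] power2_eq_square)
    also have "\<dots> \<le> nrm m * (H * (\<Sum>p\<in>P. 2 * nrm (L p) * nrm (L p))) * sz I x ^ 3"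
      using c0 by (intro mult_left_mono sz_pow_mono) auto
    finally show "\<bar>?F' a x\<bar> \<le> ?c * sz I x ^ 3"
      using 1 abs_triangle_ineq[of "m a * h (Q x)" "lin I m x * (h' (Q x) * (\<Sum>p\<in>P. 2 * L p a * G p x))"]
      by (simp add: abs_mult distrib_right)
  next
    fix a x y assume a: "a \<in> I"
    show "((\<lambda>y. ?F (x(a:=y))) has_real_derivative ?F' a (x(a:=y))) (at y)"
      by (rule derivative_eq_intros DERIV_lin DERIV_chain2[OF d DERIV_Q] a refl)+ (simp add: mult_ac)
    show "continuous_on UNIV (\<lambda>y. ?F' a (x(a:=y)))"
      unfolding G_def by (intro continuous_intros cont_lin a continuous_on_compose2[OF ch0 cont_Q] continuous_on_compose2[OF ch cont_Q]) auto
  qed measurable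
  also have "\<dots> = (\<integral>x. ip I l m * h (Q x) + (\<Sum>p\<in>P. 2 * ip I l (L p) * (lin I m x * G p x * h' (Q x))) \<partial>\<gamma>)"
  proof (rule Bochner_Integration.integral_cong[OF refl])
    fix x
    have "(\<Sum>a\<in>I. l a * (lin I m x * (h' (Q x) * (\<Sum>p\<in>P. 2 * L p a * G p x))))
      = (\<Sum>a\<in>I. \<Sum>p\<in>P. 2 * (l a * L p a) * (lin I m x * G p x * h' (Q x)))"
      by (simp add: sum_distrib_left sum_distrib_right mult_ac)
    also have "\<dots> = (\<Sum>p\<in>P. 2 * ip I l (L p) * (lin I m x * G p x * h' (Q x)))"
      by (subst sum.swap) (simp add: ip_def sum_distrib_left sum_distrib_right mult_ac)
    finally show "(\<Sum>a\<in>I. l a * ?F' a x) = ip I l m * h (Q x) + (\<Sum>p\<in>P. 2 * ip I l (L p) * (lin I m x * G p x * h' (Q x)))"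
      by (simp add: distrib_left sum.distrib ip_def sum_distrib_right mult.assoc)
  qed
  also have "\<dots> = ip I l m * (\<integral>x. h (Q x) \<partial>\<gamma>) + (\<Sum>p\<in>P. 2 * ip I l (L p) * (\<integral>x. lin I m x * G p x * h' (Q x) \<partial>\<gamma>))"
  proof -
    have i1: "integrable \<gamma> (\<lambda>x. h (Q x))"
    proof (rule integrable_growth[OF fin(1), where c=H])
      fix x show "\<bar>h (Q x)\<bar> \<le> H * sz I x ^ 4"
        using H(1)[of "Q x"] mult_left_mono[OF sz_pow_mono[of 0 4 x] H0] by simp
    qed measurable
    have i2: "integrable \<gamma> (\<lambda>x. lin I m x * G p x * h' (Q x))" for p
    proof (rule integrable_growth[OF fin(1), where c="nrm m * nrm (L p) * H"])
      fix x show "\<bar>lin I m x * G p x * h' (Q x)\<bar> \<le> nrm m * nrm (L p) * H * sz I x ^ 4"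
        using b2[of x p] mult_left_mono[OF sz_pow_mono[of 2 4 x], of "nrm m * nrm (L p) * H"] nrm_nonneg H0 by simp
    qed measurable
    show ?thesis using i1 i2 by (subst Bochner_Integration.integral_add) (auto simp: Bochner_Integration.integral_sum)
  qed
  finally show ?thesis .
qed

lemma second_moment: "(\<integral>x. lin I l x * lin I m x \<partial>\<gamma>) = ip I l m"
proof -
  interpret prob_space \<gamma> by (rule prob_space_gauss_meas)
  show ?thesis using quad_ibp[of "\<lambda>_. 1" "\<lambda>_. 0" 1 l m] by (simp add: prob_space)
qed

lemma integrable_lin4: "integrable \<gamma> (\<lambda>x. lin I l x * (lin I m x * (lin I u x * lin I v x)))"
proof (rule integrable_growth[OF fin(1), where c="nrm l * (nrm m * (nrm u * nrm v))"])
  fix x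
  have s0: "0 \<le> sz I x" for x using sz_ge1[of I x] by linarith
  have "\<bar>lin I l x * (lin I m x * (lin I u x * lin I v x))\<bar> \<le> (nrm l * sz I x) * ((nrm m * sz I x) * ((nrm u * sz I x) * (nrm v * sz I x)))"
    unfolding abs_mult using lin_le_nrm s0 nrm_nonneg by (intro mult_mono) auto
  then show "\<bar>lin I l x * (lin I m x * (lin I u x * lin I v x))\<bar> \<le> nrm l * (nrm m * (nrm u * nrm v)) * sz I x ^ 4"
    by (simp add: eval_nat_numeral mult_ac)
qed measurable

lemma integrable_lin2: "integrable \<gamma> (\<lambda>x. lin I l x * lin I m x)"
proof (rule integrable_growth[OF fin(1), where c="nrm l * nrm m"])
  fix x
  have s0: "0 \<le> sz I x" for x using sz_ge1[of I x] by linarith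
  have "\<bar>lin I l x * lin I m x\<bar> \<le> (nrm l * sz I x) * (nrm m * sz I x)"
    unfolding abs_mult using lin_le_nrm s0 nrm_nonneg by (intro mult_mono) auto
  also have "\<dots> = nrm l * nrm m * sz I x ^ 2" by (simp add: power2_eq_square mult_ac)
  also have "\<dots> \<le> nrm l * nrm m * sz I x ^ 4" using nrm_nonneg by (intro mult_left_mono sz_pow_mono) auto
  finally show "\<bar>lin I l x * lin I m x\<bar> \<le> nrm l * nrm m * sz I x ^ 4" .
qed measurable

text \<open>Isserlis' formula: one integration by parts in the direction \<open>l\<close> leaves
  products of two linear forms, which \<open>second_moment\<close> evaluates.\<close>

lemma wick: "(\<integral>x. lin I l x * (lin I m x * (lin I u x * lin I v x)) \<partial>\<gamma>)
  = ip I l m * ip I u v + ip I l u * ip I m v + ip I l v * ip I m u"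
proof -
  have s0: "0 \<le> sz I x" for x using sz_ge1[of I x] by linarith
  let ?c = "3 * (nrm m * (nrm u * nrm v))"
  let ?F' = "\<lambda>a x. m a * (lin I u x * lin I v x) + u a * (lin I m x * lin I v x) + v a * (lin I m x * lin I u x)"
  have c0: "0 \<le> nrm m * (nrm u * nrm v)" by (intro mult_nonneg_nonneg nrm_nonneg)
  have b: "\<bar>m a * (lin I u x * lin I v x)\<bar> \<le> nrm m * (nrm u * nrm v) * sz I x ^ 3" if "a \<in> I" for m u v :: "'i \<Rightarrow> real" and a x
  proof -
    have "\<bar>m a * (lin I u x * lin I v x)\<bar> \<le> nrm m * ((nrm u * sz I x) * (nrm v * sz I x))"
      unfolding abs_mult using lin_le_nrm s0 nrm_nonneg nrm_ge[OF that] by (intro mult_mono) auto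
    also have "\<dots> = nrm m * (nrm u * nrm v) * sz I x ^ 2" by (simp add: power2_eq_square mult_ac)
    also have "\<dots> \<le> nrm m * (nrm u * nrm v) * sz I x ^ 3" using nrm_nonneg by (intro mult_left_mono sz_pow_mono) auto
    finally show ?thesis .
  qed
  have "(\<integral>x. lin I l x * (lin I m x * (lin I u x * lin I v x)) \<partial>\<gamma>) = (\<integral>x. (\<Sum>a\<in>I. l a * ?F' a x) \<partial>\<gamma>)"
  proof (rule gauss_ibp_lin[OF fin(1), where c="?c"])
    fix x
    have "\<bar>lin I m x * (lin I u x * lin I v x)\<bar> \<le> (nrm m * sz I x) * ((nrm u * sz I x) * (nrm v * sz I x))"
      unfolding abs_mult using lin_le_nrm s0 nrm_nonneg by (intro mult_mono) auto
    also have "\<dots> = nrm m * (nrm u * nrm v) * sz I x ^ 3" by (simp add: power3_eq_cube mult_ac)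
    also have "\<dots> \<le> ?c * sz I x ^ 3" using c0 s0 by (intro mult_right_mono) auto
    finally show "\<bar>lin I m x * (lin I u x * lin I v x)\<bar> \<le> ?c * sz I x ^ 3" .
  next
    fix a x assume a: "a \<in> I"
    show "\<bar>?F' a x\<bar> \<le> ?c * sz I x ^ 3"
      using b[OF a, of m u x v] b[OF a, of u m x v] b[OF a, of v m x u] by (simp add: mult_ac)
  next
    fix a x y assume a: "a \<in> I"
    show "((\<lambda>y. lin I m (x(a:=y)) * (lin I u (x(a:=y)) * lin I v (x(a:=y)))) has_real_derivative ?F' a (x(a:=y))) (at y)"
      by (rule derivative_eq_intros DERIV_lin a refl)+ (simp add: algebra_simps)
    show "continuous_on UNIV (\<lambda>y. ?F' a (x(a:=y)))"
      by (intro continuous_intros cont_lin a)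
  qed measurable
  also have "\<dots> = (\<integral>x. ip I l m * (lin I u x * lin I v x) + ip I l u * (lin I m x * lin I v x) + ip I l v * (lin I m x * lin I u x) \<partial>\<gamma>)"
    by (simp add: distrib_left sum.distrib ip_def sum_distrib_right mult.assoc)
  also have "\<dots> = ip I l m * ip I u v + ip I l u * ip I m v + ip I l v * ip I m u"
    using integrable_lin2 by (simp add: second_moment)
  finally show ?thesis .
qed

text \<open>A quarter of the squared gradient of \<open>Q\<close>, which is what the integration by
  parts in \<open>Q_sin\<close> produces. \<open>V\<close> is the variance of
  \<open>Q\<close>.\<close>

definition D :: "('i \<Rightarrow> real) \<Rightarrow> real" where "D x = (\<Sum>p\<in>P. \<Sum>q\<in>P. C p q * (G p x * G q x))"
definition V :: real where "V = 2 * (\<Sum>p\<in>P. \<Sum>q\<in>P. (C p q)\<^sup>2)"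

lemma measurable_D [measurable]: "D \<in> borel_measurable \<gamma>"
  unfolding D_def[abs_def] by measurable

lemma integrable_D: "integrable \<gamma> D"
  unfolding D_def[abs_def] G_def by (intro Bochner_Integration.integrable_sum integrable_mult_right integrable_lin2)

lemma V_nonneg: "0 \<le> V" by (simp add: V_def sum_nonneg)

lemma expectation_D: "(\<integral>x. D x \<partial>\<gamma>) = V / 2"
  unfolding D_def[abs_def] G_def V_def
  by (simp add: Bochner_Integration.integral_sum integrable_lin2 second_moment power2_eq_square flip: C_def)

lemma D_square: "(D x)\<^sup>2 = (\<Sum>p\<in>P. \<Sum>q\<in>P. \<Sum>r\<in>P. \<Sum>s\<in>P. (C p q * C r s) * (G p x * (G q x * (G r x * G s x))))"
proof -
  have "(D x)\<^sup>2 = (\<Sum>p\<in>P. \<Sum>q\<in>P. C p q * (G p x * G q x) * D x)"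
    unfolding power2_eq_square by (subst (1) D_def) (simp only: sum_distrib_right)
  also have "\<dots> = (\<Sum>p\<in>P. \<Sum>q\<in>P. \<Sum>r\<in>P. \<Sum>s\<in>P. (C p q * C r s) * (G p x * (G q x * (G r x * G s x))))"
    unfolding D_def sum_distrib_left by (intro sum.cong refl) (simp add: mult_ac)
  finally show ?thesis .
qed

lemma integrable_D2: "integrable \<gamma> (\<lambda>x. (D x)\<^sup>2)"
  unfolding D_square G_def by (intro Bochner_Integration.integrable_sum integrable_mult_right integrable_lin4)

text \<open>Of the three pairings in \<open>wick\<close>, one factorises into the squared mean. The
  other two both give the trace of \<open>C^4\<close>, written as the squared Frobenius norm of
  \<open>C^2\<close>.\<close>

lemma expectation_D2: "(\<integral>x. (D x)\<^sup>2 \<partial>\<gamma>) = (V/2)\<^sup>2 + 2 * (\<Sum>p\<in>P. \<Sum>r\<in>P. (\<Sum>q\<in>P. C p q * C q r)\<^sup>2)"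
proof -
  have "(\<integral>x. (D x)\<^sup>2 \<partial>\<gamma>) = (\<Sum>p\<in>P. \<Sum>q\<in>P. \<Sum>r\<in>P. \<Sum>s\<in>P. (C p q * C r s) * (C p q * C r s + C p r * C q s + C p s * C q r))"
    unfolding D_square G_def by (simp add: Bochner_Integration.integral_sum integrable_lin4 wick flip: C_def)
  also have "\<dots> = (\<Sum>p\<in>P. \<Sum>q\<in>P. \<Sum>r\<in>P. \<Sum>s\<in>P. (C p q)\<^sup>2 * (C r s)\<^sup>2)
     + (\<Sum>p\<in>P. \<Sum>q\<in>P. \<Sum>r\<in>P. \<Sum>s\<in>P. (C p q * C q s) * (C p r * C r s))
     + (\<Sum>p\<in>P. \<Sum>q\<in>P. \<Sum>r\<in>P. \<Sum>s\<in>P. (C p q * C q r) * (C p s * C s r))"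
  proof -
    have "(C p q * C r s) * (C p q * C r s + C p r * C q s + C p s * C q r)
      = (C p q)\<^sup>2 * (C r s)\<^sup>2 + (C p q * C q s) * (C p r * C r s) + (C p q * C q r) * (C p s * C s r)" for p q r s
      unfolding C_commute[of s r] by (simp add: power2_eq_square algebra_simps)
    then show ?thesis by (simp only: sum.distrib)
  qed
  also have "(\<Sum>p\<in>P. \<Sum>q\<in>P. \<Sum>r\<in>P. \<Sum>s\<in>P. (C p q)\<^sup>2 * (C r s)\<^sup>2) = (V/2)\<^sup>2"
    by (simp only: sum_distrib_left[symmetric] sum_distrib_right[symmetric]) (simp add: V_def power2_eq_square)
  also have "(\<Sum>p\<in>P. \<Sum>q\<in>P. \<Sum>r\<in>P. \<Sum>s\<in>P. (C p q * C q s) * (C p r * C r s)) = (\<Sum>p\<in>P. \<Sum>s\<in>P. (\<Sum>q\<in>P. C p q * C q s)\<^sup>2)"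
  proof (rule sum.cong[OF refl])
    fix p
    have "(\<Sum>q\<in>P. \<Sum>r\<in>P. \<Sum>s\<in>P. (C p q * C q s) * (C p r * C r s)) = (\<Sum>q\<in>P. \<Sum>s\<in>P. \<Sum>r\<in>P. (C p q * C q s) * (C p r * C r s))"
      by (intro sum.cong refl sum.swap)
    also have "\<dots> = (\<Sum>s\<in>P. \<Sum>q\<in>P. \<Sum>r\<in>P. (C p q * C q s) * (C p r * C r s))" by (rule sum.swap)
    finally show "(\<Sum>q\<in>P. \<Sum>r\<in>P. \<Sum>s\<in>P. (C p q * C q s) * (C p r * C r s)) = (\<Sum>s\<in>P. (\<Sum>q\<in>P. C p q * C q s)\<^sup>2)"
      by (simp add: power2_eq_square sum_product)
  qed
  also have "(\<Sum>p\<in>P. \<Sum>q\<in>P. \<Sum>r\<in>P. \<Sum>s\<in>P. (C p q * C q r) * (C p s * C s r)) = (\<Sum>p\<in>P. \<Sum>r\<in>P. (\<Sum>q\<in>P. C p q * C q r)\<^sup>2)"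
    by (rule sum.cong[OF refl], subst sum.swap) (simp add: power2_eq_square sum_product)
  finally show ?thesis by simp
qed

text \<open>The Schur test: Cauchy-Schwarz with the weights \<open>\<bar>C p q\<bar>\<close> costs
  one row sum, and summing over \<open>p\<close> first costs a second one, by symmetry. What remains
  is the sum of squares \<open>V / 2\<close>.\<close>

lemma tr4_bound:
  assumes R: "\<And>p. p \<in> P \<Longrightarrow> (\<Sum>q\<in>P. \<bar>C p q\<bar>) \<le> R"
  shows "(\<Sum>p\<in>P. \<Sum>r\<in>P. (\<Sum>q\<in>P. C p q * C q r)\<^sup>2) \<le> R\<^sup>2 * V / 2"
proof (cases "P = {}")
  case False
  then have R0: "0 \<le> R" using R by (meson abs_ge_zero all_not_in_conv order_trans sum_nonneg)
  have "(\<Sum>q\<in>P. C p q * C q r)\<^sup>2 \<le> R * (\<Sum>q\<in>P. \<bar>C p q\<bar> * (C q r)\<^sup>2)" if "p \<in> P" for p r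
  proof -
    have "(\<Sum>q\<in>P. C p q * C q r)\<^sup>2 \<le> (\<Sum>q\<in>P. \<bar>C p q\<bar> * \<bar>C q r\<bar>)\<^sup>2"
      by (intro power2_le_iff_abs_le[THEN iffD2] sum_nonneg) (auto intro!: order_trans[OF sum_abs] simp: abs_mult)
    also have "\<dots> = (\<Sum>q\<in>P. sqrt \<bar>C p q\<bar> * (sqrt \<bar>C p q\<bar> * \<bar>C q r\<bar>))\<^sup>2" by (simp add: mult.assoc[symmetric])
    also have "\<dots> \<le> (\<Sum>q\<in>P. (sqrt \<bar>C p q\<bar>)\<^sup>2) * (\<Sum>q\<in>P. (sqrt \<bar>C p q\<bar> * \<bar>C q r\<bar>)\<^sup>2)" by (rule Cauchy_Schwarz_ineq_sum)
    also have "\<dots> = (\<Sum>q\<in>P. \<bar>C p q\<bar>) * (\<Sum>q\<in>P. \<bar>C p q\<bar> * (C q r)\<^sup>2)" by (simp add: power_mult_distrib)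
    also have "\<dots> \<le> R * (\<Sum>q\<in>P. \<bar>C p q\<bar> * (C q r)\<^sup>2)" using R[OF that] by (intro mult_right_mono sum_nonneg) auto
    finally show ?thesis .
  qed
  then have "(\<Sum>p\<in>P. \<Sum>r\<in>P. (\<Sum>q\<in>P. C p q * C q r)\<^sup>2) \<le> (\<Sum>p\<in>P. \<Sum>r\<in>P. R * (\<Sum>q\<in>P. \<bar>C p q\<bar> * (C q r)\<^sup>2))"
    by (intro sum_mono)
  also have "\<dots> = R * (\<Sum>p\<in>P. \<Sum>r\<in>P. \<Sum>q\<in>P. \<bar>C p q\<bar> * (C q r)\<^sup>2)" by (simp add: sum_distrib_left)
  also have "(\<Sum>p\<in>P. \<Sum>r\<in>P. \<Sum>q\<in>P. \<bar>C p q\<bar> * (C q r)\<^sup>2) = (\<Sum>p\<in>P. \<Sum>q\<in>P. \<bar>C p q\<bar> * (\<Sum>r\<in>P. (C q r)\<^sup>2))"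
  proof (rule sum.cong[OF refl])
    fix p
    show "(\<Sum>r\<in>P. \<Sum>q\<in>P. \<bar>C p q\<bar> * (C q r)\<^sup>2) = (\<Sum>q\<in>P. \<bar>C p q\<bar> * (\<Sum>r\<in>P. (C q r)\<^sup>2))"
      by (subst sum.swap) (simp add: sum_distrib_left)
  qed
  also have "\<dots> = (\<Sum>q\<in>P. (\<Sum>p\<in>P. \<bar>C q p\<bar>) * (\<Sum>r\<in>P. (C q r)\<^sup>2))"
  proof (subst sum.swap, rule sum.cong[OF refl])
    fix q
    show "(\<Sum>p\<in>P. \<bar>C p q\<bar> * (\<Sum>r\<in>P. (C q r)\<^sup>2)) = (\<Sum>p\<in>P. \<bar>C q p\<bar>) * (\<Sum>r\<in>P. (C q r)\<^sup>2)"
      unfolding sum_distrib_right by (simp only: C_commute[of _ q])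
  qed
  also have "\<dots> \<le> (\<Sum>q\<in>P. R * (\<Sum>r\<in>P. (C q r)\<^sup>2))" using R by (intro sum_mono mult_right_mono sum_nonneg) auto
  also have "\<dots> = R * (V / 2)" by (simp add: V_def flip: sum_distrib_left)
  finally show ?thesis using R0 by (simp add: power2_eq_square mult_left_mono mult.assoc)
next
  case True
  then have "(\<Sum>p\<in>P. \<Sum>r\<in>P. (\<Sum>q\<in>P. C p q * C q r)\<^sup>2) = 0" by simp
  moreover have "0 \<le> R\<^sup>2 * V / 2" using V_nonneg by simp
  ultimately show ?thesis by simp
qed

text \<open>The variance of \<open>D\<close> is twice the trace of \<open>C^4\<close>, hence at most
  \<open>R^2 V\<close>. The passage from the second to the first moment is the nonnegativity of the
  variance of \<open>\<bar>D - V/2\<bar>\<close>.\<close>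

lemma deviation_D:
  assumes R: "\<And>p. p \<in> P \<Longrightarrow> (\<Sum>q\<in>P. \<bar>C p q\<bar>) \<le> R" and R0: "0 \<le> R"
  shows "(\<integral>x. \<bar>D x - V/2\<bar> \<partial>\<gamma>) \<le> R * sqrt V"
proof -
  interpret prob_space \<gamma> by (rule prob_space_gauss_meas)
  have "(expectation (\<lambda>x. \<bar>D x - V/2\<bar>))\<^sup>2 \<le> expectation (\<lambda>x. \<bar>D x - V/2\<bar>\<^sup>2)"
  proof -
    have "integrable \<gamma> (\<lambda>x. (D x)\<^sup>2 - V * D x + (V/2)\<^sup>2)" using integrable_D integrable_D2 by auto
    moreover have "\<bar>D x - V/2\<bar>\<^sup>2 = (D x)\<^sup>2 - V * D x + (V/2)\<^sup>2" for x by (simp add: power2_eq_square field_simps)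
    ultimately have i2: "integrable \<gamma> (\<lambda>x. \<bar>D x - V/2\<bar>\<^sup>2)" by simp
    have i1: "integrable \<gamma> (\<lambda>x. \<bar>D x - V/2\<bar>)" using integrable_D by auto
    show ?thesis
      using variance_eq[OF i1 i2] variance_positive[of "\<lambda>x. \<bar>D x - V/2\<bar>"] by linarith
  qed
  also have "expectation (\<lambda>x. \<bar>D x - V/2\<bar>\<^sup>2) = expectation (\<lambda>x. (D x)\<^sup>2 - V * D x + (V/2)\<^sup>2)"
    by (intro Bochner_Integration.integral_cong refl) (simp add: power2_diff algebra_simps)
  also have "\<dots> = (V/2)\<^sup>2 + 2 * (\<Sum>p\<in>P. \<Sum>r\<in>P. (\<Sum>q\<in>P. C p q * C q r)\<^sup>2) - V * (V/2) + (V/2)\<^sup>2"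
    using integrable_D integrable_D2 by (simp add: expectation_D expectation_D2 prob_space)
  also have "\<dots> \<le> R\<^sup>2 * V" using tr4_bound[OF R] by (simp add: power2_eq_square[of "V/2"])
  also have "\<dots> = (R * sqrt V)\<^sup>2" using V_nonneg by (simp add: power_mult_distrib)
  finally show ?thesis by (rule power2_le_imp_le) (use R0 V_nonneg in simp)
qed

lemma integrable_cos: "integrable \<gamma> (\<lambda>x. cos (t * Q x + b))"
proof (rule integrable_growth[OF fin(1), where c=1])
  show "\<bar>cos (t * Q x + b)\<bar> \<le> 1 * sz I x ^ 4" for x
    using order_trans[OF abs_cos_le_one one_le_power[OF sz_ge1]] by simp
qed measurable

lemma integrable_Q2: "integrable \<gamma> (\<lambda>x. (Q x)\<^sup>2)"
proof (rule integrable_growth[OF fin(1), where c="(\<Sum>p\<in>P. (nrm (L p))\<^sup>2 + \<bar>C p p\<bar>)\<^sup>2"])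
  fix x
  have s1: "1 \<le> sz I x ^ 2" using one_le_power[OF sz_ge1] .
  have "\<bar>Q x\<bar> \<le> (\<Sum>p\<in>P. ((nrm (L p))\<^sup>2 + \<bar>C p p\<bar>) * sz I x ^ 2)"
    unfolding Q_def
  proof (rule order_trans[OF sum_abs], rule sum_mono)
    fix p
    have "\<bar>G p x\<bar>\<^sup>2 \<le> (nrm (L p) * sz I x)\<^sup>2" using lin_le_nrm unfolding G_def by (intro power_mono) auto
    moreover have "\<bar>C p p\<bar> \<le> \<bar>C p p\<bar> * sz I x ^ 2" using s1 by (simp add: mult_le_cancel_left1)
    ultimately show "\<bar>(G p x)\<^sup>2 - C p p\<bar> \<le> ((nrm (L p))\<^sup>2 + \<bar>C p p\<bar>) * sz I x ^ 2"
      using abs_triangle_ineq4[of "(G p x)\<^sup>2" "C p p"] by (simp add: power_mult_distrib distrib_right)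
  qed
  then have "\<bar>Q x\<bar>\<^sup>2 \<le> ((\<Sum>p\<in>P. ((nrm (L p))\<^sup>2 + \<bar>C p p\<bar>)) * sz I x ^ 2)\<^sup>2"
    by (intro power_mono) (auto simp: sum_distrib_right)
  then show "\<bar>(Q x)\<^sup>2\<bar> \<le> (\<Sum>p\<in>P. (nrm (L p))\<^sup>2 + \<bar>C p p\<bar>)\<^sup>2 * sz I x ^ 4"
    by (simp add: power_mult_distrib flip: power_mult)
qed measurable

lemma integrable_Q: "integrable \<gamma> Q"
proof -
  interpret prob_space \<gamma> by (rule prob_space_gauss_meas)
  show ?thesis by (rule square_integrable_imp_integrable[OF measurable_GQ(2) integrable_Q2])
qed

lemma integrable_Qbd: assumes [measurable]: "f \<in> borel_measurable borel" and "\<And>z. \<bar>f z\<bar> \<le> 1"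
  shows "integrable \<gamma> (\<lambda>x. Q x * f (Q x))"
  by (rule Bochner_Integration.integrable_bound[OF integrable_Q])
     (use assms(2) in \<open>auto simp: abs_mult mult_le_cancel_left2 intro!: mult_left_le\<close>)

lemma DERIV_char_part:
  "((\<lambda>t. \<integral>x. cos (t * Q x + b) \<partial>\<gamma>) has_real_derivative (- (\<integral>x. Q x * sin (t * Q x + b) \<partial>\<gamma>))) (at t)"
proof (rule DERIV_quadratic_bound)
  fix h :: real
  let ?r = "\<lambda>x. cos (t * Q x + b + h * Q x) - cos (t * Q x + b) + h * Q x * sin (t * Q x + b)"
  have i: "integrable \<gamma> (\<lambda>x. Q x * sin (t * Q x + b))"
    using integrable_Qbd[of "\<lambda>z. sin (t * z + b)"] by simp
  have i': "integrable \<gamma> (\<lambda>x. cos (t * Q x + b + h * Q x))"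
    using integrable_cos[of "t+h" b] by (simp add: algebra_simps)
  have eq1: "(\<integral>x. cos ((t + h) * Q x + b) \<partial>\<gamma>) - (\<integral>x. cos (t * Q x + b) \<partial>\<gamma>) - h * (- (\<integral>x. Q x * sin (t * Q x + b) \<partial>\<gamma>))
    = (\<integral>x. ?r x \<partial>\<gamma>)"
    using i i' integrable_cos[of t b] by (simp add: algebra_simps)
  have bd: "\<bar>\<integral>x. ?r x \<partial>\<gamma>\<bar> \<le> (\<integral>x. h\<^sup>2 * ((Q x)\<^sup>2 / 2) \<partial>\<gamma>)"
  proof (rule order_trans[OF integral_abs_bound integral_mono])
    show "integrable \<gamma> (\<lambda>x. \<bar>?r x\<bar>)" using i i' integrable_cos[of t b] by (auto simp: mult.assoc)
    show "integrable \<gamma> (\<lambda>x. h\<^sup>2 * ((Q x)\<^sup>2 / 2))" using integrable_Q2 by auto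
    show "\<bar>?r x\<bar> \<le> h\<^sup>2 * ((Q x)\<^sup>2 / 2)" for x
      using cos_quadratic_bound[of "t * Q x + b" "h * Q x"] by (simp add: power_mult_distrib)
  qed
  have eq2: "(\<integral>x. h\<^sup>2 * ((Q x)\<^sup>2 / 2) \<partial>\<gamma>) = (\<integral>x. (Q x)\<^sup>2 \<partial>\<gamma>) / 2 * h\<^sup>2"
    unfolding integral_mult_right_zero integral_divide_zero by (rule mult.commute)
  show "\<bar>(\<integral>x. cos ((t + h) * Q x + b) \<partial>\<gamma>) - (\<integral>x. cos (t * Q x + b) \<partial>\<gamma>) - h * (- (\<integral>x. Q x * sin (t * Q x + b) \<partial>\<gamma>))\<bar>
     \<le> (\<integral>x. (Q x)\<^sup>2 \<partial>\<gamma>) / 2 * h\<^sup>2"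
    unfolding eq1 eq2[symmetric] by (rule bd)
qed

text \<open>Each \<open>G p * (G p * sin)\<close> is integrated by parts in the direction
  \<open>L p\<close>. The derivative of the second \<open>G p\<close> contributes
  \<open>C p p\<close> times the mean of the sine, which the centring of \<open>Q\<close> cancels;
  the derivatives of the sine add up to \<open>D\<close>.\<close>

lemma Q_sin: "(\<integral>x. Q x * sin (t * Q x + b) \<partial>\<gamma>) = 2 * t * (\<integral>x. D x * cos (t * Q x + b) \<partial>\<gamma>)"
proof -
  let ?h = "\<lambda>z. sin (t * z + b)" and ?h' = "\<lambda>z. t * cos (t * z + b)"
  have q: "(\<integral>x. lin I l x * (lin I m x * ?h (Q x)) \<partial>\<gamma>)
    = ip I l m * (\<integral>x. ?h (Q x) \<partial>\<gamma>) + (\<Sum>p\<in>P. 2 * ip I l (L p) * (\<integral>x. lin I m x * G p x * ?h' (Q x) \<partial>\<gamma>))" for l m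
  proof (rule quad_ibp[where H="1 + \<bar>t\<bar>"])
    show "(?h has_real_derivative ?h' z) (at z)" for z by (auto intro!: derivative_eq_intros)
    show "continuous_on UNIV ?h'" by (intro continuous_intros)
    show "\<bar>?h z\<bar> \<le> 1 + \<bar>t\<bar>" for z using abs_sin_le_one[of "t * z + b"] by linarith
    show "\<bar>?h' z\<bar> \<le> 1 + \<bar>t\<bar>" for z using mult_left_mono[OF abs_cos_le_one[of "t * z + b"], of "\<bar>t\<bar>"] by (simp add: abs_mult)
  qed
  have isn: "integrable \<gamma> (\<lambda>x. sin (t * Q x + b))"
  proof (rule integrable_growth[OF fin(1), where c=1])
    show "\<bar>sin (t * Q x + b)\<bar> \<le> 1 * sz I x ^ 4" for x
      using order_trans[OF abs_sin_le_one one_le_power[OF sz_ge1]] by simp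
  qed measurable
  have ig: "integrable \<gamma> (\<lambda>x. (G p x * G q x) * f x)" if "f \<in> borel_measurable \<gamma>" "\<And>x. \<bar>f x\<bar> \<le> 1" for p q f
    by (rule Bochner_Integration.integrable_bound[OF integrable_lin2[of "L p" "L q"]])
       (use that in \<open>auto simp: abs_mult G_def intro!: mult_left_le\<close>)
  have ig2: "integrable \<gamma> (\<lambda>x. G p x * (G p x * sin (t * Q x + b)))" for p
    using ig[of "\<lambda>x. sin (t * Q x + b)" p p] by (simp add: mult.assoc)
  have ig3: "integrable \<gamma> (\<lambda>x. G p x * (G q x * cos (t * Q x + b)))" for p q
    using ig[of "\<lambda>x. cos (t * Q x + b)" p q] by (simp add: mult.assoc)
  have "(\<integral>x. Q x * sin (t * Q x + b) \<partial>\<gamma>) = (\<integral>x. (\<Sum>p\<in>P. G p x * (G p x * sin (t * Q x + b)) - C p p * sin (t * Q x + b)) \<partial>\<gamma>)"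
  proof (intro Bochner_Integration.integral_cong refl)
    fix x
    have "Q x * sin (t * Q x + b) = (\<Sum>p\<in>P. ((G p x)\<^sup>2 - C p p) * sin (t * Q x + b))"
      by (subst (1) Q_def) (rule sum_distrib_right)
    then show "Q x * sin (t * Q x + b) = (\<Sum>p\<in>P. G p x * (G p x * sin (t * Q x + b)) - C p p * sin (t * Q x + b))"
      by (simp add: left_diff_distrib power2_eq_square mult.assoc)
  qed
  also have "\<dots> = (\<Sum>p\<in>P. (\<integral>x. G p x * (G p x * sin (t * Q x + b)) \<partial>\<gamma>) - C p p * (\<integral>x. sin (t * Q x + b) \<partial>\<gamma>))"
    using isn ig2 by (subst Bochner_Integration.integral_sum) auto
  also have "\<dots> = (\<Sum>p\<in>P. \<Sum>q\<in>P. 2 * C p q * (\<integral>x. G p x * G q x * (t * cos (t * Q x + b)) \<partial>\<gamma>))"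
    using q[of "L _" "L _"] by (simp add: C_def G_def)
  also have "\<dots> = (\<Sum>p\<in>P. \<Sum>q\<in>P. (\<integral>x. 2 * t * (C p q * (G p x * (G q x * cos (t * Q x + b)))) \<partial>\<gamma>))"
    by (intro sum.cong refl) (simp add: mult_ac)
  also have "\<dots> = (\<integral>x. (\<Sum>p\<in>P. \<Sum>q\<in>P. 2 * t * (C p q * (G p x * (G q x * cos (t * Q x + b))))) \<partial>\<gamma>)"
    using ig3 by (subst Bochner_Integration.integral_sum, fastforce)+ simp
  also have "\<dots> = (\<integral>x. 2 * t * (D x * cos (t * Q x + b)) \<partial>\<gamma>)"
    unfolding D_def by (simp add: sum_distrib_left sum_distrib_right mult.assoc)
  finally show ?thesis by simp
qed

lemma char_part_bound:
  assumes R: "\<And>p. p \<in> P \<Longrightarrow> (\<Sum>q\<in>P. \<bar>C p q\<bar>) \<le> R" and R0: "0 \<le> R"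
  shows "\<bar>(\<integral>x. cos (t * Q x + b) \<partial>\<gamma>) - cos b * exp (- t\<^sup>2 * V / 2)\<bar> \<le> 2 * t\<^sup>2 * (R * sqrt V)"
proof -
  interpret prob_space \<gamma> by (rule prob_space_gauss_meas)
  define w where "w t = (\<integral>x. cos (t * Q x + b) \<partial>\<gamma>)" for t
  define \<epsilon> where "\<epsilon> t = (\<integral>x. (D x - V/2) * cos (t * Q x + b) \<partial>\<gamma>)" for t
  have K0: "0 \<le> R * sqrt V" using R0 V_nonneg by simp
  have iD: "integrable \<gamma> (\<lambda>x. D x * cos (t * Q x + b))" for t
    by (rule Bochner_Integration.integrable_bound[OF integrable_D]) (auto simp: abs_mult intro!: mult_left_le)
  have dw: "(w has_real_derivative (- t * V * w t - 2 * t * \<epsilon> t)) (at t)" for t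
  proof -
    have "\<epsilon> t = (\<integral>x. D x * cos (t * Q x + b) \<partial>\<gamma>) - V/2 * w t"
      unfolding \<epsilon>_def w_def left_diff_distrib using iD[of t] integrable_cos[of t b] by simp
    then have eq: "(\<integral>x. D x * cos (t * Q x + b) \<partial>\<gamma>) = \<epsilon> t + V/2 * w t" by simp
    have "(w has_real_derivative - (2 * t * (\<epsilon> t + V/2 * w t))) (at t)"
      using DERIV_char_part[of b t] unfolding Q_sin eq by (simp add: w_def[abs_def])
    then show ?thesis by (rule DERIV_cong) (simp add: algebra_simps)
  qed
  have \<epsilon>: "\<bar>\<epsilon> t\<bar> \<le> R * sqrt V" for t
  proof -
    have i: "integrable \<gamma> (\<lambda>x. (D x - V/2) * cos (t * Q x + b))"
      unfolding left_diff_distrib using iD[of t] integrable_cos[of t b] by simp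
    have "\<bar>\<epsilon> t\<bar> \<le> (\<integral>x. \<bar>D x - V/2\<bar> \<partial>\<gamma>)" unfolding \<epsilon>_def
    proof (rule order_trans[OF integral_abs_bound integral_mono])
      show "integrable \<gamma> (\<lambda>x. \<bar>(D x - V/2) * cos (t * Q x + b)\<bar>)" using i by simp
      show "integrable \<gamma> (\<lambda>x. \<bar>D x - V/2\<bar>)" using integrable_D by simp
    qed (auto simp: abs_mult intro!: mult_left_le)
    also have "\<dots> \<le> R * sqrt V" by (rule deviation_D[OF R R0])
    finally show ?thesis .
  qed
  \<comment> \<open>The integrating factor of \<open>w' = - t V w\<close>: the derivative of
    \<open>\<psi>\<close> contains the error \<open>\<epsilon>\<close> alone.\<close>
  define \<psi> where "\<psi> t = w t * exp (t\<^sup>2 * V / 2)" for t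
  have d\<psi>: "(\<psi> has_real_derivative (- 2 * t * \<epsilon> t * exp (t\<^sup>2 * V / 2))) (at t)" for t
  proof -
    have "((\<lambda>t. exp (t\<^sup>2 * V / 2)) has_real_derivative t * V * exp (t\<^sup>2 * V / 2)) (at t)"
      by (auto intro!: derivative_eq_intros)
    from DERIV_mult[OF dw this] show ?thesis unfolding \<psi>_def[abs_def] by (rule DERIV_cong) (simp add: algebra_simps)
  qed
  have "\<bar>\<psi> t - \<psi> 0\<bar> \<le> (2 * \<bar>t\<bar> * (R * sqrt V) * exp (t\<^sup>2 * V / 2)) * \<bar>t - 0\<bar>"
  proof (rule field_differentiable_bound[where S="closed_segment 0 t" and f=\<psi>, unfolded real_norm_def])
    fix z assume "z \<in> closed_segment 0 t"
    then have z: "\<bar>z\<bar> \<le> \<bar>t\<bar>" by (auto simp: closed_segment_eq_real_ivl split: if_splits)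
    show "(\<psi> has_field_derivative (- 2 * z * \<epsilon> z * exp (z\<^sup>2 * V / 2))) (at z within closed_segment 0 t)"
      by (rule has_field_derivative_at_within[OF d\<psi>])
    have "z\<^sup>2 \<le> t\<^sup>2" using z by (rule abs_le_square_iff[THEN iffD1])
    then show "\<bar>- 2 * z * \<epsilon> z * exp (z\<^sup>2 * V / 2)\<bar> \<le> 2 * \<bar>t\<bar> * (R * sqrt V) * exp (t\<^sup>2 * V / 2)"
      unfolding abs_mult using z \<epsilon>[of z] V_nonneg K0 by (intro mult_mono) (auto intro!: mult_right_mono)
  qed auto
  then have "\<bar>\<psi> t - cos b\<bar> \<le> (2 * t\<^sup>2 * (R * sqrt V)) * exp (t\<^sup>2 * V / 2)"
    by (simp add: \<psi>_def w_def prob_space power2_eq_square mult_ac flip: abs_mult)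
  \<comment> \<open>The mean value bound takes the exponential at the far end \<open>t\<close> of
    the segment, so that dividing it out again leaves no exponential of \<open>V\<close>.\<close>
  then have "\<bar>\<psi> t - cos b\<bar> * exp (- t\<^sup>2 * V / 2) \<le> (2 * t\<^sup>2 * (R * sqrt V)) * exp (t\<^sup>2 * V / 2) * exp (- t\<^sup>2 * V / 2)"
    by (intro mult_right_mono) auto
  also have "\<dots> = 2 * t\<^sup>2 * (R * sqrt V)" by (simp add: mult.assoc flip: exp_add)
  also have "\<bar>\<psi> t - cos b\<bar> * exp (- t\<^sup>2 * V / 2) = \<bar>(\<psi> t - cos b) * exp (- t\<^sup>2 * V / 2)\<bar>" by (simp add: abs_mult)
  also have "(\<psi> t - cos b) * exp (- t\<^sup>2 * V / 2) = w t - cos b * exp (- t\<^sup>2 * V / 2)"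
    by (simp add: \<psi>_def left_diff_distrib mult.assoc flip: exp_add)
  finally show ?thesis unfolding w_def .
qed

end

section \<open>Square integrable functions\<close>

definition L2 :: "'a measure \<Rightarrow> ('a \<Rightarrow> real) \<Rightarrow> bool" where
  "L2 M f \<longleftrightarrow> f \<in> borel_measurable M \<and> integrable M (\<lambda>x. (f x)\<^sup>2)"

lemma L2_measurable: "L2 M f \<Longrightarrow> f \<in> borel_measurable M" by (simp add: L2_def)
lemma L2_square: "L2 M f \<Longrightarrow> integrable M (\<lambda>x. (f x)\<^sup>2)" by (simp add: L2_def)

lemma L2_mult_integrable: assumes "L2 M f" "L2 M g" shows "integrable M (\<lambda>x. f x * g x)"
proof (rule Bochner_Integration.integrable_bound)
  show "integrable M (\<lambda>x. (f x)\<^sup>2 + (g x)\<^sup>2)" using assms by (auto simp: L2_def)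
  have "\<bar>a * b\<bar> \<le> a\<^sup>2 + b\<^sup>2" for a b :: real
    using zero_le_power2[of "a + b"] zero_le_power2[of "a - b"] zero_le_power2[of a] zero_le_power2[of b]
    unfolding power2_sum power2_diff by linarith
  then show "AE x in M. norm (f x * g x) \<le> norm ((f x)\<^sup>2 + (g x)\<^sup>2)" by auto
qed (use assms in \<open>auto simp: L2_def\<close>)

lemma L2_zero [simp]: "L2 M (\<lambda>x. 0)" by (simp add: L2_def)

lemma L2_add: assumes "L2 M f" "L2 M g" shows "L2 M (\<lambda>x. f x + g x)"
proof -
  have "integrable M (\<lambda>x. (f x)\<^sup>2 + (g x)\<^sup>2 + 2 * (f x * g x))"
    using assms L2_mult_integrable[OF assms] by (auto simp: L2_def)
  moreover have "(\<lambda>x. (f x)\<^sup>2 + (g x)\<^sup>2 + 2 * (f x * g x)) = (\<lambda>x. (f x + g x)\<^sup>2)" by (simp add: power2_sum mult.assoc)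
  ultimately show ?thesis using assms by (auto simp: L2_def)
qed

lemma L2_cmult: "L2 M f \<Longrightarrow> L2 M (\<lambda>x. c * f x)" by (auto simp: L2_def power_mult_distrib)

lemma L2_diff: assumes "L2 M f" "L2 M g" shows "L2 M (\<lambda>x. f x - g x)"
  using L2_add[OF assms(1) L2_cmult[OF assms(2), of "-1"]] by simp

lemma L2_sum: "(\<And>i. i \<in> I \<Longrightarrow> L2 M (f i)) \<Longrightarrow> L2 M (\<lambda>x. \<Sum>i\<in>I. f i x)"
  by (induction I rule: infinite_finite_induct) (auto intro: L2_add)

lemma L2_const: "prob_space M \<Longrightarrow> L2 M (\<lambda>x. c)"
proof -
  assume "prob_space M" then interpret prob_space M .
  show ?thesis by (simp add: L2_def)
qed

lemma L2_AE_eq: assumes "L2 M f" "g \<in> borel_measurable M" "AE x in M. f x = g x" shows "L2 M g"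
proof -
  have "integrable M (\<lambda>x. (f x)\<^sup>2) \<longleftrightarrow> integrable M (\<lambda>x. (g x)\<^sup>2)"
    using assms by (intro integrable_cong_AE) (auto simp: L2_def)
  then show ?thesis using assms by (simp add: L2_def)
qed

text \<open>The quadratic \<open>c^2 F - 2 c H + G\<close> is nonnegative for every
  \<open>c\<close>. Its minimum is at \<open>c = H / F\<close>; if \<open>F = 0\<close>, a large
  \<open>c\<close> forces \<open>H = 0\<close>.\<close>

lemma L2_Cauchy_Schwarz: assumes "L2 M f" "L2 M g"
  shows "(\<integral>x. \<bar>f x * g x\<bar> \<partial>M) \<le> sqrt (\<integral>x. (f x)\<^sup>2 \<partial>M) * sqrt (\<integral>x. (g x)\<^sup>2 \<partial>M)"
proof -
  let ?F = "\<integral>x. (f x)\<^sup>2 \<partial>M" and ?G = "\<integral>x. (g x)\<^sup>2 \<partial>M" and ?H = "\<integral>x. \<bar>f x * g x\<bar> \<partial>M"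
  have i: "integrable M (\<lambda>x. \<bar>f x * g x\<bar>)" using L2_mult_integrable[OF assms] by simp
  have if2: "integrable M (\<lambda>x. (f x)\<^sup>2)" and ig2: "integrable M (\<lambda>x. (g x)\<^sup>2)" using assms by (auto simp: L2_def)
  have F0: "0 \<le> ?F" "0 \<le> ?G" "0 \<le> ?H" by auto
  have q: "2 * c * ?H \<le> c\<^sup>2 * ?F + ?G" for c :: real
  proof -
    have "(\<integral>x. 2 * c * \<bar>f x * g x\<bar> \<partial>M) \<le> (\<integral>x. c\<^sup>2 * (f x)\<^sup>2 + (g x)\<^sup>2 \<partial>M)"
    proof (rule integral_mono)
      fix x
      have "0 \<le> (c * \<bar>f x\<bar> - \<bar>g x\<bar>)\<^sup>2" by simp
      then show "2 * c * \<bar>f x * g x\<bar> \<le> c\<^sup>2 * (f x)\<^sup>2 + (g x)\<^sup>2"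
        unfolding power2_diff abs_mult by (simp add: power_mult_distrib mult_ac)
    qed (use i if2 ig2 in auto)
    then show ?thesis using if2 ig2 i by simp
  qed
  have "?H\<^sup>2 \<le> ?F * ?G"
  proof (cases "?F = 0")
    case True
    have "?H = 0"
    proof (rule ccontr)
      assume "?H \<noteq> 0" then have h: "0 < ?H" using F0(3) by (metis order_le_less)
      have "2 * ((?G + 1) / ?H) * ?H \<le> ?G" using q[of "(?G + 1) / ?H"] True by simp
      then have "2 * (?G + 1) \<le> ?G" using h by simp
      then show False using F0 by simp
    qed
    then show ?thesis using F0 True by simp
  next
    case False
    then have "0 < ?F" using F0(1) by (metis order_le_less)
    moreover from this have "2 * (?H / ?F) * ?H \<le> (?H / ?F)\<^sup>2 * ?F + ?G" using q by blast
    ultimately show ?thesis by (simp add: power2_eq_square field_simps)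
  qed
  then have "?H \<le> sqrt (?F * ?G)" by (rule real_le_rsqrt)
  then show ?thesis by (simp add: real_sqrt_mult)
qed

lemma L2_Cauchy_Schwarz': assumes "L2 M f" "L2 M g"
  shows "\<bar>\<integral>x. f x * g x \<partial>M\<bar> \<le> sqrt (\<integral>x. (f x)\<^sup>2 \<partial>M) * sqrt (\<integral>x. (g x)\<^sup>2 \<partial>M)"
  using L2_Cauchy_Schwarz[OF assms] integral_abs_bound[of M "\<lambda>x. f x * g x"] by linarith

lemma L2_abs_le: assumes "prob_space M" "L2 M f" shows "integrable M f" "(\<integral>x. \<bar>f x\<bar> \<partial>M) \<le> sqrt (\<integral>x. (f x)\<^sup>2 \<partial>M)"
proof -
  interpret prob_space M by fact
  show "integrable M f" using L2_mult_integrable[OF assms(2) L2_const[OF assms(1), of 1]] by simp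
  show "(\<integral>x. \<bar>f x\<bar> \<partial>M) \<le> sqrt (\<integral>x. (f x)\<^sup>2 \<partial>M)"
    using L2_Cauchy_Schwarz[OF assms(2) L2_const[OF assms(1), of 1]] by (simp add: prob_space)
qed

lemma L2_sum_square_le:
  assumes "finite I" "\<And>i. i \<in> I \<Longrightarrow> L2 M (f i)"
  shows "(\<integral>x. (\<Sum>i\<in>I. f i x)\<^sup>2 \<partial>M) \<le> real (card I) * (\<Sum>i\<in>I. \<integral>x. (f i x)\<^sup>2 \<partial>M)"
proof -
  have "(\<integral>x. (\<Sum>i\<in>I. f i x)\<^sup>2 \<partial>M) \<le> (\<integral>x. real (card I) * (\<Sum>i\<in>I. (f i x)\<^sup>2) \<partial>M)"
  proof (rule integral_mono)
    show "integrable M (\<lambda>x. (\<Sum>i\<in>I. f i x)\<^sup>2)" by (rule L2_square[OF L2_sum[OF assms(2)]])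
    show "integrable M (\<lambda>x. real (card I) * (\<Sum>i\<in>I. (f i x)\<^sup>2))"
      using assms(2) by (intro integrable_mult_right Bochner_Integration.integrable_sum L2_square)
    show "(\<Sum>i\<in>I. f i x)\<^sup>2 \<le> real (card I) * (\<Sum>i\<in>I. (f i x)\<^sup>2)" for x
      using sum_squared_le_sum_of_squares[of "\<lambda>i. f i x" I] assms(1) by (simp add: mult.commute)
  qed
  also have "\<dots> = real (card I) * (\<Sum>i\<in>I. \<integral>x. (f i x)\<^sup>2 \<partial>M)"
    using assms(2) by (simp add: Bochner_Integration.integral_sum L2_square)
  finally show ?thesis .
qed

lemma L2_add_square_le:
  assumes "L2 M f" "L2 M g"
  shows "(\<integral>x. (f x + g x)\<^sup>2 \<partial>M) \<le> 2 * (\<integral>x. (f x)\<^sup>2 \<partial>M) + 2 * (\<integral>x. (g x)\<^sup>2 \<partial>M)"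
proof -
  have "(\<integral>x. (f x + g x)\<^sup>2 \<partial>M) \<le> (\<integral>x. 2 * (f x)\<^sup>2 + 2 * (g x)\<^sup>2 \<partial>M)"
  proof (rule integral_mono)
    show "integrable M (\<lambda>x. (f x + g x)\<^sup>2)" by (rule L2_square[OF L2_add[OF assms]])
    show "integrable M (\<lambda>x. 2 * (f x)\<^sup>2 + 2 * (g x)\<^sup>2)" using L2_square[OF assms(1)] L2_square[OF assms(2)] by auto
    show "(f x + g x)\<^sup>2 \<le> 2 * (f x)\<^sup>2 + 2 * (g x)\<^sup>2" for x
      using zero_le_power2[of "f x - g x"] unfolding power2_sum power2_diff by linarith
  qed
  then show ?thesis using assms by (simp add: L2_square)
qed

lemma L2_inner_diff:
  assumes L: "L2 M f" "L2 M f'" "L2 M g" "L2 M g'"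
  shows "(\<integral>x. (f x - f' x) * (g x - g' x) \<partial>M) = (\<integral>x. f x * g x \<partial>M) - (\<integral>x. f x * g' x \<partial>M) - (\<integral>x. f' x * g x \<partial>M) + (\<integral>x. f' x * g' x \<partial>M)"
proof -
  have "(\<integral>x. (f x - f' x) * (g x - g' x) \<partial>M) = (\<integral>x. f x * g x - f x * g' x - f' x * g x + f' x * g' x \<partial>M)"
    by (intro Bochner_Integration.integral_cong refl) (simp add: algebra_simps)
  then show ?thesis by (simp add: L2_mult_integrable L)
qed

text \<open>A vanishing perturbation in mean square does not change the limit of inner products, as
  long as the norms stay bounded; convergence of the norms is the form in which this boundedness is
  at hand. It serves both to pass to Wiener integrals and to replace \<open>YY\<close> by
  \<open>GG\<close>.\<close>

lemma L2_inner_perturb: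
  assumes L: "\<And>q::nat. L2 M (Y q)" "\<And>q. L2 M (Y' q)" "\<And>q. L2 M (G q)" "\<And>q. L2 M (G' q)"
    and c: "(\<lambda>q. \<integral>x. Y q x * Y' q x \<partial>M) \<longlonglongrightarrow> c" and n: "(\<lambda>q. \<integral>x. (Y q x)\<^sup>2 \<partial>M) \<longlonglongrightarrow> v" "(\<lambda>q. \<integral>x. (Y' q x)\<^sup>2 \<partial>M) \<longlonglongrightarrow> v'"
    and d: "(\<lambda>q. \<integral>x. (Y q x - G q x)\<^sup>2 \<partial>M) \<longlonglongrightarrow> 0" "(\<lambda>q. \<integral>x. (Y' q x - G' q x)\<^sup>2 \<partial>M) \<longlonglongrightarrow> 0"
  shows "(\<lambda>q. \<integral>x. G q x * G' q x \<partial>M) \<longlonglongrightarrow> c"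
proof -
  let ?n = "\<lambda>f. sqrt (\<integral>x. (f x)\<^sup>2 \<partial>M)"
  define d d' where "d q = (\<lambda>x. Y q x - G q x)" and "d' q = (\<lambda>x. Y' q x - G' q x)" for q
  have dL: "L2 M (d q)" "L2 M (d' q)" for q unfolding d_def d'_def by (intro L2_diff L)+
  have e: "(\<integral>x. G q x * G' q x \<partial>M) = (\<integral>x. Y q x * Y' q x \<partial>M) - (\<integral>x. Y q x * d' q x \<partial>M) - (\<integral>x. d q x * Y' q x \<partial>M) + (\<integral>x. d q x * d' q x \<partial>M)" for q
  proof -
    have "(\<integral>x. G q x * G' q x \<partial>M) = (\<integral>x. Y q x * Y' q x - Y q x * d' q x - d q x * Y' q x + d q x * d' q x \<partial>M)"
      by (intro Bochner_Integration.integral_cong refl) (simp add: d_def d'_def algebra_simps)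
    then show ?thesis by (simp add: L2_mult_integrable L dL)
  qed
  have z: "(\<lambda>q. \<integral>x. f q x * g q x \<partial>M) \<longlonglongrightarrow> 0"
    if "\<And>q. L2 M (f q)" "\<And>q. L2 M (g q)" "(\<lambda>q. ?n (f q) * ?n (g q)) \<longlonglongrightarrow> 0" for f g :: "nat \<Rightarrow> 'a \<Rightarrow> real"
    by (rule Lim_null_comparison[OF _ that(3)]) (intro always_eventually allI, unfold real_norm_def, rule L2_Cauchy_Schwarz'[OF that(1,2)])
  have s: "(\<lambda>q. ?n (Y q)) \<longlonglongrightarrow> sqrt v" "(\<lambda>q. ?n (Y' q)) \<longlonglongrightarrow> sqrt v'" "(\<lambda>q. ?n (d q)) \<longlonglongrightarrow> sqrt 0" "(\<lambda>q. ?n (d' q)) \<longlonglongrightarrow> sqrt 0"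
    unfolding d_def d'_def by (intro tendsto_real_sqrt n d)+
  have z1: "(\<lambda>q. \<integral>x. Y q x * d' q x \<partial>M) \<longlonglongrightarrow> 0" using tendsto_mult[OF s(1) s(4)] by (intro z L dL) simp
  have z2: "(\<lambda>q. \<integral>x. d q x * Y' q x \<partial>M) \<longlonglongrightarrow> 0" using tendsto_mult[OF s(3) s(2)] by (intro z L dL) simp
  have z3: "(\<lambda>q. \<integral>x. d q x * d' q x \<partial>M) \<longlonglongrightarrow> 0" using tendsto_mult[OF s(3) s(4)] by (intro z L dL) simp
  have "(\<lambda>q. (\<integral>x. Y q x * Y' q x \<partial>M) - (\<integral>x. Y q x * d' q x \<partial>M) - (\<integral>x. d q x * Y' q x \<partial>M) + (\<integral>x. d q x * d' q x \<partial>M)) \<longlonglongrightarrow> c - 0 - 0 + 0"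
    by (intro tendsto_add tendsto_diff c z1 z2 z3)
  then show ?thesis unfolding e by simp
qed

lemma L2_inner_tendsto:
  assumes "L2 M f" "L2 M g" "\<And>n. L2 M (fn n)" "\<And>n. L2 M (gn n)"
    and "(\<lambda>n::nat. \<integral>x. (f x - fn n x)\<^sup>2 \<partial>M) \<longlonglongrightarrow> 0" "(\<lambda>n. \<integral>x. (g x - gn n x)\<^sup>2 \<partial>M) \<longlonglongrightarrow> 0"
  shows "(\<lambda>n. \<integral>x. fn n x * gn n x \<partial>M) \<longlonglongrightarrow> (\<integral>x. f x * g x \<partial>M)"
  by (rule L2_inner_perturb[OF assms(1-4) tendsto_const tendsto_const tendsto_const assms(5,6)])

section \<open>Gaussian families on a probability space and perturbed sums of squares\<close>

definition std_gaussian_family :: "'w measure \<Rightarrow> 'i set \<Rightarrow> ('i \<Rightarrow> 'w \<Rightarrow> real) \<Rightarrow> bool" where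
  "std_gaussian_family M I g \<longleftrightarrow> finite I \<and> prob_space.indep_vars M (\<lambda>_. borel) g I \<and>
     (\<forall>a\<in>I. distr M borel (g a) = std_normal_distribution)"

text \<open>The index set of the normals is bound inside the definition, so its type has to be
  fixed: in the application a pair is a mode and a time interval. The representation holds almost
  surely because a Brownian motion starts at \<open>0\<close> only almost surely.\<close>

definition gaussian_family :: "'w measure \<Rightarrow> 'p set \<Rightarrow> ('p \<Rightarrow> 'w \<Rightarrow> real) \<Rightarrow> bool" where
  "gaussian_family M P G \<longleftrightarrow> (\<exists>(I :: (nat \<times> nat) set) g L. std_gaussian_family M I g \<and>
     (\<forall>p\<in>P. AE \<omega> in M. G p \<omega> = (\<Sum>a\<in>I. L p a * g a \<omega>)))"

lemma std_gaussian_family_integral: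
  fixes h :: "('i \<Rightarrow> real) \<Rightarrow> real"
  assumes "prob_space M" "std_gaussian_family M I g" and [measurable]: "h \<in> borel_measurable (gauss_meas I)"
  shows "(\<lambda>\<omega>. \<lambda>a\<in>I. g a \<omega>) \<in> measurable M (gauss_meas I)"
    and "(\<integral>\<omega>. h (\<lambda>a\<in>I. g a \<omega>) \<partial>M) = (\<integral>x. h x \<partial>gauss_meas I)"
proof -
  interpret prob_space M by fact
  have f: "finite I" and ind: "indep_vars (\<lambda>_. borel) g I" and d: "\<And>a. a \<in> I \<Longrightarrow> distr M borel (g a) = std_normal_distribution"
    using assms(2) by (auto simp: std_gaussian_family_def)
  have m: "\<And>a. a \<in> I \<Longrightarrow> g a \<in> borel_measurable M" using ind by (auto simp: indep_vars_def)
  have m2: "(\<lambda>\<omega>. \<lambda>a\<in>I. g a \<omega>) \<in> measurable M (PiM I (\<lambda>_. borel))" using m by measurable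
  then show mm: "(\<lambda>\<omega>. \<lambda>a\<in>I. g a \<omega>) \<in> measurable M (gauss_meas I)"
    by (subst measurable_cong_sets[OF refl sets_gauss_meas])
  have "distr M (gauss_meas I) (\<lambda>\<omega>. \<lambda>a\<in>I. g a \<omega>) = distr M (PiM I (\<lambda>_. borel)) (\<lambda>\<omega>. \<lambda>a\<in>I. g a \<omega>)"
    by (intro distr_cong sets_gauss_meas refl)
  also have "\<dots> = PiM I (\<lambda>a. distr M borel (g a))"
  \<comment> \<open>The product criterion for independence is about nonempty index sets; over the
    empty one, both measures are the point mass at the only function.\<close>
  proof (cases "I = {}")
    case True
    interpret Q: prob_space "distr M (PiM I (\<lambda>_. borel)) (\<lambda>\<omega>. \<lambda>a\<in>I. g a \<omega>)" by (rule prob_space_distr[OF m2])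
    show ?thesis
    proof (rule measure_eqI)
      show "sets (distr M (PiM I (\<lambda>_. borel)) (\<lambda>\<omega>. \<lambda>a\<in>I. g a \<omega>)) = sets (PiM I (\<lambda>a. distr M borel (g a)))" by (auto simp: True intro!: sets_PiM_cong)
      fix A assume "A \<in> sets (distr M (PiM I (\<lambda>_. borel)) (\<lambda>\<omega>. \<lambda>a\<in>I. g a \<omega>))"
      then have "A \<in> {{}, {\<lambda>_. undefined}}" by (simp add: True sets_PiM_empty)
      then show "emeasure (distr M (PiM I (\<lambda>_. borel)) (\<lambda>\<omega>. \<lambda>a\<in>I. g a \<omega>)) A = emeasure (PiM I (\<lambda>a. distr M borel (g a))) A"
        using Q.emeasure_space_1 by (auto simp: True space_PiM_empty)
    qed
  next
    case False
    then show ?thesis using indep_vars_iff_distr_eq_PiM'[of I g "\<lambda>_. borel"] m ind by simp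
  qed
  also have "\<dots> = gauss_meas I" using d by (intro PiM_cong refl)
  finally have "distr M (gauss_meas I) (\<lambda>\<omega>. \<lambda>a\<in>I. g a \<omega>) = gauss_meas I" .
  then show "(\<integral>\<omega>. h (\<lambda>a\<in>I. g a \<omega>) \<partial>M) = (\<integral>x. h x \<partial>gauss_meas I)"
    using integral_distr[OF mm assms(3)] by simp
qed

lemma gaussian_family_cos_bound:
  assumes "prob_space M" "finite P" "gaussian_family M P G" and m: "\<And>p. p \<in> P \<Longrightarrow> G p \<in> borel_measurable M"
    and c: "\<And>p q. p \<in> P \<Longrightarrow> q \<in> P \<Longrightarrow> c p q = (\<integral>\<omega>. G p \<omega> * G q \<omega> \<partial>M)"
    and R: "\<And>p. p \<in> P \<Longrightarrow> (\<Sum>q\<in>P. \<bar>c p q\<bar>) \<le> R" and R0: "0 \<le> R"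
  shows "\<bar>(\<integral>\<omega>. cos (t * (\<Sum>p\<in>P. (G p \<omega>)\<^sup>2 - c p p) + b) \<partial>M) - cos b * exp (- t\<^sup>2 * (2 * (\<Sum>p\<in>P. \<Sum>q\<in>P. (c p q)\<^sup>2)) / 2)\<bar>
    \<le> 2 * t\<^sup>2 * (R * sqrt (2 * (\<Sum>p\<in>P. \<Sum>q\<in>P. (c p q)\<^sup>2)))"
proof -
  interpret prob_space M by fact
  obtain I :: "(nat \<times> nat) set" and g L where sg: "std_gaussian_family M I g"
    and G: "\<And>p. p \<in> P \<Longrightarrow> AE \<omega> in M. G p \<omega> = (\<Sum>a\<in>I. L p a * g a \<omega>)"
    using assms(3) unfolding gaussian_family_def by blast
  have fI: "finite I" and mg: "\<And>a. a \<in> I \<Longrightarrow> g a \<in> borel_measurable M"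
    using sg by (auto simp: std_gaussian_family_def indep_vars_def)
  interpret gq: gauss_quad I P L by unfold_locales (use fI assms(2) in auto)
  have mL: "(\<lambda>\<omega>. \<Sum>a\<in>I. L p a * g a \<omega>) \<in> borel_measurable M" for p using mg by measurable
  have Ge: "gq.G p (\<lambda>a\<in>I. g a \<omega>) = (\<Sum>a\<in>I. L p a * g a \<omega>)" for p \<omega> by (simp add: gq.G_def lin_def)
  have cC: "c p q = gq.C p q" if "p \<in> P" "q \<in> P" for p q
  proof -
    have "c p q = (\<integral>\<omega>. gq.G p (\<lambda>a\<in>I. g a \<omega>) * gq.G q (\<lambda>a\<in>I. g a \<omega>) \<partial>M)"
      unfolding c[OF that] Ge using G[OF that(1)] G[OF that(2)] m[OF that(1)] m[OF that(2)] mL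
      by (intro integral_cong_AE) auto
    also have "\<dots> = (\<integral>x. gq.G p x * gq.G q x \<partial>gauss_meas I)"
      by (rule std_gaussian_family_integral(2)[OF assms(1) sg]) measurable
    also have "\<dots> = gq.C p q" unfolding gq.G_def gq.C_def by (rule gq.second_moment)
    finally show ?thesis .
  qed
  have V: "gq.V = 2 * (\<Sum>p\<in>P. \<Sum>q\<in>P. (c p q)\<^sup>2)" unfolding gq.V_def using cC by simp
  have "AE \<omega> in M. \<forall>p\<in>P. G p \<omega> = (\<Sum>a\<in>I. L p a * g a \<omega>)" using G assms(2) by (intro AE_finite_allI) auto
  then have "AE \<omega> in M. cos (t * (\<Sum>p\<in>P. (G p \<omega>)\<^sup>2 - c p p) + b) = cos (t * gq.Q (\<lambda>a\<in>I. g a \<omega>) + b)"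
    by eventually_elim (simp add: gq.Q_def Ge cC)
  moreover have "(\<lambda>\<omega>. cos (t * gq.Q (\<lambda>a\<in>I. g a \<omega>) + b)) \<in> borel_measurable M"
    using measurable_compose[OF std_gaussian_family_integral(1)[OF assms(1) sg gq.measurable_GQ(2)] gq.measurable_GQ(2)] by measurable
  ultimately have "(\<integral>\<omega>. cos (t * (\<Sum>p\<in>P. (G p \<omega>)\<^sup>2 - c p p) + b) \<partial>M) = (\<integral>\<omega>. cos (t * gq.Q (\<lambda>a\<in>I. g a \<omega>) + b) \<partial>M)"
    using m by (intro integral_cong_AE) auto
  also have "\<dots> = (\<integral>x. cos (t * gq.Q x + b) \<partial>gauss_meas I)"
    by (rule std_gaussian_family_integral(2)[OF assms(1) sg]) measurable
  finally have e: "(\<integral>\<omega>. cos (t * (\<Sum>p\<in>P. (G p \<omega>)\<^sup>2 - c p p) + b) \<partial>M) = (\<integral>x. cos (t * gq.Q x + b) \<partial>gauss_meas I)" .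
  have "(\<Sum>q\<in>P. \<bar>gq.C p q\<bar>) \<le> R" if "p \<in> P" for p using R[OF that] cC that by simp
  from gq.char_part_bound[OF this R0, of t b] show ?thesis unfolding e V .
qed

lemma abs_cos_diff_le: "\<bar>cos x - cos y\<bar> \<le> \<bar>x - (y::real)\<bar>"
proof -
  have "\<bar>cos x - cos y\<bar> = 2 * (\<bar>sin ((x + y) / 2)\<bar> * \<bar>sin ((y - x) / 2)\<bar>)" unfolding cos_diff_cos by (simp add: abs_mult)
  also have "\<dots> \<le> 2 * (1 * \<bar>(y - x) / 2\<bar>)"
    using abs_sin_x_le_abs_x[of "(y - x)/2"] by (intro mult_left_mono mult_mono) auto
  also have "\<dots> = \<bar>x - y\<bar>" by simp
  finally show ?thesis .
qed

text \<open>The cosine is Lipschitz, so the sum of the squares of \<open>X\<close> may be replaced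
  by that of \<open>G\<close> at the cost of a first moment. The delicate part is the cross term
  \<open>\<Sum> G p * A p\<close>: by the independence in \<open>ind\<close> its second moment is a
  bilinear form in the covariances and at most \<open>R \<alpha>\<close>. Plain Cauchy-Schwarz would
  only give the trace times \<open>\<alpha>\<close>, which does not vanish.\<close>

lemma gaussian_stage_bound:
  assumes M: "prob_space M" and P: "finite P" and X: "\<And>p. p \<in> P \<Longrightarrow> L2 M (X p)"
    and G: "\<And>p. p \<in> P \<Longrightarrow> L2 M (G p)" and A: "\<And>p. p \<in> P \<Longrightarrow> L2 M (A p)"
    and gf: "gaussian_family M P G"
    and ind: "\<And>p r. p \<in> P \<Longrightarrow> r \<in> P \<Longrightarrow> integrable M (\<lambda>\<omega>. (G p \<omega> * G r \<omega>) * (A p \<omega> * A r \<omega>)) \<and>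
      (\<integral>\<omega>. (G p \<omega> * G r \<omega>) * (A p \<omega> * A r \<omega>) \<partial>M) = (\<integral>\<omega>. G p \<omega> * G r \<omega> \<partial>M) * (\<integral>\<omega>. A p \<omega> * A r \<omega> \<partial>M)"
    and \<alpha>: "(\<Sum>p\<in>P. \<integral>\<omega>. (A p \<omega>)\<^sup>2 \<partial>M) \<le> \<alpha>"
    and c: "\<And>p q. p \<in> P \<Longrightarrow> q \<in> P \<Longrightarrow> c p q = (\<integral>\<omega>. G p \<omega> * G q \<omega> \<partial>M)"
    and R: "\<And>p. p \<in> P \<Longrightarrow> (\<Sum>q\<in>P. \<bar>c p q\<bar>) \<le> R" and R0: "0 \<le> R"
  defines "V \<equiv> 2 * (\<Sum>p\<in>P. \<Sum>q\<in>P. (c p q)\<^sup>2)"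
    and "err \<equiv> \<Sum>p\<in>P. 2 * (sqrt (\<integral>\<omega>. (X p \<omega>)\<^sup>2 \<partial>M) * sqrt (\<integral>\<omega>. (X p \<omega> - (G p \<omega> + A p \<omega>))\<^sup>2 \<partial>M)) + (\<integral>\<omega>. (X p \<omega> - (G p \<omega> + A p \<omega>))\<^sup>2 \<partial>M)"
  shows "\<bar>(\<integral>\<omega>. cos (t * ((\<Sum>p\<in>P. (X p \<omega>)\<^sup>2) - \<tau>) + b) \<partial>M) - cos b * exp (- t\<^sup>2 * V / 2)\<bar>
    \<le> 2 * t\<^sup>2 * (R * sqrt V) + \<bar>t\<bar> * (err + \<alpha> + 2 * sqrt (R * \<alpha>) + \<bar>(\<Sum>p\<in>P. c p p) - \<tau>\<bar>)"
proof -
  interpret prob_space M by fact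
  let ?Y = "\<lambda>p \<omega>. G p \<omega> + A p \<omega>"
  define U where "U \<omega> = (\<Sum>p\<in>P. 2 * \<bar>X p \<omega> * (X p \<omega> - ?Y p \<omega>)\<bar> + (X p \<omega> - ?Y p \<omega>)\<^sup>2) + (\<Sum>p\<in>P. (A p \<omega>)\<^sup>2) + 2 * \<bar>\<Sum>p\<in>P. G p \<omega> * A p \<omega>\<bar> + \<bar>(\<Sum>p\<in>P. c p p) - \<tau>\<bar>" for \<omega>
  have XY: "L2 M (\<lambda>\<omega>. X p \<omega> - ?Y p \<omega>)" if "p \<in> P" for p using X[OF that] G[OF that] A[OF that] by (intro L2_diff L2_add)
  have mX: "\<And>p. p \<in> P \<Longrightarrow> X p \<in> borel_measurable M" "\<And>p. p \<in> P \<Longrightarrow> G p \<in> borel_measurable M"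
    "\<And>p. p \<in> P \<Longrightarrow> A p \<in> borel_measurable M" using X G A by (auto simp: L2_def)
  have sq: "(\<Sum>p\<in>P. G p \<omega> * A p \<omega>)\<^sup>2 = (\<Sum>p\<in>P. \<Sum>r\<in>P. (G p \<omega> * G r \<omega>) * (A p \<omega> * A r \<omega>))" for \<omega>
    unfolding power2_eq_square sum_product by (simp add: mult_ac)
  have LGA: "L2 M (\<lambda>\<omega>. \<Sum>p\<in>P. G p \<omega> * A p \<omega>)"
    unfolding L2_def sq using ind mX by (intro conjI Bochner_Integration.integrable_sum borel_measurable_sum borel_measurable_times) auto
  have EGA: "(\<integral>\<omega>. (\<Sum>p\<in>P. G p \<omega> * A p \<omega>)\<^sup>2 \<partial>M) \<le> R * \<alpha>"
  proof -
    have cs: "c p r = c r p" if "p \<in> P" "r \<in> P" for p r using c[OF that] c[OF that(2,1)] by (simp add: mult.commute)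
    have "(\<integral>\<omega>. (\<Sum>p\<in>P. G p \<omega> * A p \<omega>)\<^sup>2 \<partial>M) = (\<Sum>p\<in>P. \<Sum>r\<in>P. c p r * (\<integral>\<omega>. A p \<omega> * A r \<omega> \<partial>M))"
      unfolding sq using ind c by (simp add: Bochner_Integration.integral_sum)
    \<comment> \<open>The Schur test again: the arithmetic-geometric mean separates
      \<open>A p\<close> from \<open>A r\<close>, and the symmetry of \<open>c\<close> makes the two
      halves equal.\<close>
    also have "\<dots> \<le> (\<Sum>p\<in>P. \<Sum>r\<in>P. \<bar>c p r\<bar> * (((\<integral>\<omega>. (A p \<omega>)\<^sup>2 \<partial>M) + (\<integral>\<omega>. (A r \<omega>)\<^sup>2 \<partial>M)) / 2))"
    proof (intro sum_mono)
      fix p r assume pr: "p \<in> P" "r \<in> P"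
      have "\<bar>\<integral>\<omega>. A p \<omega> * A r \<omega> \<partial>M\<bar> \<le> (\<integral>\<omega>. ((A p \<omega>)\<^sup>2 + (A r \<omega>)\<^sup>2) / 2 \<partial>M)"
      proof (rule order_trans[OF integral_abs_bound integral_mono])
        show "integrable M (\<lambda>\<omega>. \<bar>A p \<omega> * A r \<omega>\<bar>)" using L2_mult_integrable[OF A[OF pr(1)] A[OF pr(2)]] by simp
        show "integrable M (\<lambda>\<omega>. ((A p \<omega>)\<^sup>2 + (A r \<omega>)\<^sup>2) / 2)" using A[OF pr(1)] A[OF pr(2)] by (auto simp: L2_def)
        show "\<bar>A p \<omega> * A r \<omega>\<bar> \<le> ((A p \<omega>)\<^sup>2 + (A r \<omega>)\<^sup>2) / 2" for \<omega>
          using zero_le_power2[of "\<bar>A p \<omega>\<bar> - \<bar>A r \<omega>\<bar>"] unfolding power2_diff abs_mult by simp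
      qed
      also have "\<dots> = ((\<integral>\<omega>. (A p \<omega>)\<^sup>2 \<partial>M) + (\<integral>\<omega>. (A r \<omega>)\<^sup>2 \<partial>M)) / 2"
        using A[OF pr(1)] A[OF pr(2)] by (auto simp: L2_def)
      finally have "\<bar>c p r\<bar> * \<bar>\<integral>\<omega>. A p \<omega> * A r \<omega> \<partial>M\<bar> \<le> \<bar>c p r\<bar> * (((\<integral>\<omega>. (A p \<omega>)\<^sup>2 \<partial>M) + (\<integral>\<omega>. (A r \<omega>)\<^sup>2 \<partial>M)) / 2)"
        by (intro mult_left_mono) auto
      then show "c p r * (\<integral>\<omega>. A p \<omega> * A r \<omega> \<partial>M) \<le> \<bar>c p r\<bar> * (((\<integral>\<omega>. (A p \<omega>)\<^sup>2 \<partial>M) + (\<integral>\<omega>. (A r \<omega>)\<^sup>2 \<partial>M)) / 2)"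
        using abs_ge_self[of "c p r * (\<integral>\<omega>. A p \<omega> * A r \<omega> \<partial>M)"] unfolding abs_mult by linarith
    qed
    also have "\<dots> = (\<Sum>p\<in>P. \<Sum>r\<in>P. \<bar>c p r\<bar> * (\<integral>\<omega>. (A p \<omega>)\<^sup>2 \<partial>M)) / 2 + (\<Sum>p\<in>P. \<Sum>r\<in>P. \<bar>c p r\<bar> * (\<integral>\<omega>. (A r \<omega>)\<^sup>2 \<partial>M)) / 2"
      by (simp add: sum_divide_distrib add_divide_distrib distrib_left sum.distrib)
    also have "(\<Sum>p\<in>P. \<Sum>r\<in>P. \<bar>c p r\<bar> * (\<integral>\<omega>. (A r \<omega>)\<^sup>2 \<partial>M)) = (\<Sum>p\<in>P. \<Sum>r\<in>P. \<bar>c p r\<bar> * (\<integral>\<omega>. (A p \<omega>)\<^sup>2 \<partial>M))"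
      by (subst sum.swap) (intro sum.cong refl, simp add: cs)
    also have "(\<Sum>p\<in>P. \<Sum>r\<in>P. \<bar>c p r\<bar> * (\<integral>\<omega>. (A p \<omega>)\<^sup>2 \<partial>M)) / 2 + (\<Sum>p\<in>P. \<Sum>r\<in>P. \<bar>c p r\<bar> * (\<integral>\<omega>. (A p \<omega>)\<^sup>2 \<partial>M)) / 2
      = (\<Sum>p\<in>P. (\<Sum>r\<in>P. \<bar>c p r\<bar>) * (\<integral>\<omega>. (A p \<omega>)\<^sup>2 \<partial>M))" by (simp add: sum_distrib_right)
    also have "\<dots> \<le> (\<Sum>p\<in>P. R * (\<integral>\<omega>. (A p \<omega>)\<^sup>2 \<partial>M))" using R by (intro sum_mono mult_right_mono) auto
    also have "\<dots> \<le> R * \<alpha>" unfolding sum_distrib_left[symmetric] using \<alpha> R0 by (intro mult_left_mono)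
    finally show ?thesis .
  qed
  have iU1: "integrable M (\<lambda>\<omega>. \<Sum>p\<in>P. 2 * \<bar>X p \<omega> * (X p \<omega> - ?Y p \<omega>)\<bar> + (X p \<omega> - ?Y p \<omega>)\<^sup>2)"
    using L2_mult_integrable[OF X XY] L2_square[OF XY] by (intro Bochner_Integration.integrable_sum) auto
  have iU2: "integrable M (\<lambda>\<omega>. \<Sum>p\<in>P. (A p \<omega>)\<^sup>2)" using A by (intro Bochner_Integration.integrable_sum L2_square)
  have iU3: "integrable M (\<lambda>\<omega>. \<Sum>p\<in>P. G p \<omega> * A p \<omega>)" by (rule L2_abs_le(1)[OF M LGA])
  have iU: "integrable M U" unfolding U_def[abs_def] using iU1 iU2 iU3 by auto
  have EU: "(\<integral>\<omega>. U \<omega> \<partial>M) \<le> err + \<alpha> + 2 * sqrt (R * \<alpha>) + \<bar>(\<Sum>p\<in>P. c p p) - \<tau>\<bar>"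
  proof -
    have "(\<integral>\<omega>. U \<omega> \<partial>M) = (\<integral>\<omega>. (\<Sum>p\<in>P. 2 * \<bar>X p \<omega> * (X p \<omega> - ?Y p \<omega>)\<bar> + (X p \<omega> - ?Y p \<omega>)\<^sup>2) \<partial>M) + (\<integral>\<omega>. (\<Sum>p\<in>P. (A p \<omega>)\<^sup>2) \<partial>M)
      + 2 * (\<integral>\<omega>. (\<bar>\<Sum>p\<in>P. G p \<omega> * A p \<omega>\<bar>) \<partial>M) + \<bar>(\<Sum>p\<in>P. c p p) - \<tau>\<bar>"
      unfolding U_def[abs_def] using iU1 iU2 iU3 by (simp add: prob_space)
    moreover have "(\<integral>\<omega>. (\<Sum>p\<in>P. 2 * \<bar>X p \<omega> * (X p \<omega> - ?Y p \<omega>)\<bar> + (X p \<omega> - ?Y p \<omega>)\<^sup>2) \<partial>M) \<le> err"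
    proof -
      have "(\<integral>\<omega>. (\<Sum>p\<in>P. 2 * \<bar>X p \<omega> * (X p \<omega> - ?Y p \<omega>)\<bar> + (X p \<omega> - ?Y p \<omega>)\<^sup>2) \<partial>M)
        = (\<Sum>p\<in>P. 2 * (\<integral>\<omega>. \<bar>X p \<omega> * (X p \<omega> - ?Y p \<omega>)\<bar> \<partial>M) + (\<integral>\<omega>. (X p \<omega> - ?Y p \<omega>)\<^sup>2 \<partial>M))"
        using L2_mult_integrable[OF X XY] L2_square[OF XY] by (subst Bochner_Integration.integral_sum) auto
      also have "\<dots> \<le> err" unfolding err_def
        by (intro sum_mono add_right_mono mult_left_mono L2_Cauchy_Schwarz X XY) auto
      finally show ?thesis .
    qed
    moreover have "(\<integral>\<omega>. (\<Sum>p\<in>P. (A p \<omega>)\<^sup>2) \<partial>M) \<le> \<alpha>"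
      using \<alpha> A by (subst Bochner_Integration.integral_sum) (auto simp: L2_def)
    moreover have "(\<integral>\<omega>. (\<bar>\<Sum>p\<in>P. G p \<omega> * A p \<omega>\<bar>) \<partial>M) \<le> sqrt (R * \<alpha>)"
      using L2_abs_le(2)[OF M LGA] real_sqrt_le_mono[OF EGA] by linarith
    ultimately show ?thesis by linarith
  qed
  define x where "x \<omega> = t * ((\<Sum>p\<in>P. (X p \<omega>)\<^sup>2) - \<tau>) + b" for \<omega>
  define y where "y \<omega> = t * (\<Sum>p\<in>P. (G p \<omega>)\<^sup>2 - c p p) + b" for \<omega>
  have [measurable]: "x \<in> borel_measurable M" "y \<in> borel_measurable M"
    unfolding x_def[abs_def] y_def[abs_def] using mX by (auto intro!: borel_measurable_add borel_measurable_times borel_measurable_diff borel_measurable_sum borel_measurable_power)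
  have pw: "\<bar>cos (x \<omega>) - cos (y \<omega>)\<bar> \<le> \<bar>t\<bar> * U \<omega>" for \<omega>
  proof -
    have "x \<omega> - y \<omega> = t * ((\<Sum>p\<in>P. (X p \<omega>)\<^sup>2 - (G p \<omega>)\<^sup>2) + ((\<Sum>p\<in>P. c p p) - \<tau>))"
      by (simp add: x_def y_def sum_subtractf algebra_simps)
    \<comment> \<open>With \<open>Y = G + A\<close>, the two identities
      \<open>X^2 - Y^2 = 2 X (X - Y) - (X - Y)^2\<close> and \<open>Y^2 - G^2 = A^2 + 2 G A\<close>
      are added.\<close>
    also have "(\<Sum>p\<in>P. (X p \<omega>)\<^sup>2 - (G p \<omega>)\<^sup>2) = (\<Sum>p\<in>P. 2 * (X p \<omega> * (X p \<omega> - ?Y p \<omega>)) - (X p \<omega> - ?Y p \<omega>)\<^sup>2) + (\<Sum>p\<in>P. (A p \<omega>)\<^sup>2) + 2 * (\<Sum>p\<in>P. G p \<omega> * A p \<omega>)"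
      unfolding sum_distrib_left sum.distrib[symmetric] by (intro sum.cong refl) (simp add: power2_eq_square algebra_simps)
    also have "\<bar>t * (\<dots> + ((\<Sum>p\<in>P. c p p) - \<tau>))\<bar> \<le> \<bar>t\<bar> * U \<omega>"
      unfolding abs_mult
    proof (rule mult_left_mono)
      have 1: "\<bar>\<Sum>p\<in>P. 2 * (X p \<omega> * (X p \<omega> - ?Y p \<omega>)) - (X p \<omega> - ?Y p \<omega>)\<^sup>2\<bar> \<le> (\<Sum>p\<in>P. 2 * \<bar>X p \<omega> * (X p \<omega> - ?Y p \<omega>)\<bar> + (X p \<omega> - ?Y p \<omega>)\<^sup>2)"
        by (rule order_trans[OF sum_abs sum_mono]) (rule order_trans[OF abs_triangle_ineq4], simp add: abs_mult)
      have 2: "0 \<le> (\<Sum>p\<in>P. (A p \<omega>)\<^sup>2)" by (simp add: sum_nonneg)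
      show "\<bar>(\<Sum>p\<in>P. 2 * (X p \<omega> * (X p \<omega> - ?Y p \<omega>)) - (X p \<omega> - ?Y p \<omega>)\<^sup>2) + (\<Sum>p\<in>P. (A p \<omega>)\<^sup>2) + 2 * (\<Sum>p\<in>P. G p \<omega> * A p \<omega>) + ((\<Sum>p\<in>P. c p p) - \<tau>)\<bar> \<le> U \<omega>"
        unfolding U_def using 1 2 by linarith
    qed simp
    finally have "\<bar>x \<omega> - y \<omega>\<bar> \<le> \<bar>t\<bar> * U \<omega>" .
    then show ?thesis using abs_cos_diff_le[of "x \<omega>" "y \<omega>"] by linarith
  qed
  have icos: "integrable M (\<lambda>\<omega>. cos (x \<omega>))" "integrable M (\<lambda>\<omega>. cos (y \<omega>))"
    by (rule integrable_const_bound[where B=1]; auto)+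
  have "\<bar>(\<integral>\<omega>. cos (x \<omega>) \<partial>M) - (\<integral>\<omega>. cos (y \<omega>) \<partial>M)\<bar> = \<bar>\<integral>\<omega>. cos (x \<omega>) - cos (y \<omega>) \<partial>M\<bar>" using icos by simp
  also have "\<dots> \<le> (\<integral>\<omega>. \<bar>t\<bar> * U \<omega> \<partial>M)"
    by (rule order_trans[OF integral_abs_bound integral_mono]) (use icos iU pw in auto)
  also have "\<dots> \<le> \<bar>t\<bar> * (err + \<alpha> + 2 * sqrt (R * \<alpha>) + \<bar>(\<Sum>p\<in>P. c p p) - \<tau>\<bar>)" using EU by (simp add: mult_left_mono)
  finally have 1: "\<bar>(\<integral>\<omega>. cos (x \<omega>) \<partial>M) - (\<integral>\<omega>. cos (y \<omega>) \<partial>M)\<bar> \<le> \<bar>t\<bar> * (err + \<alpha> + 2 * sqrt (R * \<alpha>) + \<bar>(\<Sum>p\<in>P. c p p) - \<tau>\<bar>)" .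
  have 2: "\<bar>(\<integral>\<omega>. cos (y \<omega>) \<partial>M) - cos b * exp (- t\<^sup>2 * V / 2)\<bar> \<le> 2 * t\<^sup>2 * (R * sqrt V)"
    unfolding y_def V_def by (rule gaussian_family_cos_bound[OF M P gf mX(2) c R R0])
  show ?thesis using 1 2 unfolding x_def by linarith
qed

text \<open>The bound does not involve the stage \<open>q\<close>, so only the limiting covariances \<open>c\<close> matter.\<close>

lemma gaussian_limit_bound:
  assumes M: "prob_space M" and P: "finite P" and X: "\<And>p. p \<in> P \<Longrightarrow> L2 M (X p)"
    and G: "\<And>(q::nat) p. p \<in> P \<Longrightarrow> L2 M (G q p)" and A: "\<And>q p. p \<in> P \<Longrightarrow> L2 M (A q p)"
    and gf: "\<And>q. gaussian_family M P (G q)"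
    and ind: "\<And>q p r. p \<in> P \<Longrightarrow> r \<in> P \<Longrightarrow> integrable M (\<lambda>\<omega>. (G q p \<omega> * G q r \<omega>) * (A q p \<omega> * A q r \<omega>)) \<and>
      (\<integral>\<omega>. (G q p \<omega> * G q r \<omega>) * (A q p \<omega> * A q r \<omega>) \<partial>M) = (\<integral>\<omega>. G q p \<omega> * G q r \<omega> \<partial>M) * (\<integral>\<omega>. A q p \<omega> * A q r \<omega> \<partial>M)"
    and \<alpha>: "\<And>q. (\<Sum>p\<in>P. \<integral>\<omega>. (A q p \<omega>)\<^sup>2 \<partial>M) \<le> \<alpha>"
    and lim: "\<And>p. p \<in> P \<Longrightarrow> (\<lambda>q. \<integral>\<omega>. (X p \<omega> - (G q p \<omega> + A q p \<omega>))\<^sup>2 \<partial>M) \<longlonglongrightarrow> 0"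
    and c: "\<And>p r. p \<in> P \<Longrightarrow> r \<in> P \<Longrightarrow> (\<lambda>q. \<integral>\<omega>. G q p \<omega> * G q r \<omega> \<partial>M) \<longlonglongrightarrow> c p r"
    and R: "\<And>p. p \<in> P \<Longrightarrow> (\<Sum>q\<in>P. \<bar>c p q\<bar>) < R" and R0: "0 \<le> R"
  defines "V \<equiv> 2 * (\<Sum>p\<in>P. \<Sum>q\<in>P. (c p q)\<^sup>2)"
  shows "\<bar>(\<integral>\<omega>. cos (t * ((\<Sum>p\<in>P. (X p \<omega>)\<^sup>2) - \<tau>) + b) \<partial>M) - cos b * exp (- t\<^sup>2 * V / 2)\<bar>
    \<le> 2 * t\<^sup>2 * (R * sqrt V) + \<bar>t\<bar> * (\<alpha> + 2 * sqrt (R * \<alpha>) + \<bar>(\<Sum>p\<in>P. c p p) - \<tau>\<bar>)"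
proof -
  define cq where "cq q p r = (\<integral>\<omega>. G q p \<omega> * G q r \<omega> \<partial>M)" for q p r
  define Vq where "Vq q = 2 * (\<Sum>p\<in>P. \<Sum>r\<in>P. (cq q p r)\<^sup>2)" for q
  define e where "e q p = (\<integral>\<omega>. (X p \<omega> - (G q p \<omega> + A q p \<omega>))\<^sup>2 \<partial>M)" for q p
  define err where "err q = (\<Sum>p\<in>P. 2 * (sqrt (\<integral>\<omega>. (X p \<omega>)\<^sup>2 \<partial>M) * sqrt (e q p)) + e q p)" for q
  have cl: "(\<lambda>q. cq q p r) \<longlonglongrightarrow> c p r" if "p \<in> P" "r \<in> P" for p r using c[OF that] by (simp add: cq_def)
  have Vl: "Vq \<longlonglongrightarrow> V" unfolding Vq_def[abs_def] V_def by (intro tendsto_intros cl)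
  have el: "(\<lambda>q. e q p) \<longlonglongrightarrow> 0" if "p \<in> P" for p using lim[OF that] by (simp add: e_def)
  have "err \<longlonglongrightarrow> (\<Sum>p\<in>P. 2 * (sqrt (\<integral>\<omega>. (X p \<omega>)\<^sup>2 \<partial>M) * sqrt 0) + 0)"
    unfolding err_def[abs_def] by (intro tendsto_intros el)
  then have errl: "err \<longlonglongrightarrow> 0" by simp
  have sl: "(\<lambda>q. \<Sum>r\<in>P. \<bar>cq q p r\<bar>) \<longlonglongrightarrow> (\<Sum>r\<in>P. \<bar>c p r\<bar>)" if "p \<in> P" for p using that by (intro tendsto_intros cl)
  \<comment> \<open>The covariances at stage \<open>q\<close> merely converge; strictness of the
    bound on the limiting row sums passes it on to all late stages.\<close>
  have "eventually (\<lambda>q. \<forall>p\<in>P. (\<Sum>r\<in>P. \<bar>cq q p r\<bar>) < R) sequentially"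
    using P order_tendstoD(2)[OF sl R] by (simp add: eventually_ball_finite_distrib)
  then obtain N where N: "\<And>q p. N \<le> q \<Longrightarrow> p \<in> P \<Longrightarrow> (\<Sum>r\<in>P. \<bar>cq q p r\<bar>) \<le> R"
    unfolding eventually_sequentially by (meson less_imp_le)
  let ?W = "\<integral>\<omega>. cos (t * ((\<Sum>p\<in>P. (X p \<omega>)\<^sup>2) - \<tau>) + b) \<partial>M"
  show ?thesis
  proof (rule LIMSEQ_le)
    show "(\<lambda>q. \<bar>?W - cos b * exp (- t\<^sup>2 * Vq q / 2)\<bar>) \<longlonglongrightarrow> \<bar>?W - cos b * exp (- t\<^sup>2 * V / 2)\<bar>"
      by (intro tendsto_intros Vl) simp
    have "(\<lambda>q. 2 * t\<^sup>2 * (R * sqrt (Vq q)) + \<bar>t\<bar> * (err q + \<alpha> + 2 * sqrt (R * \<alpha>) + \<bar>(\<Sum>p\<in>P. cq q p p) - \<tau>\<bar>))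
      \<longlonglongrightarrow> 2 * t\<^sup>2 * (R * sqrt V) + \<bar>t\<bar> * (0 + \<alpha> + 2 * sqrt (R * \<alpha>) + \<bar>(\<Sum>p\<in>P. c p p) - \<tau>\<bar>)"
      by (intro tendsto_intros Vl errl cl)
    then show "(\<lambda>q. 2 * t\<^sup>2 * (R * sqrt (Vq q)) + \<bar>t\<bar> * (err q + \<alpha> + 2 * sqrt (R * \<alpha>) + \<bar>(\<Sum>p\<in>P. cq q p p) - \<tau>\<bar>))
      \<longlonglongrightarrow> 2 * t\<^sup>2 * (R * sqrt V) + \<bar>t\<bar> * (\<alpha> + 2 * sqrt (R * \<alpha>) + \<bar>(\<Sum>p\<in>P. c p p) - \<tau>\<bar>)" by simp
    show "\<exists>N. \<forall>q\<ge>N. \<bar>?W - cos b * exp (- t\<^sup>2 * Vq q / 2)\<bar> \<le> 2 * t\<^sup>2 * (R * sqrt (Vq q)) + \<bar>t\<bar> * (err q + \<alpha> + 2 * sqrt (R * \<alpha>) + \<bar>(\<Sum>p\<in>P. cq q p p) - \<tau>\<bar>)"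
    proof (intro exI[of _ N] allI impI)
      fix q assume "N \<le> q"
      from gaussian_stage_bound[where G="G q" and A="A q" and c="cq q" and t=t and \<tau>=\<tau> and b=b, OF M P X G A gf ind \<alpha> cq_def N[OF this] R0]
      show "\<bar>?W - cos b * exp (- t\<^sup>2 * Vq q / 2)\<bar> \<le> 2 * t\<^sup>2 * (R * sqrt (Vq q)) + \<bar>t\<bar> * (err q + \<alpha> + 2 * sqrt (R * \<alpha>) + \<bar>(\<Sum>p\<in>P. cq q p p) - \<tau>\<bar>)"
        unfolding Vq_def err_def e_def by simp
    qed
  qed
qed

section \<open>Brownian motions and Wiener integrals\<close>

lemma integral_double_sum:
  fixes f :: "'i \<Rightarrow> 'j \<Rightarrow> 'a \<Rightarrow> real"
  assumes "\<And>i j. i \<in> I \<Longrightarrow> j \<in> J \<Longrightarrow> integrable M (f i j)"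
  shows "(\<integral>x. (\<Sum>i\<in>I. \<Sum>j\<in>J. c i j * f i j x) \<partial>M) = (\<Sum>i\<in>I. \<Sum>j\<in>J. c i j * (\<integral>x. f i j x \<partial>M))"
proof -
  have "(\<integral>x. (\<Sum>i\<in>I. \<Sum>j\<in>J. c i j * f i j x) \<partial>M) = (\<Sum>i\<in>I. \<integral>x. (\<Sum>j\<in>J. c i j * f i j x) \<partial>M)"
    using assms by (intro Bochner_Integration.integral_sum Bochner_Integration.integrable_sum integrable_mult_right) auto
  also have "\<dots> = (\<Sum>i\<in>I. \<Sum>j\<in>J. \<integral>x. c i j * f i j x \<partial>M)"
    using assms by (intro sum.cong refl Bochner_Integration.integral_sum integrable_mult_right) auto
  finally show ?thesis by simp
qed

text \<open>On rectangles the probability factorises first over \<open>k\<close>, by independence of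
  the vectors, and then over \<open>l\<close>, by independence of the components within one
  vector.\<close>

lemma (in prob_space) indep_vars_pairs:
  assumes K: "indep_vars (\<lambda>_. PiM J (\<lambda>_. borel)) (\<lambda>k \<omega>. \<lambda>l\<in>J. g k l \<omega>) K" and fin: "finite J" "finite K"
    and J: "\<And>k. k \<in> K \<Longrightarrow> indep_vars (\<lambda>_. borel) (g k) J"
  shows "indep_vars (\<lambda>_. borel) (\<lambda>(k, l). g k l :: 'a \<Rightarrow> real) (K \<times> J)"
proof (cases "K \<times> J = {}")
  case True then show ?thesis by (simp only: True) (simp add: indep_vars_def2 indep_sets_def)
next
  case False
  then have ne: "K \<noteq> {}" "J \<noteq> {}" by auto
  have rv: "random_variable borel (g k l)" if "k \<in> K" "l \<in> J" for k l using J[OF that(1)] that(2) by (auto simp: indep_vars_def)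
  show ?thesis
  proof (subst indep_vars_finite[where E="\<lambda>_. sets borel"])
    show "K \<times> J \<noteq> {}" "finite (K \<times> J)" using False fin by auto
    show "sets borel = sigma_sets (space borel) (sets (borel :: real measure))" by (metis sets.sigma_sets_eq)
    show "Int_stable (sets (borel :: real measure))" by (rule sets.Int_stable)
    show "sets borel \<subseteq> Pow (space (borel :: real measure))" by (rule sets.space_closed)
    show "\<And>i. i \<in> K \<times> J \<Longrightarrow> random_variable borel (case i of (k, l) \<Rightarrow> g k l)" using rv by auto
    show "\<forall>A\<in>K \<times> J \<rightarrow> sets borel. prob (\<Inter>j\<in>K \<times> J. (case j of (k, l) \<Rightarrow> g k l) -` A j \<inter> space M) = (\<Prod>j\<in>K \<times> J. prob ((case j of (k, l) \<Rightarrow> g k l) -` A j \<inter> space M))"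
    proof
      fix A assume A: "A \<in> K \<times> J \<rightarrow> sets (borel :: real measure)"
      have sA: "PiE J (\<lambda>l. A (k, l)) \<in> sets (PiM J (\<lambda>_. borel))" if "k \<in> K" for k
        using A that fin by (intro sets_PiM_I_finite) auto
      have e: "(\<lambda>\<omega>. \<lambda>l\<in>J. g k l \<omega>) -` PiE J (\<lambda>l. A (k, l)) \<inter> space M = (\<Inter>l\<in>J. g k l -` A (k, l) \<inter> space M)" for k
        using ne by (auto simp: PiE_def Pi_def)
      have "(\<Inter>j\<in>K \<times> J. (case j of (k, l) \<Rightarrow> g k l) -` A j \<inter> space M) = (\<Inter>k\<in>K. (\<lambda>\<omega>. \<lambda>l\<in>J. g k l \<omega>) -` PiE J (\<lambda>l. A (k, l)) \<inter> space M)"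
        unfolding e using ne by auto
      also have "prob \<dots> = (\<Prod>k\<in>K. prob ((\<lambda>\<omega>. \<lambda>l\<in>J. g k l \<omega>) -` PiE J (\<lambda>l. A (k, l)) \<inter> space M))"
        by (rule indep_varsD_finite[OF K ne(1) fin(2) sA])
      also have "\<dots> = (\<Prod>k\<in>K. \<Prod>l\<in>J. prob (g k l -` A (k, l) \<inter> space M))"
      proof (rule prod.cong[OF refl])
        fix k assume k: "k \<in> K"
        show "prob ((\<lambda>\<omega>. \<lambda>l\<in>J. g k l \<omega>) -` PiE J (\<lambda>l. A (k, l)) \<inter> space M) = (\<Prod>l\<in>J. prob (g k l -` A (k, l) \<inter> space M))"
          unfolding e by (rule indep_varsD_finite[OF J[OF k] ne(2) fin(1)]) (use A k in auto)
      qed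
      also have "\<dots> = (\<Prod>j\<in>K \<times> J. prob ((case j of (k, l) \<Rightarrow> g k l) -` A j \<inter> space M))"
        by (simp add: prod.cartesian_product case_prod_unfold)
      finally show "prob (\<Inter>j\<in>K \<times> J. (case j of (k, l) \<Rightarrow> g k l) -` A j \<inter> space M) = (\<Prod>j\<in>K \<times> J. prob ((case j of (k, l) \<Rightarrow> g k l) -` A j \<inter> space M))" .
    qed
  qed auto
qed

text \<open>Functionals with values in a common type bring variables of different types into the
  scope of \<open>indep_var\<close>, and with it the factorisation of expectations.\<close>

lemma (in prob_space) independent_rvs_indep_var:
  assumes "independent_rvs M S A T B" "f \<in> measurable S S'" "h \<in> measurable T T'"
  shows "indep_var S' (\<lambda>\<omega>. f (A \<omega>)) T' (\<lambda>\<omega>. h (B \<omega>))"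
proof -
  have mA: "A \<in> measurable M S" and mB: "B \<in> measurable M T"
    and ind: "indep_set {A -` U \<inter> space M | U. U \<in> sets S} {B -` V \<inter> space M | V. V \<in> sets T}"
    using assms(1) by (auto simp: independent_rvs_def)
  have rv: "random_variable (case_bool S' T' i) (case_bool (\<lambda>\<omega>. f (A \<omega>)) (\<lambda>\<omega>. h (B \<omega>)) i)" for i
    using measurable_compose[OF mA assms(2)] measurable_compose[OF mB assms(3)] by (cases i) auto
  show ?thesis unfolding indep_var_def indep_vars_def2
  proof (intro conjI ballI rv)
    show "indep_sets (\<lambda>i. {case_bool (\<lambda>\<omega>. f (A \<omega>)) (\<lambda>\<omega>. h (B \<omega>)) i -` X \<inter> space M |X. X \<in> sets (case_bool S' T' i)}) UNIV"
    proof (rule indep_sets_mono_sets[OF ind[unfolded indep_set_def]])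
      fix i :: bool
      have 1: "(\<lambda>\<omega>. f (A \<omega>)) -` X \<inter> space M = A -` (f -` X \<inter> space S) \<inter> space M" for X
        using measurable_space[OF mA] by auto
      have 2: "(\<lambda>\<omega>. h (B \<omega>)) -` X \<inter> space M = B -` (h -` X \<inter> space T) \<inter> space M" for X
        using measurable_space[OF mB] by auto
      show "{case_bool (\<lambda>\<omega>. f (A \<omega>)) (\<lambda>\<omega>. h (B \<omega>)) i -` X \<inter> space M |X. X \<in> sets (case_bool S' T' i)}
        \<subseteq> (case i of True \<Rightarrow> {A -` U \<inter> space M |U. U \<in> sets S} | False \<Rightarrow> {B -` V \<inter> space M |V. V \<in> sets T})"
      proof (cases i)
        case True
        have "\<exists>U. (\<lambda>\<omega>. f (A \<omega>)) -` X \<inter> space M = A -` U \<inter> space M \<and> U \<in> sets S" if "X \<in> sets S'" for X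
          by (rule exI, rule conjI, rule 1, rule measurable_sets[OF assms(2) that])
        then show ?thesis by (simp add: True subset_iff) metis
      next
        case False
        have "\<exists>U. (\<lambda>\<omega>. h (B \<omega>)) -` X \<inter> space M = B -` U \<inter> space M \<and> U \<in> sets T" if "X \<in> sets T'" for X
          by (rule exI, rule conjI, rule 2, rule measurable_sets[OF assms(3) that])
        then show ?thesis by (simp add: False subset_iff) metis
      qed
    qed
  qed
qed

section \<open>Covariances of Brownian motion and of step integrals\<close>

context prob_space
begin

lemma bm_measurable: "brownian_motion M W \<Longrightarrow> 0 \<le> t \<Longrightarrow> W t \<in> borel_measurable M"
  by (simp add: brownian_motion_def)

lemma bm_increment:
  assumes bm: "brownian_motion M W" and st: "0 \<le> s" "s < t"
  shows "L2 M (\<lambda>\<omega>. W t \<omega> - W s \<omega>)" "expectation (\<lambda>\<omega>. W t \<omega> - W s \<omega>) = 0"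
    "expectation (\<lambda>\<omega>. (W t \<omega> - W s \<omega>)\<^sup>2) = t - s"
proof -
  have D: "distributed M lborel (\<lambda>\<omega>. W t \<omega> - W s \<omega>) (normal_density 0 (sqrt (t - s)))"
    using bm st by (simp add: brownian_motion_def)
  have sp: "0 < sqrt (t - s)" using st by simp
  have "integrable lborel (\<lambda>x. normal_density 0 (sqrt (t - s)) x * x\<^sup>2)"
    using integrable_normal_moment[OF sp, of 0 2] by simp
  then have "integrable M (\<lambda>\<omega>. (W t \<omega> - W s \<omega>)\<^sup>2)"
    by (subst (asm) distributed_integrable[OF D]) auto
  then show "L2 M (\<lambda>\<omega>. W t \<omega> - W s \<omega>)"
    using bm_measurable[OF bm, of t] bm_measurable[OF bm, of s] st by (auto simp: L2_def)
  show e: "expectation (\<lambda>\<omega>. W t \<omega> - W s \<omega>) = 0" by (rule normal_distributed_expectation[OF sp D])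
  show "expectation (\<lambda>\<omega>. (W t \<omega> - W s \<omega>)\<^sup>2) = t - s"
    using normal_distributed_variance[OF sp D] st unfolding e by simp
qed

lemma bm_moments:
  assumes bm: "brownian_motion M W" and s: "0 \<le> s"
  shows "L2 M (W s)" "expectation (W s) = 0" "expectation (\<lambda>\<omega>. (W s \<omega>)\<^sup>2) = s"
proof -
  have z: "AE \<omega> in M. W 0 \<omega> = 0" using bm by (simp add: brownian_motion_def)
  have m: "W s \<in> borel_measurable M" "W 0 \<in> borel_measurable M" using bm_measurable[OF bm] s by auto
  have "L2 M (W s) \<and> expectation (W s) = 0 \<and> expectation (\<lambda>\<omega>. (W s \<omega>)\<^sup>2) = s"
  proof (cases "s = 0")
    case True
    have "expectation (W 0) = 0" "expectation (\<lambda>\<omega>. (W 0 \<omega>)\<^sup>2) = 0"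
      using z by (auto intro!: integral_eq_zero_AE)
    moreover have "L2 M (W 0)" using L2_AE_eq[OF L2_zero m(2)] z by (auto elim: AE_mp)
    ultimately show ?thesis using True by simp
  next
    case False
    then have "0 < s" using s by simp
    note i = bm_increment[OF bm order_refl this]
    have ae: "AE \<omega> in M. W s \<omega> - W 0 \<omega> = W s \<omega>" using z by auto
    have "expectation (W s) = expectation (\<lambda>\<omega>. W s \<omega> - W 0 \<omega>)" "expectation (\<lambda>\<omega>. (W s \<omega>)\<^sup>2) = expectation (\<lambda>\<omega>. (W s \<omega> - W 0 \<omega>)\<^sup>2)"
      using ae m by (auto intro!: integral_cong_AE)
    then show ?thesis using i L2_AE_eq[OF i(1) m(1) ae] by simp
  qed
  then show "L2 M (W s)" "expectation (W s) = 0" "expectation (\<lambda>\<omega>. (W s \<omega>)\<^sup>2) = s" by auto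
qed

text \<open>Polarisation: the variance of the increment and the two second moments determine the
  mixed moment.\<close>

lemma bm_cov:
  assumes bm: "brownian_motion M W" and s: "0 \<le> s" "0 \<le> t"
  shows "expectation (\<lambda>\<omega>. W s \<omega> * W t \<omega>) = min s t"
proof -
  have *: "expectation (\<lambda>\<omega>. W s \<omega> * W t \<omega>) = s" if st: "0 \<le> s" "s < t" for s t
  proof -
    have t: "0 \<le> t" using st by simp
    note L = bm_moments[OF bm st(1)] bm_moments[OF bm t]
    have e: "(W t \<omega> - W s \<omega>)\<^sup>2 = (W t \<omega>)\<^sup>2 + (W s \<omega>)\<^sup>2 - 2 * (W s \<omega> * W t \<omega>)" for \<omega> by (simp add: power2_diff)
    have "t - s = expectation (\<lambda>\<omega>. (W t \<omega>)\<^sup>2 + (W s \<omega>)\<^sup>2 - 2 * (W s \<omega> * W t \<omega>))"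
      using bm_increment(3)[OF bm st] unfolding e by simp
    also have "\<dots> = t + s - 2 * expectation (\<lambda>\<omega>. W s \<omega> * W t \<omega>)"
      using L2_square[OF L(1)] L2_square[OF L(4)] L2_mult_integrable[OF L(1) L(4)] L(3,6) by simp
    finally show ?thesis by simp
  qed
  consider "s < t" | "t < s" | "s = t" by linarith
  then show ?thesis
  proof cases
    case 1 then show ?thesis using *[of s t] s by simp
  next
    case 2 then show ?thesis using *[of t s] s by (simp add: mult.commute)
  next
    case 3 then show ?thesis using bm_moments(3)[OF bm s(1)] by (simp add: power2_eq_square)
  qed
qed

lemma step_integral_L2:
  assumes bm: "brownian_motion M W" and \<tau>: "\<And>i. i \<le> N \<Longrightarrow> 0 \<le> \<tau> i"
  shows "L2 M (step_integral W N \<tau> c)"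
  unfolding step_integral_def[abs_def] using \<tau> by (intro L2_sum L2_cmult L2_diff bm_moments(1)[OF bm]) auto

lemma step_fun_L2: "L2 lborel (step_fun N \<tau> c)"
proof -
  have "L2 lborel (indicator {a<..b} :: real \<Rightarrow> real)" for a b :: real
  proof -
    have "(\<lambda>x. (indicator {a<..b} x :: real)\<^sup>2) = indicator {a<..b}" by (auto split: split_indicator)
    moreover have "integrable lborel (indicator {a<..b} :: real \<Rightarrow> real)"
      by (intro integrable_real_indicator emeasure_bounded_finite bounded_subset[OF bounded_closed_interval[of a b]]) auto
    ultimately show ?thesis by (simp add: L2_def)
  qed
  then show ?thesis unfolding step_fun_def[abs_def] by (intro L2_sum L2_cmult)
qed

text \<open>The length of the intersection is written with four minima in order to match, term by
  term, the product of two increments expanded with \<open>bm_cov\<close>.\<close>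

lemma integral_indicator_Ioc_mult:
  fixes a b c d :: real assumes "a \<le> b" "c \<le> d"
  shows "(\<integral>s. indicator {a<..b} s * indicator {c<..d} s \<partial>lborel) = min b d - min b c - min a d + min a c"
proof -
  have "(\<integral>s. indicator {a<..b} s * indicator {c<..d} s \<partial>lborel) = (\<integral>s. (indicator {max a c<..min b d} s :: real) \<partial>lborel)"
    by (intro Bochner_Integration.integral_cong refl) (auto split: split_indicator)
  also have "\<dots> = measure lborel {max a c<..min b d}" by simp
  also have "\<dots> = min b d - min b c - min a d + min a c"
  proof (cases "max a c \<le> min b d")
    case True then have "measure lborel {max a c<..min b d} = min b d - max a c" by (rule measure_lborel_Ioc)
    moreover have "min b d - max a c = min b d - min b c - min a d + min a c" using True assms by linarith
    ultimately show ?thesis by simp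
  next
    case False then have "{max a c<..min b d} = {}" by auto
    moreover have "0 = min b d - min b c - min a d + min a c" using False assms by linarith
    ultimately show ?thesis by simp
  qed
  finally show ?thesis .
qed

text \<open>The Ito isometry, polarised, for step functions on two different grids. By bilinearity
  it is checked on pairs of intervals, which avoids a common refinement.\<close>

lemma step_integral_inner:
  assumes bm: "brownian_motion M W" and \<tau>: "0 \<le> \<tau> 0" "\<And>i. i < N \<Longrightarrow> \<tau> i \<le> \<tau> (Suc i)"
    and \<tau>': "0 \<le> \<tau>' 0" "\<And>i. i < N' \<Longrightarrow> \<tau>' i \<le> \<tau>' (Suc i)"
  shows "expectation (\<lambda>\<omega>. step_integral W N \<tau> c \<omega> * step_integral W N' \<tau>' c' \<omega>)
    = (\<integral>s. step_fun N \<tau> c s * step_fun N' \<tau>' c' s \<partial>lborel)"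
proof -
  have p: "0 \<le> \<tau> i" if "i \<le> N" for i using that by (induction i) (use \<tau> in \<open>auto intro: order_trans\<close>)
  have p': "0 \<le> \<tau>' i" if "i \<le> N'" for i using that by (induction i) (use \<tau>' in \<open>auto intro: order_trans\<close>)
  have I: "expectation (\<lambda>\<omega>. (W b \<omega> - W a \<omega>) * (W d \<omega> - W c \<omega>)) = (\<integral>s. indicator {a<..b} s * indicator {c<..d} s \<partial>lborel)"
    and iI: "integrable M (\<lambda>\<omega>. (W b \<omega> - W a \<omega>) * (W d \<omega> - W c \<omega>))"
    if "0 \<le> a" "a \<le> b" "0 \<le> c" "c \<le> d" for a b c d
  proof -
    have q: "0 \<le> b" "0 \<le> d" using that by auto
    note LL = bm_moments(1)[OF bm]
    have i: "integrable M (\<lambda>\<omega>. W u \<omega> * W v \<omega>)" if "0 \<le> u" "0 \<le> v" for u v using that by (intro L2_mult_integrable LL)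
    have e: "(W b \<omega> - W a \<omega>) * (W d \<omega> - W c \<omega>) = W b \<omega> * W d \<omega> - W b \<omega> * W c \<omega> - W a \<omega> * W d \<omega> + W a \<omega> * W c \<omega>" for \<omega>
      by (simp add: algebra_simps)
    show "integrable M (\<lambda>\<omega>. (W b \<omega> - W a \<omega>) * (W d \<omega> - W c \<omega>))"
      unfolding e using i that q by auto
    show "expectation (\<lambda>\<omega>. (W b \<omega> - W a \<omega>) * (W d \<omega> - W c \<omega>)) = (\<integral>s. indicator {a<..b} s * indicator {c<..d} s \<partial>lborel)"
      unfolding e integral_indicator_Ioc_mult[OF that(2,4)] using i that q bm_cov[OF bm] by simp
  qed
  have ii: "integrable lborel (\<lambda>s. indicator {a<..b} s * indicator {c<..d} s :: real)" for a b c d :: real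
  proof -
    have "(\<lambda>s. indicator {a<..b} s * indicator {c<..d} s :: real) = indicator ({a<..b} \<inter> {c<..d})" by (auto split: split_indicator)
    moreover have "integrable lborel (indicator ({a<..b} \<inter> {c<..d}) :: real \<Rightarrow> real)"
      by (intro integrable_real_indicator emeasure_bounded_finite bounded_subset[OF bounded_closed_interval[of a b]]) auto
    ultimately show ?thesis by simp
  qed
  have "expectation (\<lambda>\<omega>. step_integral W N \<tau> c \<omega> * step_integral W N' \<tau>' c' \<omega>)
    = expectation (\<lambda>\<omega>. \<Sum>i<N. \<Sum>j<N'. (c i * c' j) * ((W (\<tau> (Suc i)) \<omega> - W (\<tau> i) \<omega>) * (W (\<tau>' (Suc j)) \<omega> - W (\<tau>' j) \<omega>)))"
    unfolding step_integral_def sum_product by (intro Bochner_Integration.integral_cong refl sum.cong) (simp add: mult_ac)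
  also have "\<dots> = (\<Sum>i<N. \<Sum>j<N'. (c i * c' j) * (\<integral>s. indicator {\<tau> i<..\<tau> (Suc i)} s * indicator {\<tau>' j<..\<tau>' (Suc j)} s \<partial>lborel))"
  proof -
    have "integrable M (\<lambda>\<omega>. (W (\<tau> (Suc i)) \<omega> - W (\<tau> i) \<omega>) * (W (\<tau>' (Suc j)) \<omega> - W (\<tau>' j) \<omega>))"
      "expectation (\<lambda>\<omega>. (W (\<tau> (Suc i)) \<omega> - W (\<tau> i) \<omega>) * (W (\<tau>' (Suc j)) \<omega> - W (\<tau>' j) \<omega>))
        = (\<integral>s. indicator {\<tau> i<..\<tau> (Suc i)} s * indicator {\<tau>' j<..\<tau>' (Suc j)} s \<partial>lborel)" if "i < N" "j < N'" for i j
      using iI[of "\<tau> i" "\<tau> (Suc i)" "\<tau>' j" "\<tau>' (Suc j)"] I[of "\<tau> i" "\<tau> (Suc i)" "\<tau>' j" "\<tau>' (Suc j)"] p[of i] p'[of j] \<tau>(2)[of i] \<tau>'(2)[of j] that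
      by simp_all
    then show ?thesis by (subst integral_double_sum) auto
  qed
  also have "\<dots> = (\<integral>s. (\<Sum>i<N. \<Sum>j<N'. (c i * c' j) * (indicator {\<tau> i<..\<tau> (Suc i)} s * indicator {\<tau>' j<..\<tau>' (Suc j)} s)) \<partial>lborel)"
    using ii by (subst integral_double_sum) auto
  also have "\<dots> = (\<integral>s. step_fun N \<tau> c s * step_fun N' \<tau>' c' s \<partial>lborel)"
    unfolding step_fun_def sum_product by (intro Bochner_Integration.integral_cong refl sum.cong) (simp add: mult_ac)
  finally show ?thesis .
qed

end

lemma nn_integral_square_tendsto:
  fixes h :: "nat \<Rightarrow> 'a \<Rightarrow> real"
  assumes "\<And>p. h p \<in> borel_measurable M" "(\<lambda>p. \<integral>\<^sup>+ x. ennreal ((h p x)\<^sup>2) \<partial>M) \<longlonglongrightarrow> 0"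
  shows "(\<lambda>p. \<integral>x. (h p x)\<^sup>2 \<partial>M) \<longlonglongrightarrow> 0"
proof -
  have "(\<integral>x. (h p x)\<^sup>2 \<partial>M) = enn2real (\<integral>\<^sup>+ x. ennreal ((h p x)\<^sup>2) \<partial>M)" for p
    using assms(1) by (intro integral_eq_nn_integral) auto
  moreover have "(\<lambda>p. \<integral>\<^sup>+ x. ennreal ((h p x)\<^sup>2) \<partial>M) \<longlonglongrightarrow> ennreal 0" using assms(2) by simp
  from tendsto_enn2real[OF this] have "(\<lambda>p. enn2real (\<integral>\<^sup>+ x. ennreal ((h p x)\<^sup>2) \<partial>M)) \<longlonglongrightarrow> 0" by simp
  ultimately show ?thesis by simp
qed

text \<open>The content of \<open>has_wiener_integral\<close> in terms of Lebesgue integrals of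
  square integrable functions. The integrand is cut off to \<open>{0..t}\<close>, so that integrals
  with different end points live on the same space.\<close>

definition step_approximation ::
  "'w measure \<Rightarrow> (real \<Rightarrow> 'w \<Rightarrow> real) \<Rightarrow> (real \<Rightarrow> real) \<Rightarrow> real \<Rightarrow> ('w \<Rightarrow> real) \<Rightarrow>
    (nat \<Rightarrow> nat \<Rightarrow> real) \<Rightarrow> (nat \<Rightarrow> nat) \<Rightarrow> (nat \<Rightarrow> nat \<Rightarrow> real) \<Rightarrow> bool" where
  "step_approximation M W f t Z \<tau> N c \<longleftrightarrow>
    (\<forall>p. \<tau> p 0 = 0) \<and> (\<forall>p. \<forall>i<N p. \<tau> p i \<le> \<tau> p (Suc i)) \<and>
    L2 M Z \<and> L2 lborel (\<lambda>s. f s * indicator {0..t} s) \<and>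
    (\<lambda>p. \<integral>s. (f s * indicator {0..t} s - step_fun (N p) (\<tau> p) (c p) s)\<^sup>2 \<partial>lborel) \<longlonglongrightarrow> 0 \<and>
    (\<lambda>p. \<integral>\<omega>. (Z \<omega> - step_integral W (N p) (\<tau> p) (c p) \<omega>)\<^sup>2 \<partial>M) \<longlonglongrightarrow> 0"

lemma step_approximation_nonneg: "step_approximation M W f t Z \<tau> N c \<Longrightarrow> i \<le> N p \<Longrightarrow> 0 \<le> \<tau> p i"
  by (induction i) (auto simp: step_approximation_def less_eq_Suc_le intro: order_trans)

lemma (in prob_space) wiener_approx:
  assumes bm: "brownian_motion M W" and Z: "has_wiener_integral M W f t Z" and cf: "continuous_on UNIV f"
  shows "\<exists>\<tau> N c. step_approximation M W f t Z \<tau> N c"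
proof -
  obtain N \<tau> c where mZ: "Z \<in> borel_measurable M" and \<tau>: "\<And>p. \<tau> p 0 = 0" "\<And>p. \<tau> p (N p) = t" "\<And>p i. i < N p \<Longrightarrow> \<tau> p i \<le> \<tau> p (Suc i)"
    and l1: "(\<lambda>p. \<integral>\<^sup>+ s. ennreal ((f s - step_fun (N p) (\<tau> p) (c p) s)\<^sup>2) * indicator {0..t} s \<partial>lborel) \<longlonglongrightarrow> 0"
    and l2: "(\<lambda>p. \<integral>\<^sup>+ \<omega>. ennreal ((Z \<omega> - step_integral W (N p) (\<tau> p) (c p) \<omega>)\<^sup>2) \<partial>M) \<longlonglongrightarrow> 0"
    using Z unfolding has_wiener_integral_def by blast
  have mono: "\<tau> p i \<le> \<tau> p j" if "i \<le> j" "j \<le> N p" for p i j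
    using that by (induction j rule: dec_induct) (use \<tau>(3) in \<open>auto intro: order_trans\<close>)
  have \<tau>b: "0 \<le> \<tau> p i" "\<tau> p i \<le> t" if "i \<le> N p" for p i using mono[of 0 i p] mono[of i "N p" p] that \<tau> by auto
  have LS: "L2 M (step_integral W (N p) (\<tau> p) (c p))" for p by (rule step_integral_L2[OF bm]) (use \<tau>b in auto)
  have LZ: "L2 M Z"
  proof -
    \<comment> \<open>Square integrability of \<open>Z\<close> is not part of
      \<open>has_wiener_integral\<close>; it follows since \<open>Z\<close> is at finite distance
      from one late step integral.\<close>
    have "eventually (\<lambda>p. (\<integral>\<^sup>+ \<omega>. ennreal ((Z \<omega> - step_integral W (N p) (\<tau> p) (c p) \<omega>)\<^sup>2) \<partial>M) < 1) sequentially"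
      using l2 by (rule order_tendstoD(2)) simp
    then obtain p where p: "(\<integral>\<^sup>+ \<omega>. ennreal ((Z \<omega> - step_integral W (N p) (\<tau> p) (c p) \<omega>)\<^sup>2) \<partial>M) < 1"
      by (auto simp: eventually_sequentially)
    have "L2 M (\<lambda>\<omega>. Z \<omega> - step_integral W (N p) (\<tau> p) (c p) \<omega>)"
      unfolding L2_def
    proof (intro conjI integrableI_bounded)
      show "(\<lambda>\<omega>. Z \<omega> - step_integral W (N p) (\<tau> p) (c p) \<omega>) \<in> borel_measurable M" using mZ L2_measurable[OF LS] by simp
      then show "(\<lambda>\<omega>. (Z \<omega> - step_integral W (N p) (\<tau> p) (c p) \<omega>)\<^sup>2) \<in> borel_measurable M" by simp
      show "(\<integral>\<^sup>+ \<omega>. ennreal (norm ((Z \<omega> - step_integral W (N p) (\<tau> p) (c p) \<omega>)\<^sup>2)) \<partial>M) < \<infinity>" using order.strict_trans[OF p, of \<infinity>] by simp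
    qed
    from L2_add[OF this LS[of p]] show ?thesis by simp
  qed
  have [measurable]: "f \<in> borel_measurable borel" by (rule borel_measurable_continuous_onI[OF cf])
  have Lf: "L2 lborel (\<lambda>s. f s * indicator {0..t} s)"
  proof -
    have "set_integrable lborel {0..t} (\<lambda>s. (f s)\<^sup>2)"
      by (rule borel_integrable_atLeastAtMost') (intro continuous_intros continuous_on_subset[OF cf], auto)
    moreover have "(\<lambda>s. (f s * indicator {0..t} s)\<^sup>2) = (\<lambda>s. indicator {0..t} s *\<^sub>R (f s)\<^sup>2)" by (auto split: split_indicator)
    ultimately show ?thesis by (simp add: L2_def set_integrable_def)
  qed
  have [measurable]: "step_fun N \<tau> c \<in> borel_measurable borel" for N \<tau> c
    using L2_measurable[OF step_fun_L2] by simp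
  \<comment> \<open>The grid points lie in \<open>{0..t}\<close>, so cutting off the integrand alone
    does not change the approximation error.\<close>
  have z: "step_fun (N p) (\<tau> p) (c p) s = 0" if "s \<notin> {0..t}" for p s
    unfolding step_fun_def
  proof (intro sum.neutral ballI)
    fix i assume "i \<in> {..<N p}"
    then have "s \<notin> {\<tau> p i<..\<tau> p (Suc i)}" using \<tau>b[of i p] \<tau>b[of "Suc i" p] that by auto
    then show "c p i * indicator {\<tau> p i<..\<tau> p (Suc i)} s = 0" by simp
  qed
  have "(\<lambda>p. \<integral>s. (f s * indicator {0..t} s - step_fun (N p) (\<tau> p) (c p) s)\<^sup>2 \<partial>lborel) \<longlonglongrightarrow> 0"
  proof (rule nn_integral_square_tendsto)
    have "ennreal ((f s * indicator {0..t} s - step_fun (N p) (\<tau> p) (c p) s)\<^sup>2) = ennreal ((f s - step_fun (N p) (\<tau> p) (c p) s)\<^sup>2) * indicator {0..t} s" for p s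
      using z[of s p] by (auto split: split_indicator)
    then show "(\<lambda>p. \<integral>\<^sup>+ s. ennreal ((f s * indicator {0..t} s - step_fun (N p) (\<tau> p) (c p) s)\<^sup>2) \<partial>lborel) \<longlonglongrightarrow> 0" using l1 by simp
  qed measurable
  moreover have "(\<lambda>p. \<integral>\<omega>. (Z \<omega> - step_integral W (N p) (\<tau> p) (c p) \<omega>)\<^sup>2 \<partial>M) \<longlonglongrightarrow> 0"
    by (rule nn_integral_square_tendsto[OF _ l2]) (use mZ L2_measurable[OF LS] in simp)
  ultimately have "step_approximation M W f t Z \<tau> N c" using \<tau> LZ Lf by (simp add: step_approximation_def)
  then show ?thesis by blast
qed

context prob_space
begin

lemma wiener_L2: "brownian_motion M W \<Longrightarrow> has_wiener_integral M W f t Z \<Longrightarrow> continuous_on UNIV f \<Longrightarrow> L2 M Z"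
  using wiener_approx by (metis step_approximation_def)

lemma step_approximation_inner:
  assumes bm: "brownian_motion M W" "brownian_motion M W'"
    and sa: "step_approximation M W f t Z \<tau> N c" "step_approximation M W' f' t' Z' \<tau>' N' c'"
  shows "(\<lambda>p. expectation (\<lambda>\<omega>. step_integral W (N p) (\<tau> p) (c p) \<omega> * step_integral W' (N' p) (\<tau>' p) (c' p) \<omega>)) \<longlonglongrightarrow> expectation (\<lambda>\<omega>. Z \<omega> * Z' \<omega>)"
proof (rule L2_inner_tendsto)
  show "L2 M (step_integral W (N p) (\<tau> p) (c p))" for p
    by (intro step_integral_L2[OF bm(1)] step_approximation_nonneg[OF sa(1)])
  show "L2 M (step_integral W' (N' p) (\<tau>' p) (c' p))" for p
    by (intro step_integral_L2[OF bm(2)] step_approximation_nonneg[OF sa(2)])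
qed (use sa in \<open>auto simp: step_approximation_def\<close>)

text \<open>Both sides are limits of the polarised isometry for step functions. The two
  approximations may be chosen independently of each other.\<close>

lemma wiener_cov:
  assumes bm: "brownian_motion M W" and Z: "has_wiener_integral M W f t Z" "continuous_on UNIV f"
    and Z': "has_wiener_integral M W f' t' Z'" "continuous_on UNIV f'"
  shows "expectation (\<lambda>\<omega>. Z \<omega> * Z' \<omega>) = (\<integral>s. (f s * indicator {0..t} s) * (f' s * indicator {0..t'} s) \<partial>lborel)"
proof -
  obtain \<tau> N c where a: "step_approximation M W f t Z \<tau> N c" using wiener_approx[OF bm Z] by blast
  obtain \<tau>' N' c' where a': "step_approximation M W f' t' Z' \<tau>' N' c'" using wiener_approx[OF bm Z'] by blast
  have "(\<lambda>p. \<integral>s. step_fun (N p) (\<tau> p) (c p) s * step_fun (N' p) (\<tau>' p) (c' p) s \<partial>lborel) \<longlonglongrightarrow> (\<integral>s. (f s * indicator {0..t} s) * (f' s * indicator {0..t'} s) \<partial>lborel)"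
    by (rule L2_inner_tendsto[OF _ _ step_fun_L2 step_fun_L2]) (use a a' in \<open>auto simp: step_approximation_def\<close>)
  moreover have "expectation (\<lambda>\<omega>. step_integral W (N p) (\<tau> p) (c p) \<omega> * step_integral W (N' p) (\<tau>' p) (c' p) \<omega>)
     = (\<integral>s. step_fun (N p) (\<tau> p) (c p) s * step_fun (N' p) (\<tau>' p) (c' p) s \<partial>lborel)" for p
    by (rule step_integral_inner[OF bm]) (use a a' in \<open>auto simp: step_approximation_def\<close>)
  ultimately show ?thesis using step_approximation_inner[OF bm bm a a'] by (simp add: LIMSEQ_unique)
qed

end

section \<open>Independent Brownian motions and the span of their values\<close>

locale brownian_family = prob_space M for M :: "'w measure" +
  fixes W :: "nat \<Rightarrow> real \<Rightarrow> 'w \<Rightarrow> real"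
  assumes ibm: "independent_brownian_motions M W"
begin

lemma bm: "1 \<le> k \<Longrightarrow> brownian_motion M (W k)"
  using ibm by (simp add: independent_brownian_motions_def)

lemma ind_paths: "indep_vars (\<lambda>_. PiM {0..} (\<lambda>_. borel)) (\<lambda>k \<omega>. \<lambda>t\<in>{0..}. W k t \<omega>) {1..}"
  using ibm by (simp add: independent_brownian_motions_def)

lemma bm_cross:
  assumes "1 \<le> k" "1 \<le> l" "k \<noteq> l" "0 \<le> s" "0 \<le> t"
  shows "expectation (\<lambda>\<omega>. W k s \<omega> * W l t \<omega>) = 0"
proof -
  let ?Y = "\<lambda>j (x :: real \<Rightarrow> real). if j = k then x s else x t"
  have ind: "indep_vars (\<lambda>_. borel) (\<lambda>j \<omega>. ?Y j (\<lambda>t\<in>{0..}. W j t \<omega>)) {k, l}"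
  proof (rule indep_vars_compose2[where M'="\<lambda>_. PiM {0..} (\<lambda>_. borel)" and X="\<lambda>k \<omega>. \<lambda>t\<in>{0..}. W k t \<omega>" and Y="?Y"])
    show "indep_vars (\<lambda>_. PiM {0..} (\<lambda>_. borel)) (\<lambda>k \<omega>. \<lambda>t\<in>{0..}. W k t \<omega>) {k, l}"
      by (rule indep_vars_subset[OF ind_paths]) (use assms in auto)
    show "?Y j \<in> measurable (PiM {0..} (\<lambda>_. borel)) borel" for j
      using assms by (cases "j = k") auto
  qed
  have int: "integrable M (\<lambda>\<omega>. ?Y j (\<lambda>t\<in>{0..}. W j t \<omega>))" if "j \<in> {k, l}" for j
    using that assms L2_abs_le(1)[OF prob_space_axioms bm_moments(1)[OF bm]] by auto
  have "expectation (\<lambda>\<omega>. \<Prod>j\<in>{k, l}. ?Y j (\<lambda>t\<in>{0..}. W j t \<omega>)) = (\<Prod>j\<in>{k, l}. expectation (\<lambda>\<omega>. ?Y j (\<lambda>t\<in>{0..}. W j t \<omega>)))"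
    by (rule indep_vars_lebesgue_integral[OF _ ind int]) auto
  then show ?thesis using assms bm_moments(2)[OF bm[OF assms(1)] assms(4)] by simp
qed

text \<open>Finite combinations of Brownian values have two properties that the Wiener integrals
  share only up to limits: they are exactly jointly Gaussian (\<open>span_gaussian_family\<close>),
  and they are explicit functions of the paths (\<open>span_path_functional\<close>).\<close>

definition span :: "('w \<Rightarrow> real) set" where
  "span = {f. \<exists>S c. finite S \<and> S \<subseteq> {1..} \<times> {0..} \<and> (\<forall>\<omega>. f \<omega> = (\<Sum>(k, s)\<in>S. c (k, s) * W k s \<omega>))}"

lemma span_W: "1 \<le> k \<Longrightarrow> 0 \<le> s \<Longrightarrow> (\<lambda>\<omega>. W k s \<omega>) \<in> span"
  unfolding span_def by (intro CollectI exI[of _ "{(k, s)}"] exI[of _ "\<lambda>_. 1"]) auto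

lemma span_zero: "(\<lambda>\<omega>. 0) \<in> span"
  unfolding span_def by (intro CollectI exI[of _ "{}"]) auto

lemma span_cmult: assumes "f \<in> span" shows "(\<lambda>\<omega>. a * f \<omega>) \<in> span"
proof -
  obtain S c where S: "finite S" "S \<subseteq> {1..} \<times> {0..}" "\<And>\<omega>. f \<omega> = (\<Sum>(k, s)\<in>S. c (k, s) * W k s \<omega>)"
    using assms unfolding span_def by blast
  then show ?thesis unfolding span_def
    by (intro CollectI exI[of _ S] exI[of _ "\<lambda>p. a * c p"]) (auto simp: sum_distrib_left case_prod_unfold mult.assoc)
qed

lemma span_extend:
  assumes "finite T" "S \<subseteq> T"
  shows "(\<Sum>(k, s)\<in>S. c (k, s) * W k s \<omega>) = (\<Sum>(k, s)\<in>T. (if (k, s) \<in> S then c (k, s) else 0) * W k s \<omega>)"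
  by (rule sum.mono_neutral_cong_left) (use assms in auto)

lemma span_add: assumes "f \<in> span" "g \<in> span" shows "(\<lambda>\<omega>. f \<omega> + g \<omega>) \<in> span"
proof -
  obtain S c where S: "finite S" "S \<subseteq> {1..} \<times> {0..}" "\<And>\<omega>. f \<omega> = (\<Sum>(k, s)\<in>S. c (k, s) * W k s \<omega>)"
    using assms(1) unfolding span_def by blast
  obtain T d where T: "finite T" "T \<subseteq> {1..} \<times> {0..}" "\<And>\<omega>. g \<omega> = (\<Sum>(k, s)\<in>T. d (k, s) * W k s \<omega>)"
    using assms(2) unfolding span_def by blast
  have "f \<omega> + g \<omega> = (\<Sum>(k, s)\<in>S \<union> T. ((if (k, s) \<in> S then c (k, s) else 0) + (if (k, s) \<in> T then d (k, s) else 0)) * W k s \<omega>)" for \<omega>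
    unfolding S(3) T(3) span_extend[of "S \<union> T" S c \<omega>, OF finite_UnI[OF S(1) T(1)] Un_upper1] span_extend[of "S \<union> T" T d \<omega>, OF finite_UnI[OF S(1) T(1)] Un_upper2]
    by (simp add: sum.distrib[symmetric] case_prod_unfold distrib_right)
  then show ?thesis unfolding span_def using S T
    by (intro CollectI exI[of _ "S \<union> T"] exI[of _ "\<lambda>p. (if p \<in> S then c p else 0) + (if p \<in> T then d p else 0)"]) auto
qed

lemma span_diff: "f \<in> span \<Longrightarrow> g \<in> span \<Longrightarrow> (\<lambda>\<omega>. f \<omega> - g \<omega>) \<in> span"
  using span_add[of f "\<lambda>\<omega>. -1 * g \<omega>"] span_cmult[of g "-1"] by simp

lemma span_sum: "(\<And>i. i \<in> I \<Longrightarrow> f i \<in> span) \<Longrightarrow> (\<lambda>\<omega>. \<Sum>i\<in>I. f i \<omega>) \<in> span"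
  by (induction I rule: infinite_finite_induct) (auto intro: span_add span_zero)

lemma span_step_integral:
  assumes "1 \<le> k" "\<And>i. i \<le> N \<Longrightarrow> 0 \<le> \<tau> i" shows "step_integral (W k) N \<tau> c \<in> span"
  unfolding step_integral_def[abs_def] using assms by (intro span_sum span_cmult span_diff span_W) auto

text \<open>Independence of \<open>\<xi>\<close> is assumed from the family of paths; as a
  measurable functional of the paths, an element of \<open>span\<close> inherits it.\<close>

lemma span_path_functional:
  assumes "f \<in> span"
  shows "\<exists>h \<in> borel_measurable (PiM {1..} (\<lambda>_. PiM {0..} (\<lambda>_. borel))). \<forall>\<omega>. f \<omega> = h (\<lambda>k\<in>{1..}. \<lambda>t\<in>{0..}. W k t \<omega>)"
proof -
  obtain S c where S: "finite S" "S \<subseteq> {1..} \<times> {0..}" "\<And>\<omega>. f \<omega> = (\<Sum>(k, s)\<in>S. c (k, s) * W k s \<omega>)"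
    using assms unfolding span_def by blast
  let ?h = "\<lambda>x :: nat \<Rightarrow> real \<Rightarrow> real. \<Sum>p\<in>S. c p * x (fst p) (snd p)"
  show ?thesis
  proof (intro bexI[of _ ?h] allI)
    show "f \<omega> = ?h (\<lambda>k\<in>{1..}. \<lambda>t\<in>{0..}. W k t \<omega>)" for \<omega>
      unfolding S(3) using S(2) by (auto intro!: sum.cong simp: case_prod_unfold)
    show "?h \<in> borel_measurable (PiM {1..} (\<lambda>_. PiM {0..} (\<lambda>_. borel)))"
    proof (intro borel_measurable_sum borel_measurable_times borel_measurable_const)
      fix p assume "p \<in> S"
      then have p: "fst p \<in> {1..}" "snd p \<in> {0..}" using S(2) by auto
      show "(\<lambda>x. x (fst p) (snd p)) \<in> borel_measurable (PiM {1..} (\<lambda>_. PiM {0..} (\<lambda>_. borel)))"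
        using measurable_compose[OF measurable_component_singleton[OF p(1)] measurable_component_singleton[OF p(2)]] .
    qed
  qed
qed

text \<open>\<open>indep_vars_pairs\<close> combines independence of the increments of one path with
  independence of the paths, of which the vectors of increments are measurable functions.\<close>

lemma increments_std_gaussian:
  assumes K: "finite K" "K \<subseteq> {1..}" and \<tau>: "0 \<le> \<tau> 0" "\<And>i. i < N \<Longrightarrow> \<tau> i < \<tau> (Suc i)"
  shows "std_gaussian_family M (K \<times> {..<N}) (\<lambda>(k, l) \<omega>. (W k (\<tau> (Suc l)) \<omega> - W k (\<tau> l) \<omega>) / sqrt (\<tau> (Suc l) - \<tau> l))"
proof -
  let ?g = "\<lambda>k l \<omega>. (W k (\<tau> (Suc l)) \<omega> - W k (\<tau> l) \<omega>) / sqrt (\<tau> (Suc l) - \<tau> l)"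
  have pos: "0 \<le> \<tau> i" if "i \<le> N" for i using that
  proof (induction i)
    case (Suc i) then show ?case using \<tau>(2)[of i] by simp
  qed (use \<tau> in simp)
  have "indep_vars (\<lambda>_. borel) (\<lambda>(k, l). ?g k l) (K \<times> {..<N})"
  proof (rule indep_vars_pairs)
    fix k assume "k \<in> K"
    then have "brownian_motion M (W k)" using K bm by auto
    then have "indep_vars (\<lambda>_. borel) (\<lambda>i \<omega>. W k (\<tau> (Suc i)) \<omega> - W k (\<tau> i) \<omega>) {..<N}"
      using \<tau> unfolding brownian_motion_def by blast
    then show "indep_vars (\<lambda>_. borel) (?g k) {..<N}"
      by (rule indep_vars_compose2[where Y="\<lambda>l x. x / sqrt (\<tau> (Suc l) - \<tau> l)"]) auto
  next
    let ?Y = "\<lambda>x :: real \<Rightarrow> real. \<lambda>l\<in>{..<N}. (x (\<tau> (Suc l)) - x (\<tau> l)) / sqrt (\<tau> (Suc l) - \<tau> l)"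
    have "indep_vars (\<lambda>_. PiM {..<N} (\<lambda>_. borel)) (\<lambda>k \<omega>. ?Y (\<lambda>t\<in>{0..}. W k t \<omega>)) K"
    proof (rule indep_vars_compose2[where M'="\<lambda>_. PiM {0..} (\<lambda>_. borel)" and X="\<lambda>k \<omega>. \<lambda>t\<in>{0..}. W k t \<omega>" and Y="\<lambda>_. ?Y"])
      show "indep_vars (\<lambda>_. PiM {0..} (\<lambda>_. borel)) (\<lambda>k \<omega>. \<lambda>t\<in>{0..}. W k t \<omega>) K"
        by (rule indep_vars_subset[OF ind_paths K(2)])
      show "?Y \<in> measurable (PiM {0..} (\<lambda>_. borel)) (PiM {..<N} (\<lambda>_. borel))"
      proof (rule measurable_restrict)
        fix l assume "l \<in> {..<N}"
        then have "\<tau> (Suc l) \<in> {0..}" "\<tau> l \<in> {0..}" using pos by auto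
        then show "(\<lambda>x. (x (\<tau> (Suc l)) - x (\<tau> l)) / sqrt (\<tau> (Suc l) - \<tau> l)) \<in> borel_measurable (PiM {0..} (\<lambda>_. borel))"
          by measurable
      qed
    qed
    moreover have "?Y (\<lambda>t\<in>{0..}. W k t \<omega>) = (\<lambda>l\<in>{..<N}. ?g k l \<omega>)" for k \<omega> using pos by (auto simp: fun_eq_iff)
    ultimately show "indep_vars (\<lambda>_. PiM {..<N} (\<lambda>_. borel)) (\<lambda>k \<omega>. \<lambda>l\<in>{..<N}. ?g k l \<omega>) K" by simp
  qed (use K in auto)
  moreover have "distr M borel (?g k l) = std_normal_distribution" if "k \<in> K" "l < N" for k l
  proof -
    have b: "brownian_motion M (W k)" using K bm that by auto
    have "distributed M lborel (\<lambda>\<omega>. W k (\<tau> (Suc l)) \<omega> - W k (\<tau> l) \<omega>) (normal_density 0 (sqrt (\<tau> (Suc l) - \<tau> l)))"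
      using b \<tau>(2)[OF that(2)] pos[of l] that unfolding brownian_motion_def by simp
    then have "distributed M lborel (?g k l) std_normal_density"
      using normal_standard_normal_convert[of "sqrt (\<tau> (Suc l) - \<tau> l)" "\<lambda>\<omega>. W k (\<tau> (Suc l)) \<omega> - W k (\<tau> l) \<omega>" 0] \<tau>(2)[OF that(2)] by simp
    then have "distr M lborel (?g k l) = std_normal_distribution" by (simp add: distributed_def)
    moreover have "distr M lborel (?g k l) = distr M borel (?g k l)" by (intro distr_cong) auto
    ultimately show ?thesis by simp
  qed
  ultimately show ?thesis unfolding std_gaussian_family_def using K by (auto simp: case_prod_unfold)
qed

text \<open>All modes and all times occurring in the family are collected. The normalised increments
  of these paths over the sorted times form one standard family, in which every \<open>G p\<close>
  is linear up to a null set.\<close>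

lemma span_gaussian_family:
  assumes P: "finite P" and G: "\<And>p. p \<in> P \<Longrightarrow> G p \<in> span"
  shows "gaussian_family M P G"
proof -
  have "\<forall>p\<in>P. \<exists>S c. finite S \<and> S \<subseteq> {1..} \<times> {0..} \<and> (\<forall>\<omega>. G p \<omega> = (\<Sum>(k, s)\<in>S. c (k, s) * W k s \<omega>))"
    using G unfolding span_def by blast
  from bchoice[OF this] obtain S where
    "\<forall>p\<in>P. \<exists>c. finite (S p) \<and> S p \<subseteq> {1..} \<times> {0..} \<and> (\<forall>\<omega>. G p \<omega> = (\<Sum>(k, s)\<in>S p. c (k, s) * W k s \<omega>))" ..
  from bchoice[OF this] obtain c where
    Sc: "\<forall>p\<in>P. finite (S p) \<and> S p \<subseteq> {1..} \<times> {0..} \<and> (\<forall>\<omega>. G p \<omega> = (\<Sum>(k, s)\<in>S p. c p (k, s) * W k s \<omega>))" ..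
  have S: "finite (S p)" "S p \<subseteq> {1..} \<times> {0..}" "G p \<omega> = (\<Sum>(k, s)\<in>S p. c p (k, s) * W k s \<omega>)" if "p \<in> P" for p \<omega>
    using bspec[OF Sc that] by simp_all
  define K where "K = fst ` (\<Union>p\<in>P. S p)"
  \<comment> \<open>Time \<open>0\<close> is added so that a Brownian value is the sum of the
    increments up to its time.\<close>
  define T where "T = insert 0 (snd ` (\<Union>p\<in>P. S p))"
  have "(\<Union>p\<in>P. S p) \<subseteq> {1..} \<times> {0..}" using S(2) by blast
  from image_mono[OF this, of fst] image_mono[OF this, of snd]
  have KT: "K \<subseteq> {1..}" "T \<subseteq> {0..}" unfolding K_def T_def by auto
  have fS: "finite (\<Union>p\<in>P. S p)" using S(1) P by simp
  have K: "finite K" "K \<subseteq> {1..}" using fS KT unfolding K_def by auto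
  have T: "finite T" "T \<subseteq> {0..}" "0 \<in> T" using fS KT unfolding T_def by auto
  define xs where "xs = sorted_list_of_set T"
  have xs: "sorted xs" "distinct xs" "set xs = T" using T by (auto simp: xs_def)
  define N where "N = length xs - 1"
  have len: "length xs = Suc N" using xs T by (cases xs) (auto simp: N_def)
  define \<tau> where "\<tau> i = xs ! i" for i
  have \<tau>T: "\<tau> i \<in> T" if "i \<le> N" for i using that xs len nth_mem[of i xs] by (auto simp: \<tau>_def)
  have \<tau>inc: "\<tau> i < \<tau> (Suc i)" if "i < N" for i
    using that xs len sorted_nth_mono[of xs i "Suc i"] nth_eq_iff_index_eq[of xs i "Suc i"] by (auto simp: \<tau>_def order.strict_iff_order)
  have \<tau>0: "\<tau> 0 = 0"
  proof -
    obtain i where "i < length xs" "xs ! i = 0" using T(3) xs(3) by (metis in_set_conv_nth)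
    then have "\<tau> 0 \<le> 0" using sorted_nth_mono[OF xs(1), of 0 i] by (simp add: \<tau>_def)
    then show ?thesis using \<tau>T[of 0] T(2) by auto
  qed
  define idx where "idx s = (SOME i. i \<le> N \<and> \<tau> i = s)" for s
  have idx: "idx s \<le> N" "\<tau> (idx s) = s" if "s \<in> T" for s
  proof -
    have "\<exists>i. i \<le> N \<and> \<tau> i = s" using that xs(3) len by (metis \<tau>_def in_set_conv_nth less_Suc_eq_le)
    from someI_ex[OF this] show "idx s \<le> N" "\<tau> (idx s) = s" by (simp_all add: idx_def)
  qed
  define g where "g = (\<lambda>(k, l) \<omega>. (W k (\<tau> (Suc l)) \<omega> - W k (\<tau> l) \<omega>) / sqrt (\<tau> (Suc l) - \<tau> l))"
  have sg: "std_gaussian_family M (K \<times> {..<N}) g"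
    unfolding g_def by (rule increments_std_gaussian[where \<tau>=\<tau>]) (use K \<tau>0 \<tau>inc in auto)
  have W0: "AE \<omega> in M. \<forall>k\<in>K. W k 0 \<omega> = 0"
    using K bm by (intro AE_finite_allI) (auto simp: brownian_motion_def)
  \<comment> \<open>The sum runs over all intervals, with coefficient zero from \<open>i\<close> on,
    so that every Brownian value uses the same family of increments.\<close>
  have WN: "W k (\<tau> i) \<omega> = (\<Sum>l<N. (if l < i then sqrt (\<tau> (Suc l) - \<tau> l) else 0) * g (k, l) \<omega>)"
    if "W k 0 \<omega> = 0" "i \<le> N" for k \<omega> i
    using that(2)
  proof (induction i)
    case 0 then show ?case using that(1) \<tau>0 by simp
  next
    case (Suc i)
    have "(\<Sum>l<N. (if l < Suc i then sqrt (\<tau> (Suc l) - \<tau> l) else 0) * g (k, l) \<omega>)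
      = (\<Sum>l<N. (if l < i then sqrt (\<tau> (Suc l) - \<tau> l) else 0) * g (k, l) \<omega> + (if l = i then sqrt (\<tau> (Suc l) - \<tau> l) * g (k, l) \<omega> else 0))"
      by (intro sum.cong refl) auto
    also have "\<dots> = W k (\<tau> i) \<omega> + sqrt (\<tau> (Suc i) - \<tau> i) * g (k, i) \<omega>"
      using Suc by (simp add: sum.distrib)
    also have "\<dots> = W k (\<tau> (Suc i)) \<omega>" using \<tau>inc[of i] Suc by (simp add: g_def)
    finally show ?case by simp
  qed
  \<comment> \<open>The coefficient of the increment \<open>a = (k, l)\<close> collects the terms of
    \<open>G p\<close> that belong to path \<open>k\<close> and to a time after the interval
    \<open>l\<close>.\<close>
  define L where "L p a = (\<Sum>q\<in>S p. if fst q = fst a \<and> snd a < idx (snd q) then c p q * sqrt (\<tau> (Suc (snd a)) - \<tau> (snd a)) else 0)" for p a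
  have "AE \<omega> in M. G p \<omega> = (\<Sum>a\<in>K \<times> {..<N}. L p a * g a \<omega>)" if p: "p \<in> P" for p
    using W0
  proof eventually_elim
    fix \<omega> assume z: "\<forall>k\<in>K. W k 0 \<omega> = 0"
    have "(\<Sum>a\<in>K \<times> {..<N}. L p a * g a \<omega>) = (\<Sum>k\<in>K. \<Sum>l<N. L p (k, l) * g (k, l) \<omega>)"
      by (simp add: sum.cartesian_product)
    also have "\<dots> = (\<Sum>k\<in>K. \<Sum>l<N. \<Sum>q\<in>S p. (if fst q = k \<and> l < idx (snd q) then c p q * sqrt (\<tau> (Suc l) - \<tau> l) else 0) * g (k, l) \<omega>)"
      unfolding L_def by (simp add: sum_distrib_right cong: if_cong)
    also have "\<dots> = (\<Sum>q\<in>S p. \<Sum>k\<in>K. \<Sum>l<N. (if fst q = k \<and> l < idx (snd q) then c p q * sqrt (\<tau> (Suc l) - \<tau> l) else 0) * g (k, l) \<omega>)"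
      by (subst (2) sum.swap, subst sum.swap) (rule refl)
    also have "\<dots> = (\<Sum>q\<in>S p. c p q * W (fst q) (snd q) \<omega>)"
    proof (rule sum.cong[OF refl])
      fix q assume q: "q \<in> S p"
      have qK: "fst q \<in> K" "snd q \<in> T" using q p by (auto simp: K_def T_def)
      have "(\<Sum>k\<in>K. \<Sum>l<N. (if fst q = k \<and> l < idx (snd q) then c p q * sqrt (\<tau> (Suc l) - \<tau> l) else 0) * g (k, l) \<omega>)
        = (\<Sum>k\<in>K. if k = fst q then (\<Sum>l<N. (if l < idx (snd q) then c p q * sqrt (\<tau> (Suc l) - \<tau> l) else 0) * g (k, l) \<omega>) else 0)"
        by (intro sum.cong refl) auto
      also have "\<dots> = (\<Sum>l<N. (if l < idx (snd q) then c p q * sqrt (\<tau> (Suc l) - \<tau> l) else 0) * g (fst q, l) \<omega>)"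
        using K(1) qK by simp
      also have "\<dots> = c p q * (\<Sum>l<N. (if l < idx (snd q) then sqrt (\<tau> (Suc l) - \<tau> l) else 0) * g (fst q, l) \<omega>)"
        unfolding sum_distrib_left by (intro sum.cong refl) auto
      also have "\<dots> = c p q * W (fst q) (snd q) \<omega>"
        using WN[of "fst q" \<omega> "idx (snd q)"] z qK idx[OF qK(2)] by simp
      finally show "(\<Sum>k\<in>K. \<Sum>l<N. (if fst q = k \<and> l < idx (snd q) then c p q * sqrt (\<tau> (Suc l) - \<tau> l) else 0) * g (k, l) \<omega>) = c p q * W (fst q) (snd q) \<omega>" .
    qed
    also have "\<dots> = G p \<omega>" using S(3)[OF p] by (simp add: case_prod_unfold)
    finally show "G p \<omega> = (\<Sum>a\<in>K \<times> {..<N}. L p a * g a \<omega>)" by simp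
  qed
  then show ?thesis unfolding gaussian_family_def using sg by blast
qed

lemma span_L2: assumes "f \<in> span" shows "L2 M f"
proof -
  obtain S c where S: "finite S" "S \<subseteq> {1..} \<times> {0..}" "\<And>\<omega>. f \<omega> = (\<Sum>(k, s)\<in>S. c (k, s) * W k s \<omega>)"
    using assms unfolding span_def by blast
  have "L2 M (\<lambda>\<omega>. \<Sum>p\<in>S. c p * W (fst p) (snd p) \<omega>)"
    using S(2) by (intro L2_sum L2_cmult bm_moments(1)[OF bm]) auto
  moreover have "f = (\<lambda>\<omega>. \<Sum>p\<in>S. c p * W (fst p) (snd p) \<omega>)" using S(3) by (simp add: fun_eq_iff case_prod_unfold)
  ultimately show ?thesis by simp
qed

lemma wiener_span_approx:
  assumes "1 \<le> k" "has_wiener_integral M (W k) f t Z" "continuous_on UNIV f" "0 < \<epsilon>"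
  shows "\<exists>S\<in>span. expectation (\<lambda>\<omega>. (Z \<omega> - S \<omega>)\<^sup>2) < \<epsilon>"
proof -
  obtain \<tau> N c where a: "step_approximation M (W k) f t Z \<tau> N c"
    using wiener_approx[OF bm[OF assms(1)] assms(2,3)] by blast
  then have "(\<lambda>p. expectation (\<lambda>\<omega>. (Z \<omega> - step_integral (W k) (N p) (\<tau> p) (c p) \<omega>)\<^sup>2)) \<longlonglongrightarrow> 0"
    by (simp add: step_approximation_def)
  from order_tendstoD(2)[OF this assms(4)] obtain p where "expectation (\<lambda>\<omega>. (Z \<omega> - step_integral (W k) (N p) (\<tau> p) (c p) \<omega>)\<^sup>2) < \<epsilon>"
    by (auto simp: eventually_sequentially)
  moreover have "step_integral (W k) (N p) (\<tau> p) (c p) \<in> span"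
    by (rule span_step_integral[OF assms(1) step_approximation_nonneg[OF a]])
  ultimately show ?thesis by blast
qed

lemma wiener_cross:
  assumes k: "1 \<le> k" "1 \<le> l" "k \<noteq> l" and Z: "has_wiener_integral M (W k) f t Z" "continuous_on UNIV f"
    and Z': "has_wiener_integral M (W l) f' t' Z'" "continuous_on UNIV f'"
  shows "expectation (\<lambda>\<omega>. Z \<omega> * Z' \<omega>) = 0"
proof -
  obtain \<tau> N c where a: "step_approximation M (W k) f t Z \<tau> N c" using wiener_approx[OF bm[OF k(1)] Z] by blast
  obtain \<tau>' N' c' where a': "step_approximation M (W l) f' t' Z' \<tau>' N' c'" using wiener_approx[OF bm[OF k(2)] Z'] by blast
  note nn = step_approximation_nonneg[OF a] step_approximation_nonneg[OF a']
  let ?d = "\<lambda>p i \<omega>. W k (\<tau> p (Suc i)) \<omega> - W k (\<tau> p i) \<omega>" and ?d' = "\<lambda>p i \<omega>. W l (\<tau>' p (Suc i)) \<omega> - W l (\<tau>' p i) \<omega>"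
  have "expectation (\<lambda>\<omega>. step_integral (W k) (N p) (\<tau> p) (c p) \<omega> * step_integral (W l) (N' p) (\<tau>' p) (c' p) \<omega>) = 0" for p
  proof -
    have z: "integrable M (\<lambda>\<omega>. ?d p i \<omega> * ?d' p j \<omega>)" "expectation (\<lambda>\<omega>. ?d p i \<omega> * ?d' p j \<omega>) = 0" if "i < N p" "j < N' p" for i j
    proof -
      have n: "0 \<le> \<tau> p i" "0 \<le> \<tau> p (Suc i)" "0 \<le> \<tau>' p j" "0 \<le> \<tau>' p (Suc j)" using nn that by auto
      note L = bm_moments(1)[OF bm[OF k(1)] n(2)] bm_moments(1)[OF bm[OF k(1)] n(1)] bm_moments(1)[OF bm[OF k(2)] n(4)] bm_moments(1)[OF bm[OF k(2)] n(3)]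
      show "integrable M (\<lambda>\<omega>. ?d p i \<omega> * ?d' p j \<omega>)" by (intro L2_mult_integrable L2_diff L)
      show "expectation (\<lambda>\<omega>. ?d p i \<omega> * ?d' p j \<omega>) = 0" unfolding L2_inner_diff[OF L] using bm_cross[OF k] n by simp
    qed
    have "expectation (\<lambda>\<omega>. step_integral (W k) (N p) (\<tau> p) (c p) \<omega> * step_integral (W l) (N' p) (\<tau>' p) (c' p) \<omega>)
      = expectation (\<lambda>\<omega>. \<Sum>i<N p. \<Sum>j<N' p. (c p i * c' p j) * (?d p i \<omega> * ?d' p j \<omega>))"
      unfolding step_integral_def sum_product by (intro Bochner_Integration.integral_cong refl sum.cong) (simp add: mult_ac)
    also have "\<dots> = (\<Sum>i<N p. \<Sum>j<N' p. (c p i * c' p j) * expectation (\<lambda>\<omega>. ?d p i \<omega> * ?d' p j \<omega>))"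
      by (rule integral_double_sum) (use z(1) in auto)
    also have "\<dots> = 0" using z(2) by (intro sum.neutral ballI) auto
    finally show ?thesis .
  qed
  then show ?thesis using step_approximation_inner[OF bm[OF k(1)] bm[OF k(2)] a a'] by (simp add: LIMSEQ_const_iff)
qed

end

section \<open>Theta series\<close>

lemma second_diff_bound:
  fixes g g' g'' :: "real \<Rightarrow> real"
  assumes d: "\<And>x. (g has_real_derivative g' x) (at x)" "\<And>x. (g' has_real_derivative g'' x) (at x)"
    and B: "\<And>z. \<bar>z - x\<bar> \<le> 1 \<Longrightarrow> \<bar>g'' z\<bar> \<le> B"
  shows "\<bar>g (x + 1) - 2 * g x + g (x - 1)\<bar> \<le> B"
proof -
  have 1: "\<bar>g (x + 1) - g x - 1 * g' x\<bar> \<le> B * 1\<^sup>2 / 2" by (rule taylor_quadratic[OF d]) (use B in auto)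
  have 2: "\<bar>g (x + (-1)) - g x - (-1) * g' x\<bar> \<le> B * (-1)\<^sup>2 / 2" by (rule taylor_quadratic[OF d]) (use B in auto)
  have "\<bar>g (x + 1) - g x - g' x\<bar> \<le> B / 2" "\<bar>g (x - 1) - g x + g' x\<bar> \<le> B / 2" using 1 2 by simp_all
  then show ?thesis by linarith
qed

text \<open>The midpoint rule on a unit interval: in the difference of the two Taylor expansions of
  \<open>F\<close> the terms with \<open>g'\<close> cancel, and \<open>g''\<close> bounds the
  rest.\<close>

lemma midpoint_bound:
  fixes F g g' g'' :: "real \<Rightarrow> real"
  assumes d: "\<And>x. (F has_real_derivative g x) (at x)" "\<And>x. (g has_real_derivative g' x) (at x)" "\<And>x. (g' has_real_derivative g'' x) (at x)"
    and B: "\<And>z. \<bar>z - x\<bar> \<le> 1 \<Longrightarrow> \<bar>g'' z\<bar> \<le> B"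
  shows "\<bar>F (x + 1/2) - F (x - 1/2) - g x\<bar> \<le> B"
proof -
  define df where "df = (\<lambda>m::nat. if m = 0 then F else if m = 1 then g else if m = 2 then g' else g'')"
  have B0: "0 \<le> B" using B[of x] by simp
  have T: "\<bar>F (x + h) - F x - h * g x - h\<^sup>2 / 2 * g' x\<bar> \<le> B / 2" if h: "h = 1/2 \<or> h = -1/2" for h
  proof -
    have "\<exists>t. (if x + h < x then x + h < t \<and> t < x else x < t \<and> t < x + h) \<and>
      F (x + h) = (\<Sum>m<3. (df m x / fact m) * (x + h - x)^m) + (df 3 t / fact 3) * (x + h - x)^3"
    proof (rule Taylor[where a="x - \<bar>h\<bar>" and b="x + \<bar>h\<bar>"])
      show "\<forall>m t. m < 3 \<and> x - \<bar>h\<bar> \<le> t \<and> t \<le> x + \<bar>h\<bar> \<longrightarrow> (df m has_real_derivative df (Suc m) t) (at t)"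
        using d by (auto simp: df_def less_Suc_eq numeral_3_eq_3 numeral_2_eq_2)
    qed (use h in \<open>auto simp: df_def\<close>)
    then obtain t where t0: "if x + h < x then x + h < t \<and> t < x else x < t \<and> t < x + h"
      and t2: "F (x + h) = (\<Sum>m<3. (df m x / fact m) * h^m) + (df 3 t / fact 3) * h^3"
      unfolding add_diff_cancel_left' by blast
    have t: "\<bar>t - x\<bar> \<le> \<bar>h\<bar>" using t0 by (auto split: if_splits)
    have "F (x + h) - F x - h * g x - h\<^sup>2 / 2 * g' x = g'' t / 6 * h^3"
      unfolding t2 by (simp add: df_def eval_nat_numeral)
    also have "\<bar>\<dots>\<bar> \<le> B / 6 * 1" unfolding abs_mult
    proof (intro mult_mono)
      show "\<bar>h^3\<bar> \<le> 1" using h by (elim disjE; hypsubst; simp add: power3_eq_cube)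
      have "\<bar>t - x\<bar> \<le> 1" using t h by auto
      then show "\<bar>g'' t / 6\<bar> \<le> B / 6" using B by simp
    qed (use B0 in auto)
    finally show ?thesis using B0 by simp
  qed
  have "\<bar>F (x + 1/2) - F x - g x / 2 - g' x / 8\<bar> \<le> B / 2" "\<bar>F (x - 1/2) - F x + g x / 2 - g' x / 8\<bar> \<le> B / 2"
    using T[of "1/2"] T[of "-1/2"] by (simp_all add: power2_eq_square)
  then show ?thesis by linarith
qed

lemma poly_le_exp:
  fixes a :: real assumes "0 < a"
  shows "\<exists>C>0. \<forall>u\<ge>0. (1 + u)^k \<le> C * exp (a * u)"
proof (cases "k = 0")
  case True then show ?thesis using assms by (intro exI[of _ 1]) auto
next
  case False
  define K where "K = max 1 (real k / a)"
  have K: "1 \<le> K" "real k / a \<le> K" by (auto simp: K_def)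
  show ?thesis
  proof (intro exI[of _ "K^k"] conjI allI impI)
    show "0 < K^k" using K by simp
    fix u :: real assume u: "0 \<le> u"
    have "u = (real k / a) * (a * u / real k)" using assms False by simp
    also have "\<dots> \<le> K * (a * u / real k)" using K u assms by (intro mult_right_mono) auto
    finally have "1 + u \<le> K * (1 + a * u / real k)" using K by (simp add: distrib_left)
    also have "\<dots> \<le> K * exp (a * u / real k)" using K by (intro mult_left_mono exp_ge_add_one_self) auto
    finally have "(1 + u)^k \<le> (K * exp (a * u / real k))^k" using u by (intro power_mono) auto
    also have "\<dots> = K^k * exp (a * u)" using False by (simp add: power_mult_distrib flip: exp_of_nat_mult)
    finally show "(1 + u)^k \<le> K^k * exp (a * u)" .
  qed
qed

text \<open>Comparison with the integral, whose antiderivative is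
  \<open>arctan (sqrt s * x) / sqrt s\<close>. All the powers \<open>sqrt s\<close> in the bounds on
  the theta series come from here.\<close>

lemma sum_recip_quadratic:
  fixes s :: real assumes "0 < s"
  shows "(\<Sum>k=1..N. 1 / (1 + s * (real k)\<^sup>2)) \<le> 2 / sqrt s"
proof -
  have *: "(\<Sum>k=1..N. 1 / (1 + s * (real k)\<^sup>2)) \<le> arctan (sqrt s * real N) / sqrt s"
  proof (induction N)
    case (Suc N)
    have "\<exists>z>real N. z < real (Suc N) \<and> arctan (sqrt s * real (Suc N)) - arctan (sqrt s * real N) = (real (Suc N) - real N) * (sqrt s / (1 + (sqrt s * z)\<^sup>2))"
      by (rule MVT2) (auto intro!: derivative_eq_intros simp: field_simps)
    then obtain z where z: "real N < z" "z < real (Suc N)"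
      and e: "arctan (sqrt s * real (Suc N)) - arctan (sqrt s * real N) = sqrt s / (1 + (sqrt s * z)\<^sup>2)" by auto
    have "(sqrt s * z)\<^sup>2 = s * z\<^sup>2" using assms by (simp add: power_mult_distrib)
    moreover have "z\<^sup>2 \<le> (real (Suc N))\<^sup>2" using z by (intro power_mono) auto
    ultimately have "1 / (1 + s * (real (Suc N))\<^sup>2) \<le> 1 / (1 + (sqrt s * z)\<^sup>2)"
      using assms by (intro divide_left_mono mult_pos_pos add_pos_nonneg) (auto intro: mult_left_mono)
    also have "\<dots> = (arctan (sqrt s * real (Suc N)) - arctan (sqrt s * real N)) / sqrt s" using e assms by simp
    finally show ?case using Suc by (simp add: diff_divide_distrib)
  qed simp
  have "arctan (sqrt s * real N) \<le> 2" using arctan_ubound[of "sqrt s * real N"] pi_half_less_two by linarith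
  then show ?thesis using * assms by (meson divide_right_mono order_trans real_sqrt_ge_zero less_imp_le)
qed

lemma suminf_recip_quadratic:
  fixes s :: real assumes "0 < s"
  shows "summable (\<lambda>k. 1 / (1 + s * (real (Suc k))\<^sup>2))" "(\<Sum>k. 1 / (1 + s * (real (Suc k))\<^sup>2)) \<le> 2 / sqrt s"
proof -
  have b: "(\<Sum>k<N. 1 / (1 + s * (real (Suc k))\<^sup>2)) \<le> 2 / sqrt s" for N
    using sum_recip_quadratic[OF assms, of N] by (simp add: sum.atLeast1_atMost_eq)
  have p: "0 \<le> 1 / (1 + s * (real (Suc k))\<^sup>2)" for k using assms by simp
  show "summable (\<lambda>k. 1 / (1 + s * (real (Suc k))\<^sup>2))" by (rule bounded_imp_summable[OF p]) (use b[of "Suc _"] in \<open>simp only: lessThan_Suc_atMost\<close>)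
  then show "(\<Sum>k. 1 / (1 + s * (real (Suc k))\<^sup>2)) \<le> 2 / sqrt s" using b by (intro suminf_le_const)
qed

text \<open>Multiplication by \<open>2 - 2 cos \<theta>\<close> acts on
  \<open>cos (k \<theta>)\<close> as a negative second difference in \<open>k\<close>, and two
  summations by parts move it to \<open>u\<close>. The term \<open>2 u 1 - 2 u 0\<close> is the
  second difference at \<open>0\<close> of the even extension of \<open>u\<close>.\<close>

lemma cos_sum_by_parts:
  fixes u :: "nat \<Rightarrow> real"
  shows "(2 - 2 * cos \<theta>) * (u 0 + 2 * (\<Sum>k=1..N. u k * cos (real k * \<theta>))) =
    - (2 * u 1 - 2 * u 0 + 2 * (\<Sum>k=1..N. (u (k + 1) - 2 * u k + u (k - 1)) * cos (real k * \<theta>)))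
    + 2 * u (N + 1) * cos (real N * \<theta>) - 2 * u N * cos (real (N + 1) * \<theta>)"
proof (induction N)
  case 0 show ?case by (simp add: algebra_simps)
next
  case (Suc N)
  let ?x = "real (N + 1) * \<theta>"
  have c: "cos (real (Suc (N + 1)) * \<theta>) = 2 * cos \<theta> * cos ?x - cos (real N * \<theta>)"
  proof -
    have "real (Suc (N + 1)) * \<theta> = ?x + \<theta>" "real N * \<theta> = ?x - \<theta>" by (simp_all add: algebra_simps)
    then show ?thesis by (simp only: cos_add cos_diff) (simp add: algebra_simps)
  qed
  have "(2 - 2 * cos \<theta>) * (u 0 + 2 * (\<Sum>k=1..Suc N. u k * cos (real k * \<theta>)))
    = (2 - 2 * cos \<theta>) * (u 0 + 2 * (\<Sum>k=1..N. u k * cos (real k * \<theta>))) + (2 - 2 * cos \<theta>) * 2 * u (Suc N) * cos ?x"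
    by (simp add: algebra_simps)
  moreover have "(\<Sum>k=1..Suc N. (u (k + 1) - 2 * u k + u (k - 1)) * cos (real k * \<theta>))
    = (\<Sum>k=1..N. (u (k + 1) - 2 * u k + u (k - 1)) * cos (real k * \<theta>)) + (u (Suc (N + 1)) - 2 * u (N + 1) + u N) * cos ?x"
    by simp
  ultimately show ?case using Suc c unfolding Suc_eq_plus1 by algebra
qed

lemma cos_sum_bound:
  fixes u :: "nat \<Rightarrow> real"
  assumes lim: "(\<lambda>N. u 0 + 2 * (\<Sum>k=1..N. u k * cos (real k * \<theta>))) \<longlonglongrightarrow> P" and u0: "u \<longlonglongrightarrow> 0"
    and B: "\<And>N. (\<Sum>k=1..N. \<bar>u (k + 1) - 2 * u k + u (k - 1)\<bar>) \<le> B" and B0: "\<bar>2 * u 1 - 2 * u 0\<bar> \<le> B0"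
  shows "(2 - 2 * cos \<theta>) * \<bar>P\<bar> \<le> B0 + 2 * B"
proof -
  have "\<bar>(2 - 2 * cos \<theta>) * P\<bar> \<le> B0 + 2 * B + 0 + 0"
  proof (rule LIMSEQ_le)
    show "(\<lambda>N. \<bar>(2 - 2 * cos \<theta>) * (u 0 + 2 * (\<Sum>k=1..N. u k * cos (real k * \<theta>)))\<bar>) \<longlonglongrightarrow> \<bar>(2 - 2 * cos \<theta>) * P\<bar>"
      by (intro tendsto_intros lim)
    have "(\<lambda>N. u (N + 1)) \<longlonglongrightarrow> 0" using LIMSEQ_ignore_initial_segment[OF u0, of 1] .
    then show "(\<lambda>N. B0 + 2 * B + 2 * \<bar>u (N + 1)\<bar> + 2 * \<bar>u N\<bar>) \<longlonglongrightarrow> B0 + 2 * B + 0 + 0"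
      using u0 by (intro tendsto_add tendsto_const tendsto_mult_right_zero tendsto_rabs_zero)
    show "\<exists>N. \<forall>n\<ge>N. \<bar>(2 - 2 * cos \<theta>) * (u 0 + 2 * (\<Sum>k=1..n. u k * cos (real k * \<theta>)))\<bar> \<le> B0 + 2 * B + 2 * \<bar>u (n + 1)\<bar> + 2 * \<bar>u n\<bar>"
    proof (intro exI allI impI)
      fix N
      have "\<bar>\<Sum>k=1..N. (u (k + 1) - 2 * u k + u (k - 1)) * cos (real k * \<theta>)\<bar> \<le> B"
        by (rule order_trans[OF sum_abs order_trans[OF sum_mono B]]) (auto simp: abs_mult intro: mult_left_le)
      moreover have "\<bar>2 * u (N + 1) * cos (real N * \<theta>)\<bar> \<le> 2 * \<bar>u (N + 1)\<bar>" "\<bar>2 * u N * cos (real (N + 1) * \<theta>)\<bar> \<le> 2 * \<bar>u N\<bar>"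
        by (auto simp: abs_mult intro: mult_left_le)
      ultimately show "\<bar>(2 - 2 * cos \<theta>) * (u 0 + 2 * (\<Sum>k=1..N. u k * cos (real k * \<theta>)))\<bar> \<le> B0 + 2 * B + 2 * \<bar>u (N + 1)\<bar> + 2 * \<bar>u N\<bar>"
        unfolding cos_sum_by_parts using B0 by linarith
    qed
  qed
  moreover have "0 \<le> 2 - 2 * cos \<theta>" by simp
  ultimately show ?thesis by (simp add: abs_mult)
qed

lemma gauss_antiderivative:
  "\<exists>F::real \<Rightarrow> real. (\<forall>x. (F has_real_derivative exp (- x\<^sup>2)) (at x)) \<and> (\<forall>x. F (- x) = - F x) \<and> (F \<longlongrightarrow> sqrt pi / 2) at_top"
proof -
  let ?g = "\<lambda>x::real. exp (- x\<^sup>2)"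
  have sc: "continuous_on A ?g" for A by (intro continuous_intros)
  have ant: "\<exists>F. \<forall>x. (F has_real_derivative ?g x) (at x)"
  proof -
    let ?F = "\<lambda>u::real. LBINT y=ereal 0..ereal u. ?g y"
    have "(?F has_real_derivative ?g x) (at x)" for x
    proof -
      let ?b = "\<bar>x\<bar> + 1"
      have "(?F has_vector_derivative ?g x) (at x within {-?b..?b})"
        by (rule interval_integral_FTC2) (auto simp: sc)
      moreover have "at x within {-?b..?b} = at x" by (rule at_within_interior) (auto simp: interior_atLeastAtMost_real)
      ultimately show ?thesis by (simp add: has_real_derivative_iff_has_vector_derivative)
    qed
    then show ?thesis by blast
  qed
  then obtain F0 where F0: "\<And>x. (F0 has_real_derivative ?g x) (at x)" by blast
  \<comment> \<open>Antisymmetrisation fixes the constant of integration: the result is odd and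
    vanishes at \<open>0\<close>, so its limit is half of the Gaussian integral.\<close>
  define F1 where "F1 x = (F0 x - F0 (- x)) / 2" for x
  have dF1: "(F1 has_real_derivative ?g x) (at x)" for x
    unfolding F1_def[abs_def] by (auto intro!: derivative_eq_intros F0 DERIV_chain2[OF F0])
  have si: "set_integrable lborel {0..} ?g" "(LINT x:{0..}|lborel. ?g x) = sqrt pi / 2"
    using gaussian_moment_0 by (auto simp: has_bochner_integral_iff set_integrable_def set_lebesgue_integral_def)
  have "((\<lambda>b. (LINT x:{0..b}|lborel. ?g x)) \<longlongrightarrow> sqrt pi / 2) at_top"
    using tendsto_set_lebesgue_integral_at_top[of 0 lborel ?g] si by simp
  moreover have "(LINT x:{0..b}|lborel. ?g x) = F1 b" if "0 \<le> b" for b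
  proof -
    have "(LBINT x=ereal 0..ereal b. ?g x) = F1 b - F1 0"
      using that dF1 by (intro interval_integral_FTC_finite) (auto simp: has_real_derivative_iff_has_vector_derivative[symmetric] intro: sc has_field_derivative_at_within)
    then show ?thesis using interval_integral_Icc[OF that, of ?g] by (simp add: F1_def)
  qed
  ultimately have "(F1 \<longlongrightarrow> sqrt pi / 2) at_top"
    by (rule_tac Lim_transform_eventually) (auto simp: eventually_at_top_linorder)
  then show ?thesis using dF1 by (intro exI[of _ F1]) (auto simp: F1_def field_simps)
qed

section \<open>Theta series at a fixed time\<close>

locale theta_series =
  fixes c0 a :: real
  assumes a_pos: "0 < a"
begin

definition lam :: "real \<Rightarrow> real" where "lam x = c0 + a * x\<^sup>2"
definition E :: "real \<Rightarrow> real \<Rightarrow> real" where "E s x = exp (- lam x * s)"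

lemma DERIV_E_x:
  "((\<lambda>x. E s x) has_real_derivative - 2 * a * s * x * E s x) (at x)"
  "((\<lambda>x. - 2 * a * s * x * E s x) has_real_derivative (4 * a\<^sup>2 * s\<^sup>2 * x\<^sup>2 - 2 * a * s) * E s x) (at x)"
  unfolding E_def lam_def by (auto intro!: derivative_eq_intros simp: power2_eq_square algebra_simps)

lemma DERIV_E_s: "((\<lambda>s. E s x) has_real_derivative - lam x * E s x) (at s)"
  unfolding E_def by (auto intro!: derivative_eq_intros)

text \<open>By \<open>DERIV_E_s\<close>, \<open>- lam x * E s x\<close> is the time derivative of
  \<open>E\<close>; these derivatives in \<open>x\<close> control how its second differences change
  in time.\<close>

lemma DERIV_lamE_x:
  "((\<lambda>x. - lam x * E s x) has_real_derivative (2 * a * x * (lam x * s - 1)) * E s x) (at x)"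
  "((\<lambda>x. (2 * a * x * (lam x * s - 1)) * E s x) has_real_derivative
     (2 * a * (lam x * s - 1) + 4 * a\<^sup>2 * x\<^sup>2 * s * (2 - lam x * s)) * E s x) (at x)"
  unfolding E_def lam_def by (auto intro!: derivative_eq_intros simp: power2_eq_square algebra_simps)

text \<open>Times up to \<open>2\<close> occur because covariances contain sums of two times in
  \<open>{0..1}\<close>; on this range the factor \<open>exp (- c0 * s)\<close> is bounded. Of the
  three powers, two absorb the quadratic prefactors in \<open>E_xx_bounds\<close> and one remains as
  decay.\<close>

lemma E_bound:
  "\<exists>C>0. \<forall>s x. 0 < s \<and> s \<le> 2 \<longrightarrow> (1 + s * x\<^sup>2)^3 * E s x \<le> C"
proof -
  obtain C where C: "C > 0" "\<And>u. u \<ge> 0 \<Longrightarrow> (1 + u)^3 \<le> C * exp (a * u)" using poly_le_exp[OF a_pos, of 3] by blast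
  show ?thesis
  proof (intro exI[of _ "C * exp (2 * \<bar>c0\<bar>)"] conjI allI impI)
    show "0 < C * exp (2 * \<bar>c0\<bar>)" using C by simp
    fix s x :: real assume s: "0 < s \<and> s \<le> 2"
    have "- c0 * s \<le> \<bar>c0\<bar> * s" using s by (intro mult_right_mono) auto
    also have "\<dots> \<le> \<bar>c0\<bar> * 2" using s by (intro mult_left_mono) auto
    finally have "E s x \<le> exp (2 * \<bar>c0\<bar>) * exp (- (a * (s * x\<^sup>2)))"
      unfolding E_def lam_def by (simp add: algebra_simps flip: exp_add)
    then have "(1 + s * x\<^sup>2)^3 * E s x \<le> (C * exp (a * (s * x\<^sup>2))) * (exp (2 * \<bar>c0\<bar>) * exp (- (a * (s * x\<^sup>2))))"
      using s C by (intro mult_mono) (auto simp: E_def)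
    also have "\<dots> = C * exp (2 * \<bar>c0\<bar>)" by (simp add: mult_ac flip: exp_add)
    finally show "(1 + s * x\<^sup>2)^3 * E s x \<le> C * exp (2 * \<bar>c0\<bar>)" .
  qed
qed

lemma E_xx_bounds:
  "\<exists>C>0. \<forall>s x. 0 < s \<and> s \<le> 2 \<longrightarrow> E s x \<le> C / (1 + s * x\<^sup>2) \<and>
     \<bar>(4 * a\<^sup>2 * s\<^sup>2 * x\<^sup>2 - 2 * a * s) * E s x\<bar> \<le> C * s / (1 + s * x\<^sup>2) \<and>
     \<bar>(2 * a * (lam x * s - 1) + 4 * a\<^sup>2 * x\<^sup>2 * s * (2 - lam x * s)) * E s x\<bar> \<le> C / (1 + s * x\<^sup>2)"
proof -
  obtain C where C: "C > 0" "\<And>s x. 0 < s \<Longrightarrow> s \<le> 2 \<Longrightarrow> (1 + s * x\<^sup>2)^3 * E s x \<le> C" using E_bound by blast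
  define K where "K = 1 + 2 * a + 4 * a\<^sup>2 + (2 * a + 4 * a\<^sup>2) * (2 + 2 * \<bar>c0\<bar> + a)"
  have K0: "0 \<le> (2 * a + 4 * a\<^sup>2) * (2 + 2 * \<bar>c0\<bar> + a)" using a_pos by (intro mult_nonneg_nonneg add_nonneg_nonneg) auto
  have K1: "1 \<le> K" "2 * a + 4 * a\<^sup>2 \<le> K" "(2 * a + 4 * a\<^sup>2) * (2 + 2 * \<bar>c0\<bar> + a) \<le> K"
    using K0 a_pos unfolding K_def by (auto simp: add_nonneg_nonneg)
  have main: "\<bar>f\<bar> * E s x \<le> K * C / (1 + s * x\<^sup>2)" if s: "0 < s" "s \<le> 2" and f: "\<bar>f\<bar> \<le> K * (1 + s * x\<^sup>2)^2" for s x f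
  proof -
    have p: "0 < 1 + s * x\<^sup>2" using s by (simp add: add_pos_nonneg)
    have "\<bar>f\<bar> * E s x * (1 + s * x\<^sup>2) \<le> K * (1 + s * x\<^sup>2)^2 * E s x * (1 + s * x\<^sup>2)"
      using f p by (intro mult_right_mono) (auto simp: E_def)
    also have "\<dots> = K * ((1 + s * x\<^sup>2)^3 * E s x)" by (simp add: power2_eq_square power3_eq_cube)
    also have "\<dots> \<le> K * C" using C(2)[OF s] K1 by (intro mult_left_mono) auto
    finally show ?thesis using p by (simp add: pos_le_divide_eq)
  qed
  show ?thesis
  proof (intro exI[of _ "K * C"] conjI allI impI; (elim conjE)?)
    show "0 < K * C" using K1 C by (intro mult_pos_pos) auto
    fix s x :: real assume s: "0 < s" "s \<le> 2"
    define u where "u = s * x\<^sup>2"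
    have u0: "0 \<le> u" using s by (simp add: u_def)
    have u1: "1 \<le> (1+u)^2" "1 + u \<le> (1+u)^2" using u0 by (auto simp: power2_eq_square algebra_simps)
    have E0: "0 \<le> E s x" by (simp add: E_def)
    have "\<bar>1\<bar> * E s x \<le> K * C / (1 + s * x\<^sup>2)"
    proof (rule main[OF s])
      show "\<bar>1\<bar> \<le> K * (1 + s * x\<^sup>2)^2" using mult_mono[of 1 K 1 "(1+u)^2"] K1 u1 by (simp add: u_def)
    qed
    then show "E s x \<le> K * C / (1 + s * x\<^sup>2)" by simp
    have "\<bar>4 * a\<^sup>2 * u - 2 * a\<bar> * E s x \<le> K * C / (1 + s * x\<^sup>2)"
    proof (rule main[OF s])
      have "\<bar>4 * a\<^sup>2 * u - 2 * a\<bar> \<le> 4 * a\<^sup>2 * u + 2 * a" using a_pos u0 by (intro abs_leI) (auto simp: add_nonneg_nonneg)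
      also have "\<dots> \<le> (2 * a + 4 * a\<^sup>2) * (1 + u)" using a_pos u0 by (simp add: algebra_simps)
      also have "\<dots> \<le> K * (1 + u)^2" using K1 u0 u1 by (intro mult_mono) auto
      finally show "\<bar>4 * a\<^sup>2 * u - 2 * a\<bar> \<le> K * (1 + s * x\<^sup>2)^2" by (simp add: u_def)
    qed
    then have "s * (\<bar>4 * a\<^sup>2 * u - 2 * a\<bar> * E s x) \<le> s * (K * C / (1 + s * x\<^sup>2))" using s by (intro mult_left_mono) auto
    moreover have e: "(4 * a\<^sup>2 * s\<^sup>2 * x\<^sup>2 - 2 * a * s) * E s x = s * ((4 * a\<^sup>2 * u - 2 * a) * E s x)"
      by (simp add: u_def power2_eq_square algebra_simps)
    ultimately show "\<bar>(4 * a\<^sup>2 * s\<^sup>2 * x\<^sup>2 - 2 * a * s) * E s x\<bar> \<le> K * C * s / (1 + s * x\<^sup>2)"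
      unfolding e abs_mult using s E0 by (simp add: mult_ac)
    have l: "\<bar>lam x * s\<bar> \<le> 2 * \<bar>c0\<bar> + a * u"
    proof -
      have "\<bar>c0\<bar> * s \<le> \<bar>c0\<bar> * 2" using s by (intro mult_left_mono) auto
      moreover have "\<bar>lam x * s\<bar> \<le> \<bar>c0\<bar> * s + a * u"
        using abs_triangle_ineq[of "c0 * s" "a * u"] a_pos u0 s by (simp add: lam_def u_def abs_mult algebra_simps)
      ultimately show ?thesis by simp
    qed
    have "\<bar>2 * a * (lam x * s - 1) + 4 * a\<^sup>2 * u * (2 - lam x * s)\<bar> * E s x \<le> K * C / (1 + s * x\<^sup>2)"
    proof (rule main[OF s])
      have "\<bar>2 * a * (lam x * s - 1)\<bar> \<le> 2 * a * (2 + 2 * \<bar>c0\<bar> + a * u)"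
        unfolding abs_mult using l a_pos by (intro mult_mono) auto
      moreover have "\<bar>4 * a\<^sup>2 * u * (2 - lam x * s)\<bar> \<le> 4 * a\<^sup>2 * u * (2 + 2 * \<bar>c0\<bar> + a * u)"
        unfolding abs_mult using l a_pos u0 by (intro mult_mono) auto
      ultimately have "\<bar>2 * a * (lam x * s - 1) + 4 * a\<^sup>2 * u * (2 - lam x * s)\<bar> \<le> (2 * a + 4 * a\<^sup>2 * u) * (2 + 2 * \<bar>c0\<bar> + a * u)"
        by (simp add: algebra_simps)
      also have "\<dots> \<le> ((2 * a + 4 * a\<^sup>2) * (1 + u)) * ((2 + 2 * \<bar>c0\<bar> + a) * (1 + u))"
        using a_pos u0 by (intro mult_mono) (auto simp: algebra_simps add_nonneg_nonneg)
      also have "\<dots> = (2 * a + 4 * a\<^sup>2) * (2 + 2 * \<bar>c0\<bar> + a) * (1 + u)^2" by (simp add: power2_eq_square mult_ac)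
      also have "\<dots> \<le> K * (1 + u)^2" using K1 by (intro mult_right_mono) auto
      finally show "\<bar>2 * a * (lam x * s - 1) + 4 * a\<^sup>2 * u * (2 - lam x * s)\<bar> \<le> K * (1 + s * x\<^sup>2)^2" by (simp add: u_def)
    qed
    then show "\<bar>(2 * a * (lam x * s - 1) + 4 * a\<^sup>2 * x\<^sup>2 * s * (2 - lam x * s)) * E s x\<bar> \<le> K * C / (1 + s * x\<^sup>2)"
      using E0 by (simp add: abs_mult u_def mult_ac)
  qed
qed

definition D2 :: "real \<Rightarrow> real \<Rightarrow> real" where "D2 s x = E s (x + 1) - 2 * E s x + E s (x - 1)"

text \<open>Taylor remainders are evaluated at a point within distance \<open>1\<close> of
  \<open>x\<close>; this moves the decay back to \<open>x\<close>. The constant is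
  \<open>5 = 1 + 2 * 2\<close>, since \<open>s\<close> is at most \<open>2\<close>.\<close>

lemma recip_quadratic_shift:
  fixes s x z :: real
  assumes "0 < s" "s \<le> 2" "\<bar>z - x\<bar> \<le> 1"
  shows "1 / (1 + s * z\<^sup>2) \<le> 5 / (1 + s * x\<^sup>2)"
proof -
  have "x\<^sup>2 \<le> 2 * z\<^sup>2 + 2 * (z - x)\<^sup>2" using zero_le_power2[of "2 * z - x"] by (simp add: power2_eq_square algebra_simps)
  also have "(z - x)\<^sup>2 \<le> 1" using assms(3) by (simp add: abs_square_le_1)
  finally have "s * x\<^sup>2 \<le> s * (2 * z\<^sup>2 + 2)" using assms by (intro mult_left_mono) auto
  then have "1 + s * x\<^sup>2 \<le> 1 + (2 * (s * z\<^sup>2) + 2 * s)" by (simp add: algebra_simps)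
  also have "\<dots> \<le> 1 + (5 * (s * z\<^sup>2) + 2 * 2)" using assms by (intro add_mono mult_mono) auto
  also have "\<dots> = 5 * (1 + s * z\<^sup>2)" by simp
  finally have "1 + s * x\<^sup>2 \<le> 5 * (1 + s * z\<^sup>2)" .
  moreover have "0 < 1 + s * z\<^sup>2" "0 < 1 + s * x\<^sup>2" using assms by (auto intro: add_pos_nonneg)
  ultimately show ?thesis by (simp add: divide_le_eq pos_le_divide_eq mult.commute)
qed

text \<open>For the last bound the mean value theorem in time comes first and the Taylor estimate in
  \<open>x\<close> second; the intermediate time exceeds \<open>s'\<close>, whence the decay at
  \<open>s'\<close>.\<close>

lemma D2_bounds:
  "\<exists>C>0. (\<forall>s x. 0 < s \<and> s \<le> 2 \<longrightarrow> E s x \<le> C / (1 + s * x\<^sup>2)) \<and>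
     (\<forall>s x. 0 < s \<and> s \<le> 2 \<longrightarrow> \<bar>D2 s x\<bar> \<le> C * s / (1 + s * x\<^sup>2)) \<and>
     (\<forall>s s' x. 0 < s' \<and> s' < s \<and> s \<le> 2 \<longrightarrow> \<bar>D2 s x - D2 s' x\<bar> \<le> C * (s - s') / (1 + s' * x\<^sup>2))"
proof -
  obtain C where C: "C > 0" and C1: "\<And>s x. 0 < s \<Longrightarrow> s \<le> 2 \<Longrightarrow> E s x \<le> C / (1 + s * x\<^sup>2)"
    and C2: "\<And>s x. 0 < s \<Longrightarrow> s \<le> 2 \<Longrightarrow> \<bar>(4 * a\<^sup>2 * s\<^sup>2 * x\<^sup>2 - 2 * a * s) * E s x\<bar> \<le> C * s / (1 + s * x\<^sup>2)"
    and C3: "\<And>s x. 0 < s \<Longrightarrow> s \<le> 2 \<Longrightarrow> \<bar>(2 * a * (lam x * s - 1) + 4 * a\<^sup>2 * x\<^sup>2 * s * (2 - lam x * s)) * E s x\<bar> \<le> C / (1 + s * x\<^sup>2)"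
    using E_xx_bounds by blast
  show ?thesis
  proof (intro exI[of _ "5 * C"] conjI allI impI; (elim conjE)?)
    show "0 < 5 * C" using C by simp
  next
    fix s x :: real assume s: "0 < s" "s \<le> 2"
    have "0 < 1 + s * x\<^sup>2" using s by (auto intro: add_pos_nonneg)
    then have "C / (1 + s * x\<^sup>2) \<le> 5 * C / (1 + s * x\<^sup>2)" using C by (intro divide_right_mono) auto
    then show "E s x \<le> 5 * C / (1 + s * x\<^sup>2)" using C1[OF s, of x] by linarith
  next
    fix s x :: real assume s: "0 < s" "s \<le> 2"
    show "\<bar>D2 s x\<bar> \<le> 5 * C * s / (1 + s * x\<^sup>2)" unfolding D2_def
    proof (rule second_diff_bound[OF DERIV_E_x])
      fix z assume z: "\<bar>z - x\<bar> \<le> 1"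
      have "C * s * (1 / (1 + s * z\<^sup>2)) \<le> C * s * (5 / (1 + s * x\<^sup>2))"
        using C s by (intro mult_left_mono recip_quadratic_shift[OF s z]) auto
      then show "\<bar>(4 * a\<^sup>2 * s\<^sup>2 * z\<^sup>2 - 2 * a * s) * E s z\<bar> \<le> 5 * C * s / (1 + s * x\<^sup>2)"
        using C2[OF s, of z] by (simp add: mult_ac)
    qed
  next
    fix s s' x :: real assume s: "0 < s'" "s' < s" "s \<le> 2"
    let ?h = "\<lambda>s x. - lam x * E s x"
    have "\<exists>\<tau>>s'. \<tau> < s \<and> D2 s x - D2 s' x = (s - s') * (?h \<tau> (x + 1) - 2 * ?h \<tau> x + ?h \<tau> (x - 1))"
      unfolding D2_def by (rule MVT2[OF s(2)], (rule derivative_eq_intros DERIV_E_s refl)+) (simp add: algebra_simps)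
    then obtain \<tau> where \<tau>: "s' < \<tau>" "\<tau> < s"
      and e: "D2 s x - D2 s' x = (s - s') * (?h \<tau> (x + 1) - 2 * ?h \<tau> x + ?h \<tau> (x - 1))" by blast
    have \<tau>2: "0 < \<tau>" "\<tau> \<le> 2" using \<tau> s by auto
    have p: "0 < 1 + s' * x\<^sup>2" "0 < 1 + \<tau> * x\<^sup>2" using s \<tau>2 by (auto intro: add_pos_nonneg)
    have "\<bar>?h \<tau> (x + 1) - 2 * ?h \<tau> x + ?h \<tau> (x - 1)\<bar> \<le> 5 * C / (1 + \<tau> * x\<^sup>2)"
    proof (rule second_diff_bound[OF DERIV_lamE_x])
      fix z assume z: "\<bar>z - x\<bar> \<le> 1"
      have "C * (1 / (1 + \<tau> * z\<^sup>2)) \<le> C * (5 / (1 + \<tau> * x\<^sup>2))"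
        using C by (intro mult_left_mono recip_quadratic_shift[OF \<tau>2 z]) auto
      then show "\<bar>(2 * a * (lam z * \<tau> - 1) + 4 * a\<^sup>2 * z\<^sup>2 * \<tau> * (2 - lam z * \<tau>)) * E \<tau> z\<bar> \<le> 5 * C / (1 + \<tau> * x\<^sup>2)"
        using C3[OF \<tau>2, of z] by (simp add: mult_ac)
    qed
    also have "\<dots> \<le> 5 * C / (1 + s' * x\<^sup>2)"
      using C p \<tau> by (intro divide_left_mono mult_pos_pos) (auto intro: mult_right_mono)
    finally have "(s - s') * \<bar>?h \<tau> (x + 1) - 2 * ?h \<tau> x + ?h \<tau> (x - 1)\<bar> \<le> (s - s') * (5 * C / (1 + s' * x\<^sup>2))"
      using s by (intro mult_left_mono) auto
    then show "\<bar>D2 s x - D2 s' x\<bar> \<le> 5 * C * (s - s') / (1 + s' * x\<^sup>2)"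
      unfolding e abs_mult using s by (simp add: mult_ac)
  qed
qed

text \<open>The series over all integers, folded by evenness. The mode \<open>0\<close> is kept
  because both the summation by parts and the comparison with an integral over the line concern even
  sequences; it drops out of \<open>\<Delta>\<Theta>\<close>.\<close>

definition \<Theta> :: "real \<Rightarrow> real \<Rightarrow> real" where
  "\<Theta> s \<theta> = E s 0 + 2 * (\<Sum>k. E s (real (Suc k)) * cos (real (Suc k) * \<theta>))"

lemma E_summable: assumes "0 < s" "s \<le> 2"
  shows "summable (\<lambda>k. E s (real (Suc k)))" "summable (\<lambda>k. E s (real (Suc k)) * cos (real (Suc k) * \<theta>))"
proof -
  obtain C where C: "\<And>x. E s x \<le> C / (1 + s * x\<^sup>2)" using D2_bounds assms by metis
  have E0: "0 \<le> E s x" for x by (simp add: E_def)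
  have "summable (\<lambda>k. C * (1 / (1 + s * (real (Suc k))\<^sup>2)))" by (intro summable_mult suminf_recip_quadratic assms)
  then show 1: "summable (\<lambda>k. E s (real (Suc k)))"
    by (rule summable_comparison_test'[where N=0]) (use C E0 in auto)
  show "summable (\<lambda>k. E s (real (Suc k)) * cos (real (Suc k) * \<theta>))"
    by (rule summable_comparison_test'[OF 1, where N=0]) (use E0 in \<open>auto simp: abs_mult intro: mult_left_le\<close>)
qed

lemma \<Theta>_LIMSEQ: assumes "0 < s" "s \<le> 2"
  shows "(\<lambda>N. E s (real 0) + 2 * (\<Sum>k=1..N. E s (real k) * cos (real k * \<theta>))) \<longlonglongrightarrow> \<Theta> s \<theta>"
proof -
  have "(\<lambda>N. E s 0 + 2 * (\<Sum>k<N. E s (real (Suc k)) * cos (real (Suc k) * \<theta>))) \<longlonglongrightarrow> \<Theta> s \<theta>"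
    unfolding \<Theta>_def by (intro tendsto_intros summable_LIMSEQ E_summable assms)
  then show ?thesis by (simp add: sum.atLeast1_atMost_eq)
qed

lemma E_LIMSEQ: assumes "0 < s" "s \<le> 2" shows "(\<lambda>k. E s (real k)) \<longlonglongrightarrow> 0"
  using summable_LIMSEQ_zero[OF E_summable(1)[OF assms]] by (rule LIMSEQ_imp_Suc)

text \<open>By \<open>cos_sum_bound\<close> only the absolute sum of the second differences matters.
  Terms of size \<open>C s / (1 + s k^2)\<close> add up to order \<open>s / sqrt s\<close>; the same
  argument, applied to the difference of two times, gives the second bound.\<close>

lemma \<Theta>_bounds:
  "\<exists>C>0. (\<forall>s \<theta>. 0 < s \<and> s \<le> 2 \<longrightarrow> (1 - cos \<theta>) * \<bar>\<Theta> s \<theta>\<bar> \<le> C * sqrt s) \<and>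
     (\<forall>s s' \<theta>. 0 < s' \<and> s' < s \<and> s \<le> 2 \<longrightarrow> (1 - cos \<theta>) * \<bar>\<Theta> s \<theta> - \<Theta> s' \<theta>\<bar> \<le> C * (s - s') / sqrt s')"
proof -
  obtain C where C: "C > 0" and C2: "\<And>s x. 0 < s \<Longrightarrow> s \<le> 2 \<Longrightarrow> \<bar>D2 s x\<bar> \<le> C * s / (1 + s * x\<^sup>2)"
     and C3: "\<And>s s' x. 0 < s' \<Longrightarrow> s' < s \<Longrightarrow> s \<le> 2 \<Longrightarrow> \<bar>D2 s x - D2 s' x\<bar> \<le> C * (s - s') / (1 + s' * x\<^sup>2)"
    using D2_bounds by blast
  have ev: "E s (-1) = E s 1" for s by (simp add: E_def lam_def)
  \<comment> \<open>On the range up to \<open>2\<close> the boundary term of order \<open>s\<close>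
    is absorbed into \<open>sqrt s\<close>.\<close>
  have sq: "s \<le> 2 * sqrt s" if "0 < s" "s \<le> 2" for s :: real
  proof -
    have "sqrt s \<le> sqrt 4" using that by (intro real_sqrt_le_mono) auto
    then have "sqrt s * sqrt s \<le> 2 * sqrt s" using that by (intro mult_right_mono) auto
    then show ?thesis using that by simp
  qed
  show ?thesis
  proof (intro exI[of _ "3 * C"] conjI allI impI; (elim conjE)?)
    show "0 < 3 * C" using C by simp
  next
    fix s \<theta> :: real assume s: "0 < s" "s \<le> 2"
    have "(2 - 2 * cos \<theta>) * \<bar>\<Theta> s \<theta>\<bar> \<le> C * s + 2 * (C * s * (2 / sqrt s))"
    proof (rule cos_sum_bound[OF \<Theta>_LIMSEQ[OF s] E_LIMSEQ[OF s]])
      fix N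
      have "(\<Sum>k=1..N. \<bar>E s (real (k + 1)) - 2 * E s (real k) + E s (real (k - 1))\<bar>) \<le> (\<Sum>k=1..N. C * s * (1 / (1 + s * (real k)\<^sup>2)))"
      proof (rule sum_mono)
        fix k assume "k \<in> {1..N}"
        then have "E s (real (k + 1)) - 2 * E s (real k) + E s (real (k - 1)) = D2 s (real k)"
          by (simp add: D2_def of_nat_diff add.commute)
        then show "\<bar>E s (real (k + 1)) - 2 * E s (real k) + E s (real (k - 1))\<bar> \<le> C * s * (1 / (1 + s * (real k)\<^sup>2))"
          using C2[OF s, of "real k"] by simp
      qed
      also have "\<dots> \<le> C * s * (2 / sqrt s)" unfolding sum_distrib_left[symmetric] using C s by (intro mult_left_mono sum_recip_quadratic) auto
      finally show "(\<Sum>k=1..N. \<bar>E s (real (k + 1)) - 2 * E s (real k) + E s (real (k - 1))\<bar>) \<le> C * s * (2 / sqrt s)" .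
      show "\<bar>2 * E s (real 1) - 2 * E s (real 0)\<bar> \<le> C * s" using C2[OF s, of 0] by (simp add: D2_def ev)
    qed
    also have "\<dots> = C * s + 4 * C * sqrt s" using s by (simp add: field_simps)
    also have "\<dots> \<le> C * (2 * sqrt s) + 4 * C * sqrt s" using sq[OF s] C by (intro add_right_mono mult_left_mono) auto
    finally show "(1 - cos \<theta>) * \<bar>\<Theta> s \<theta>\<bar> \<le> 3 * C * sqrt s" by (simp add: algebra_simps)
  next
    fix s s' \<theta> :: real assume s: "0 < s'" "s' < s" "s \<le> 2"
    then have s2: "0 < s" "s' \<le> 2" by auto
    let ?u = "\<lambda>k. E s (real k) - E s' (real k)"
    have "(2 - 2 * cos \<theta>) * \<bar>\<Theta> s \<theta> - \<Theta> s' \<theta>\<bar> \<le> C * (s - s') + 2 * (C * (s - s') * (2 / sqrt s'))"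
    proof (rule cos_sum_bound[where u="?u"])
      show "(\<lambda>N. ?u 0 + 2 * (\<Sum>k=1..N. ?u k * cos (real k * \<theta>))) \<longlonglongrightarrow> \<Theta> s \<theta> - \<Theta> s' \<theta>"
        using tendsto_diff[OF \<Theta>_LIMSEQ[OF s2(1) s(3)] \<Theta>_LIMSEQ[OF s(1) s2(2)], of \<theta> \<theta>]
        by (simp add: left_diff_distrib sum_subtractf algebra_simps)
      show "?u \<longlonglongrightarrow> 0" using tendsto_diff[OF E_LIMSEQ[OF s2(1) s(3)] E_LIMSEQ[OF s(1) s2(2)]] by simp
    next
      fix N
      have "(\<Sum>k=1..N. \<bar>?u (k + 1) - 2 * ?u k + ?u (k - 1)\<bar>) \<le> (\<Sum>k=1..N. C * (s - s') * (1 / (1 + s' * (real k)\<^sup>2)))"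
      proof (rule sum_mono)
        fix k assume "k \<in> {1..N}"
        then have "?u (k + 1) - 2 * ?u k + ?u (k - 1) = D2 s (real k) - D2 s' (real k)"
          by (simp add: D2_def of_nat_diff add.commute)
        then show "\<bar>?u (k + 1) - 2 * ?u k + ?u (k - 1)\<bar> \<le> C * (s - s') * (1 / (1 + s' * (real k)\<^sup>2))"
          using C3[OF s, of "real k"] by simp
      qed
      also have "\<dots> \<le> C * (s - s') * (2 / sqrt s')" unfolding sum_distrib_left[symmetric] using C s by (intro mult_left_mono sum_recip_quadratic) auto
      finally show "(\<Sum>k=1..N. \<bar>?u (k + 1) - 2 * ?u k + ?u (k - 1)\<bar>) \<le> C * (s - s') * (2 / sqrt s')" .
      show "\<bar>2 * ?u 1 - 2 * ?u 0\<bar> \<le> C * (s - s')" using C3[OF s, of 0] by (simp add: D2_def ev)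
    qed
    also have "\<dots> \<le> C * (s - s') * (2 / sqrt s') + 2 * (C * (s - s') * (2 / sqrt s'))"
    proof -
      have "sqrt s' \<le> sqrt 4" using s by (intro real_sqrt_le_mono) auto
      then have "1 \<le> 2 / sqrt s'" using s by (simp add: pos_le_divide_eq)
      then have "C * (s - s') * 1 \<le> C * (s - s') * (2 / sqrt s')" using C s by (intro mult_left_mono) auto
      then show ?thesis by simp
    qed
    also have "\<dots> = 2 * (3 * C * (s - s') / sqrt s')" by simp
    also have "(2 - 2 * cos \<theta>) * \<bar>\<Theta> s \<theta> - \<Theta> s' \<theta>\<bar> = 2 * ((1 - cos \<theta>) * \<bar>\<Theta> s \<theta> - \<Theta> s' \<theta>\<bar>)" by (simp add: algebra_simps)
    finally show "(1 - cos \<theta>) * \<bar>\<Theta> s \<theta> - \<Theta> s' \<theta>\<bar> \<le> 3 * C * (s - s') / sqrt s'" by linarith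
  qed
qed

text \<open>The midpoint rule compares the sum with the Gaussian integral
  \<open>exp (- c0 * s) * sqrt (pi / (a * s))\<close>. The errors of the unit intervals are
  \<open>C s / (1 + s k^2)\<close> and add up to order \<open>sqrt s\<close>.\<close>

lemma \<Theta>_diag: "\<exists>C>0. \<forall>s. 0 < s \<and> s \<le> 2 \<longrightarrow> \<bar>\<Theta> s 0 - sqrt (pi / (a * s))\<bar> \<le> C * sqrt s"
proof -
  obtain F where F: "\<And>x. (F has_real_derivative exp (- x\<^sup>2)) (at x)" "\<And>x. F (- x) = - F x" "(F \<longlongrightarrow> sqrt pi / 2) at_top"
    using gauss_antiderivative by blast
  obtain C where C: "C > 0"
    and C2: "\<And>s x. 0 < s \<Longrightarrow> s \<le> 2 \<Longrightarrow> \<bar>(4 * a\<^sup>2 * s\<^sup>2 * x\<^sup>2 - 2 * a * s) * E s x\<bar> \<le> C * s / (1 + s * x\<^sup>2)"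
    using E_xx_bounds by blast
  let ?K = "exp (2 * \<bar>c0\<bar>)"
  have ec: "exp (- c0 * s) \<le> ?K" if "0 < s" "s \<le> 2" for s
  proof -
    have "- c0 * s \<le> \<bar>c0\<bar> * s" using that by (intro mult_right_mono) auto
    also have "\<dots> \<le> \<bar>c0\<bar> * 2" using that by (intro mult_left_mono) auto
    finally show ?thesis by simp
  qed
  have main: "\<bar>\<Theta> s 0 - exp (- c0 * s) * sqrt (pi / (a * s))\<bar> \<le> 5 * C * s + 2 * (5 * C * s * (2 / sqrt s))" if s: "0 < s" "s \<le> 2" for s
  proof -
    define \<rho> where "\<rho> = sqrt (a * s)"
    have \<rho>: "0 < \<rho>" "\<rho>\<^sup>2 = a * s" using s a_pos by (auto simp: \<rho>_def)
    define \<Psi> where "\<Psi> x = exp (- c0 * s) * F (\<rho> * x) / \<rho>" for x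
    have d\<Psi>: "(\<Psi> has_real_derivative E s x) (at x)" for x
    proof -
      have "(\<Psi> has_real_derivative exp (- c0 * s) * (exp (- (\<rho> * x)\<^sup>2) * \<rho>) / \<rho>) (at x)"
        unfolding \<Psi>_def[abs_def] by (rule derivative_eq_intros DERIV_chain2[OF F(1)] refl)+ (use \<rho> in \<open>simp_all add: field_simps\<close>)
      moreover have "exp (- c0 * s) * (exp (- (\<rho> * x)\<^sup>2) * \<rho>) / \<rho> = E s x"
        using \<rho> by (simp add: E_def lam_def power_mult_distrib algebra_simps flip: exp_add)
      ultimately show ?thesis by simp
    qed
    have mb: "\<bar>\<Psi> (real k + 1/2) - \<Psi> (real k - 1/2) - E s (real k)\<bar> \<le> 5 * C * s * (1 / (1 + s * (real k)\<^sup>2))" for k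
    proof (rule midpoint_bound[OF d\<Psi> DERIV_E_x])
      fix z assume z: "\<bar>z - real k\<bar> \<le> 1"
      have "C * s * (1 / (1 + s * z\<^sup>2)) \<le> C * s * (5 / (1 + s * (real k)\<^sup>2))"
        using C s by (intro mult_left_mono recip_quadratic_shift[OF s z]) auto
      then show "\<bar>(4 * a\<^sup>2 * s\<^sup>2 * z\<^sup>2 - 2 * a * s) * E s z\<bar> \<le> 5 * C * s * (1 / (1 + s * (real k)\<^sup>2))"
        using C2[OF s, of z] by (simp add: mult_ac)
    qed
    have tel: "2 * \<Psi> (real N + 1/2) = (\<Psi> (real 0 + 1/2) - \<Psi> (real 0 - 1/2)) + 2 * (\<Sum>k=1..N. \<Psi> (real k + 1/2) - \<Psi> (real k - 1/2))" for N
    proof (induction N)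
      case 0
      have "\<Psi> (- (1/2)) = - \<Psi> (1/2)" using F(2)[of "\<rho> * (1/2)"] by (simp add: \<Psi>_def)
      then show ?case by simp
    next
      case (Suc N)
      then show ?case by (simp add: algebra_simps)
    qed
    have "\<bar>\<Theta> s 0 - 2 * (exp (- c0 * s) * (sqrt pi / 2) / \<rho>)\<bar> \<le> 5 * C * s + 2 * (5 * C * s * (2 / sqrt s))"
    proof (rule LIMSEQ_le_const2)
      have "filterlim (\<lambda>N. \<rho> * (real N + 1/2)) at_top sequentially"
        using \<rho> by real_asymp
      then have "(\<lambda>N. F (\<rho> * (real N + 1/2))) \<longlonglongrightarrow> sqrt pi / 2" by (rule filterlim_compose[OF F(3)])
      then have "(\<lambda>N. \<Psi> (real N + 1/2)) \<longlonglongrightarrow> exp (- c0 * s) * (sqrt pi / 2) / \<rho>"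
        unfolding \<Psi>_def by (intro tendsto_intros) (use \<rho> in auto)
      then show "(\<lambda>N. \<bar>E s (real 0) + 2 * (\<Sum>k=1..N. E s (real k) * cos (real k * 0)) - 2 * \<Psi> (real N + 1/2)\<bar>)
         \<longlonglongrightarrow> \<bar>\<Theta> s 0 - 2 * (exp (- c0 * s) * (sqrt pi / 2) / \<rho>)\<bar>"
        by (intro tendsto_intros \<Theta>_LIMSEQ s)
      show "\<exists>N. \<forall>n\<ge>N. \<bar>E s (real 0) + 2 * (\<Sum>k=1..n. E s (real k) * cos (real k * 0)) - 2 * \<Psi> (real n + 1/2)\<bar> \<le> 5 * C * s + 2 * (5 * C * s * (2 / sqrt s))"
      proof (intro exI allI impI)
        fix N
        let ?e = "\<lambda>k. \<Psi> (real k + 1/2) - \<Psi> (real k - 1/2) - E s (real k)"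
        have "E s (real 0) + 2 * (\<Sum>k=1..N. E s (real k) * cos (real k * 0)) - 2 * \<Psi> (real N + 1/2) = - ?e 0 - 2 * (\<Sum>k=1..N. ?e k)"
          unfolding tel[of N] sum_subtractf by simp
        moreover have "\<bar>\<Sum>k=1..N. ?e k\<bar> \<le> 5 * C * s * (2 / sqrt s)"
        proof -
          have "\<bar>\<Sum>k=1..N. ?e k\<bar> \<le> (\<Sum>k=1..N. 5 * C * s * (1 / (1 + s * (real k)\<^sup>2)))"
            by (rule order_trans[OF sum_abs sum_mono[OF mb]])
          also have "\<dots> \<le> 5 * C * s * (2 / sqrt s)" unfolding sum_distrib_left[symmetric] using C s by (intro mult_left_mono sum_recip_quadratic) auto
          finally show ?thesis .
        qed
        moreover have "\<bar>?e 0\<bar> \<le> 5 * C * s" using mb[of 0] by simp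
        ultimately show "\<bar>E s (real 0) + 2 * (\<Sum>k=1..N. E s (real k) * cos (real k * 0)) - 2 * \<Psi> (real N + 1/2)\<bar> \<le> 5 * C * s + 2 * (5 * C * s * (2 / sqrt s))"
          by linarith
      qed
    qed
    moreover have "2 * (exp (- c0 * s) * (sqrt pi / 2) / \<rho>) = exp (- c0 * s) * sqrt (pi / (a * s))"
      by (simp add: \<rho>_def real_sqrt_divide)
    ultimately show ?thesis by simp
  qed
  \<comment> \<open>Replacing \<open>exp (- c0 * s)\<close> by \<open>1\<close> costs a factor of
    order \<open>s\<close>; multiplied by the main term of order \<open>1 / sqrt s\<close>, this is
    again of order \<open>sqrt s\<close>.\<close>
  have e1: "\<bar>exp (- c0 * s) - 1\<bar> \<le> \<bar>c0\<bar> * ?K * s" if s: "0 < s" "s \<le> 2" for s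
  proof -
    have "\<exists>z>0. z < s \<and> exp (- c0 * s) - exp (- c0 * 0) = (s - 0) * (- c0 * exp (- c0 * z))"
      by (rule MVT2[OF s(1)]) (auto intro!: derivative_eq_intros)
    then obtain z where z: "0 < z" "z < s" and e: "exp (- c0 * s) - 1 = s * (- c0 * exp (- c0 * z))" by auto
    have "\<bar>exp (- c0 * s) - 1\<bar> = s * (\<bar>c0\<bar> * exp (- c0 * z))" unfolding e using s by (simp add: abs_mult)
    also have "\<dots> \<le> s * (\<bar>c0\<bar> * ?K)" using s z by (intro mult_left_mono ec) auto
    finally show ?thesis by (simp add: mult_ac)
  qed
  let ?B = "\<bar>c0\<bar> * ?K * sqrt (pi / a)"
  show ?thesis
  proof (intro exI[of _ "30 * C + ?B"] conjI allI impI; (elim conjE)?)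
    show "0 < 30 * C + ?B" using C a_pos by (intro add_pos_nonneg mult_nonneg_nonneg) auto
    fix s :: real assume s: "0 < s" "s \<le> 2"
    have ss: "s = sqrt s * sqrt s" "s / sqrt s = sqrt s" using s by (auto simp: real_div_sqrt)
    have "sqrt s \<le> sqrt 4" using s by (intro real_sqrt_le_mono) auto
    then have sq: "s \<le> 2 * sqrt s" using mult_right_mono[of "sqrt s" 2 "sqrt s"] s by simp
    have "\<bar>(exp (- c0 * s) - 1) * sqrt (pi / (a * s))\<bar> \<le> (\<bar>c0\<bar> * ?K * s) * sqrt (pi / (a * s))"
      unfolding abs_mult using e1[OF s] s a_pos by (intro mult_mono) auto
    also have "\<dots> = ?B * (s / sqrt s)" by (simp add: real_sqrt_divide real_sqrt_mult)
    also have "\<dots> = ?B * sqrt s" by (simp only: ss(2))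
    finally have 1: "\<bar>exp (- c0 * s) * sqrt (pi / (a * s)) - sqrt (pi / (a * s))\<bar> \<le> ?B * sqrt s" by (simp add: left_diff_distrib)
    have "5 * C * s + 2 * (5 * C * s * (2 / sqrt s)) = 5 * C * s + 20 * C * (s / sqrt s)" by simp
    also have "\<dots> \<le> 5 * C * (2 * sqrt s) + 20 * C * sqrt s" unfolding ss(2) using sq C by (intro add_right_mono mult_left_mono) auto
    finally have "5 * C * s + 2 * (5 * C * s * (2 / sqrt s)) \<le> 30 * C * sqrt s" by simp
    with main[OF s] 1 show "\<bar>\<Theta> s 0 - sqrt (pi / (a * s))\<bar> \<le> (30 * C + ?B) * sqrt s"
      by (simp add: distrib_right)
  qed
qed

end

section \<open>Theta series integrated in time\<close>

lemma interval_integral_inverse_sqrt: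
  assumes "0 \<le> u" "u < v"
  shows "set_integrable lborel {u<..<v} (\<lambda>s. 1 / sqrt s)" "(LINT s:{u<..<v}|lborel. 1 / sqrt s) = 2 * sqrt v - 2 * sqrt u"
proof -
  have uv: "ereal u < ereal v" using assms by simp
  note FTC = interval_integral_FTC_nonneg[of "ereal u" "ereal v" "\<lambda>s. 2 * sqrt s" "\<lambda>s. 1 / sqrt s" "2 * sqrt u" "2 * sqrt v"]
  have 1: "((\<lambda>s. 2 * sqrt s) has_real_derivative 1 / sqrt x) (at x)" if "ereal u < ereal x" for x
    using that assms by (auto intro!: derivative_eq_intros simp: divide_simps)
  have 2: "isCont (\<lambda>s. 1 / sqrt s) x" if "ereal u < ereal x" for x using that assms by (intro continuous_intros) auto
  have 3: "AE x in lborel. ereal u < ereal x \<longrightarrow> ereal x < ereal v \<longrightarrow> 0 \<le> 1 / sqrt x" using assms by auto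
  have A: "(((\<lambda>s. 2 * sqrt s) \<circ> real_of_ereal) \<longlongrightarrow> 2 * sqrt u) (at_right (ereal u))"
    unfolding at_right_ereal by (simp add: comp_def filterlim_filtermap) (auto intro!: tendsto_eq_intros)
  have B: "(((\<lambda>s. 2 * sqrt s) \<circ> real_of_ereal) \<longlongrightarrow> 2 * sqrt v) (at_left (ereal v))"
    unfolding at_left_ereal by (simp add: comp_def filterlim_filtermap) (auto intro!: tendsto_eq_intros)
  have e: "einterval (ereal u) (ereal v) = {u<..<v}" by (auto simp: einterval_def)
  show "set_integrable lborel {u<..<v} (\<lambda>s. 1 / sqrt s)" using FTC(1)[OF uv 1 2 3 A B] unfolding e .
  show "(LINT s:{u<..<v}|lborel. 1 / sqrt s) = 2 * sqrt v - 2 * sqrt u"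
    using FTC(2)[OF uv 1 2 3 A B] uv by (simp add: interval_lebesgue_integral_def e)
qed

lemma set_integral_exp_neg:
  fixes l :: real assumes "0 < l" "0 \<le> t"
  shows "set_integrable lborel {0<..<t} (\<lambda>s. exp (- l * s))" "(LINT s:{0<..<t}|lborel. exp (- l * s)) = (1 - exp (- l * t)) / l"
proof -
  have c: "continuous_on A (\<lambda>s. exp (- l * s))" for A :: "real set" by (intro continuous_intros)
  have "set_integrable lborel {0..t} (\<lambda>s. exp (- l * s))" by (rule borel_integrable_atLeastAtMost'[OF c])
  then show "set_integrable lborel {0<..<t} (\<lambda>s. exp (- l * s))" by (rule set_integrable_subset) auto
  have d: "((\<lambda>s. - exp (- l * s) / l) has_real_derivative exp (- l * s)) (at s)" for s
    using assms by (auto intro!: derivative_eq_intros)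
  have "(LBINT s=ereal 0..ereal t. exp (- l * s)) = (- exp (- l * t) / l) - (- exp (- l * 0) / l)"
  proof (rule interval_integral_FTC_finite[OF c])
    show "((\<lambda>s. - exp (- l * s) / l) has_vector_derivative exp (- l * x)) (at x within {min 0 t..max 0 t})" for x
      using d[of x] unfolding has_real_derivative_iff_has_vector_derivative by (rule has_vector_derivative_at_within)
  qed
  moreover have "einterval (ereal 0) (ereal t) = {0<..<t}" by (auto simp: einterval_def)
  ultimately show "(LINT s:{0<..<t}|lborel. exp (- l * s)) = (1 - exp (- l * t)) / l"
    using assms by (simp add: interval_lebesgue_integral_def diff_divide_distrib)
qed

lemma set_integral_bound:
  fixes f g :: "real \<Rightarrow> real"
  assumes "set_integrable lborel A f" "set_integrable lborel A g" "\<And>s. s \<in> A \<Longrightarrow> \<bar>f s\<bar> \<le> g s"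
  shows "\<bar>LINT s:A|lborel. f s\<bar> \<le> (LINT s:A|lborel. g s)"
proof -
  have "\<bar>LINT s:A|lborel. f s\<bar> \<le> (\<integral>s. \<bar>indicator A s *\<^sub>R f s\<bar> \<partial>lborel)" unfolding set_lebesgue_integral_def by (rule integral_abs_bound)
  also have "\<dots> \<le> (LINT s:A|lborel. g s)" unfolding set_lebesgue_integral_def
    using assms by (intro integral_mono) (auto simp: set_integrable_def split: split_indicator)
  finally show ?thesis .
qed

lemma set_integral_translate:
  fixes f :: "real \<Rightarrow> real"
  shows "(LINT s:{u<..<v}|lborel. f (s + h)) = (LINT s:{u + h<..<v + h}|lborel. f s)"
    "set_integrable lborel {u<..<v} (\<lambda>s. f (s + h)) \<longleftrightarrow> set_integrable lborel {u + h<..<v + h} f"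
proof -
  have e: "indicator {u<..<v} s = (indicator {u + h<..<v + h} (h + 1 * s) :: real)" for s by (auto split: split_indicator)
  show "(LINT s:{u<..<v}|lborel. f (s + h)) = (LINT s:{u + h<..<v + h}|lborel. f s)"
    using lborel_integral_real_affine[of 1 "\<lambda>s. indicator {u + h<..<v + h} s *\<^sub>R f s" h]
    unfolding set_lebesgue_integral_def e by (simp add: add.commute)
  show "set_integrable lborel {u<..<v} (\<lambda>s. f (s + h)) \<longleftrightarrow> set_integrable lborel {u + h<..<v + h} f"
    using lborel_integrable_real_affine_iff[of 1 "\<lambda>s. indicator {u + h<..<v + h} s *\<^sub>R f s" h]
    unfolding set_integrable_def e by (simp add: add.commute)
qed

lemma set_integral_split:
  fixes f :: "real \<Rightarrow> real"
  assumes "set_integrable lborel {u<..<w} f" "u \<le> v" "v \<le> w"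
  shows "(LINT s:{u<..<w}|lborel. f s) = (LINT s:{u<..<v}|lborel. f s) + (LINT s:{v<..<w}|lborel. f s)"
proof -
  have i: "set_integrable lborel {u<..<v} f" "set_integrable lborel {v<..<w} f"
    using assms by (auto intro: set_integrable_subset)
  have "(LINT s:{u<..<v} \<union> {v<..<w}|lborel. f s) = (LINT s:{u<..<v}|lborel. f s) + (LINT s:{v<..<w}|lborel. f s)"
    by (rule set_integral_Un[OF _ i]) auto
  moreover have "(LINT s:{u<..<w}|lborel. f s) = (LINT s:{u<..<v} \<union> {v<..<w}|lborel. f s)"
    by (rule set_integral_discrete_difference[where X="{v}"]) (use assms in auto)
  ultimately show ?thesis by simp
qed

lemma abs_half_diff_le:
  fixes x y :: real
  shows "\<bar>(x - y) / 2\<bar> \<le> (\<bar>x\<bar> + \<bar>y\<bar>) / 2" "\<bar>(x - y) / 2\<bar> \<le> \<bar>x\<bar> + \<bar>y\<bar>"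
proof -
  show h: "\<bar>(x - y) / 2\<bar> \<le> (\<bar>x\<bar> + \<bar>y\<bar>) / 2"
    unfolding abs_divide abs_numeral by (rule divide_right_mono[OF abs_triangle_ineq4]) simp
  have "(\<bar>x\<bar> + \<bar>y\<bar>) / 2 \<le> \<bar>x\<bar> + \<bar>y\<bar>" by simp
  with h show "\<bar>(x - y) / 2\<bar> \<le> \<bar>x\<bar> + \<bar>y\<bar>" by (rule order_trans)
qed

locale positive_theta_series = theta_series +
  assumes lam_pos: "\<And>k. 1 \<le> k \<Longrightarrow> 0 < lam (real (k::nat))"
begin

text \<open>For negative \<open>c0\<close> the bound \<open>c0 * k^2 \<le> c0\<close> reduces
  everything to the first eigenvalue \<open>c0 + a\<close>, whose positivity keeps the constant
  positive.\<close>

lemma lam_lower: "\<exists>c>0. \<forall>k::nat. 1 \<le> k \<longrightarrow> c * (real k)\<^sup>2 \<le> lam (real k)"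
proof (intro exI[of _ "min a (c0 + a)"] conjI allI impI)
  show "0 < min a (c0 + a)" using a_pos lam_pos[of 1] by (simp add: lam_def)
  fix k :: nat assume "1 \<le> k"
  then have k: "1 \<le> (real k)\<^sup>2" by (simp add: one_le_power)
  show "min a (c0 + a) * (real k)\<^sup>2 \<le> lam (real k)"
  proof (cases "0 \<le> c0")
    case True
    have "min a (c0 + a) * (real k)\<^sup>2 \<le> a * (real k)\<^sup>2" by (intro mult_right_mono) auto
    then show ?thesis using True by (simp add: lam_def)
  next
    case False
    have "min a (c0 + a) * (real k)\<^sup>2 \<le> (c0 + a) * (real k)\<^sup>2" by (intro mult_right_mono) auto
    moreover have "c0 * (real k)\<^sup>2 \<le> c0" using k False by (simp add: mult_le_cancel_left1)
    ultimately show ?thesis by (simp add: lam_def distrib_right)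
  qed
qed

lemma lam_inverse_summable: "summable (\<lambda>k. 1 / lam (real (Suc k)))"
proof -
  obtain c where c: "c > 0" "\<And>k::nat. 1 \<le> k \<Longrightarrow> c * (real k)\<^sup>2 \<le> lam (real k)" using lam_lower by blast
  have "summable (\<lambda>k. (2 / c) * (1 / (1 + 1 * (real (Suc k))\<^sup>2)))" by (intro summable_mult suminf_recip_quadratic) simp
  then show ?thesis
  proof (rule summable_comparison_test'[where N=0])
    fix k
    have p: "0 < lam (real (Suc k))" by (rule lam_pos) simp
    have "c * (1 + (real (Suc k))\<^sup>2) \<le> 2 * (c * (real (Suc k))\<^sup>2)" using c(1) by (simp add: distrib_left mult_le_cancel_left1 one_le_power)
    also have "\<dots> \<le> 2 * lam (real (Suc k))" using c(2)[of "Suc k"] by simp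
    finally have "c * (1 + (real (Suc k))\<^sup>2) \<le> 2 * lam (real (Suc k))" .
    moreover have "0 < c * (1 + (real (Suc k))\<^sup>2)" using c(1) by (intro mult_pos_pos add_pos_nonneg) auto
    ultimately have "1 / (2 * lam (real (Suc k))) \<le> 1 / (c * (1 + (real (Suc k))\<^sup>2))" using le_imp_inverse_le unfolding inverse_eq_divide by blast
    then have "1 / lam (real (Suc k)) \<le> 2 / (c * (1 + (real (Suc k))\<^sup>2))" by simp
    then show "norm (1 / lam (real (Suc k))) \<le> (2 / c) * (1 / (1 + 1 * (real (Suc k))\<^sup>2))" using p by simp
  qed
qed

text \<open>The integral of \<open>exp (- lam k * s)\<close> over \<open>s\<close> from
  \<open>0\<close> to \<open>t\<close>.\<close>

definition wk :: "real \<Rightarrow> nat \<Rightarrow> real" where "wk t k = (1 - exp (- lam (real k) * t)) / lam (real k)"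

lemma wk_bounds: assumes "1 \<le> k" "0 \<le> t" shows "0 \<le> wk t k" "wk t k \<le> 1 / lam (real k)" "wk t k \<le> 2 * t / (1 + lam (real k) * t)"
proof -
  have p: "0 < lam (real k)" by (rule lam_pos[OF assms(1)])
  have "0 \<le> lam (real k) * t" using p assms by simp
  then show "0 \<le> wk t k" "wk t k \<le> 1 / lam (real k)" using p unfolding wk_def by (auto intro!: divide_right_mono divide_nonneg_pos)
  let ?x = "lam (real k) * t"
  have x: "0 \<le> ?x" using p assms by simp
  have "(1 - exp (- ?x)) * (1 + ?x) \<le> 2 * ?x"
  proof -
    have "1 - ?x \<le> exp (- ?x)" using exp_ge_add_one_self[of "- ?x"] by simp
    then have "(1 - exp (- ?x)) \<le> ?x" by simp
    moreover have "(1 - exp (- ?x)) * ?x \<le> 1 * ?x" using x by (intro mult_right_mono) auto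
    ultimately show ?thesis by (simp add: distrib_left)
  qed
  then have "(1 - exp (- ?x)) \<le> 2 * ?x / (1 + ?x)" using x by (subst pos_le_divide_eq) auto
  then have "wk t k \<le> (2 * ?x / (1 + ?x)) / lam (real k)" unfolding wk_def using p by (intro divide_right_mono) auto
  also have "\<dots> = 2 * t / (1 + ?x)" using p by simp
  finally show "wk t k \<le> 2 * t / (1 + lam (real k) * t)" .
qed

text \<open>The third bound of \<open>wk_bounds\<close> and the quadratic growth of
  \<open>lam\<close> reduce this to \<open>sum_recip_quadratic\<close> with \<open>s = c t\<close>:
  the result is \<open>t\<close> times \<open>1 / sqrt t\<close>.\<close>

lemma sum_wk_bound: "\<exists>C>0. \<forall>t N. 0 < t \<longrightarrow> (\<Sum>k=1..N. wk t k) \<le> C * sqrt t"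
proof -
  obtain c where c: "c > 0" "\<And>k::nat. 1 \<le> k \<Longrightarrow> c * (real k)\<^sup>2 \<le> lam (real k)" using lam_lower by blast
  show ?thesis
  proof (intro exI[of _ "4 / sqrt c"] conjI allI impI)
    show "0 < 4 / sqrt c" using c by simp
    fix t :: real and N assume t: "0 < t"
    have "(\<Sum>k=1..N. wk t k) \<le> (\<Sum>k=1..N. 2 * t * (1 / (1 + (c * t) * (real k)\<^sup>2)))"
    proof (rule sum_mono)
      fix k assume "k \<in> {1..N}"
      then have k: "1 \<le> k" by simp
      have "(c * (real k)\<^sup>2) * t \<le> lam (real k) * t" using c(2)[OF k] t by (intro mult_right_mono) auto
      moreover have "0 \<le> (c * (real k)\<^sup>2) * t" using c t by simp
      ultimately have le: "1 + (c * t) * (real k)\<^sup>2 \<le> 1 + lam (real k) * t" "0 < 1 + (c * t) * (real k)\<^sup>2"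
        by (simp_all add: mult_ac)
      then have "2 * t / (1 + lam (real k) * t) \<le> 2 * t / (1 + (c * t) * (real k)\<^sup>2)"
        using t by (intro divide_left_mono mult_pos_pos) (use le in linarith)+
      then show "wk t k \<le> 2 * t * (1 / (1 + (c * t) * (real k)\<^sup>2))" using wk_bounds(3)[OF k, of t] t by simp
    qed
    also have "\<dots> = 2 * t * (\<Sum>k=1..N. 1 / (1 + (c * t) * (real k)\<^sup>2))" by (simp add: sum_distrib_left)
    also have "\<dots> \<le> 2 * t * (2 / sqrt (c * t))" using c t by (intro mult_left_mono sum_recip_quadratic) auto
    also have "\<dots> = 4 / sqrt c * (t / sqrt t)" by (simp add: real_sqrt_mult)
    also have "t / sqrt t = sqrt t" using t by (simp add: real_div_sqrt)
    finally show "(\<Sum>k=1..N. wk t k) \<le> 4 / sqrt c * sqrt t" .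
  qed
qed

text \<open>The difference of cosines stems from the product of two sines in the eigenfunctions. It
  starts at mode \<open>1\<close>, where \<open>lam\<close> is positive.\<close>

definition Kc :: "real \<Rightarrow> real \<Rightarrow> real \<Rightarrow> real" where
  "Kc t \<theta> \<theta>' = (\<Sum>k. wk t (Suc k) * (cos (real (Suc k) * \<theta>) - cos (real (Suc k) * \<theta>')))"

lemma Kc_summable: assumes "0 \<le> t"
  shows "summable (\<lambda>k. wk t (Suc k) * (cos (real (Suc k) * \<theta>) - cos (real (Suc k) * \<theta>')))"
proof (rule summable_comparison_test'[where N=0])
  show "summable (\<lambda>k. 2 * (1 / lam (real (Suc k))))" by (intro summable_mult lam_inverse_summable)
  fix k
  have "\<bar>cos (real (Suc k) * \<theta>) - cos (real (Suc k) * \<theta>')\<bar> \<le> 2"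
    using abs_cos_le_one[of "real (Suc k) * \<theta>"] abs_cos_le_one[of "real (Suc k) * \<theta>'"] by linarith
  then have "\<bar>wk t (Suc k)\<bar> * \<bar>cos (real (Suc k) * \<theta>) - cos (real (Suc k) * \<theta>')\<bar> \<le> (1 / lam (real (Suc k))) * 2"
    using wk_bounds[of "Suc k" t] assms lam_pos[of "Suc k"] by (intro mult_mono) auto
  then show "norm (wk t (Suc k) * (cos (real (Suc k) * \<theta>) - cos (real (Suc k) * \<theta>'))) \<le> 2 * (1 / lam (real (Suc k)))"
    by (simp add: abs_mult)
qed

definition \<Delta>\<Theta> :: "real \<Rightarrow> real \<Rightarrow> real \<Rightarrow> real" where "\<Delta>\<Theta> \<theta> \<theta>' s = (\<Theta> s \<theta> - \<Theta> s \<theta>') / 2"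

text \<open>Integration term by term: the integrals of the absolute values are at most
  \<open>2 / lam\<close>, which is summable. This makes the bounds on \<open>\<Theta>\<close>
  available for \<open>Kc\<close>, although \<open>\<Theta>\<close> blows up at time
  \<open>0\<close> for the angle \<open>0\<close>.\<close>

lemma Kc_integral:
  assumes t: "0 \<le> t" "t \<le> 2"
  shows "set_integrable lborel {0<..<t} (\<Delta>\<Theta> \<theta> \<theta>')" "Kc t \<theta> \<theta>' = (LINT s:{0<..<t}|lborel. \<Delta>\<Theta> \<theta> \<theta>' s)"
proof -
  let ?d = "\<lambda>k. cos (real (Suc k) * \<theta>) - cos (real (Suc k) * \<theta>')"
  let ?f = "\<lambda>k s. indicator {0<..<t} s *\<^sub>R (E s (real (Suc k)) * ?d k)"
  have lp: "0 < lam (real (Suc k))" for k by (rule lam_pos) simp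
  have E: "E s (real (Suc k)) = exp (- lam (real (Suc k)) * s)" for s k by (simp add: E_def)
  have ie: "integrable lborel (\<lambda>s. indicator {0<..<t} s *\<^sub>R E s (real (Suc k)))"
    and iv: "(\<integral>s. indicator {0<..<t} s *\<^sub>R E s (real (Suc k)) \<partial>lborel) = wk t (Suc k)" for k
    using set_integral_exp_neg[OF lp t(1), of k] unfolding E wk_def set_integrable_def set_lebesgue_integral_def by auto
  have fe: "?f k = (\<lambda>s. (indicator {0<..<t} s *\<^sub>R E s (real (Suc k))) * ?d k)" for k by (auto simp: fun_eq_iff)
  have i: "integrable lborel (?f k)" for k unfolding fe using ie[of k] by simp
  have dv: "\<Delta>\<Theta> \<theta> \<theta>' s = (\<Sum>k. E s (real (Suc k)) * ?d k)" if "0 < s" "s \<le> 2" for s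
  proof -
    have "(\<Sum>k. E s (real (Suc k)) * ?d k) = (\<Sum>k. E s (real (Suc k)) * cos (real (Suc k) * \<theta>)) - (\<Sum>k. E s (real (Suc k)) * cos (real (Suc k) * \<theta>'))"
      unfolding right_diff_distrib by (intro suminf_diff[symmetric] E_summable that)
    then show ?thesis by (simp add: \<Delta>\<Theta>_def \<Theta>_def)
  qed
  have sm: "AE s in lborel. summable (\<lambda>k. norm (?f k s))"
  proof (intro AE_I2)
    fix s
    show "summable (\<lambda>k. norm (?f k s))"
    proof (cases "s \<in> {0<..<t}")
      case True
      then have s: "0 < s" "s \<le> 2" using t by auto
      show ?thesis
      proof (rule summable_comparison_test'[where N=0])
        show "summable (\<lambda>k. 2 * E s (real (Suc k)))" by (intro summable_mult E_summable s)
        fix k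
        have "\<bar>?d k\<bar> \<le> 2" using abs_cos_le_one[of "real (Suc k) * \<theta>"] abs_cos_le_one[of "real (Suc k) * \<theta>'"] by linarith
        then have "E s (real (Suc k)) * \<bar>?d k\<bar> \<le> E s (real (Suc k)) * 2" by (intro mult_left_mono) (auto simp: E_def)
        then show "norm (norm (?f k s)) \<le> 2 * E s (real (Suc k))" using True by (simp add: abs_mult E_def)
      qed
    qed simp
  qed
  have sn: "summable (\<lambda>k. \<integral>s. norm (?f k s) \<partial>lborel)"
  proof (rule summable_comparison_test'[where N=0])
    show "summable (\<lambda>k. 2 * (1 / lam (real (Suc k))))" by (intro summable_mult lam_inverse_summable)
    fix k
    have "\<bar>?d k\<bar> \<le> 2" using abs_cos_le_one[of "real (Suc k) * \<theta>"] abs_cos_le_one[of "real (Suc k) * \<theta>'"] by linarith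
    have "norm (?f k s) = (indicator {0<..<t} s *\<^sub>R E s (real (Suc k))) * \<bar>?d k\<bar>" for s by (simp add: abs_mult E_def)
    then have "(\<integral>s. norm (?f k s) \<partial>lborel) = wk t (Suc k) * \<bar>?d k\<bar>" using iv[of k] by simp
    also have "\<dots> \<le> (1 / lam (real (Suc k))) * 2" using wk_bounds[of "Suc k" t] t lp[of k] \<open>\<bar>?d k\<bar> \<le> 2\<close> by (intro mult_mono) auto
    finally show "norm (\<integral>s. norm (?f k s) \<partial>lborel) \<le> 2 * (1 / lam (real (Suc k)))" by simp
  qed
  have pe: "(\<lambda>s. \<Sum>k. ?f k s) = (\<lambda>s. indicator {0<..<t} s *\<^sub>R \<Delta>\<Theta> \<theta> \<theta>' s)"
  proof
    fix s show "(\<Sum>k. ?f k s) = indicator {0<..<t} s *\<^sub>R \<Delta>\<Theta> \<theta> \<theta>' s"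
      using dv[of s] t by (cases "s \<in> {0<..<t}") auto
  qed
  show "set_integrable lborel {0<..<t} (\<Delta>\<Theta> \<theta> \<theta>')"
    using integrable_suminf[OF i sm sn] unfolding pe set_integrable_def .
  have "(LINT s:{0<..<t}|lborel. \<Delta>\<Theta> \<theta> \<theta>' s) = (\<Sum>k. \<integral>s. ?f k s \<partial>lborel)"
    using integral_suminf[OF i sm sn] unfolding pe set_lebesgue_integral_def .
  also have "\<dots> = Kc t \<theta> \<theta>'" unfolding Kc_def fe using iv by simp
  finally show "Kc t \<theta> \<theta>' = (LINT s:{0<..<t}|lborel. \<Delta>\<Theta> \<theta> \<theta>' s)" by simp
qed

lemma cos_lt_imp: "cos (\<theta>::real) \<noteq> 1 \<Longrightarrow> 0 < 1 - cos \<theta>"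
  using cos_le_one[of \<theta>] by linarith

text \<open>All three bounds integrate the bounds on \<open>\<Theta>\<close> in time: for the angle
  \<open>0\<close> the singular leading term is subtracted first, for other angles the integrand is
  of order \<open>sqrt s\<close>, and the second difference uses the time increments of
  \<open>\<Theta>\<close>.\<close>

lemma Kc_bounds:
  "\<exists>C>0. (\<forall>t \<theta>'. 0 < t \<and> t \<le> 2 \<and> cos \<theta>' \<noteq> 1 \<longrightarrow> \<bar>Kc t 0 \<theta>' - sqrt (pi * t / a)\<bar> \<le> C * (t * sqrt t) * (1 + 1 / (1 - cos \<theta>'))) \<and>
    (\<forall>t \<theta> \<theta>'. 0 < t \<and> t \<le> 2 \<and> cos \<theta> \<noteq> 1 \<and> cos \<theta>' \<noteq> 1 \<longrightarrow> \<bar>Kc t \<theta> \<theta>'\<bar> \<le> C * (t * sqrt t) * (1 / (1 - cos \<theta>) + 1 / (1 - cos \<theta>'))) \<and>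
    (\<forall>t h \<theta> \<theta>'. 0 < h \<and> h \<le> t \<and> t + h \<le> 2 \<and> cos \<theta> \<noteq> 1 \<and> cos \<theta>' \<noteq> 1 \<longrightarrow>
      \<bar>Kc (t + h) \<theta> \<theta>' - 2 * Kc t \<theta> \<theta>' + Kc (t - h) \<theta> \<theta>'\<bar> \<le> C * (h\<^sup>2 / sqrt t) * (1 / (1 - cos \<theta>) + 1 / (1 - cos \<theta>')))"
proof -
  obtain C1 where C1: "C1 > 0" and b1: "\<And>s \<theta>. 0 < s \<Longrightarrow> s \<le> 2 \<Longrightarrow> (1 - cos \<theta>) * \<bar>\<Theta> s \<theta>\<bar> \<le> C1 * sqrt s"
    and b2: "\<And>s s' \<theta>. 0 < s' \<Longrightarrow> s' < s \<Longrightarrow> s \<le> 2 \<Longrightarrow> (1 - cos \<theta>) * \<bar>\<Theta> s \<theta> - \<Theta> s' \<theta>\<bar> \<le> C1 * (s - s') / sqrt s'"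
    using \<Theta>_bounds by blast
  obtain C2 where C2: "C2 > 0" and b3: "\<And>s. 0 < s \<Longrightarrow> s \<le> 2 \<Longrightarrow> \<bar>\<Theta> s 0 - sqrt (pi / (a * s))\<bar> \<le> C2 * sqrt s"
    using \<Theta>_diag by blast
  define C where "C = C1 + C2"
  have C: "C > 0" "C1 \<le> C" "C2 \<le> C" using C1 C2 by (auto simp: C_def)
  have c1: "\<bar>\<Theta> s \<theta>\<bar> \<le> C * sqrt s * (1 / (1 - cos \<theta>))" if "0 < s" "s \<le> 2" "cos \<theta> \<noteq> 1" for s \<theta>
  proof -
    have p: "0 < 1 - cos \<theta>" using cos_lt_imp that by blast
    have "(1 - cos \<theta>) * \<bar>\<Theta> s \<theta>\<bar> \<le> C * sqrt s" by (rule order_trans[OF b1[OF that(1,2)] mult_right_mono[OF C(2)]]) (use that in simp)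
    then show ?thesis using p by (simp add: pos_le_divide_eq mult.commute)
  qed
  have c2: "\<bar>\<Theta> s \<theta> - \<Theta> s' \<theta>\<bar> \<le> C * (s - s') / sqrt s' * (1 / (1 - cos \<theta>))" if "0 < s'" "s' < s" "s \<le> 2" "cos \<theta> \<noteq> 1" for s s' \<theta>
  proof -
    have p: "0 < 1 - cos \<theta>" using cos_lt_imp that by blast
    have "C1 * (s - s') / sqrt s' \<le> C * (s - s') / sqrt s'" using that C by (intro divide_right_mono mult_right_mono) auto
    then have "(1 - cos \<theta>) * \<bar>\<Theta> s \<theta> - \<Theta> s' \<theta>\<bar> \<le> C * (s - s') / sqrt s'" using b2[OF that(1-3), of \<theta>] by linarith
    then have "\<bar>\<Theta> s \<theta> - \<Theta> s' \<theta>\<bar> \<le> (C * (s - s') / sqrt s') / (1 - cos \<theta>)" using p by (metis mult.commute pos_le_divide_eq)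
    then show ?thesis by simp
  qed
  have const: "(LINT s:{0<..<t}|lborel. c) = c * t" "set_integrable lborel {0<..<t} (\<lambda>s. c)" if "0 \<le> t" for c t :: real
    using that by (auto simp: set_lebesgue_integral_def set_integrable_def)
  show ?thesis
  proof (intro exI[of _ C] conjI allI impI; (elim conjE)?)
    show "0 < C" by (rule C)
  next
    fix t \<theta>' :: real assume t: "0 < t" "t \<le> 2" and n: "cos \<theta>' \<noteq> 1"
    have p: "0 < 1 - cos \<theta>'" using cos_lt_imp n by blast
    \<comment> \<open>Half of the leading term \<open>sqrt (pi / (a * s))\<close> of
      \<open>\<Theta> s 0\<close>; its integral is \<open>sqrt (pi * t / a)\<close>.\<close>
    let ?g = "\<lambda>s. sqrt (pi / a) / 2 * (1 / sqrt s)"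
    have ig: "set_integrable lborel {0<..<t} ?g" using interval_integral_inverse_sqrt(1)[of 0 t] t by (intro set_integrable_mult_right) auto
    have vg: "(LINT s:{0<..<t}|lborel. ?g s) = sqrt (pi * t / a)"
      using interval_integral_inverse_sqrt(2)[of 0 t] t by (subst set_integral_mult_right) (simp add: real_sqrt_divide real_sqrt_mult)
    note K = Kc_integral[of t 0 \<theta>']
    have t0: "0 \<le> t" using t by simp
    let ?B = "C * sqrt t * (1 + 1 / (1 - cos \<theta>'))"
    have "Kc t 0 \<theta>' - sqrt (pi * t / a) = (LINT s:{0<..<t}|lborel. \<Delta>\<Theta> 0 \<theta>' s - ?g s)"
      unfolding K(2)[OF t0 t(2)] vg[symmetric] by (rule set_integral_diff(2)[OF K(1)[OF t0 t(2)] ig, symmetric])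
    also have "\<bar>\<dots>\<bar> \<le> (LINT s:{0<..<t}|lborel. ?B)"
    proof (rule set_integral_bound)
      show "set_integrable lborel {0<..<t} (\<lambda>s. \<Delta>\<Theta> 0 \<theta>' s - ?g s)" by (rule set_integral_diff(1)[OF K(1)[OF t0 t(2)] ig])
      show "set_integrable lborel {0<..<t} (\<lambda>s. ?B)" by (rule const(2)[OF t0])
      fix s assume "s \<in> {0<..<t}"
      then have s: "0 < s" "s \<le> 2" "s \<le> t" using t by auto
      have e: "\<Delta>\<Theta> 0 \<theta>' s - ?g s = ((\<Theta> s 0 - sqrt (pi / (a * s))) - \<Theta> s \<theta>') / 2"
        by (simp add: \<Delta>\<Theta>_def real_sqrt_divide real_sqrt_mult diff_divide_distrib)
      have "\<bar>\<Delta>\<Theta> 0 \<theta>' s - ?g s\<bar> \<le> \<bar>\<Theta> s 0 - sqrt (pi / (a * s))\<bar> + \<bar>\<Theta> s \<theta>'\<bar>" unfolding e by (rule abs_half_diff_le)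
      also have "\<dots> \<le> C * sqrt s + C * sqrt s * (1 / (1 - cos \<theta>'))"
        by (intro add_mono order_trans[OF b3 mult_right_mono[OF C(3)]] c1 s n) (use s in simp)
      also have "\<dots> = C * sqrt s * (1 + 1 / (1 - cos \<theta>'))" by (simp add: distrib_left)
      also have "\<dots> \<le> ?B" using C p s by (intro mult_right_mono mult_left_mono) auto
      finally show "\<bar>\<Delta>\<Theta> 0 \<theta>' s - ?g s\<bar> \<le> ?B" .
    qed
    also have "\<dots> = ?B * t" by (rule const(1)[OF t0])
    finally show "\<bar>Kc t 0 \<theta>' - sqrt (pi * t / a)\<bar> \<le> C * (t * sqrt t) * (1 + 1 / (1 - cos \<theta>'))" by (simp add: mult_ac)
  next
    fix t \<theta> \<theta>' :: real assume t: "0 < t" "t \<le> 2" and n: "cos \<theta> \<noteq> 1" "cos \<theta>' \<noteq> 1"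
    have p: "0 < 1 - cos \<theta>" "0 < 1 - cos \<theta>'" using cos_lt_imp n by blast+
    have t0: "0 \<le> t" using t by simp
    let ?B = "C * sqrt t * (1 / (1 - cos \<theta>) + 1 / (1 - cos \<theta>'))"
    have "\<bar>Kc t \<theta> \<theta>'\<bar> \<le> (LINT s:{0<..<t}|lborel. ?B)" unfolding Kc_integral(2)[OF t0 t(2)]
    proof (rule set_integral_bound[OF Kc_integral(1)[OF t0 t(2)] const(2)[OF t0]])
      fix s assume "s \<in> {0<..<t}"
      then have s: "0 < s" "s \<le> 2" "s \<le> t" using t by auto
      have "\<bar>\<Delta>\<Theta> \<theta> \<theta>' s\<bar> \<le> \<bar>\<Theta> s \<theta>\<bar> + \<bar>\<Theta> s \<theta>'\<bar>" unfolding \<Delta>\<Theta>_def by (rule abs_half_diff_le)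
      also have "\<dots> \<le> C * sqrt s * (1 / (1 - cos \<theta>)) + C * sqrt s * (1 / (1 - cos \<theta>'))"
        by (intro add_mono c1 s n)
      also have "\<dots> = C * sqrt s * (1 / (1 - cos \<theta>) + 1 / (1 - cos \<theta>'))" by (simp only: distrib_left)
      also have "\<dots> \<le> ?B" using C p s by (intro mult_right_mono mult_left_mono) auto
      finally show "\<bar>\<Delta>\<Theta> \<theta> \<theta>' s\<bar> \<le> ?B" .
    qed
    also have "\<dots> = ?B * t" by (rule const(1)[OF t0])
    finally show "\<bar>Kc t \<theta> \<theta>'\<bar> \<le> C * (t * sqrt t) * (1 / (1 - cos \<theta>) + 1 / (1 - cos \<theta>'))" by (simp add: mult_ac)
  next
    fix t h \<theta> \<theta>' :: real assume h: "0 < h" "h \<le> t" "t + h \<le> 2" and n: "cos \<theta> \<noteq> 1" "cos \<theta>' \<noteq> 1"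
    have p: "0 < 1 - cos \<theta>" "0 < 1 - cos \<theta>'" using cos_lt_imp n by blast+
    let ?f = "\<Delta>\<Theta> \<theta> \<theta>'" and ?S = "1 / (1 - cos \<theta>) + 1 / (1 - cos \<theta>')"
    have I: "set_integrable lborel {0<..<t + h} ?f" using h by (intro Kc_integral) auto
    have i1: "set_integrable lborel {t - h<..<t} ?f" "set_integrable lborel {t<..<t + h} ?f" "set_integrable lborel {0<..<t} ?f"
      by (rule set_integrable_subset[OF I]; use h in auto)+
    have i2: "set_integrable lborel {t - h<..<t} (\<lambda>s. ?f (s + h))" using i1(2) unfolding set_integral_translate(2) by simp
    have "Kc (t + h) \<theta> \<theta>' = Kc t \<theta> \<theta>' + (LINT s:{t<..<t + h}|lborel. ?f s)"
      using set_integral_split[OF I, of t] h by (simp add: Kc_integral)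
    moreover have "Kc t \<theta> \<theta>' = Kc (t - h) \<theta> \<theta>' + (LINT s:{t - h<..<t}|lborel. ?f s)"
      using set_integral_split[OF i1(3), of "t - h"] h by (simp add: Kc_integral)
    moreover have "(LINT s:{t<..<t + h}|lborel. ?f s) = (LINT s:{t - h<..<t}|lborel. ?f (s + h))"
      unfolding set_integral_translate(1) by simp
    \<comment> \<open>A second difference of an integral is the integral, over one time step, of the
      increment of the integrand.\<close>
    ultimately have "Kc (t + h) \<theta> \<theta>' - 2 * Kc t \<theta> \<theta>' + Kc (t - h) \<theta> \<theta>' = (LINT s:{t - h<..<t}|lborel. ?f (s + h)) - (LINT s:{t - h<..<t}|lborel. ?f s)"
      by linarith
    also have "\<dots> = (LINT s:{t - h<..<t}|lborel. ?f (s + h) - ?f s)" by (rule set_integral_diff(2)[OF i2 i1(1), symmetric])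
    finally have e: "Kc (t + h) \<theta> \<theta>' - 2 * Kc t \<theta> \<theta>' + Kc (t - h) \<theta> \<theta>' = (LINT s:{t - h<..<t}|lborel. ?f (s + h) - ?f s)" .
    \<comment> \<open>The majorant \<open>1 / sqrt s\<close> stays integrable if
      \<open>t = h\<close> and the interval starts at \<open>0\<close>, which is the case of lag
      one.\<close>
    have "\<bar>LINT s:{t - h<..<t}|lborel. ?f (s + h) - ?f s\<bar> \<le> (LINT s:{t - h<..<t}|lborel. (C * h * ?S / 2) * (1 / sqrt s))"
    proof (rule set_integral_bound)
      show "set_integrable lborel {t - h<..<t} (\<lambda>s. ?f (s + h) - ?f s)" by (rule set_integral_diff(1)[OF i2 i1(1)])
      show "set_integrable lborel {t - h<..<t} (\<lambda>s. (C * h * ?S / 2) * (1 / sqrt s))"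
        using interval_integral_inverse_sqrt(1)[of "t - h" t] h by (intro set_integrable_mult_right) auto
      fix s assume "s \<in> {t - h<..<t}"
      then have s: "0 < s" "s < s + h" "s + h \<le> 2" using h by auto
      have e: "?f (s + h) - ?f s = ((\<Theta> (s + h) \<theta> - \<Theta> s \<theta>) - (\<Theta> (s + h) \<theta>' - \<Theta> s \<theta>')) / 2" by (simp add: \<Delta>\<Theta>_def diff_divide_distrib)
      have "\<bar>?f (s + h) - ?f s\<bar> \<le> (\<bar>\<Theta> (s + h) \<theta> - \<Theta> s \<theta>\<bar> + \<bar>\<Theta> (s + h) \<theta>' - \<Theta> s \<theta>'\<bar>) / 2" unfolding e by (rule abs_half_diff_le)
      also have "\<dots> \<le> (C * (s + h - s) / sqrt s * (1 / (1 - cos \<theta>)) + C * (s + h - s) / sqrt s * (1 / (1 - cos \<theta>'))) / 2"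
        by (intro divide_right_mono add_mono c2 s n) auto
      also have "\<dots> = (C * h * ?S / 2) * (1 / sqrt s)" by (simp add: algebra_simps add_divide_distrib)
      finally show "\<bar>?f (s + h) - ?f s\<bar> \<le> (C * h * ?S / 2) * (1 / sqrt s)" .
    qed
    also have "\<dots> = (C * h * ?S / 2) * (2 * sqrt t - 2 * sqrt (t - h))"
      using interval_integral_inverse_sqrt(2)[of "t - h" t] h by (subst set_integral_mult_right) simp
    also have "\<dots> \<le> (C * h * ?S / 2) * (2 * (h / sqrt t))"
    proof (rule mult_left_mono)
      have "t - h \<le> sqrt t * sqrt (t - h)"
      proof -
        have "sqrt (t - h) * sqrt (t - h) \<le> sqrt t * sqrt (t - h)" using h by (intro mult_right_mono) auto
        then show ?thesis using h by simp
      qed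
      moreover have "sqrt t * sqrt t = t" using h by simp
      ultimately have "(sqrt t - sqrt (t - h)) * sqrt t \<le> h" unfolding left_diff_distrib mult.commute[of "sqrt (t - h)"] by linarith
      then have "sqrt t - sqrt (t - h) \<le> h / sqrt t" using h by (subst pos_le_divide_eq) auto
      then show "2 * sqrt t - 2 * sqrt (t - h) \<le> 2 * (h / sqrt t)" by simp
      show "0 \<le> C * h * ?S / 2" using C h p by (intro divide_nonneg_pos mult_nonneg_nonneg add_nonneg_nonneg) auto
    qed
    also have "\<dots> = C * (h\<^sup>2 / sqrt t) * ?S" by (simp add: power2_eq_square)
    finally show "\<bar>Kc (t + h) \<theta> \<theta>' - 2 * Kc t \<theta> \<theta>' + Kc (t - h) \<theta> \<theta>'\<bar> \<le> C * (h\<^sup>2 / sqrt t) * ?S" unfolding e .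
  qed
qed

end

section \<open>Toeplitz sums\<close>

text \<open>The distance of \<open>i\<close> and \<open>j\<close>: one of the two truncated
  differences is zero.\<close>

definition lag :: "nat \<Rightarrow> nat \<Rightarrow> nat" where "lag i j = (i - j) + (j - i)"

lemma lag_commute: "lag i j = lag j i" by (simp add: lag_def)
lemma lag_self [simp]: "lag i i = 0" by (simp add: lag_def)

lemma sum_lag_row:
  fixes f :: "nat \<Rightarrow> real"
  assumes "i \<in> {1..n}"
  shows "(\<Sum>j=1..n. f (lag i j)) = f 0 + (\<Sum>r=1..i-1. f r) + (\<Sum>r=1..n-i. f r)"
proof -
  have s: "{1..n} = {1..<i} \<union> {i} \<union> {i<..n}" using assms by auto
  have "(\<Sum>j=1..n. f (lag i j)) = (\<Sum>j\<in>{1..<i}. f (lag i j)) + f (lag i i) + (\<Sum>j\<in>{i<..n}. f (lag i j))"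
    unfolding s by (subst sum.union_disjoint; force)+
  also have "(\<Sum>j\<in>{1..<i}. f (lag i j)) = (\<Sum>r=1..i-1. f r)"
    by (rule sum.reindex_bij_witness[where i="\<lambda>r. i - r" and j="\<lambda>j. i - j"]) (use assms in \<open>auto simp: lag_def\<close>)
  also have "(\<Sum>j\<in>{i<..n}. f (lag i j)) = (\<Sum>r=1..n-i. f r)"
    by (rule sum.reindex_bij_witness[where i="\<lambda>r. i + r" and j="\<lambda>j. j - i"]) (use assms in \<open>auto simp: lag_def\<close>)
  finally show ?thesis by simp
qed

lemma sum_lag_row_le:
  fixes f :: "nat \<Rightarrow> real"
  assumes "i \<in> {1..n}" "\<And>r. 0 \<le> f r"
  shows "(\<Sum>j=1..n. f (lag i j)) \<le> f 0 + 2 * (\<Sum>r=1..n. f r)"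
proof -
  have "(\<Sum>r=1..i-1. f r) \<le> (\<Sum>r=1..n. f r)" "(\<Sum>r=1..n-i. f r) \<le> (\<Sum>r=1..n. f r)"
    using assms by (auto intro!: sum_mono2)
  then show ?thesis unfolding sum_lag_row[OF assms(1)] by simp
qed

lemma sum_anti_row_le:
  fixes f :: "nat \<Rightarrow> real"
  assumes "i \<in> {1..n}" "\<And>r. 0 \<le> f r"
  shows "(\<Sum>j=1..n. f (i + j - 1)) \<le> (\<Sum>r=1..2*n. f r)"
proof -
  have "(\<Sum>j=1..n. f (i + j - 1)) = (\<Sum>r\<in>{i..i+n-1}. f r)"
    by (rule sum.reindex_bij_witness[where i="\<lambda>r. r + 1 - i" and j="\<lambda>j. i + j - 1"]) (use assms in auto)
  also have "\<dots> \<le> (\<Sum>r=1..2*n. f r)" using assms by (intro sum_mono2) auto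
  finally show ?thesis .
qed

text \<open>A lag \<open>r \<ge> 1\<close> occurs \<open>2 (n - r)\<close> times in the square; the
  induction adds the last row and the last column.\<close>

lemma sum_lag_square:
  fixes f :: "nat \<Rightarrow> real"
  shows "(\<Sum>i=1..n. \<Sum>j=1..n. f (lag i j)) = real n * f 0 + 2 * (\<Sum>r=1..n. (real n - real r) * f r)"
proof (induction n)
  case (Suc n)
  have last: "(\<Sum>j=1..n. f (lag (Suc n) j)) = (\<Sum>r=1..n. f r)"
    by (rule sum.reindex_bij_witness[where i="\<lambda>r. Suc n - r" and j="\<lambda>j. Suc n - j"]) (auto simp: lag_def)
  have "(\<Sum>i=1..Suc n. \<Sum>j=1..Suc n. f (lag i j)) = (\<Sum>i=1..n. \<Sum>j=1..n. f (lag i j)) + (\<Sum>i=1..n. f (lag i (Suc n))) + (\<Sum>j=1..n. f (lag (Suc n) j)) + f 0"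
    by (simp add: sum.distrib)
  also have "(\<Sum>i=1..n. f (lag i (Suc n))) = (\<Sum>j=1..n. f (lag (Suc n) j))" by (simp add: lag_commute)
  also have "(\<Sum>i=1..n. \<Sum>j=1..n. f (lag i j)) + (\<Sum>j=1..n. f (lag (Suc n) j)) + (\<Sum>j=1..n. f (lag (Suc n) j)) + f 0
    = real (Suc n) * f 0 + 2 * (\<Sum>r=1..Suc n. (real (Suc n) - real r) * f r)"
    unfolding Suc last by (simp add: algebra_simps sum.distrib sum_subtractf)
  finally show ?case .
qed simp

lemma sum_inverse_sqrt_le: "(\<Sum>i=1..n. 1 / sqrt (real i)) \<le> 2 * sqrt (real n)"
proof (induction n)
  case (Suc n)
  have "1 / sqrt (real (Suc n)) \<le> 2 * (sqrt (real (Suc n)) - sqrt (real n))"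
  proof -
    have p: "0 < sqrt (real (Suc n))" by simp
    have "sqrt (real n) * sqrt (real (Suc n)) \<le> (real n + real (Suc n)) / 2"
      using arith_geo_mean_sqrt[of "real n" "real (Suc n)"] by (simp add: real_sqrt_mult)
    then have "1 \<le> 2 * (sqrt (real (Suc n)) - sqrt (real n)) * sqrt (real (Suc n))" by (simp add: algebra_simps)
    then show ?thesis using p by (simp only: pos_divide_le_eq)
  qed
  then show ?case using Suc by simp
qed simp

text \<open>Convergence along every choice of an index is uniform convergence: it applies in
  particular to the choice \<open>js\<close> of the worst index at each stage, whose error dominates
  that of the average.\<close>

lemma average_tendsto:
  fixes T :: "nat \<Rightarrow> nat \<Rightarrow> real"
  assumes m: "\<And>n. 1 \<le> n \<Longrightarrow> 1 \<le> m n"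
    and T: "\<And>js. (\<And>n. 1 \<le> n \<Longrightarrow> js n \<in> {1..m n}) \<Longrightarrow> (\<lambda>n. T n (js n)) \<longlonglongrightarrow> L"
  shows "(\<lambda>n. (\<Sum>j=1..m n. T n j) / real (m n)) \<longlonglongrightarrow> L"
proof -
  have "\<exists>j. 1 \<le> n \<longrightarrow> j \<in> {1..m n} \<and> (\<forall>i\<in>{1..m n}. \<bar>T n i - L\<bar> \<le> \<bar>T n j - L\<bar>)" for n
  proof (cases "1 \<le> n")
    case True
    then have ne: "{1..m n} \<noteq> {}" using m by auto
    let ?M = "Max ((\<lambda>i. \<bar>T n i - L\<bar>) ` {1..m n})"
    have "?M \<in> (\<lambda>i. \<bar>T n i - L\<bar>) ` {1..m n}" using ne by (intro Max_in) auto
    then obtain j where "j \<in> {1..m n}" "?M = \<bar>T n j - L\<bar>" by auto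
    moreover have "\<bar>T n i - L\<bar> \<le> ?M" if "i \<in> {1..m n}" for i using that by (intro Max_ge) auto
    ultimately show ?thesis by auto
  qed simp
  then obtain js where js: "\<And>n. 1 \<le> n \<Longrightarrow> js n \<in> {1..m n}"
    "\<And>n i. 1 \<le> n \<Longrightarrow> i \<in> {1..m n} \<Longrightarrow> \<bar>T n i - L\<bar> \<le> \<bar>T n (js n) - L\<bar>" by metis
  have "(\<lambda>n. (\<Sum>j=1..m n. T n j) / real (m n) - L) \<longlonglongrightarrow> 0"
  proof (rule Lim_null_comparison)
    show "(\<lambda>n. \<bar>T n (js n) - L\<bar>) \<longlonglongrightarrow> 0" using T[OF js(1)] by (intro tendsto_rabs_zero LIM_zero) auto
    show "\<forall>\<^sub>F n in sequentially. norm ((\<Sum>j=1..m n. T n j) / real (m n) - L) \<le> \<bar>T n (js n) - L\<bar>"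
      using eventually_ge_at_top[of 1]
    proof eventually_elim
      case (elim n)
      have mp: "0 < real (m n)" using m[OF elim] by simp
      have "(\<Sum>j=1..m n. T n j) / real (m n) - L = (\<Sum>j=1..m n. T n j - L) / real (m n)"
        using mp by (simp add: sum_subtractf diff_divide_distrib)
      also have "\<bar>\<dots>\<bar> \<le> (\<Sum>j=1..m n. \<bar>T n (js n) - L\<bar>) / real (m n)"
      proof -
        have "\<bar>\<Sum>j=1..m n. T n j - L\<bar> \<le> (\<Sum>j=1..m n. \<bar>T n (js n) - L\<bar>)"
          by (rule order_trans[OF sum_abs sum_mono]) (rule js(2)[OF elim])
        then have "\<bar>\<Sum>j=1..m n. T n j - L\<bar> / real (m n) \<le> (\<Sum>j=1..m n. \<bar>T n (js n) - L\<bar>) / real (m n)"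
          by (rule divide_right_mono) simp
        then show ?thesis unfolding abs_divide by simp
      qed
      also have "\<dots> = \<bar>T n (js n) - L\<bar>" using mp by simp
      finally show ?case by simp
    qed
  qed
  then show ?thesis by (rule LIM_zero_cancel)
qed

text \<open>The squares split into a Toeplitz part, a Hankel part and a mixed part. Tannery's
  theorem with the majorant \<open>C^2 / r^2\<close> gives the limit of the first, the second is of
  order \<open>1 / sqrt n\<close>, and Cauchy-Schwarz bounds the third by the other two.\<close>

lemma toeplitz_square_tendsto:
  fixes u :: "nat \<Rightarrow> nat \<Rightarrow> real"
  assumes C1: "\<And>n r. 1 \<le> n \<Longrightarrow> 1 \<le> r \<Longrightarrow> real r * \<bar>u n r\<bar> \<le> C" and C0: "\<And>n. 1 \<le> n \<Longrightarrow> \<bar>u n 0\<bar> \<le> C"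
    and C2: "\<And>n N. 1 \<le> n \<Longrightarrow> (\<Sum>r=1..N. \<bar>u n r\<bar>) \<le> C"
    and lim: "\<And>r. (\<lambda>n. u n r) \<longlonglongrightarrow> s r"
  shows "summable (\<lambda>r. (s (Suc r))\<^sup>2)"
    and "(\<lambda>n. (\<Sum>i=1..n. \<Sum>j=1..n. (u n (lag i j) + u n (i + j - 1))\<^sup>2) / real n) \<longlonglongrightarrow> (s 0)\<^sup>2 + 2 * (\<Sum>r. (s (Suc r))\<^sup>2)"
proof -
  have Cp: "0 \<le> C" using C0[of 1] by (meson abs_ge_zero order_trans le_refl)
  \<comment> \<open>The normalised contribution of the lag \<open>Suc r\<close>, continued by zero
    beyond \<open>n\<close>, so that Tannery's theorem applies to a series with varying
    \<open>n\<close>.\<close>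
  let ?a = "\<lambda>r n. (if Suc r \<le> n then (1 - real (Suc r) / real n) * (u n (Suc r))\<^sup>2 else 0)"
  have u2: "\<bar>u n (Suc r)\<bar> \<le> C / real (Suc r)" if "1 \<le> n" for n r
    using C1[OF that, of "Suc r"] by (simp add: pos_le_divide_eq mult.commute)
  have sM: "summable (\<lambda>r. C\<^sup>2 * (1 / (real (Suc r))\<^sup>2))"
    by (intro summable_mult) (use inverse_squares_sums in \<open>auto simp: sums_iff\<close>)
  have bnd: "norm (?a r n) \<le> C\<^sup>2 * (1 / (real (Suc r))\<^sup>2)" if n: "1 \<le> n" for r n
  proof (cases "Suc r \<le> n")
    case True
    have "real (Suc r) / real n \<le> 1" "0 \<le> real (Suc r) / real n" using True by auto
    then have "\<bar>(1 - real (Suc r) / real n) * (u n (Suc r))\<^sup>2\<bar> \<le> 1 * (C / real (Suc r))\<^sup>2"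
      unfolding abs_mult using power_mono[OF u2[OF n, of r] abs_ge_zero, of 2] by (intro mult_mono) auto
    then show ?thesis using True by (simp add: power_divide)
  qed simp
  have alim: "(\<lambda>n. ?a r n) \<longlonglongrightarrow> (s (Suc r))\<^sup>2" for r
  proof -
    have "(\<lambda>n. (1 - real (Suc r) / real n) * (u n (Suc r))\<^sup>2) \<longlonglongrightarrow> (1 - 0) * (s (Suc r))\<^sup>2"
      by (intro tendsto_intros lim)
    moreover have "eventually (\<lambda>n. (1 - real (Suc r) / real n) * (u n (Suc r))\<^sup>2 = ?a r n) sequentially"
      using eventually_ge_at_top[of "Suc r"] by eventually_elim simp
    ultimately show ?thesis by (simp add: Lim_transform_eventually)
  qed
  have ev: "eventually (\<lambda>(r, n). norm (?a r n) \<le> C\<^sup>2 * (1 / (real (Suc r))\<^sup>2)) (at_top \<times>\<^sub>F sequentially)"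
    unfolding eventually_prod_filter
    by (intro exI[of _ "\<lambda>_. True"] exI[of _ "\<lambda>n. 1 \<le> n"] conjI) (use bnd eventually_ge_at_top[of 1] in auto)
  have tan: "summable (\<lambda>r. norm ((s (Suc r))\<^sup>2))" "(\<lambda>n. \<Sum>r. ?a r n) \<longlonglongrightarrow> (\<Sum>r. (s (Suc r))\<^sup>2)"
    using tannerys_theorem[where a="\<lambda>r n. ?a r n" and b="\<lambda>r. (s (Suc r))\<^sup>2", OF alim ev sM] by auto
  show "summable (\<lambda>r. (s (Suc r))\<^sup>2)" using tan(1) by simp
  define A where "A n = (\<Sum>i=1..n. \<Sum>j=1..n. (u n (lag i j))\<^sup>2) / real n" for n
  define B where "B n = (\<Sum>i=1..n. \<Sum>j=1..n. (u n (i + j - 1))\<^sup>2) / real n" for n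
  define X where "X n = (\<Sum>i=1..n. \<Sum>j=1..n. u n (lag i j) * u n (i + j - 1)) / real n" for n
  have Aeq: "A n = (u n 0)\<^sup>2 + 2 * (\<Sum>r. ?a r n)" if n: "1 \<le> n" for n
  proof -
    have "(\<Sum>r. ?a r n) = (\<Sum>r<n. ?a r n)" by (rule suminf_finite) auto
    also have "\<dots> = (\<Sum>r=1..n. (1 - real r / real n) * (u n r)\<^sup>2)" by (simp add: sum.atLeast1_atMost_eq)
    also have "\<dots> = (\<Sum>r=1..n. (real n - real r) * (u n r)\<^sup>2) / real n"
      unfolding sum_divide_distrib using n by (intro sum.cong refl) (simp add: field_simps)
    finally show ?thesis unfolding A_def sum_lag_square[of "\<lambda>r. (u n r)\<^sup>2"] using n by (simp add: add_divide_distrib)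
  qed
  have "(\<lambda>n. (u n 0)\<^sup>2 + 2 * (\<Sum>r. ?a r n)) \<longlonglongrightarrow> (s 0)\<^sup>2 + 2 * (\<Sum>r. (s (Suc r))\<^sup>2)" by (intro tendsto_intros lim tan)
  moreover have "eventually (\<lambda>n. (u n 0)\<^sup>2 + 2 * (\<Sum>r. ?a r n) = A n) sequentially"
    using eventually_ge_at_top[of 1] by eventually_elim (simp add: Aeq)
  ultimately have Al: "A \<longlonglongrightarrow> (s 0)\<^sup>2 + 2 * (\<Sum>r. (s (Suc r))\<^sup>2)" by (rule Lim_transform_eventually)
  have A0: "0 \<le> A n" "0 \<le> B n" for n by (auto simp: A_def B_def intro!: divide_nonneg_nonneg sum_nonneg)
  have Bl: "B \<longlonglongrightarrow> 0"
  proof (rule tendsto_sandwich[where f="\<lambda>_. 0"])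
    show "\<forall>\<^sub>F n in sequentially. B n \<le> C\<^sup>2 * (2 * sqrt (real n)) / real n" using eventually_ge_at_top[of 1]
    proof eventually_elim
      case (elim n)
      have "(\<Sum>i=1..n. \<Sum>j=1..n. (u n (i + j - 1))\<^sup>2) \<le> (\<Sum>i=1..n. C\<^sup>2 * (1 / sqrt (real i)))"
      proof (rule sum_mono)
        fix i assume i: "i \<in> {1..n}"
        \<comment> \<open>One factor is bounded by the decay in the index, weakened from
          \<open>C / i\<close> to \<open>C / sqrt i\<close>, and the other is summed over the
          row.\<close>
        have "(\<Sum>j=1..n. (u n (i + j - 1))\<^sup>2) \<le> (\<Sum>j=1..n. (C / sqrt (real i)) * \<bar>u n (i + j - 1)\<bar>)"
        proof (rule sum_mono)
          fix j assume j: "j \<in> {1..n}"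
          let ?r = "i + j - 1"
          have r: "i \<le> ?r" "1 \<le> ?r" using i j by auto
          have "real i * \<bar>u n ?r\<bar> \<le> real ?r * \<bar>u n ?r\<bar>" using r by (intro mult_right_mono) auto
          then have "real i * \<bar>u n ?r\<bar> \<le> C" using C1[OF elim r(2)] by linarith
          moreover have "sqrt (real i) \<le> real i" using i by (simp add: real_le_lsqrt self_le_power power2_eq_square)
          then have "sqrt (real i) * \<bar>u n ?r\<bar> \<le> real i * \<bar>u n ?r\<bar>" by (intro mult_right_mono) auto
          ultimately have "\<bar>u n ?r\<bar> \<le> C / sqrt (real i)" using i by (simp add: pos_le_divide_eq mult.commute)
          then have "\<bar>u n ?r\<bar> * \<bar>u n ?r\<bar> \<le> (C / sqrt (real i)) * \<bar>u n ?r\<bar>" by (intro mult_right_mono) auto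
          then show "(u n ?r)\<^sup>2 \<le> (C / sqrt (real i)) * \<bar>u n ?r\<bar>" by (simp add: power2_eq_square abs_mult[symmetric])
        qed
        also have "\<dots> = (C / sqrt (real i)) * (\<Sum>j=1..n. \<bar>u n (i + j - 1)\<bar>)" by (simp add: sum_distrib_left)
        also have "\<dots> \<le> (C / sqrt (real i)) * C"
          using sum_anti_row_le[OF i, of "\<lambda>r. \<bar>u n r\<bar>"] C2[OF elim, of "2 * n"] Cp by (intro mult_left_mono) auto
        finally show "(\<Sum>j=1..n. (u n (i + j - 1))\<^sup>2) \<le> C\<^sup>2 * (1 / sqrt (real i))" by (simp add: power2_eq_square)
      qed
      also have "\<dots> = C\<^sup>2 * (\<Sum>i=1..n. 1 / sqrt (real i))" by (simp add: sum_distrib_left)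
      also have "\<dots> \<le> C\<^sup>2 * (2 * sqrt (real n))" by (intro mult_left_mono sum_inverse_sqrt_le) auto
      finally show ?case unfolding B_def by (intro divide_right_mono) auto
    qed
    have "(\<lambda>n. sqrt (real n) / real n) \<longlonglongrightarrow> 0" by real_asymp
    then have "(\<lambda>n. C\<^sup>2 * 2 * (sqrt (real n) / real n)) \<longlonglongrightarrow> C\<^sup>2 * 2 * 0" by (intro tendsto_intros)
    then show "(\<lambda>n. C\<^sup>2 * (2 * sqrt (real n)) / real n) \<longlonglongrightarrow> 0" by (simp add: mult.assoc)
  qed (use A0 in auto)
  have Xb: "\<bar>X n\<bar> \<le> sqrt (A n) * sqrt (B n)" for n
  proof -
    let ?P = "{1..n} \<times> {1..n}"
    have "(\<Sum>p\<in>?P. u n (lag (fst p) (snd p)) * u n (fst p + snd p - 1))\<^sup>2 \<le> (\<Sum>p\<in>?P. (u n (lag (fst p) (snd p)))\<^sup>2) * (\<Sum>p\<in>?P. (u n (fst p + snd p - 1))\<^sup>2)"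
      by (rule Cauchy_Schwarz_ineq_sum)
    then have "(X n)\<^sup>2 \<le> A n * B n"
      unfolding X_def A_def B_def by (simp add: sum.cartesian_product case_prod_unfold power_divide power2_eq_square divide_right_mono)
    then have "sqrt ((X n)\<^sup>2) \<le> sqrt (A n * B n)" by (rule real_sqrt_le_mono)
    then show ?thesis by (simp add: real_sqrt_mult)
  qed
  have "(\<lambda>n. sqrt (A n) * sqrt (B n)) \<longlonglongrightarrow> sqrt ((s 0)\<^sup>2 + 2 * (\<Sum>r. (s (Suc r))\<^sup>2)) * sqrt 0" by (intro tendsto_intros Al Bl)
  then have "(\<lambda>n. sqrt (A n) * sqrt (B n)) \<longlonglongrightarrow> 0" by simp
  then have Xl: "X \<longlonglongrightarrow> 0" by (rule Lim_null_comparison[rotated]) (use Xb in \<open>auto intro: always_eventually\<close>)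
  have "(\<lambda>n. A n + B n + 2 * X n) \<longlonglongrightarrow> ((s 0)\<^sup>2 + 2 * (\<Sum>r. (s (Suc r))\<^sup>2)) + 0 + 2 * 0" by (intro tendsto_intros Al Bl Xl)
  moreover have "A n + B n + 2 * X n = (\<Sum>i=1..n. \<Sum>j=1..n. (u n (lag i j) + u n (i + j - 1))\<^sup>2) / real n" for n
    unfolding A_def B_def X_def power2_sum by (simp add: sum.distrib add_divide_distrib sum_distrib_left mult.assoc)
  ultimately show "(\<lambda>n. (\<Sum>i=1..n. \<Sum>j=1..n. (u n (lag i j) + u n (i + j - 1))\<^sup>2) / real n) \<longlonglongrightarrow> (s 0)\<^sup>2 + 2 * (\<Sum>r. (s (Suc r))\<^sup>2)"
    by simp
qed

section \<open>Second differences in time\<close>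

context positive_theta_series
begin

text \<open>The second difference of the even extension of \<open>Kc\<close> in time: at
  \<open>r = 0\<close> the lag \<open>- 1\<close> is read as \<open>1\<close>. The weights
  \<open>sw\<close> follow the same convention.\<close>

definition S :: "real \<Rightarrow> nat \<Rightarrow> real \<Rightarrow> real \<Rightarrow> real" where
  "S h r \<theta> \<theta>' = Kc (real (Suc r) * h) \<theta> \<theta>' - 2 * Kc (real r * h) \<theta> \<theta>' + Kc (real (if r = 0 then 1 else r - 1) * h) \<theta> \<theta>'"

lemma Kc_0 [simp]: "Kc 0 \<theta> \<theta>' = 0" by (simp add: Kc_def wk_def)

lemma S_0: "S h 0 \<theta> \<theta>' = 2 * Kc h \<theta> \<theta>'" by (simp add: S_def)

definition sw :: "real \<Rightarrow> nat \<Rightarrow> nat \<Rightarrow> real" where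
  "sw h r k = wk (real (Suc r) * h) k - 2 * wk (real r * h) k + wk (real (if r = 0 then 1 else r - 1) * h) k"

lemma S_series: assumes "0 \<le> h"
  shows "summable (\<lambda>k. sw h r (Suc k) * (cos (real (Suc k) * \<theta>) - cos (real (Suc k) * \<theta>')))"
    "S h r \<theta> \<theta>' = (\<Sum>k. sw h r (Suc k) * (cos (real (Suc k) * \<theta>) - cos (real (Suc k) * \<theta>')))"
proof -
  let ?d = "\<lambda>k. cos (real (Suc k) * \<theta>) - cos (real (Suc k) * \<theta>')"
  have s: "(\<lambda>k. wk t (Suc k) * ?d k) sums Kc t \<theta> \<theta>'" if "0 \<le> t" for t
    using Kc_summable[OF that, of \<theta> \<theta>'] unfolding Kc_def by (rule summable_sums)
  have "(\<lambda>k. wk (real (Suc r) * h) (Suc k) * ?d k - 2 * (wk (real r * h) (Suc k) * ?d k) + wk (real (if r = 0 then 1 else r - 1) * h) (Suc k) * ?d k) sums S h r \<theta> \<theta>'"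
    unfolding S_def by (intro sums_add sums_diff sums_mult s mult_nonneg_nonneg assms) auto
  moreover have "(\<lambda>k. wk (real (Suc r) * h) (Suc k) * ?d k - 2 * (wk (real r * h) (Suc k) * ?d k) + wk (real (if r = 0 then 1 else r - 1) * h) (Suc k) * ?d k)
     = (\<lambda>k. sw h r (Suc k) * ?d k)" by (simp add: sw_def fun_eq_iff algebra_simps)
  ultimately have "(\<lambda>k. sw h r (Suc k) * ?d k) sums S h r \<theta> \<theta>'" by simp
  then show "summable (\<lambda>k. sw h r (Suc k) * ?d k)" "S h r \<theta> \<theta>' = (\<Sum>k. sw h r (Suc k) * ?d k)" by (auto simp: sums_iff)
qed

text \<open>With \<open>q = exp (- lam k * h)\<close>, the second difference of
  \<open>1 - q^r\<close> is \<open>- (1 - q)^2 q^(r - 1)\<close>. It is nonpositive and its absolute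
  value decreases in \<open>r\<close>; \<open>diag_S\<close> rests on these two facts.\<close>

lemma sw_eq: assumes "1 \<le> k" "1 \<le> r"
  shows "sw h r k = - ((1 - exp (- lam (real k) * h))\<^sup>2 * exp (- lam (real k) * h) ^ (r - 1) / lam (real k))"
proof -
  define q where "q = exp (- lam (real k) * h)"
  have e: "exp (- lam (real k) * (real j * h)) = q ^ j" for j
    unfolding q_def by (simp add: mult_ac flip: exp_of_nat_mult)
  obtain r' where r': "r = Suc r'" using assms by (cases r) auto
  have l: "lam (real k) \<noteq> 0" using lam_pos[OF assms(1)] by simp
  have "sw h r k = ((1 - q ^ Suc r) - 2 * (1 - q ^ r) + (1 - q ^ (r - 1))) / lam (real k)"
    unfolding sw_def wk_def e using assms by (simp add: diff_divide_distrib add_divide_distrib)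
  also have "(1 - q ^ Suc r) - 2 * (1 - q ^ r) + (1 - q ^ (r - 1)) = - ((1 - q)\<^sup>2 * q ^ (r - 1))"
    unfolding r' by (simp add: power2_eq_square algebra_simps)
  finally show ?thesis unfolding q_def by simp
qed

lemma diag_mono: assumes "0 \<le> t" "t \<le> t'" shows "Kc t 0 \<theta>' \<le> Kc t' 0 \<theta>'"
proof -
  have "wk t (Suc k) * (cos (real (Suc k) * 0) - cos (real (Suc k) * \<theta>')) \<le> wk t' (Suc k) * (cos (real (Suc k) * 0) - cos (real (Suc k) * \<theta>'))" for k
  proof (rule mult_right_mono)
    have p: "0 < lam (real (Suc k))" by (rule lam_pos) simp
    show "wk t (Suc k) \<le> wk t' (Suc k)" unfolding wk_def using p assms by (intro divide_right_mono) auto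
  qed simp
  then show ?thesis unfolding Kc_def using assms by (intro suminf_le Kc_summable) auto
qed

text \<open>At the angle \<open>0\<close> the weights \<open>1 - cos\<close> are nonnegative, so
  sign and monotonicity pass from \<open>sw\<close> to \<open>S\<close>. The sign makes the sum of
  absolute values telescope; monotonicity bounds \<open>r\<close> times the term at \<open>r\<close>
  by the sum of the first \<open>r\<close> terms.\<close>

lemma diag_S: assumes h: "0 < h"
  shows "1 \<le> r \<Longrightarrow> S h r 0 \<theta>' \<le> 0" "1 \<le> r \<Longrightarrow> - S h (Suc r) 0 \<theta>' \<le> - S h r 0 \<theta>'"
    "(\<Sum>r=1..N. \<bar>S h r 0 \<theta>'\<bar>) \<le> Kc h 0 \<theta>'" "1 \<le> r \<Longrightarrow> real r * \<bar>S h r 0 \<theta>'\<bar> \<le> Kc h 0 \<theta>'"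
proof -
  have h0: "0 \<le> h" using h by simp
  let ?d = "\<lambda>k. cos (real (Suc k) * 0) - cos (real (Suc k) * \<theta>')"
  have q: "0 \<le> exp (- lam (real (Suc k)) * h)" "exp (- lam (real (Suc k)) * h) \<le> 1" "0 < lam (real (Suc k))" for k
    using lam_pos[of "Suc k"] h by auto
  have neg: "S h r 0 \<theta>' \<le> 0" if "1 \<le> r" for r
  proof -
    have "(\<Sum>k. sw h r (Suc k) * ?d k) \<le> (\<Sum>k. 0)"
    proof (rule suminf_le[OF _ S_series(1)[OF h0] summable_zero])
      fix k
      have "sw h r (Suc k) \<le> 0" unfolding sw_eq[OF _ that, of "Suc k", simplified] using q[of k] by simp
      then show "sw h r (Suc k) * ?d k \<le> 0" by (intro mult_nonpos_nonneg) auto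
    qed
    then show ?thesis unfolding S_series(2)[OF h0] by simp
  qed
  then show "1 \<le> r \<Longrightarrow> S h r 0 \<theta>' \<le> 0" .
  have dec: "- S h (Suc r) 0 \<theta>' \<le> - S h r 0 \<theta>'" if "1 \<le> r" for r
  proof -
    have "(\<Sum>k. sw h r (Suc k) * ?d k) \<le> (\<Sum>k. sw h (Suc r) (Suc k) * ?d k)"
    proof (rule suminf_le[OF _ S_series(1)[OF h0] S_series(1)[OF h0]])
      fix k
      let ?q = "exp (- lam (real (Suc k)) * h)"
      have "?q ^ (Suc r - 1) \<le> ?q ^ (r - 1)" using q[of k] by (intro power_decreasing) auto
      then have "(1 - ?q)\<^sup>2 * ?q ^ (Suc r - 1) / lam (real (Suc k)) \<le> (1 - ?q)\<^sup>2 * ?q ^ (r - 1) / lam (real (Suc k))"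
        using q[of k] by (intro divide_right_mono mult_left_mono) auto
      then have "sw h r (Suc k) \<le> sw h (Suc r) (Suc k)"
        unfolding sw_eq[of "Suc k" r h, OF _ that, simplified] sw_eq[of "Suc k" "Suc r" h, simplified] by simp
      then show "sw h r (Suc k) * ?d k \<le> sw h (Suc r) (Suc k) * ?d k" by (intro mult_right_mono) auto
    qed
    then show ?thesis unfolding S_series(2)[OF h0] by simp
  qed
  then show "1 \<le> r \<Longrightarrow> - S h (Suc r) 0 \<theta>' \<le> - S h r 0 \<theta>'" .
  have tel: "(\<Sum>r=1..N. S h r 0 \<theta>') = Kc (real (Suc N) * h) 0 \<theta>' - Kc (real N * h) 0 \<theta>' - Kc h 0 \<theta>'" for N
    by (induction N) (auto simp: S_def)
  have sm: "(\<Sum>r=1..N. \<bar>S h r 0 \<theta>'\<bar>) \<le> Kc h 0 \<theta>'" for N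
  proof -
    have "(\<Sum>r=1..N. \<bar>S h r 0 \<theta>'\<bar>) = - (\<Sum>r=1..N. S h r 0 \<theta>')"
      unfolding sum_negf[symmetric] using neg by (intro sum.cong refl) auto
    moreover have "Kc (real N * h) 0 \<theta>' \<le> Kc (real (Suc N) * h) 0 \<theta>'" using h by (intro diag_mono mult_right_mono) auto
    ultimately show ?thesis unfolding tel by simp
  qed
  then show "(\<Sum>r=1..N. \<bar>S h r 0 \<theta>'\<bar>) \<le> Kc h 0 \<theta>'" .
  show "real r * \<bar>S h r 0 \<theta>'\<bar> \<le> Kc h 0 \<theta>'" if r: "1 \<le> r"
  proof -
    have anti: "\<bar>S h r 0 \<theta>'\<bar> \<le> \<bar>S h j 0 \<theta>'\<bar>" if "1 \<le> j" "j \<le> r" for j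
      using that(2,1)
    proof (induction r rule: dec_induct)
      case (step i) then show ?case using dec[of i] neg[of i] neg[of "Suc i"] by auto
    qed simp
    have "real r * \<bar>S h r 0 \<theta>'\<bar> = (\<Sum>j=1..r. \<bar>S h r 0 \<theta>'\<bar>)" by simp
    also have "\<dots> \<le> (\<Sum>j=1..r. \<bar>S h j 0 \<theta>'\<bar>)" using anti by (intro sum_mono) auto
    also have "\<dots> \<le> Kc h 0 \<theta>'" by (rule sm)
    finally show ?thesis .
  qed
qed

lemma diag_Kc_bound: "\<exists>C>0. \<forall>t \<theta>'. 0 < t \<longrightarrow> 0 \<le> Kc t 0 \<theta>' \<and> Kc t 0 \<theta>' \<le> C * sqrt t"
proof -
  obtain C where C: "C > 0" "\<And>t N. 0 < t \<Longrightarrow> (\<Sum>k=1..N. wk t k) \<le> C * sqrt t" using sum_wk_bound by blast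
  show ?thesis
  proof (intro exI[of _ "2 * C"] conjI allI impI)
    show "0 < 2 * C" using C by simp
    fix t \<theta>' :: real assume t: "0 < t"
    then have t0: "0 \<le> t" by simp
    show "0 \<le> Kc t 0 \<theta>'" using diag_mono[of 0 t \<theta>'] t by simp
    show "Kc t 0 \<theta>' \<le> 2 * C * sqrt t" unfolding Kc_def
    proof (rule suminf_le_const[OF Kc_summable[OF t0]])
      fix N
      have "(\<Sum>k<N. wk t (Suc k) * (cos (real (Suc k) * 0) - cos (real (Suc k) * \<theta>'))) \<le> (\<Sum>k<N. wk t (Suc k) * 2)"
      proof (intro sum_mono mult_left_mono)
        fix k
        show "cos (real (Suc k) * 0) - cos (real (Suc k) * \<theta>') \<le> 2" using cos_ge_minus_one[of "real (Suc k) * \<theta>'"] by simp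
        show "0 \<le> wk t (Suc k)" using wk_bounds(1)[of "Suc k" t] t by simp
      qed
      also have "\<dots> = 2 * (\<Sum>k=1..N. wk t k)" by (simp add: sum.atLeast1_atMost_eq sum_distrib_left mult.commute)
      also have "\<dots> \<le> 2 * C * sqrt t" using C(2)[OF t, of N] by simp
      finally show "(\<Sum>k<N. wk t (Suc k) * (cos (real (Suc k) * 0) - cos (real (Suc k) * \<theta>'))) \<le> 2 * C * sqrt t" .
    qed
  qed
qed

text \<open>\<open>Kc\<close> at time \<open>j / n\<close> equals \<open>sqrt (pi j / (a n))\<close>
  up to order \<open>n^(-3/2)\<close>, uniformly in the angles that \<open>\<kappa>\<close> admits.
  The limit is \<open>1\<close> at \<open>r = 0\<close> and \<open>- I_coeff (r - 1) / 2\<close> at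
  \<open>r \<ge> 1\<close>.\<close>

lemma diag_S_limit:
  assumes \<kappa>: "0 < \<kappa>" "\<And>n. 1 \<le> n \<Longrightarrow> \<kappa> \<le> 1 - cos (\<theta>' n)"
  shows "(\<lambda>n. sqrt (a / pi) / 2 * S (1 / real n) r 0 (\<theta>' n) * sqrt (real n)) \<longlonglongrightarrow>
    (sqrt (real (Suc r)) - 2 * sqrt (real r) + sqrt (real (if r = 0 then 1 else r - 1))) / 2"
proof -
  obtain C where C: "C > 0" and b: "\<And>t \<theta>'. 0 < t \<Longrightarrow> t \<le> 2 \<Longrightarrow> cos \<theta>' \<noteq> 1 \<Longrightarrow> \<bar>Kc t 0 \<theta>' - sqrt (pi * t / a)\<bar> \<le> C * (t * sqrt t) * (1 + 1 / (1 - cos \<theta>'))"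
    using Kc_bounds by metis
  have K: "(\<lambda>n. sqrt (a / pi) * Kc (real j * (1 / real n)) 0 (\<theta>' n) * sqrt (real n)) \<longlonglongrightarrow> sqrt (real j)" for j
  proof -
    let ?D = "sqrt (a / pi) * C * (real j * sqrt (real j)) * (1 + 1 / \<kappa>)"
    have "(\<lambda>n. sqrt (a / pi) * Kc (real j * (1 / real n)) 0 (\<theta>' n) * sqrt (real n) - sqrt (real j)) \<longlonglongrightarrow> 0"
    proof (rule Lim_null_comparison)
      have "(\<lambda>n. 1 / real n) \<longlonglongrightarrow> 0" by real_asymp
      then show "(\<lambda>n. ?D * (1 / real n)) \<longlonglongrightarrow> 0" by (rule tendsto_mult_right_zero)
      show "\<forall>\<^sub>F n in sequentially. norm (sqrt (a / pi) * Kc (real j * (1 / real n)) 0 (\<theta>' n) * sqrt (real n) - sqrt (real j)) \<le> ?D * (1 / real n)"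
        using eventually_ge_at_top[of "max 1 j"]
      proof eventually_elim
        case (elim n)
        then have n: "1 \<le> n" "j \<le> n" by auto
        have np: "0 < real n" using n by simp
        show ?case
        proof (cases "j = 0")
          case False
          let ?t = "real j * (1 / real n)"
          have t: "0 < ?t" "?t \<le> 2" using False n by (auto simp: divide_simps)
          have c: "cos (\<theta>' n) \<noteq> 1" "\<kappa> \<le> 1 - cos (\<theta>' n)" using \<kappa>(2)[OF n(1)] \<kappa>(1) by auto
          have e1: "sqrt (a / pi) * sqrt (pi * ?t / a) * sqrt (real n) = sqrt (real j)"
            using np a_pos by (simp add: real_sqrt_mult real_sqrt_divide)
          have e2: "?t * sqrt ?t * sqrt (real n) = real j * sqrt (real j) * (1 / real n)"
            using np by (simp add: real_sqrt_mult real_sqrt_divide)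
          have "sqrt (a / pi) * Kc ?t 0 (\<theta>' n) * sqrt (real n) - sqrt (real j) = sqrt (a / pi) * (Kc ?t 0 (\<theta>' n) - sqrt (pi * ?t / a)) * sqrt (real n)"
            unfolding e1[symmetric] by (simp add: algebra_simps)
          also have "\<bar>\<dots>\<bar> = sqrt (a / pi) * \<bar>Kc ?t 0 (\<theta>' n) - sqrt (pi * ?t / a)\<bar> * sqrt (real n)"
            using a_pos by (simp add: abs_mult)
          also have "\<dots> \<le> sqrt (a / pi) * (C * (?t * sqrt ?t) * (1 + 1 / (1 - cos (\<theta>' n)))) * sqrt (real n)"
            using a_pos by (intro mult_right_mono mult_left_mono b t c) auto
          also have "\<dots> \<le> sqrt (a / pi) * (C * (?t * sqrt ?t) * (1 + 1 / \<kappa>)) * sqrt (real n)"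
          proof (intro mult_right_mono mult_left_mono add_left_mono)
            show "1 / (1 - cos (\<theta>' n)) \<le> 1 / \<kappa>" using c \<kappa>(1) by (intro divide_left_mono mult_pos_pos) auto
          qed (use C a_pos t in auto)
          also have "\<dots> = sqrt (a / pi) * C * (1 + 1 / \<kappa>) * (?t * sqrt ?t * sqrt (real n))" by (simp only: mult_ac)
          also have "\<dots> = ?D * (1 / real n)" unfolding e2 by (simp only: mult_ac)
          finally show ?thesis by simp
        qed simp
      qed
    qed
    then show ?thesis by (rule LIM_zero_cancel)
  qed
  define j where "j = (if r = 0 then 1 else r - 1)"
  let ?F = "\<lambda>n. (sqrt (a / pi) * Kc (real (Suc r) * (1 / real n)) 0 (\<theta>' n) * sqrt (real n) - 2 * (sqrt (a / pi) * Kc (real r * (1 / real n)) 0 (\<theta>' n) * sqrt (real n))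
      + sqrt (a / pi) * Kc (real j * (1 / real n)) 0 (\<theta>' n) * sqrt (real n)) / 2"
  have F: "?F \<longlonglongrightarrow> (sqrt (real (Suc r)) - 2 * sqrt (real r) + sqrt (real j)) / 2"
    by (intro tendsto_intros K) simp
  have "?F = (\<lambda>n. sqrt (a / pi) / 2 * S (1 / real n) r 0 (\<theta>' n) * sqrt (real n))"
    unfolding S_def j_def[symmetric] by (rule ext) (simp add: algebra_simps add_divide_distrib diff_divide_distrib)
  with F show ?thesis unfolding j_def[symmetric] by (simp only:)
qed

end

section \<open>Covariances at the observation points\<close>

lemma sin_ge_half: assumes "0 \<le> x" "x \<le> pi / 2" shows "x / 2 \<le> sin (x::real)"
proof -
  have "\<bar>sin x - (\<Sum>m<3. sin_coeff m * x ^ m)\<bar> \<le> inverse (fact 3) * \<bar>x\<bar> ^ 3" by (rule Maclaurin_sin_bound)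
  moreover have "(\<Sum>m<3. sin_coeff m * x ^ m) = x" by (simp add: numeral_3_eq_3 sin_coeff_def)
  moreover have "inverse (fact 3) * \<bar>x\<bar> ^ 3 = x^3 / 6" using assms by (simp add: fact_numeral)
  ultimately have 1: "x - x^3 / 6 \<le> sin x" by linarith
  have "x \<le> 1.6" using assms pi_approx(2) by simp
  then have "x^2 \<le> 1.6^2" using assms by (intro power_mono) auto
  then have "x * (x^2) \<le> x * 3" using assms by (intro mult_left_mono) (auto simp: power2_eq_square)
  then have "x^3 / 6 \<le> x / 2" by (simp add: power2_eq_square power3_eq_cube)
  then show ?thesis using 1 by linarith
qed

text \<open>The half angle formula with \<open>sin x \<ge> x / 2\<close> and \<open>pi > 3\<close>;
  it turns distances between observation points into lower bounds for
  \<open>1 - cos\<close>.\<close>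

lemma one_minus_cos_pi_ge: assumes "0 \<le> d" "d \<le> 1" shows "d\<^sup>2 \<le> 1 - cos (pi * d)"
proof -
  have "pi * d / 2 / 2 \<le> sin (pi * d / 2)" using assms by (intro sin_ge_half) auto
  moreover have "3 * d / 4 \<le> pi * d / 2 / 2" using assms pi_gt3 by (simp add: mult_right_mono)
  ultimately have "(3 * d / 4)\<^sup>2 \<le> (sin (pi * d / 2))\<^sup>2" using assms by (intro power_mono) auto
  moreover have "cos (pi * d) = 1 - 2 * (sin (pi * d / 2))\<^sup>2" using cos_double_sin[of "pi * d / 2"] by simp
  ultimately have "2 * (9 / 16 * d\<^sup>2) \<le> 1 - cos (pi * d)" by (simp add: power_mult_distrib power_divide)
  moreover have "0 \<le> d\<^sup>2" by (rule zero_le_power2)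
  ultimately show ?thesis by argo
qed

lemma sum_inverse_squares_le: "(\<Sum>l=1..m. 1 / (real l)\<^sup>2) \<le> 2"
proof (cases "m = 0")
  case False
  then have "1 \<le> m" by simp
  then have "(\<Sum>l=1..m. 1 / (real l)\<^sup>2) \<le> 2 - 1 / real m"
  proof (induction m rule: dec_induct)
    case (step m)
    have "1 / (real (Suc m))\<^sup>2 \<le> 1 / real m - 1 / real (Suc m)"
    proof -
      have "1 / real m - 1 / real (Suc m) = 1 / (real m * real (Suc m))" using step by (simp add: field_simps)
      moreover have "1 / (real (Suc m) * real (Suc m)) \<le> 1 / (real m * real (Suc m))"
        using step by (intro divide_left_mono mult_right_mono mult_pos_pos) auto
      ultimately show ?thesis by (simp add: power2_eq_square)
    qed
    then show ?case using step by simp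
  qed simp
  moreover have "0 \<le> 1 / real m" by simp
  ultimately show ?thesis by linarith
qed simp

lemma sum_inverse_le_ln: assumes "1 \<le> N" shows "(\<Sum>r=1..N. 1 / real r) \<le> 1 + ln (real N)"
  using assms
proof (induction N rule: dec_induct)
  case (step N)
  have "ln (real N / real (Suc N)) \<le> real N / real (Suc N) - 1" using step by (intro ln_le_minus_one) auto
  also have "\<dots> = - (1 / real (Suc N))" by (simp add: field_simps)
  finally have "1 / real (Suc N) \<le> ln (real (Suc N)) - ln (real N)" using step by (simp add: ln_div)
  then show ?case using step by simp
qed simp

text \<open>\<open>I_coeff r\<close> is the decrement of \<open>sqrt (r + 1) - sqrt r\<close>, a
  decreasing sequence with values in \<open>{0..1}\<close>. So its square is at most itself, and the
  sum telescopes.\<close>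

lemma I_coeff_square_summable: "summable (\<lambda>r. (I_coeff r)\<^sup>2)"
proof (rule summableI_nonneg_bounded)
  let ?d = "\<lambda>r. sqrt (real (Suc r)) - sqrt (real r)"
  have I: "I_coeff r = ?d r - ?d (Suc r)" for r by (simp add: I_coeff_def algebra_simps)
  have d0: "0 \<le> ?d r" for r by simp
  have d1: "?d r \<le> 1" for r
  proof -
    have "sqrt (real (Suc r)) \<le> sqrt (real r) + 1" by (rule real_le_lsqrt) (auto simp: power2_sum)
    then show ?thesis by simp
  qed
  have dec: "?d (Suc r) \<le> ?d r" for r
  proof -
    have e: "?d k = 1 / (sqrt (real (Suc k)) + sqrt (real k))" for k
    proof -
      have "(sqrt (real (Suc k)) - sqrt (real k)) * (sqrt (real (Suc k)) + sqrt (real k)) = 1" by (simp add: algebra_simps)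
      moreover have "0 < sqrt (real (Suc k)) + sqrt (real k)" by (intro add_pos_nonneg) auto
      ultimately show ?thesis by (simp add: eq_divide_eq)
    qed
    show ?thesis unfolding e by (intro divide_left_mono add_mono mult_pos_pos add_pos_nonneg) auto
  qed
  have "(I_coeff r)\<^sup>2 \<le> ?d r - ?d (Suc r)" for r
  proof -
    have "0 \<le> I_coeff r" "I_coeff r \<le> 1" unfolding I using dec[of r] d0[of "Suc r"] d1[of r] by linarith+
    then have "I_coeff r * I_coeff r \<le> I_coeff r * 1" by (intro mult_left_mono)
    then show ?thesis using I[of r] by (simp add: power2_eq_square)
  qed
  then have "(\<Sum>r<n. (I_coeff r)\<^sup>2) \<le> (\<Sum>r<n. ?d r - ?d (Suc r))" for n by (rule sum_mono)
  then show "(\<Sum>r<n. (I_coeff r)\<^sup>2) \<le> 1" for n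
    unfolding sum_lessThan_telescope'[of ?d] by (rule order_trans) (use d0[of n] d1[of 0] in linarith)
qed simp

text \<open>The gaps between neighbours add up, so the spacing condition bounds the distance of any
  two points from below by a multiple of their lag divided by \<open>m\<close>.\<close>

lemma observation_scheme_points:
  assumes "observation_scheme m y \<delta>"
  shows "\<exists>c. 0 < c \<and> 0 < \<delta> \<and> (\<forall>n\<ge>1. 1 \<le> m n \<and>
    (\<forall>j\<in>{1..m n}. \<delta> \<le> y n j \<and> y n j \<le> 1 - \<delta>) \<and>
    (\<forall>i\<in>{1..m n}. \<forall>j\<in>{1..m n}. c * real (lag i j) \<le> real (m n) * \<bar>y n i - y n j\<bar>))"
proof -
  obtain c where c: "c > 0" and gap: "\<And>n j. 1 \<le> n \<Longrightarrow> j \<in> {2..m n} \<Longrightarrow> c \<le> real (m n) * \<bar>y n j - y n (j - 1)\<bar>"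
    using assms unfolding observation_scheme_def by blast
  have d: "0 < \<delta>" and m1: "\<And>n. 1 \<le> n \<Longrightarrow> 1 \<le> m n" and e: "\<And>n. 1 \<le> n \<Longrightarrow> \<delta> \<le> y n 1" "\<And>n. 1 \<le> n \<Longrightarrow> y n (m n) \<le> 1 - \<delta>"
    and inc: "\<And>n j. 1 \<le> n \<Longrightarrow> j \<in> {2..m n} \<Longrightarrow> y n (j - 1) < y n j"
    using assms unfolding observation_scheme_def by auto
  have g: "c * real (j - i) \<le> real (m n) * (y n j - y n i)" if n: "1 \<le> n" and ij: "1 \<le> i" "i \<le> j" "j \<le> m n" for n i j
    using ij(2,1,3)
  proof (induction j rule: dec_induct)
    case (step j)
    have "Suc j \<in> {2..m n}" using step by auto
    from gap[OF n this] inc[OF n this] have "c \<le> real (m n) * (y n (Suc j) - y n j)" by simp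
    then show ?case using step by (simp add: Suc_diff_le algebra_simps)
  qed simp
  have mono: "y n i \<le> y n j" if n: "1 \<le> n" and ij: "1 \<le> i" "i \<le> j" "j \<le> m n" for n i j
  proof -
    have "0 \<le> c * real (j - i)" using c by simp
    then have "0 \<le> real (m n) * (y n j - y n i)" using g[OF that] by linarith
    then show ?thesis using m1[OF n] by (simp add: zero_le_mult_iff)
  qed
  have g2: "c * real (lag i j) \<le> real (m n) * \<bar>y n i - y n j\<bar>" if "1 \<le> n" "i \<in> {1..m n}" "j \<in> {1..m n}" for n i j
  proof (cases "i \<le> j")
    case True then show ?thesis using g[of n i j] mono[of n i j] that by (simp add: lag_def)
  next
    case False then show ?thesis using g[of n j i] mono[of n j i] that by (simp add: lag_def)
  qed
  have b: "\<delta> \<le> y n j \<and> y n j \<le> 1 - \<delta>" if "1 \<le> n" "j \<in> {1..m n}" for n j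
    using mono[of n 1 j] mono[of n j "m n"] e[OF that(1)] that by auto
  show ?thesis using c d m1 b g2 by (intro exI[of _ c]) blast
qed

text \<open>Both alternatives for \<open>m\<close> give a bound \<open>C n^\<rho>\<close> with
  \<open>\<rho> < 1/2\<close>. The first limit serves the row sums, the trace and the initial value;
  the second, with its logarithm, the squared covariances of different points.\<close>

lemma observation_scheme_growth:
  assumes "observation_scheme m y \<delta>"
  shows "(\<lambda>n. (real (m n))\<^sup>2 / real n) \<longlonglongrightarrow> 0"
    "(\<lambda>n. (real (m n))^4 / (real n)\<^sup>2 * (1 + ln (2 * real n))) \<longlonglongrightarrow> 0"
proof -
  have "\<exists>C \<rho>. 0 < \<rho> \<and> \<rho> < 1/2 \<and> eventually (\<lambda>n. real (m n) \<le> C * real n powr \<rho>) sequentially"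
  proof (cases "\<exists>m0. \<forall>n\<ge>1. m n = m0")
    case True
    then obtain m0 where m0: "\<And>n. 1 \<le> n \<Longrightarrow> m n = m0" by blast
    show ?thesis
    \<comment> \<open>For constant \<open>m\<close> any exponent strictly between \<open>0\<close>
      and \<open>1/2\<close> can be chosen.\<close>
    proof (rule exI[of _ "real m0"], rule exI[of _ "1/4"], intro conjI)
      show "eventually (\<lambda>n. real (m n) \<le> real m0 * real n powr (1/4)) sequentially"
        using eventually_ge_at_top[of 1]
      proof eventually_elim
        case (elim n)
        have "1 \<le> real n powr (1/4)" using elim by (intro ge_one_powr_ge_zero) auto
        then have "real m0 * 1 \<le> real m0 * real n powr (1/4)" by (intro mult_left_mono) auto
        then show ?case using m0[OF elim] by simp
      qed
    qed auto
  next
    case False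
    then obtain \<rho> where \<rho>: "0 < \<rho>" "\<rho> < 1/2" "(\<lambda>n. real (m n)) \<in> O(\<lambda>n. real n powr \<rho>)"
      using assms unfolding observation_scheme_def by blast
    obtain C where "eventually (\<lambda>n. norm (real (m n)) \<le> C * norm (real n powr \<rho>)) sequentially"
      using landau_o.bigE[OF \<rho>(3)] by blast
    then have "eventually (\<lambda>n. real (m n) \<le> C * real n powr \<rho>) sequentially" by (auto elim: eventually_mono)
    then show ?thesis using \<rho> by blast
  qed
  then obtain C \<rho> where \<rho>: "0 < \<rho>" "\<rho> < 1/2" and ev: "eventually (\<lambda>n. real (m n) \<le> C * real n powr \<rho>) sequentially" by blast
  show "(\<lambda>n. (real (m n))\<^sup>2 / real n) \<longlonglongrightarrow> 0"
  proof (rule tendsto_sandwich[where f="\<lambda>_. 0"])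
    have "2 * \<rho> - 1 < 0" using \<rho> by simp
    then show "(\<lambda>n. C\<^sup>2 * real n powr (2 * \<rho>) / real n) \<longlonglongrightarrow> 0" using \<rho> by real_asymp
    show "\<forall>\<^sub>F n in sequentially. (real (m n))\<^sup>2 / real n \<le> C\<^sup>2 * real n powr (2 * \<rho>) / real n" using ev eventually_ge_at_top[of 1]
    proof eventually_elim
      case (elim n)
      have "(real (m n))\<^sup>2 \<le> (C * real n powr \<rho>)\<^sup>2" using elim by (intro power_mono) auto
      also have "\<dots> = C\<^sup>2 * real n powr (2 * \<rho>)" using elim by (simp add: power_mult_distrib powr_power mult.commute)
      finally show ?case by (intro divide_right_mono) auto
    qed
  qed auto
  show "(\<lambda>n. (real (m n))^4 / (real n)\<^sup>2 * (1 + ln (2 * real n))) \<longlonglongrightarrow> 0"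
  proof (rule tendsto_sandwich[where f="\<lambda>_. 0"])
    have "4 * \<rho> - 2 < 0" using \<rho> by simp
    then show "(\<lambda>n. C^4 * real n powr (4 * \<rho>) / (real n)\<^sup>2 * (1 + ln (2 * real n))) \<longlonglongrightarrow> 0" using \<rho> by real_asymp
    show "\<forall>\<^sub>F n in sequentially. (real (m n))^4 / (real n)\<^sup>2 * (1 + ln (2 * real n)) \<le> C^4 * real n powr (4 * \<rho>) / (real n)\<^sup>2 * (1 + ln (2 * real n))"
      using ev eventually_ge_at_top[of 1]
    proof eventually_elim
      case (elim n)
      have "(real (m n))^4 \<le> (C * real n powr \<rho>)^4" using elim by (intro power_mono) auto
      also have "\<dots> = C^4 * real n powr (4 * \<rho>)" using elim by (simp add: power_mult_distrib powr_power mult.commute)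
      finally show ?case using elim by (intro mult_right_mono divide_right_mono) auto
    qed
    show "\<forall>\<^sub>F n in sequentially. 0 \<le> (real (m n))^4 / (real n)\<^sup>2 * (1 + ln (2 * real n))" using eventually_ge_at_top[of 1]
      by eventually_elim auto
  qed auto
qed

section \<open>The covariance matrix of the rescaled noise increments\<close>

locale scheme_covariance = positive_theta_series +
  fixes \<sigma> \<delta> :: real and m :: "nat \<Rightarrow> nat" and y :: "nat \<Rightarrow> nat \<Rightarrow> real"
  assumes scheme: "observation_scheme m y \<delta>"
begin

definition \<theta>d :: "nat \<Rightarrow> nat \<Rightarrow> nat \<Rightarrow> real" where "\<theta>d n i j = pi * (y n i - y n j)"
definition \<theta>s :: "nat \<Rightarrow> nat \<Rightarrow> nat \<Rightarrow> real" where "\<theta>s n i j = pi * (y n i + y n j)"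
definition Sn :: "nat \<Rightarrow> nat \<Rightarrow> nat \<Rightarrow> nat \<Rightarrow> real" where "Sn n r i j = S (1 / real n) r (\<theta>d n i j) (\<theta>s n i j)"
text \<open>In \<open>spde\<close> the value of \<open>a\<close> is \<open>pi^2 * \<theta>2\<close>,
  so \<open>sqrt (a / pi)\<close> is the normalisation \<open>sqrt (pi * \<theta>2)\<close> of the
  estimator; \<open>\<sigma>^2 / 2\<close> is the factor in \<open>Z_cov\<close>.\<close>

definition K0 :: real where "K0 = sqrt (a / pi) * \<sigma>\<^sup>2 / 2"

text \<open>The covariance of the rescaled noise increments at the space-time points \<open>(i, j)\<close> and \<open>(i', j')\<close>:
  a stationary part that depends on the lag \<open>\<bar>i - i'\<bar>\<close>, and a correction for starting at \<open>0\<close>.\<close>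

definition cc :: "nat \<Rightarrow> nat \<times> nat \<Rightarrow> nat \<times> nat \<Rightarrow> real" where
  "cc n p q = K0 / sqrt (real (m n)) * (Sn n (lag (fst p) (fst q)) (snd p) (snd q) + Sn n (fst p + fst q - 1) (snd p) (snd q))"

definition PP :: "nat \<Rightarrow> (nat \<times> nat) set" where "PP n = {1..n} \<times> {1..m n}"

lemma K0_nonneg: "0 \<le> K0" using a_pos by (simp add: K0_def)

lemma m_ge1: "1 \<le> n \<Longrightarrow> 1 \<le> m n" using observation_scheme_points[OF scheme] by metis

lemma delta_pos: "0 < \<delta>" using observation_scheme_points[OF scheme] by metis

lemma y_bounds: "1 \<le> n \<Longrightarrow> j \<in> {1..m n} \<Longrightarrow> \<delta> \<le> y n j \<and> y n j \<le> 1 - \<delta>"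
  using observation_scheme_points[OF scheme] by metis

lemma \<theta>s_bound: assumes "1 \<le> n" "i \<in> {1..m n}" "j \<in> {1..m n}" shows "4 * \<delta>\<^sup>2 \<le> 1 - cos (\<theta>s n i j)"
proof -
  let ?s = "y n i + y n j"
  have s: "2 * \<delta> \<le> ?s" "?s \<le> 2 - 2 * \<delta>" using y_bounds[OF assms(1,2)] y_bounds[OF assms(1,3)] by auto
  \<comment> \<open>Reflection of \<open>?s\<close> at \<open>1\<close> leaves the cosine unchanged
    and brings the sum of the two points into the range of
    \<open>one_minus_cos_pi_ge\<close>.\<close>
  define v where "v = min ?s (2 - ?s)"
  have v: "2 * \<delta> \<le> v" "v \<le> 1" using s by (auto simp: v_def)
  have "cos (pi * (2 - ?s)) = cos (pi * ?s)"
  proof -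
    have "pi * (2 - ?s) = 2 * pi - pi * ?s" by (simp add: algebra_simps)
    then show ?thesis by (simp only: cos_2pi_minus)
  qed
  then have "cos (pi * v) = cos (\<theta>s n i j)" by (auto simp: v_def \<theta>s_def min_def)
  moreover have "v\<^sup>2 \<le> 1 - cos (pi * v)" using v delta_pos by (intro one_minus_cos_pi_ge) auto
  moreover have "(2 * \<delta>)\<^sup>2 \<le> v\<^sup>2" using v delta_pos by (intro power_mono) auto
  ultimately show ?thesis by (simp add: power_mult_distrib)
qed

lemma \<theta>d_self [simp]: "\<theta>d n j j = 0" by (simp add: \<theta>d_def)

text \<open>The dependence on \<open>r\<close> of \<open>h^2 / sqrt t\<close> at
  \<open>t = r h\<close>, after a factor \<open>h * sqrt h\<close> is taken out. Lag
  \<open>0\<close> is covered by the bound on \<open>Kc\<close> itself, which is of order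
  \<open>h * sqrt h\<close>.\<close>

definition hh :: "nat \<Rightarrow> real" where "hh r = (if r = 0 then 1 else 1 / sqrt (real r))"

lemma hh_nonneg: "0 \<le> hh r" by (simp add: hh_def)

text \<open>At distance \<open>d\<close> the difference angle has \<open>1 - cos\<close> at least
  \<open>d^2\<close>, and the spacing gives \<open>d \<ge> c * lag / m\<close>. The range
  \<open>r < 2 n\<close> is the condition \<open>t + h \<le> 2\<close> of \<open>Kc_bounds\<close>
  and contains all indices \<open>i + i' - 1\<close>.\<close>

lemma Sn_off_diagonal:
  "\<exists>C>0. \<forall>n i j r. 1 \<le> n \<longrightarrow> i \<in> {1..m n} \<longrightarrow> j \<in> {1..m n} \<longrightarrow> i \<noteq> j \<longrightarrow> r < 2 * n \<longrightarrow>
     \<bar>Sn n r i j\<bar> \<le> C * (1 / (real n * sqrt (real n))) * ((real (m n))\<^sup>2 / (real (lag i j))\<^sup>2) * hh r"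
proof -
  obtain C where C: "C > 0" and b1: "\<And>t \<theta> \<theta>'. 0 < t \<Longrightarrow> t \<le> 2 \<Longrightarrow> cos \<theta> \<noteq> 1 \<Longrightarrow> cos \<theta>' \<noteq> 1 \<Longrightarrow>
      \<bar>Kc t \<theta> \<theta>'\<bar> \<le> C * (t * sqrt t) * (1 / (1 - cos \<theta>) + 1 / (1 - cos \<theta>'))"
    and b2: "\<And>t h \<theta> \<theta>'. 0 < h \<Longrightarrow> h \<le> t \<Longrightarrow> t + h \<le> 2 \<Longrightarrow> cos \<theta> \<noteq> 1 \<Longrightarrow> cos \<theta>' \<noteq> 1 \<Longrightarrow>
      \<bar>Kc (t + h) \<theta> \<theta>' - 2 * Kc t \<theta> \<theta>' + Kc (t - h) \<theta> \<theta>'\<bar> \<le> C * (h\<^sup>2 / sqrt t) * (1 / (1 - cos \<theta>) + 1 / (1 - cos \<theta>'))"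
    using Kc_bounds by metis
  obtain c where c: "0 < c" and gap: "\<And>n i j. 1 \<le> n \<Longrightarrow> i \<in> {1..m n} \<Longrightarrow> j \<in> {1..m n} \<Longrightarrow> c * real (lag i j) \<le> real (m n) * \<bar>y n i - y n j\<bar>"
    using observation_scheme_points[OF scheme] by metis
  define D where "D = 1 / c\<^sup>2 + 1 / (4 * \<delta>\<^sup>2)"
  have D: "0 < D" using c delta_pos by (auto simp: D_def intro!: add_pos_pos)
  show ?thesis
  proof (intro exI[of _ "2 * C * D"] conjI allI impI)
    show "0 < 2 * C * D" using C D by simp
    fix n i j r assume n: "1 \<le> n" and ij: "i \<in> {1..m n}" "j \<in> {1..m n}" "i \<noteq> j" and r: "r < 2 * n"
    let ?\<theta> = "\<theta>d n i j" and ?\<theta>' = "\<theta>s n i j" and ?h = "1 / real n"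
    let ?M = "(real (m n))\<^sup>2 / (real (lag i j))\<^sup>2"
    have np: "0 < real n" using n by simp
    have l: "1 \<le> lag i j" "lag i j \<le> m n" using ij by (auto simp: lag_def)
    have lp: "0 < (real (lag i j))\<^sup>2" using l by simp
    have mp: "0 < (real (m n))\<^sup>2" using m_ge1[OF n] by simp
    \<comment> \<open>As the lag is at most \<open>m\<close>, the constant contribution of the sum
      angle can be absorbed into \<open>?M\<close>.\<close>
    have M1: "1 \<le> ?M" using l by (simp add: pos_le_divide_eq lp power_mono)
    define d where "d = \<bar>y n i - y n j\<bar>"
    have d1: "d \<le> 1" using y_bounds[OF n ij(1)] y_bounds[OF n ij(2)] delta_pos by (auto simp: d_def)
    have dl: "c * real (lag i j) \<le> real (m n) * d" using gap[OF n ij(1,2)] by (simp add: d_def)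
    have "(c * real (lag i j))\<^sup>2 \<le> (real (m n) * d)\<^sup>2" using dl c by (intro power_mono) auto
    then have dsq: "c\<^sup>2 * (real (lag i j))\<^sup>2 \<le> (real (m n))\<^sup>2 * d\<^sup>2" by (simp add: power_mult_distrib)
    have "0 < c\<^sup>2 * (real (lag i j))\<^sup>2" using c lp by simp
    then have "0 < (real (m n))\<^sup>2 * d\<^sup>2" using dsq by linarith
    then have d0: "0 < d\<^sup>2" using mp by (simp add: zero_less_mult_iff)
    have "cos ?\<theta> = cos (pi * d)" by (auto simp: \<theta>d_def d_def abs_if algebra_simps cos_diff)
    moreover have "d\<^sup>2 \<le> 1 - cos (pi * d)" using d1 by (intro one_minus_cos_pi_ge) (auto simp: d_def)
    ultimately have cd: "d\<^sup>2 \<le> 1 - cos ?\<theta>" by simp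
    have cs: "4 * \<delta>\<^sup>2 \<le> 1 - cos ?\<theta>'" by (rule \<theta>s_bound[OF n ij(1,2)])
    have ds: "0 < 4 * \<delta>\<^sup>2" using delta_pos by simp
    have ne: "cos ?\<theta> \<noteq> 1" "cos ?\<theta>' \<noteq> 1" using cd cs d0 ds by auto
    have dd: "0 < 1 - cos ?\<theta>" "0 < 1 - cos ?\<theta>'" using cd cs d0 ds by linarith+
    have "1 / (1 - cos ?\<theta>) \<le> 1 / d\<^sup>2" by (rule divide_left_mono[OF cd _ mult_pos_pos[OF dd(1) d0]]) simp
    also have "\<dots> \<le> 1 / c\<^sup>2 * ?M" using dsq d0 lp c by (simp add: divide_simps mult_ac)
    finally have S1: "1 / (1 - cos ?\<theta>) \<le> 1 / c\<^sup>2 * ?M" .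
    have "1 / (1 - cos ?\<theta>') \<le> 1 / (4 * \<delta>\<^sup>2)" by (rule divide_left_mono[OF cs _ mult_pos_pos[OF dd(2) ds]]) simp
    also have "\<dots> \<le> 1 / (4 * \<delta>\<^sup>2) * ?M" using mult_left_mono[OF M1, of "1 / (4 * \<delta>\<^sup>2)"] ds by simp
    finally have SS: "1 / (1 - cos ?\<theta>) + 1 / (1 - cos ?\<theta>') \<le> D * ?M" unfolding D_def distrib_right by (rule add_mono[OF S1])
    show "\<bar>Sn n r i j\<bar> \<le> 2 * C * D * (1 / (real n * sqrt (real n))) * ?M * hh r"
    proof (cases "r = 0")
      case True
      have hb: "0 < ?h" "?h \<le> 2" using n by (auto simp: divide_simps)
      have "\<bar>Sn n r i j\<bar> = 2 * \<bar>Kc ?h ?\<theta> ?\<theta>'\<bar>" unfolding True Sn_def S_0 by (simp add: abs_mult)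
      also have "\<dots> \<le> 2 * (C * (?h * sqrt ?h) * (1 / (1 - cos ?\<theta>) + 1 / (1 - cos ?\<theta>')))"
        by (intro mult_left_mono b1 hb ne) auto
      also have "\<dots> \<le> 2 * (C * (?h * sqrt ?h) * (D * ?M))"
        using SS C by (intro mult_left_mono mult_nonneg_nonneg) auto
      also have "\<dots> = 2 * C * D * (1 / (real n * sqrt (real n))) * ?M * hh r"
        by (simp add: True hh_def real_sqrt_divide)
      finally show ?thesis .
    next
      case False
      let ?t = "real r * ?h"
      have t: "0 < ?h" "?h \<le> ?t" "?t + ?h \<le> 2" using n r False by (auto simp: field_simps)
      have e: "Sn n r i j = Kc (?t + ?h) ?\<theta> ?\<theta>' - 2 * Kc ?t ?\<theta> ?\<theta>' + Kc (?t - ?h) ?\<theta> ?\<theta>'"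
        using False by (simp add: Sn_def S_def of_nat_diff add_divide_distrib diff_divide_distrib add.commute)
      have "\<bar>Sn n r i j\<bar> \<le> C * (?h\<^sup>2 / sqrt ?t) * (1 / (1 - cos ?\<theta>) + 1 / (1 - cos ?\<theta>'))" unfolding e by (rule b2[OF t ne])
      also have "\<dots> \<le> C * (?h\<^sup>2 / sqrt ?t) * (D * ?M)"
        using SS C t by (intro mult_left_mono mult_nonneg_nonneg divide_nonneg_nonneg) auto
      also have "\<dots> \<le> 2 * (C * (?h\<^sup>2 / sqrt ?t) * (D * ?M))"
      proof -
        have "0 \<le> C * (?h\<^sup>2 / sqrt ?t) * (D * ?M)" using C D by (intro mult_nonneg_nonneg divide_nonneg_nonneg) auto
        then show ?thesis by linarith
      qed
      also have "?h\<^sup>2 / sqrt ?t = 1 / (real n * sqrt (real n)) * hh r"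
      proof -
        have "sqrt (real n) * sqrt (real n) = real n" by simp
        then show ?thesis using False np by (simp add: hh_def real_sqrt_divide power2_eq_square field_simps)
      qed
      finally show ?thesis by (simp add: mult_ac)
    qed
  qed
qed

lemma Sn_diagonal:
  "\<exists>C>0. \<forall>n j. 1 \<le> n \<longrightarrow> (\<forall>N. (\<Sum>r=1..N. \<bar>Sn n r j j\<bar>) \<le> C / sqrt (real n)) \<and>
     (\<forall>r\<ge>1. real r * \<bar>Sn n r j j\<bar> \<le> C / sqrt (real n)) \<and> \<bar>Sn n 0 j j\<bar> \<le> C / sqrt (real n)"
proof -
  obtain C where C: "C > 0" "\<And>t \<theta>'. 0 < t \<Longrightarrow> 0 \<le> Kc t 0 \<theta>'" "\<And>t \<theta>'. 0 < t \<Longrightarrow> Kc t 0 \<theta>' \<le> C * sqrt t"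
    using diag_Kc_bound by blast
  show ?thesis
  proof (intro exI[of _ "2 * C"] conjI allI impI)
    show "0 < 2 * C" using C by simp
    fix n j assume n: "1 \<le> (n::nat)"
    have h: "0 < 1 / real n" using n by simp
    have K: "Kc (1 / real n) 0 (\<theta>s n j j) \<le> C / sqrt (real n)" using C(3)[OF h, of "\<theta>s n j j"] by (simp add: real_sqrt_divide)
    have K0: "0 \<le> Kc (1 / real n) 0 (\<theta>s n j j)" by (rule C(2)[OF h])
    then have K2: "Kc (1 / real n) 0 (\<theta>s n j j) \<le> 2 * C / sqrt (real n)" using K by simp
    show "(\<Sum>r=1..N. \<bar>Sn n r j j\<bar>) \<le> 2 * C / sqrt (real n)" for N
      unfolding Sn_def \<theta>d_self by (rule order_trans[OF diag_S(3)[OF h] K2])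
    show "real r * \<bar>Sn n r j j\<bar> \<le> 2 * C / sqrt (real n)" if "1 \<le> r" for r
      unfolding Sn_def \<theta>d_self by (rule order_trans[OF diag_S(4)[OF h that] K2])
    show "\<bar>Sn n 0 j j\<bar> \<le> 2 * C / sqrt (real n)"
      unfolding Sn_def \<theta>d_self S_0 using K K0 by simp
  qed
qed

end

context scheme_covariance
begin

lemma sum_PP: "(\<Sum>p\<in>PP n. f p) = (\<Sum>j=1..m n. \<Sum>i=1..n. f (i, j))"
proof -
  have "(\<Sum>p\<in>PP n. f p) = (\<Sum>i=1..n. \<Sum>j=1..m n. f (i, j))"
    unfolding PP_def by (simp add: sum.cartesian_product case_prod_unfold)
  then show ?thesis using sum.swap[of "\<lambda>i j. f (i, j)" "{1..m n}" "{1..n}"] by simp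
qed

lemma sum_hh_le: "(\<Sum>r=1..N. hh r) \<le> 2 * sqrt (real N)"
proof -
  have "(\<Sum>r=1..N. hh r) = (\<Sum>r=1..N. 1 / sqrt (real r))" by (intro sum.cong refl) (auto simp: hh_def)
  then show ?thesis using sum_inverse_sqrt_le[of N] by simp
qed

lemma sum_lag_inverse_square_le:
  assumes "j \<in> {1..N}" shows "(\<Sum>j'=1..N. 1 / (real (lag j j'))\<^sup>2) \<le> 4"
  using sum_lag_row_le[OF assms, of "\<lambda>r. 1 / (real r)\<^sup>2"] sum_inverse_squares_le[of N] by simp

text \<open>The block of the point itself contributes order \<open>1 / sqrt n\<close>. In the other
  blocks the sums of \<open>hh\<close> over time give \<open>sqrt n\<close> and the inverse squared
  lags over space give a constant, which leaves \<open>m^2 / n\<close>.\<close>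

lemma row_sums_tendsto:
  "\<exists>R. R \<longlonglongrightarrow> 0 \<and> (\<forall>n\<ge>1. 0 \<le> R n \<and> (\<forall>p\<in>PP n. (\<Sum>q\<in>PP n. \<bar>cc n p q\<bar>) < R n))"
proof -
  obtain C1 where C1: "C1 > 0" "\<And>n j N. 1 \<le> n \<Longrightarrow> (\<Sum>r=1..N. \<bar>Sn n r j j\<bar>) \<le> C1 / sqrt (real n)" "\<And>n j. 1 \<le> n \<Longrightarrow> \<bar>Sn n 0 j j\<bar> \<le> C1 / sqrt (real n)"
    using Sn_diagonal by metis
  obtain C2 where C2: "C2 > 0" "\<And>n i j r. 1 \<le> n \<Longrightarrow> i \<in> {1..m n} \<Longrightarrow> j \<in> {1..m n} \<Longrightarrow> i \<noteq> j \<Longrightarrow> r < 2 * n \<Longrightarrow>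
     \<bar>Sn n r i j\<bar> \<le> C2 * (1 / (real n * sqrt (real n))) * ((real (m n))\<^sup>2 / (real (lag i j))\<^sup>2) * hh r"
    using Sn_off_diagonal by metis
  \<comment> \<open>The factor \<open>4\<close> counts lag zero once, the two sides of the Toeplitz
    row, and the indices \<open>i + i' - 1\<close>. The factor \<open>36\<close> is
    \<open>9 * 4\<close>, from \<open>9 * sqrt n\<close> for the sums of \<open>hh\<close> and
    \<open>4\<close> for the inverse squares. The term \<open>1 / n\<close> makes the bound
    strict.\<close>
  define R where "R n = 4 * K0 * C1 * (1 / sqrt (real n)) + 36 * K0 * C2 * ((real (m n))\<^sup>2 / real n) + 1 / real n" for n
  have "(\<lambda>n. 1 / sqrt (real n)) \<longlonglongrightarrow> 0" "(\<lambda>n. 1 / real n) \<longlonglongrightarrow> 0" by real_asymp+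
  then have "R \<longlonglongrightarrow> 4 * K0 * C1 * 0 + 36 * K0 * C2 * 0 + 0"
    unfolding R_def by (intro tendsto_intros observation_scheme_growth[OF scheme])
  moreover have "0 \<le> R n" for n unfolding R_def using K0_nonneg C1(1) C2(1) by (intro add_nonneg_nonneg mult_nonneg_nonneg) auto
  moreover have "(\<Sum>q\<in>PP n. \<bar>cc n p q\<bar>) < R n" if n: "1 \<le> n" and p: "p \<in> PP n" for n p
  proof -
    obtain i j where ij: "p = (i, j)" "i \<in> {1..n}" "j \<in> {1..m n}" using p by (auto simp: PP_def)
    let ?m = "real (m n)"
    have m1: "1 \<le> sqrt ?m" using m_ge1[OF n] by simp
    let ?g = "\<lambda>j'. (\<Sum>i'=1..n. \<bar>Sn n (lag i i') j j'\<bar>) + (\<Sum>i'=1..n. \<bar>Sn n (i + i' - 1) j j'\<bar>)"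
    have "(\<Sum>q\<in>PP n. \<bar>cc n p q\<bar>) \<le> (\<Sum>j'=1..m n. K0 * ?g j')"
      unfolding sum_PP
    proof (rule sum_mono)
      fix j'
      have "(\<Sum>i'=1..n. \<bar>cc n p (i', j')\<bar>) \<le> (\<Sum>i'=1..n. K0 * (\<bar>Sn n (lag i i') j j'\<bar> + \<bar>Sn n (i + i' - 1) j j'\<bar>))"
      proof (rule sum_mono)
        fix i'
        have "\<bar>cc n p (i', j')\<bar> = K0 / sqrt ?m * \<bar>Sn n (lag i i') j j' + Sn n (i + i' - 1) j j'\<bar>"
          unfolding cc_def ij using K0_nonneg by (simp add: abs_mult)
        also have "\<dots> \<le> K0 * (\<bar>Sn n (lag i i') j j'\<bar> + \<bar>Sn n (i + i' - 1) j j'\<bar>)"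
        proof (rule mult_mono)
          have "K0 / sqrt ?m \<le> K0 / 1" using m1 K0_nonneg by (intro divide_left_mono) auto
          then show "K0 / sqrt ?m \<le> K0" by simp
        qed (use K0_nonneg abs_triangle_ineq in auto)
        finally show "\<bar>cc n p (i', j')\<bar> \<le> K0 * (\<bar>Sn n (lag i i') j j'\<bar> + \<bar>Sn n (i + i' - 1) j j'\<bar>)" .
      qed
      then show "(\<Sum>i'=1..n. \<bar>cc n p (i', j')\<bar>) \<le> K0 * ?g j'" by (simp add: sum_distrib_left sum.distrib distrib_left)
    qed
    also have "\<dots> \<le> (\<Sum>j'=1..m n. (if j' = j then 4 * K0 * C1 * (1 / sqrt (real n)) else 0) + 9 * K0 * C2 * (?m\<^sup>2 / real n) * (1 / (real (lag j j'))\<^sup>2))"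
    proof (rule sum_mono)
      fix j' assume j': "j' \<in> {1..m n}"
      show "K0 * ?g j' \<le> (if j' = j then 4 * K0 * C1 * (1 / sqrt (real n)) else 0) + 9 * K0 * C2 * (?m\<^sup>2 / real n) * (1 / (real (lag j j'))\<^sup>2)"
      proof (cases "j' = j")
        case True
        have "?g j \<le> (\<bar>Sn n 0 j j\<bar> + 2 * (\<Sum>r=1..n. \<bar>Sn n r j j\<bar>)) + (\<Sum>r=1..2*n. \<bar>Sn n r j j\<bar>)"
          by (intro add_mono sum_lag_row_le[OF ij(2), of "\<lambda>r. \<bar>Sn n r j j\<bar>"] sum_anti_row_le[OF ij(2), of "\<lambda>r. \<bar>Sn n r j j\<bar>"]) auto
        also have "\<dots> \<le> 4 * (C1 / sqrt (real n))" using C1(2)[OF n, of j n] C1(2)[OF n, of j "2*n"] C1(3)[OF n, of j] by linarith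
        finally have "K0 * ?g j \<le> K0 * (4 * (C1 / sqrt (real n)))" using K0_nonneg by (rule mult_left_mono)
        moreover have "K0 * (4 * (C1 / sqrt (real n))) = 4 * K0 * C1 * (1 / sqrt (real n))" by simp
        ultimately have "K0 * ?g j \<le> 4 * K0 * C1 * (1 / sqrt (real n))" by (simp only:)
        then show ?thesis unfolding True by (simp add: lag_def)
      next
        case False
        define A where "A = C2 * (1 / (real n * sqrt (real n))) * (?m\<^sup>2 / (real (lag j j'))\<^sup>2)"
        have A0: "0 \<le> A" using C2(1) by (auto simp: A_def intro!: mult_nonneg_nonneg)
        have b: "\<bar>Sn n r j j'\<bar> \<le> A * hh r" if "r < 2 * n" for r
          unfolding A_def by (rule C2(2)[OF n ij(3) j' _ that]) (use False in auto)
        have "?g j' \<le> (\<Sum>i'=1..n. A * hh (lag i i')) + (\<Sum>i'=1..n. A * hh (i + i' - 1))"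
          by (intro add_mono sum_mono b) (use ij(2) n in \<open>auto simp: lag_def\<close>)
        also have "\<dots> = A * ((\<Sum>i'=1..n. hh (lag i i')) + (\<Sum>i'=1..n. hh (i + i' - 1)))" by (simp add: sum_distrib_left distrib_left)
        also have "\<dots> \<le> A * (9 * sqrt (real n))"
        proof (rule mult_left_mono[OF _ A0])
          have "(\<Sum>i'=1..n. hh (lag i i')) \<le> hh 0 + 2 * (\<Sum>r=1..n. hh r)" by (rule sum_lag_row_le[OF ij(2) hh_nonneg])
          moreover have "(\<Sum>i'=1..n. hh (i + i' - 1)) \<le> (\<Sum>r=1..2*n. hh r)" by (rule sum_anti_row_le[OF ij(2) hh_nonneg])
          moreover have "sqrt (real (2 * n)) \<le> 2 * sqrt (real n)" by (rule real_le_lsqrt) (auto simp: power_mult_distrib)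
          moreover have "1 \<le> sqrt (real n)" using n by simp
          moreover have "hh 0 = 1" by (simp add: hh_def)
          ultimately show "(\<Sum>i'=1..n. hh (lag i i')) + (\<Sum>i'=1..n. hh (i + i' - 1)) \<le> 9 * sqrt (real n)"
            using sum_hh_le[of n] sum_hh_le[of "2*n"] by linarith
        qed
        finally have "K0 * ?g j' \<le> K0 * (A * (9 * sqrt (real n)))" using K0_nonneg by (rule mult_left_mono)
        also have "\<dots> = 9 * K0 * C2 * (?m\<^sup>2 / real n) * (1 / (real (lag j j'))\<^sup>2)" using n by (simp add: A_def)
        finally show ?thesis using False by simp
      qed
    qed
    also have "\<dots> = 4 * K0 * C1 * (1 / sqrt (real n)) + 9 * K0 * C2 * (?m\<^sup>2 / real n) * (\<Sum>j'=1..m n. 1 / (real (lag j j'))\<^sup>2)"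
      using ij(3) by (simp add: sum.distrib sum_distrib_left)
    also have "\<dots> \<le> 4 * K0 * C1 * (1 / sqrt (real n)) + 9 * K0 * C2 * (?m\<^sup>2 / real n) * 4"
      using K0_nonneg C2(1) by (intro add_left_mono mult_left_mono sum_lag_inverse_square_le[OF ij(3)] mult_nonneg_nonneg) auto
    also have "\<dots> < R n"
    proof -
      have "9 * K0 * C2 * (?m\<^sup>2 / real n) * 4 = 36 * K0 * C2 * (?m\<^sup>2 / real n)" by simp
      moreover have "0 < 1 / real n" using n by simp
      ultimately show ?thesis unfolding R_def by linarith
    qed
    finally show ?thesis .
  qed
  ultimately show ?thesis by (intro exI[of _ R]) auto
qed

text \<open>For equal points the limit of the Toeplitz sums holds along any choice of the point,
  hence for the average. Different points contribute at most \<open>m^4 / n^2\<close> times a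
  logarithm, which comes from summing \<open>(hh r)^2 = 1 / r\<close>.\<close>

lemma variance_tendsto:
  "(\<lambda>n. 2 * (\<Sum>p\<in>PP n. \<Sum>q\<in>PP n. (cc n p q)\<^sup>2)) \<longlonglongrightarrow> \<sigma>^4 * (2 + (\<Sum>r. (I_coeff r)\<^sup>2))"
proof -
  obtain C1 where C1: "C1 > 0" "\<And>n j N. 1 \<le> n \<Longrightarrow> (\<Sum>r=1..N. \<bar>Sn n r j j\<bar>) \<le> C1 / sqrt (real n)" "\<And>n j. 1 \<le> n \<Longrightarrow> \<bar>Sn n 0 j j\<bar> \<le> C1 / sqrt (real n)"
      "\<And>n j r. 1 \<le> n \<Longrightarrow> 1 \<le> r \<Longrightarrow> real r * \<bar>Sn n r j j\<bar> \<le> C1 / sqrt (real n)"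
    using Sn_diagonal by metis
  obtain C2 where C2: "C2 > 0" "\<And>n i j r. 1 \<le> n \<Longrightarrow> i \<in> {1..m n} \<Longrightarrow> j \<in> {1..m n} \<Longrightarrow> i \<noteq> j \<Longrightarrow> r < 2 * n \<Longrightarrow>
     \<bar>Sn n r i j\<bar> \<le> C2 * (1 / (real n * sqrt (real n))) * ((real (m n))\<^sup>2 / (real (lag i j))\<^sup>2) * hh r"
    using Sn_off_diagonal by metis
  define H where "H n j j' = (\<Sum>i=1..n. \<Sum>i'=1..n. (Sn n (lag i i') j j' + Sn n (i + i' - 1) j j')\<^sup>2)" for n j j'
  define T where "T n j = K0\<^sup>2 * H n j j" for n j
  define \<rho> where "\<rho> = sqrt (a / pi) / 2"
  have \<rho>0: "0 \<le> \<rho>" using a_pos by (simp add: \<rho>_def)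
  have K0\<rho>: "K0 = \<rho> * \<sigma>\<^sup>2" by (simp add: K0_def \<rho>_def)
  \<comment> \<open>The limits of \<open>diag_S_limit\<close>. As \<open>s (Suc r)\<close> is
    \<open>- I_coeff r / 2\<close>, the factor \<open>2\<close> in the Toeplitz limit and the factor
    \<open>2\<close> of the variance turn its squares into \<open>I_coeff r\<close> squared with
    coefficient one, while \<open>s 0 = 1\<close> contributes the summand \<open>2\<close>.\<close>
  define s where "s r = (sqrt (real (Suc r)) - 2 * sqrt (real r) + sqrt (real (if r = 0 then 1 else r - 1))) / 2" for r
  have s0: "s 0 = 1" by (simp add: s_def)
  have sS: "s (Suc r) = - (I_coeff r / 2)" for r by (simp add: s_def I_coeff_def algebra_simps add_divide_distrib diff_divide_distrib)
  let ?L = "\<sigma>^4 * ((s 0)\<^sup>2 + 2 * (\<Sum>r. (s (Suc r))\<^sup>2))"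
  have Ulim: "(\<lambda>n. \<rho> * Sn n r (js n) (js n) * sqrt (real n)) \<longlonglongrightarrow> s r" if js: "\<And>n. 1 \<le> n \<Longrightarrow> js n \<in> {1..m n}" for js r
  proof -
    have k: "0 < 4 * \<delta>\<^sup>2" using delta_pos by simp
    have th: "4 * \<delta>\<^sup>2 \<le> 1 - cos (\<theta>s n (js n) (js n))" if "1 \<le> n" for n by (rule \<theta>s_bound[OF that js[OF that] js[OF that]])
    show ?thesis unfolding s_def \<rho>_def Sn_def \<theta>d_self by (rule diag_S_limit[OF k]) (rule th)
  qed
  have Ttend: "(\<lambda>n. T n (js n)) \<longlonglongrightarrow> ?L" if js: "\<And>n. 1 \<le> n \<Longrightarrow> js n \<in> {1..m n}" for js
  proof -
    define u where "u n r = \<rho> * Sn n r (js n) (js n) * sqrt (real n)" for n r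
    have ub: "\<bar>u n r\<bar> = \<rho> * \<bar>Sn n r (js n) (js n)\<bar> * sqrt (real n)" for n r using \<rho>0 by (simp add: u_def abs_mult)
    have sc: "\<rho> * x * sqrt (real n) \<le> \<rho> * C1" if "1 \<le> n" "x \<le> C1 / sqrt (real n)" for n x
    proof -
      have "x * sqrt (real n) \<le> C1" using that by (simp add: pos_le_divide_eq)
      then have "\<rho> * (x * sqrt (real n)) \<le> \<rho> * C1" using \<rho>0 by (rule mult_left_mono)
      then show ?thesis by (simp add: mult.assoc)
    qed
    have U1: "real r * \<bar>u n r\<bar> \<le> \<rho> * C1" if "1 \<le> n" "1 \<le> r" for n r
      using sc[OF that(1) C1(4)[OF that, of "js n"]] unfolding ub by (simp add: mult_ac)
    have U0: "\<bar>u n 0\<bar> \<le> \<rho> * C1" if "1 \<le> n" for n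
      using sc[OF that C1(3)[OF that, of "js n"]] unfolding ub .
    have U2: "(\<Sum>r=1..N. \<bar>u n r\<bar>) \<le> \<rho> * C1" if "1 \<le> n" for n N
      using sc[OF that C1(2)[OF that, of "js n" N]] unfolding ub by (simp add: sum_distrib_left sum_distrib_right)
    have Ul: "(\<lambda>n. u n r) \<longlonglongrightarrow> s r" for r unfolding u_def by (rule Ulim[OF js])
    have "(\<lambda>n. (\<Sum>i=1..n. \<Sum>j=1..n. (u n (lag i j) + u n (i + j - 1))\<^sup>2) / real n) \<longlonglongrightarrow> (s 0)\<^sup>2 + 2 * (\<Sum>r. (s (Suc r))\<^sup>2)"
      by (rule toeplitz_square_tendsto(2)[OF U1 U0 U2 Ul]; assumption)
    then have "(\<lambda>n. \<sigma>^4 * ((\<Sum>i=1..n. \<Sum>j=1..n. (u n (lag i j) + u n (i + j - 1))\<^sup>2) / real n)) \<longlonglongrightarrow> ?L"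
      by (rule tendsto_mult_left)
    moreover have "eventually (\<lambda>n. \<sigma>^4 * ((\<Sum>i=1..n. \<Sum>j=1..n. (u n (lag i j) + u n (i + j - 1))\<^sup>2) / real n) = T n (js n)) sequentially"
      using eventually_ge_at_top[of 1]
    proof eventually_elim
      case (elim n)
      have e: "(u n k + u n l)\<^sup>2 = \<rho>\<^sup>2 * real n * (Sn n k (js n) (js n) + Sn n l (js n) (js n))\<^sup>2" for k l
      proof -
        have "u n k + u n l = \<rho> * sqrt (real n) * (Sn n k (js n) (js n) + Sn n l (js n) (js n))" by (simp add: u_def algebra_simps)
        then show ?thesis by (simp add: power_mult_distrib)
      qed
      have "(\<Sum>i=1..n. \<Sum>j=1..n. (u n (lag i j) + u n (i + j - 1))\<^sup>2) = \<rho>\<^sup>2 * real n * H n (js n) (js n)"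
        unfolding e H_def by (simp add: sum_distrib_left)
      moreover have "K0\<^sup>2 = \<rho>\<^sup>2 * \<sigma>^4" unfolding K0\<rho> by (simp add: power_mult_distrib flip: power_mult)
      ultimately show ?case unfolding T_def using elim by (simp add: mult_ac)
    qed
    ultimately show ?thesis by (rule Lim_transform_eventually)
  qed
  have diag: "(\<lambda>n. (\<Sum>j=1..m n. T n j) / real (m n)) \<longlonglongrightarrow> ?L"
    by (rule average_tendsto[OF m_ge1 Ttend])
  define Off where "Off n = K0\<^sup>2 / real (m n) * (\<Sum>j=1..m n. \<Sum>j'=1..m n. if j' = j then 0 else H n j j')" for n
  have H0: "0 \<le> H n j j'" for n j j' by (auto simp: H_def intro!: sum_nonneg)
  have Off: "Off \<longlonglongrightarrow> 0"
  proof (rule tendsto_sandwich[where f="\<lambda>_. 0"])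
    show "\<forall>\<^sub>F n in sequentially. 0 \<le> Off n" unfolding Off_def
      by (intro always_eventually allI mult_nonneg_nonneg sum_nonneg) (use H0 in auto)
    have "(\<lambda>n. 32 * K0\<^sup>2 * C2\<^sup>2 * ((real (m n))^4 / (real n)\<^sup>2 * (1 + ln (2 * real n)))) \<longlonglongrightarrow> 32 * K0\<^sup>2 * C2\<^sup>2 * 0"
      by (intro tendsto_intros observation_scheme_growth[OF scheme])
    then show "(\<lambda>n. 32 * K0\<^sup>2 * C2\<^sup>2 * ((real (m n))^4 / (real n)\<^sup>2 * (1 + ln (2 * real n)))) \<longlonglongrightarrow> 0" by simp
    show "\<forall>\<^sub>F n in sequentially. Off n \<le> 32 * K0\<^sup>2 * C2\<^sup>2 * ((real (m n))^4 / (real n)\<^sup>2 * (1 + ln (2 * real n)))"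
      using eventually_ge_at_top[of 1]
    proof eventually_elim
      case (elim n)
      let ?m = "real (m n)"
      have np: "0 < real n" and mp: "1 \<le> ?m" using elim m_ge1[OF elim] by auto
      define l where "l = 1 + ln (2 * real n)"
      have l1: "1 \<le> l" using elim by (simp add: l_def)
      have hsq: "(\<Sum>r=1..N. (hh r)\<^sup>2) \<le> l" if "1 \<le> N" "N \<le> 2 * n" for N
      proof -
        have "(\<Sum>r=1..N. (hh r)\<^sup>2) = (\<Sum>r=1..N. 1 / real r)" by (intro sum.cong refl) (auto simp: hh_def power_divide)
        also have "\<dots> \<le> 1 + ln (real N)" by (rule sum_inverse_le_ln[OF that(1)])
        also have "\<dots> \<le> l" using that unfolding l_def by (simp add: ln_mono)
        finally show ?thesis .
      qed
      have HH: "H n j j' \<le> (C2\<^sup>2 * (1 / (real n)^3) * (?m^4 * (1 / (real (lag j j'))\<^sup>2))) * (8 * real n * l)"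
        if j: "j \<in> {1..m n}" "j' \<in> {1..m n}" "j' \<noteq> j" for j j'
      proof -
        define A where "A = C2 * (1 / (real n * sqrt (real n))) * (?m\<^sup>2 / (real (lag j j'))\<^sup>2)"
        have b: "\<bar>Sn n r j j'\<bar> \<le> A * hh r" if "r < 2 * n" for r
          unfolding A_def by (rule C2(2)[OF elim j(1,2) _ that]) (use j in auto)
        have bs: "(Sn n k j j' + Sn n r j j')\<^sup>2 \<le> A\<^sup>2 * (2 * (hh k)\<^sup>2 + 2 * (hh r)\<^sup>2)" if "k < 2 * n" "r < 2 * n" for k r
        proof -
          have "\<bar>Sn n k j j' + Sn n r j j'\<bar> \<le> A * hh k + A * hh r" using b[OF that(1)] b[OF that(2)] by linarith
          then have "\<bar>Sn n k j j' + Sn n r j j'\<bar>\<^sup>2 \<le> (A * hh k + A * hh r)\<^sup>2" by (intro power_mono) auto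
          also have "\<dots> \<le> A\<^sup>2 * (2 * (hh k)\<^sup>2 + 2 * (hh r)\<^sup>2)"
          proof -
            have "0 \<le> A\<^sup>2 * (hh k - hh r)\<^sup>2" by simp
            then show ?thesis by (simp add: power2_eq_square algebra_simps)
          qed
          finally show ?thesis by simp
        qed
        have "H n j j' \<le> (\<Sum>i=1..n. \<Sum>i'=1..n. A\<^sup>2 * (2 * (hh (lag i i'))\<^sup>2 + 2 * (hh (i + i' - 1))\<^sup>2))"
          unfolding H_def by (intro sum_mono bs) (auto simp: lag_def)
        also have "\<dots> = A\<^sup>2 * (\<Sum>i=1..n. 2 * (\<Sum>i'=1..n. (hh (lag i i'))\<^sup>2) + 2 * (\<Sum>i'=1..n. (hh (i + i' - 1))\<^sup>2))"
          by (simp add: sum_distrib_left sum.distrib distrib_left)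
        also have "\<dots> \<le> A\<^sup>2 * (\<Sum>i=1..n. 8 * l)"
        proof (intro mult_left_mono sum_mono)
          fix i assume i: "i \<in> {1..n}"
          have "(\<Sum>i'=1..n. (hh (lag i i'))\<^sup>2) \<le> (hh 0)\<^sup>2 + 2 * (\<Sum>r=1..n. (hh r)\<^sup>2)"
            by (rule sum_lag_row_le[OF i, of "\<lambda>r. (hh r)\<^sup>2"]) simp
          moreover have "(\<Sum>i'=1..n. (hh (i + i' - 1))\<^sup>2) \<le> (\<Sum>r=1..2*n. (hh r)\<^sup>2)"
            by (rule sum_anti_row_le[OF i, of "\<lambda>r. (hh r)\<^sup>2"]) simp
          moreover have "(hh 0)\<^sup>2 = 1" by (simp add: hh_def)
          ultimately show "2 * (\<Sum>i'=1..n. (hh (lag i i'))\<^sup>2) + 2 * (\<Sum>i'=1..n. (hh (i + i' - 1))\<^sup>2) \<le> 8 * l"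
            using hsq[of n] hsq[of "2*n"] l1 elim by simp
        qed simp
        also have "\<dots> = A\<^sup>2 * (8 * real n * l)" by simp
        \<comment> \<open>\<open>A^2\<close> contains the inverse fourth power of the lag; weakening
          it to the inverse square allows \<open>sum_lag_inverse_square_le\<close>.\<close>
        also have "\<dots> \<le> (C2\<^sup>2 * (1 / (real n)^3) * (?m^4 * (1 / (real (lag j j'))\<^sup>2))) * (8 * real n * l)"
        proof (rule mult_right_mono)
          have lg: "1 \<le> lag j j'" using j by (auto simp: lag_def)
          have "(real n * sqrt (real n))\<^sup>2 = (real n)^3" by (simp add: power_mult_distrib power3_eq_cube power2_eq_square)
          then have e: "A\<^sup>2 = C2\<^sup>2 * (1 / (real n)^3) * (?m^4 * (1 / (real (lag j j'))^4))"
            unfolding A_def by (simp add: power_mult_distrib power_divide flip: power_mult)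
          have "(real (lag j j'))\<^sup>2 \<le> (real (lag j j'))^4" using lg by (intro power_increasing) auto
          then have "1 / (real (lag j j'))^4 \<le> 1 / (real (lag j j'))\<^sup>2" using lg by (intro divide_left_mono mult_pos_pos) auto
          then show "A\<^sup>2 \<le> C2\<^sup>2 * (1 / (real n)^3) * (?m^4 * (1 / (real (lag j j'))\<^sup>2))"
            unfolding e by (intro mult_left_mono) auto
        qed (use l1 in simp)
        finally show ?thesis .
      qed
      have "(\<Sum>j=1..m n. \<Sum>j'=1..m n. if j' = j then 0 else H n j j')
        \<le> (\<Sum>j=1..m n. \<Sum>j'=1..m n. (C2\<^sup>2 * (1 / (real n)^3) * (?m^4 * (1 / (real (lag j j'))\<^sup>2))) * (8 * real n * l))"
      proof (intro sum_mono)
        fix j j' assume j: "j \<in> {1..m n}" "j' \<in> {1..m n}"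
        have "0 \<le> (C2\<^sup>2 * (1 / (real n)^3) * (?m^4 * (1 / (real (lag j j'))\<^sup>2))) * (8 * real n * l)" using l1 by (intro mult_nonneg_nonneg) auto
        then show "(if j' = j then 0 else H n j j') \<le> (C2\<^sup>2 * (1 / (real n)^3) * (?m^4 * (1 / (real (lag j j'))\<^sup>2))) * (8 * real n * l)"
          using HH[OF j] by auto
      qed
      also have "\<dots> = C2\<^sup>2 * (1 / (real n)^3) * ?m^4 * (8 * real n * l) * (\<Sum>j=1..m n. \<Sum>j'=1..m n. 1 / (real (lag j j'))\<^sup>2)"
        unfolding sum_distrib_left by (intro sum.cong refl) (simp only: mult_ac)
      also have "\<dots> \<le> C2\<^sup>2 * (1 / (real n)^3) * ?m^4 * (8 * real n * l) * (\<Sum>j=1..m n. 4)"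
        using l1 by (intro mult_left_mono sum_mono sum_lag_inverse_square_le mult_nonneg_nonneg) auto
      also have "\<dots> = 32 * C2\<^sup>2 * (?m^4 / (real n)\<^sup>2 * l) * ?m" using np by (simp add: power2_eq_square power3_eq_cube)
      finally have "Off n \<le> K0\<^sup>2 / ?m * (32 * C2\<^sup>2 * (?m^4 / (real n)\<^sup>2 * l) * ?m)"
        unfolding Off_def using mp by (intro mult_left_mono) auto
      also have "\<dots> = 32 * K0\<^sup>2 * C2\<^sup>2 * (?m^4 / (real n)\<^sup>2 * l)" using mp by simp
      finally show ?case unfolding l_def .
    qed
  qed auto
  have split: "(\<Sum>p\<in>PP n. \<Sum>q\<in>PP n. (cc n p q)\<^sup>2) = (\<Sum>j=1..m n. T n j) / real (m n) + Off n" for n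
  proof -
    have c2: "(cc n (i, j) (i', j'))\<^sup>2 = K0\<^sup>2 / real (m n) * (Sn n (lag i i') j j' + Sn n (i + i' - 1) j j')\<^sup>2" for i j i' j'
      unfolding cc_def by (simp add: power_mult_distrib power_divide)
    have "(\<Sum>p\<in>PP n. \<Sum>q\<in>PP n. (cc n p q)\<^sup>2) = (\<Sum>j=1..m n. \<Sum>i=1..n. \<Sum>j'=1..m n. \<Sum>i'=1..n. K0\<^sup>2 / real (m n) * (Sn n (lag i i') j j' + Sn n (i + i' - 1) j j')\<^sup>2)"
      unfolding sum_PP c2 ..
    also have "\<dots> = (\<Sum>j=1..m n. \<Sum>j'=1..m n. \<Sum>i=1..n. \<Sum>i'=1..n. K0\<^sup>2 / real (m n) * (Sn n (lag i i') j j' + Sn n (i + i' - 1) j j')\<^sup>2)"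
      by (intro sum.cong refl sum.swap)
    also have "\<dots> = K0\<^sup>2 / real (m n) * (\<Sum>j=1..m n. \<Sum>j'=1..m n. H n j j')"
      unfolding H_def sum_distrib_left ..
    also have "(\<Sum>j=1..m n. \<Sum>j'=1..m n. H n j j') = (\<Sum>j=1..m n. H n j j + (\<Sum>j'=1..m n. if j' = j then 0 else H n j j'))"
    proof (rule sum.cong[OF refl])
      fix j assume j: "j \<in> {1..m n}"
      have "(\<Sum>j'=1..m n. H n j j') = (\<Sum>j'=1..m n. (if j' = j then H n j j else 0) + (if j' = j then 0 else H n j j'))"
        by (intro sum.cong refl) auto
      also have "\<dots> = H n j j + (\<Sum>j'=1..m n. if j' = j then 0 else H n j j')" using j by (simp add: sum.distrib)
      finally show "(\<Sum>j'=1..m n. H n j j') = H n j j + (\<Sum>j'=1..m n. if j' = j then 0 else H n j j')" .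
    qed
    also have "K0\<^sup>2 / real (m n) * \<dots> = (\<Sum>j=1..m n. T n j) / real (m n) + Off n"
      unfolding T_def Off_def sum.distrib distrib_left by (simp add: sum_distrib_left sum_divide_distrib)
    finally show ?thesis .
  qed
  have lim: "(\<lambda>n. 2 * (\<Sum>p\<in>PP n. \<Sum>q\<in>PP n. (cc n p q)\<^sup>2)) \<longlonglongrightarrow> 2 * (?L + 0)"
    unfolding split by (intro tendsto_intros diag Off)
  have L: "2 * (?L + 0) = \<sigma>^4 * (2 + (\<Sum>r. (I_coeff r)\<^sup>2))"
  proof -
    have e: "(s (Suc r))\<^sup>2 = (1/4) * (I_coeff r)\<^sup>2" for r unfolding sS by (simp add: power_divide)
    have "(\<Sum>r. (s (Suc r))\<^sup>2) = (1/4) * (\<Sum>r. (I_coeff r)\<^sup>2)" unfolding e by (rule suminf_mult[OF I_coeff_square_summable])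
    then show ?thesis by (simp add: s0 algebra_simps)
  qed
  show ?thesis using lim unfolding L .
qed

text \<open>Over all times, the lag zero value \<open>2 Kc h\<close> gives
  \<open>\<sigma>^2 sqrt n / sqrt m\<close> per point. The error of this, and the correction for the
  start at \<open>0\<close>, are of order \<open>1 / sqrt n\<close> per point, so that
  \<open>m\<close> points give \<open>m / sqrt n\<close>.\<close>

lemma trace_tendsto: "(\<lambda>n. (\<Sum>p\<in>PP n. cc n p p) - sqrt (real (m n) * real n) * \<sigma>\<^sup>2) \<longlonglongrightarrow> 0"
proof -
  obtain C1 where C1: "C1 > 0" "\<And>n j N. 1 \<le> n \<Longrightarrow> (\<Sum>r=1..N. \<bar>Sn n r j j\<bar>) \<le> C1 / sqrt (real n)"
    using Sn_diagonal by metis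
  obtain C where C: "C > 0" and b1: "\<And>t \<theta>'. 0 < t \<Longrightarrow> t \<le> 2 \<Longrightarrow> cos \<theta>' \<noteq> 1 \<Longrightarrow>
      \<bar>Kc t 0 \<theta>' - sqrt (pi * t / a)\<bar> \<le> C * (t * sqrt t) * (1 + 1 / (1 - cos \<theta>'))"
    using Kc_bounds by metis
  define \<rho> where "\<rho> = sqrt (a / pi)"
  have \<rho>0: "0 \<le> \<rho>" using a_pos by (simp add: \<rho>_def)
  have K0\<rho>: "2 * K0 = \<rho> * \<sigma>\<^sup>2" by (simp add: K0_def \<rho>_def)
  define D where "D = \<rho> * \<sigma>\<^sup>2 * C * (1 + 1 / (4 * \<delta>\<^sup>2)) + K0 * C1"
  have D0: "0 \<le> D" unfolding D_def using \<rho>0 C C1 K0_nonneg by (intro add_nonneg_nonneg mult_nonneg_nonneg) auto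
  show ?thesis
  proof (rule Lim_null_comparison)
    have "(\<lambda>n. sqrt ((real (m n))\<^sup>2 / real n)) \<longlonglongrightarrow> sqrt 0" by (intro tendsto_intros observation_scheme_growth[OF scheme])
    then have "(\<lambda>n. sqrt ((real (m n))\<^sup>2 / real n)) \<longlonglongrightarrow> 0" by simp
    then show "(\<lambda>n. D * sqrt ((real (m n))\<^sup>2 / real n)) \<longlonglongrightarrow> 0" by (rule tendsto_mult_right_zero)
    show "\<forall>\<^sub>F n in sequentially. norm ((\<Sum>p\<in>PP n. cc n p p) - sqrt (real (m n) * real n) * \<sigma>\<^sup>2) \<le> D * sqrt ((real (m n))\<^sup>2 / real n)"
      using eventually_ge_at_top[of 1]
    proof eventually_elim
      case (elim n)
      let ?m = "real (m n)" and ?h = "1 / real n"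
      have np: "0 < real n" and mp: "1 \<le> ?m" using elim m_ge1[OF elim] by auto
      have h: "0 < ?h" "?h \<le> 2" using elim by (auto simp: divide_simps)
      have m1: "1 \<le> sqrt ?m" using mp by simp
      have sqm: "?m / sqrt ?m = sqrt ?m" using mp by (simp add: real_div_sqrt)
      define f where "f j = (\<Sum>i=1..n. cc n (i, j) (i, j))" for j
      have fj: "\<bar>f j - \<sigma>\<^sup>2 * sqrt (real n) / sqrt ?m\<bar> \<le> D * (1 / sqrt (real n))" if j: "j \<in> {1..m n}" for j
      proof -
        let ?th = "\<theta>s n j j"
        have cs: "4 * \<delta>\<^sup>2 \<le> 1 - cos ?th" by (rule \<theta>s_bound[OF elim j j])
        have dp: "0 < 4 * \<delta>\<^sup>2" using delta_pos by simp
        have ne: "cos ?th \<noteq> 1" using cs dp by auto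
        define Kh where "Kh = Kc ?h 0 ?th"
        have "\<bar>Kh - sqrt (pi * ?h / a)\<bar> \<le> C * (?h * sqrt ?h) * (1 + 1 / (1 - cos ?th))" unfolding Kh_def by (rule b1[OF h ne])
        also have "\<dots> \<le> C * (?h * sqrt ?h) * (1 + 1 / (4 * \<delta>\<^sup>2))"
        proof (intro mult_left_mono add_left_mono)
          have "0 < 1 - cos ?th" using cs dp by linarith
          then show "1 / (1 - cos ?th) \<le> 1 / (4 * \<delta>\<^sup>2)" by (intro divide_left_mono[OF cs] mult_pos_pos dp) auto
        qed (use C in auto)
        finally have kb: "\<bar>Kh - sqrt (pi * ?h / a)\<bar> \<le> C * (?h * sqrt ?h) * (1 + 1 / (4 * \<delta>\<^sup>2))" .
        have f1: "f j = K0 / sqrt ?m * (real n * (2 * Kh)) + K0 / sqrt ?m * (\<Sum>i=1..n. Sn n (2 * i - 1) j j)"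
        proof -
          have c: "cc n (i, j) (i, j) = K0 / sqrt ?m * (2 * Kh) + K0 / sqrt ?m * Sn n (2 * i - 1) j j" for i
          proof -
            have l: "lag i i = 0" "i + i - 1 = 2 * i - 1" by (simp_all add: lag_def)
            have "Sn n 0 j j = 2 * Kh" by (simp add: Sn_def S_0 Kh_def)
            then show ?thesis unfolding cc_def fst_conv snd_conv l by (simp only: distrib_left)
          qed
          have "f j = (\<Sum>i=1..n. K0 / sqrt ?m * (2 * Kh)) + (\<Sum>i=1..n. K0 / sqrt ?m * Sn n (2 * i - 1) j j)"
            unfolding f_def c by (rule sum.distrib)
          moreover have "(\<Sum>i=1..n. K0 / sqrt ?m * (2 * Kh)) = K0 / sqrt ?m * (real n * (2 * Kh))" by simp
          ultimately show ?thesis by (simp only: sum_distrib_left)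
        qed
        have e1: "\<rho> * sqrt (pi * ?h / a) * real n = sqrt (real n)"
        proof -
          have "\<rho> * sqrt (pi * ?h / a) = 1 / sqrt (real n)" unfolding \<rho>_def using a_pos by (simp add: real_sqrt_mult real_sqrt_divide)
          then show ?thesis using np by (simp add: real_div_sqrt)
        qed
        have "K0 / sqrt ?m * (real n * (2 * Kh)) - \<sigma>\<^sup>2 * sqrt (real n) / sqrt ?m = (\<rho> * \<sigma>\<^sup>2 * real n / sqrt ?m) * (Kh - sqrt (pi * ?h / a))"
        proof -
          define z where "z = sqrt (pi * ?h / a)"
          have "K0 / sqrt ?m * (real n * (2 * Kh)) = (2 * K0) * real n * Kh / sqrt ?m" by simp
          also have "\<dots> = \<rho> * \<sigma>\<^sup>2 * real n * Kh / sqrt ?m" unfolding K0\<rho> ..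
          finally have k: "K0 / sqrt ?m * (real n * (2 * Kh)) = \<rho> * \<sigma>\<^sup>2 * real n * Kh / sqrt ?m" .
          have "sqrt (real n) = \<rho> * z * real n" using e1 by (simp add: z_def)
          then have "\<sigma>\<^sup>2 * sqrt (real n) / sqrt ?m = \<rho> * \<sigma>\<^sup>2 * real n * z / sqrt ?m" by (simp only: mult_ac)
          then show ?thesis unfolding k z_def[symmetric] by (simp only: right_diff_distrib times_divide_eq_left diff_divide_distrib)
        qed
        also have "\<bar>\<dots>\<bar> = (\<rho> * \<sigma>\<^sup>2 * real n / sqrt ?m) * \<bar>Kh - sqrt (pi * ?h / a)\<bar>" using \<rho>0 by (simp add: abs_mult)
        also have "\<dots> \<le> (\<rho> * \<sigma>\<^sup>2 * real n / 1) * (C * (?h * sqrt ?h) * (1 + 1 / (4 * \<delta>\<^sup>2)))"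
          using kb m1 \<rho>0 by (intro mult_mono divide_left_mono) auto
        also have "\<dots> = \<rho> * \<sigma>\<^sup>2 * C * (1 + 1 / (4 * \<delta>\<^sup>2)) * (1 / sqrt (real n))" using np by (simp add: real_sqrt_divide)
        finally have p1: "\<bar>K0 / sqrt ?m * (real n * (2 * Kh)) - \<sigma>\<^sup>2 * sqrt (real n) / sqrt ?m\<bar> \<le> \<rho> * \<sigma>\<^sup>2 * C * (1 + 1 / (4 * \<delta>\<^sup>2)) * (1 / sqrt (real n))" .
        have "\<bar>\<Sum>i=1..n. Sn n (2 * i - 1) j j\<bar> \<le> (\<Sum>i=1..n. \<bar>Sn n (2 * i - 1) j j\<bar>)" by (rule sum_abs)
        \<comment> \<open>The lags \<open>2 i - 1\<close> are distinct, so the correction is a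
          partial sum of the absolutely bounded series in \<open>Sn_diagonal\<close>.\<close>
        also have "\<dots> = (\<Sum>r\<in>(\<lambda>i. 2 * i - 1) ` {1..n}. \<bar>Sn n r j j\<bar>)" by (subst sum.reindex) (auto simp: inj_on_def)
        also have "\<dots> \<le> (\<Sum>r=1..2*n. \<bar>Sn n r j j\<bar>)" by (intro sum_mono2) auto
        also have "\<dots> \<le> C1 / sqrt (real n)" by (rule C1(2)[OF elim])
        finally have "K0 / sqrt ?m * \<bar>\<Sum>i=1..n. Sn n (2 * i - 1) j j\<bar> \<le> K0 / 1 * (C1 / sqrt (real n))"
          using m1 K0_nonneg C1 by (intro mult_mono divide_left_mono) auto
        then have p2: "\<bar>K0 / sqrt ?m * (\<Sum>i=1..n. Sn n (2 * i - 1) j j)\<bar> \<le> K0 * C1 * (1 / sqrt (real n))"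
          using K0_nonneg by (simp add: abs_mult)
        show ?thesis unfolding f1 D_def distrib_right using p1 p2 by linarith
      qed
      have sn: "sqrt (?m * real n) * \<sigma>\<^sup>2 = (\<Sum>j=1..m n. \<sigma>\<^sup>2 * sqrt (real n) / sqrt ?m)"
      proof -
        have "(\<Sum>j=1..m n. \<sigma>\<^sup>2 * sqrt (real n) / sqrt ?m) = (?m / sqrt ?m) * (\<sigma>\<^sup>2 * sqrt (real n))" by simp
        then show ?thesis unfolding sqm by (simp add: real_sqrt_mult mult_ac)
      qed
      have "(\<Sum>p\<in>PP n. cc n p p) - sqrt (?m * real n) * \<sigma>\<^sup>2 = (\<Sum>j=1..m n. f j - \<sigma>\<^sup>2 * sqrt (real n) / sqrt ?m)"
        unfolding sum_PP sn f_def sum_subtractf ..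
      also have "\<bar>\<dots>\<bar> \<le> (\<Sum>j=1..m n. D * (1 / sqrt (real n)))" by (rule order_trans[OF sum_abs sum_mono[OF fj]])
      also have "\<dots> = D * sqrt (?m\<^sup>2 / real n)" by (simp add: real_sqrt_divide)
      finally show ?case by simp
    qed
  qed
qed

end

section \<open>The Hilbert space and the eigenfunction expansion\<close>

text \<open>Multiplication by the root of the weight maps \<open>H_space\<close> isometrically into
  the square integrable functions on the line; the facts on \<open>L2\<close> then apply.\<close>

definition wt :: "real \<Rightarrow> real \<Rightarrow> (real \<Rightarrow> real) \<Rightarrow> real \<Rightarrow> real" where
  "wt \<theta>1 \<theta>2 f y = indicator {0..1} y * (exp (y * \<theta>1 / (2 * \<theta>2)) * f y)"

lemma wt_mult: "wt \<theta>1 \<theta>2 f y * wt \<theta>1 \<theta>2 g y = indicator {0..1} y *\<^sub>R (exp (y * \<theta>1 / \<theta>2) * f y * g y)"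
proof -
  have e: "exp (y * \<theta>1 / \<theta>2) = exp (y * \<theta>1 / (2 * \<theta>2)) * exp (y * \<theta>1 / (2 * \<theta>2))" by (simp flip: exp_add)
  show ?thesis unfolding wt_def e by (simp split: split_indicator)
qed

lemma H_inner_wt: "H_inner \<theta>1 \<theta>2 f g = (\<integral>y. wt \<theta>1 \<theta>2 f y * wt \<theta>1 \<theta>2 g y \<partial>lborel)"
  unfolding H_inner_def set_lebesgue_integral_def wt_mult ..

lemma H_space_wt: "f \<in> H_space \<theta>1 \<theta>2 \<longleftrightarrow> L2 lborel (wt \<theta>1 \<theta>2 f)"
proof -
  have "set_borel_measurable lborel {0..1} f \<longleftrightarrow> wt \<theta>1 \<theta>2 f \<in> borel_measurable lborel"
  proof
    assume "set_borel_measurable lborel {0..1} f"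
    then have [measurable]: "(\<lambda>y. indicator {0..1} y *\<^sub>R f y) \<in> borel_measurable lborel" by (simp add: set_borel_measurable_def)
    have "wt \<theta>1 \<theta>2 f = (\<lambda>y. exp (y * \<theta>1 / (2 * \<theta>2)) * (indicator {0..1} y *\<^sub>R f y))"
      by (rule ext) (simp add: wt_def mult_ac)
    moreover have "(\<lambda>y. exp (y * \<theta>1 / (2 * \<theta>2)) * (indicator {0..1} y *\<^sub>R f y)) \<in> borel_measurable lborel" by measurable
    ultimately show "wt \<theta>1 \<theta>2 f \<in> borel_measurable lborel" by (simp only:)
  next
    assume [measurable]: "wt \<theta>1 \<theta>2 f \<in> borel_measurable lborel"
    have "(\<lambda>y. indicator {0..1} y *\<^sub>R f y) = (\<lambda>y. exp (- (y * \<theta>1 / (2 * \<theta>2))) * wt \<theta>1 \<theta>2 f y)"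
      by (rule ext) (simp add: wt_def exp_minus)
    moreover have "(\<lambda>y. exp (- (y * \<theta>1 / (2 * \<theta>2))) * wt \<theta>1 \<theta>2 f y) \<in> borel_measurable lborel" by measurable
    ultimately show "set_borel_measurable lborel {0..1} f" unfolding set_borel_measurable_def by (simp only:)
  qed
  moreover have "set_integrable lborel {0..1} (\<lambda>y. exp (y * \<theta>1 / \<theta>2) * f y * f y) \<longleftrightarrow> integrable lborel (\<lambda>y. (wt \<theta>1 \<theta>2 f y)\<^sup>2)"
    unfolding set_integrable_def power2_eq_square wt_mult ..
  ultimately show ?thesis by (auto simp: H_space_def L2_def)
qed

lemma wt_diff: "wt \<theta>1 \<theta>2 (\<lambda>y. f y - g y) = (\<lambda>y. wt \<theta>1 \<theta>2 f y - wt \<theta>1 \<theta>2 g y)"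
  by (auto simp: wt_def algebra_simps)

lemma wt_sum: "wt \<theta>1 \<theta>2 (\<lambda>y. \<Sum>i\<in>I. c i * f i y) = (\<lambda>y. \<Sum>i\<in>I. c i * wt \<theta>1 \<theta>2 (f i) y)"
  by (rule ext) (simp add: wt_def sum_distrib_left sum_distrib_right mult_ac)

lemma L2_bounded_support:
  assumes [measurable]: "f \<in> borel_measurable lborel" and b: "\<And>y. \<bar>f y\<bar> \<le> B * indicator {0..1::real} y"
  shows "L2 lborel f"
  unfolding L2_def
proof
  show "integrable lborel (\<lambda>x. (f x)\<^sup>2)"
  proof (rule Bochner_Integration.integrable_bound)
    show "integrable lborel (\<lambda>y. B\<^sup>2 * indicator {0..1::real} y)" by simp
    show "AE x in lborel. norm ((f x)\<^sup>2) \<le> norm (B\<^sup>2 * indicator {0..1} x)"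
    proof (rule AE_I2)
      fix x
      have "\<bar>f x\<bar>\<^sup>2 \<le> (B * indicator {0..1} x)\<^sup>2" by (intro power_mono b) simp
      then show "norm ((f x)\<^sup>2) \<le> norm (B\<^sup>2 * indicator {0..1} x)" by (simp split: split_indicator_asm)
    qed
  qed simp
qed simp

lemma wt_weight_le:
  assumes "0 \<le> y" "y \<le> (1::real)" shows "exp (y * \<theta>1 / (2 * \<theta>2)) \<le> exp (\<bar>\<theta>1 / (2 * \<theta>2)\<bar>)"
proof -
  have "y * (\<theta>1 / (2 * \<theta>2)) \<le> \<bar>y * (\<theta>1 / (2 * \<theta>2))\<bar>" by (rule abs_ge_self)
  also have "\<dots> = y * \<bar>\<theta>1 / (2 * \<theta>2)\<bar>" using assms by (simp add: abs_mult)
  also have "\<dots> \<le> 1 * \<bar>\<theta>1 / (2 * \<theta>2)\<bar>" using assms by (intro mult_right_mono) auto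
  finally show ?thesis by simp
qed

lemma H_space_bounded:
  assumes [measurable]: "f \<in> borel_measurable borel" and b: "\<And>y. 0 \<le> y \<Longrightarrow> y \<le> 1 \<Longrightarrow> \<bar>f y\<bar> \<le> B"
  shows "f \<in> H_space \<theta>1 \<theta>2"
  unfolding H_space_wt
proof (rule L2_bounded_support)
  show "wt \<theta>1 \<theta>2 f \<in> borel_measurable lborel" unfolding wt_def by measurable
  fix y
  have "0 \<le> B" using b[of 0] by simp
  show "\<bar>wt \<theta>1 \<theta>2 f y\<bar> \<le> exp (\<bar>\<theta>1 / (2 * \<theta>2)\<bar>) * B * indicator {0..1} y"
  proof (cases "y \<in> {0..1}")
    case True
    then have "exp (y * \<theta>1 / (2 * \<theta>2)) * \<bar>f y\<bar> \<le> exp (\<bar>\<theta>1 / (2 * \<theta>2)\<bar>) * B"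
      by (intro mult_mono wt_weight_le b) auto
    then show ?thesis using True by (simp add: wt_def abs_mult)
  qed (simp add: wt_def)
qed

lemma H_norm_wt: "H_norm \<theta>1 \<theta>2 f = sqrt (\<integral>y. (wt \<theta>1 \<theta>2 f y)\<^sup>2 \<partial>lborel)"
  unfolding H_norm_def H_inner_wt power2_eq_square ..

lemma H_inner_le:
  assumes "f \<in> H_space \<theta>1 \<theta>2" "g \<in> H_space \<theta>1 \<theta>2"
  shows "\<bar>H_inner \<theta>1 \<theta>2 f g\<bar> \<le> H_norm \<theta>1 \<theta>2 f * H_norm \<theta>1 \<theta>2 g"
  using L2_Cauchy_Schwarz'[OF assms[unfolded H_space_wt]] unfolding H_inner_wt H_norm_wt .

lemma H_space_diff: "f \<in> H_space \<theta>1 \<theta>2 \<Longrightarrow> g \<in> H_space \<theta>1 \<theta>2 \<Longrightarrow> (\<lambda>y. f y - g y) \<in> H_space \<theta>1 \<theta>2"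
  unfolding H_space_wt wt_diff by (rule L2_diff)

lemma H_space_sum: "(\<And>i. i \<in> I \<Longrightarrow> f i \<in> H_space \<theta>1 \<theta>2) \<Longrightarrow> (\<lambda>y. \<Sum>i\<in>I. c i * f i y) \<in> H_space \<theta>1 \<theta>2"
  unfolding H_space_wt wt_sum by (intro L2_sum L2_cmult) auto

lemma H_inner_diff:
  assumes "f \<in> H_space \<theta>1 \<theta>2" "g \<in> H_space \<theta>1 \<theta>2" "h \<in> H_space \<theta>1 \<theta>2"
  shows "H_inner \<theta>1 \<theta>2 (\<lambda>y. f y - g y) h = H_inner \<theta>1 \<theta>2 f h - H_inner \<theta>1 \<theta>2 g h"
  using assms unfolding H_space_wt H_inner_wt wt_diff left_diff_distrib
  by (intro Bochner_Integration.integral_diff L2_mult_integrable)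

lemma H_inner_sum:
  assumes "\<And>i. i \<in> I \<Longrightarrow> f i \<in> H_space \<theta>1 \<theta>2" "h \<in> H_space \<theta>1 \<theta>2"
  shows "H_inner \<theta>1 \<theta>2 (\<lambda>y. \<Sum>i\<in>I. c i * f i y) h = (\<Sum>i\<in>I. c i * H_inner \<theta>1 \<theta>2 (f i) h)"
proof -
  have i: "integrable lborel (\<lambda>y. wt \<theta>1 \<theta>2 (f i) y * wt \<theta>1 \<theta>2 h y)" if "i \<in> I" for i
    using assms that unfolding H_space_wt by (intro L2_mult_integrable) auto
  have "H_inner \<theta>1 \<theta>2 (\<lambda>y. \<Sum>i\<in>I. c i * f i y) h = (\<integral>y. (\<Sum>i\<in>I. c i * (wt \<theta>1 \<theta>2 (f i) y * wt \<theta>1 \<theta>2 h y)) \<partial>lborel)"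
    unfolding H_inner_wt wt_sum by (simp add: sum_distrib_right mult.assoc)
  also have "\<dots> = (\<Sum>i\<in>I. \<integral>y. c i * (wt \<theta>1 \<theta>2 (f i) y * wt \<theta>1 \<theta>2 h y) \<partial>lborel)"
    using i by (intro Bochner_Integration.integral_sum integrable_mult_right) auto
  finally show ?thesis by (simp add: H_inner_wt)
qed

lemma H_norm_nonneg: "0 \<le> H_norm \<theta>1 \<theta>2 f" by (simp add: H_norm_wt)

text \<open>By Cauchy-Schwarz the half spaces of \<open>H_inner\<close> are open. It makes the
  coefficients of \<open>\<xi>\<close> measurable functionals of \<open>\<xi>\<close>, as the
  independence of \<open>\<xi>\<close> from the noise requires.\<close>

lemma H_inner_measurable:
  assumes h: "h \<in> H_space \<theta>1 \<theta>2"
  shows "(\<lambda>f. H_inner \<theta>1 \<theta>2 f h) \<in> borel_measurable (H_borel \<theta>1 \<theta>2)"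
proof -
  have sub: "{U. H_open \<theta>1 \<theta>2 U} \<subseteq> Pow (H_space \<theta>1 \<theta>2)" by (auto simp: H_open_def)
  have sp: "space (H_borel \<theta>1 \<theta>2) = H_space \<theta>1 \<theta>2" unfolding H_borel_def by (rule space_measure_of[OF sub])
  show ?thesis
  proof (subst borel_measurable_iff_greater, intro allI)
    fix c
    let ?U = "{f \<in> H_space \<theta>1 \<theta>2. c < H_inner \<theta>1 \<theta>2 f h}"
    have "H_open \<theta>1 \<theta>2 ?U"
      unfolding H_open_def
    proof (intro conjI ballI)
      fix f assume f: "f \<in> ?U"
      \<comment> \<open>The summand \<open>1\<close> keeps the radius meaningful when
        \<open>h\<close> has norm zero.\<close>
      define N where "N = H_norm \<theta>1 \<theta>2 h + 1"
      have N: "0 < N" using H_norm_nonneg[of \<theta>1 \<theta>2 h] by (simp add: N_def)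
      define e where "e = (H_inner \<theta>1 \<theta>2 f h - c) / N"
      have e: "0 < e" using f N by (simp add: e_def)
      show "\<exists>\<epsilon>>0. \<forall>g\<in>H_space \<theta>1 \<theta>2. H_norm \<theta>1 \<theta>2 (\<lambda>y. g y - f y) < \<epsilon> \<longrightarrow> g \<in> ?U"
      proof (intro exI[of _ e] conjI ballI impI e)
        fix g assume g: "g \<in> H_space \<theta>1 \<theta>2" and d: "H_norm \<theta>1 \<theta>2 (\<lambda>y. g y - f y) < e"
        have fH: "f \<in> H_space \<theta>1 \<theta>2" using f by simp
        have "\<bar>H_inner \<theta>1 \<theta>2 g h - H_inner \<theta>1 \<theta>2 f h\<bar> \<le> H_norm \<theta>1 \<theta>2 (\<lambda>y. g y - f y) * H_norm \<theta>1 \<theta>2 h"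
          using H_inner_le[OF H_space_diff[OF g fH] h] unfolding H_inner_diff[OF g fH h] .
        also have "\<dots> \<le> H_norm \<theta>1 \<theta>2 (\<lambda>y. g y - f y) * N" by (intro mult_left_mono H_norm_nonneg) (simp add: N_def)
        also have "\<dots> < e * N" using d N by (rule mult_strict_right_mono)
        also have "\<dots> = H_inner \<theta>1 \<theta>2 f h - c" using N by (simp add: e_def)
        finally have "c < H_inner \<theta>1 \<theta>2 g h" by linarith
        then show "g \<in> ?U" using g by simp
      qed
    qed auto
    then have "?U \<in> sets (H_borel \<theta>1 \<theta>2)" unfolding H_borel_def sets_measure_of[OF sub] by (intro sigma_sets.Basic) simp
    then show "{f \<in> space (H_borel \<theta>1 \<theta>2). c < H_inner \<theta>1 \<theta>2 f h} \<in> sets (H_borel \<theta>1 \<theta>2)" unfolding sp .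
  qed
qed

lemma eigfun_measurable [measurable]: "eigfun \<theta>1 \<theta>2 k \<in> borel_measurable borel"
  unfolding eigfun_def[abs_def] by measurable

lemma eigfun_bound:
  assumes "0 \<le> y" "y \<le> 1" shows "\<bar>eigfun \<theta>1 \<theta>2 k y\<bar> \<le> sqrt 2 * exp (\<bar>\<theta>1 / (2 * \<theta>2)\<bar>)"
proof -
  have "exp (y * (- \<theta>1) / (2 * \<theta>2)) \<le> exp (\<bar>(- \<theta>1) / (2 * \<theta>2)\<bar>)" by (rule wt_weight_le[OF assms])
  then have "exp (- (\<theta>1 / (2 * \<theta>2)) * y) \<le> exp (\<bar>\<theta>1 / (2 * \<theta>2)\<bar>)" by (simp add: mult.commute)
  then have "\<bar>sin (pi * real k * y)\<bar> * exp (- (\<theta>1 / (2 * \<theta>2)) * y) \<le> 1 * exp (\<bar>\<theta>1 / (2 * \<theta>2)\<bar>)"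
    by (intro mult_mono) auto
  then show ?thesis by (simp add: eigfun_def abs_mult)
qed

lemma eigfun_H_space: "eigfun \<theta>1 \<theta>2 k \<in> H_space \<theta>1 \<theta>2"
  by (rule H_space_bounded[OF eigfun_measurable eigfun_bound])

text \<open>Pairing with \<open>avg y \<epsilon>\<close> takes the mean over \<open>{y..y + \<epsilon>}\<close>; these means turn the convergence of the
  eigenfunction series in \<open>H_norm\<close> into information on the point values of a continuous path.\<close>

definition avg :: "real \<Rightarrow> real \<Rightarrow> real \<Rightarrow> real \<Rightarrow> real \<Rightarrow> real" where
  "avg \<theta>1 \<theta>2 y \<epsilon> z = indicator {y..y + \<epsilon>} z * exp (- (z * \<theta>1 / \<theta>2)) / \<epsilon>"

context
  fixes y \<epsilon> :: real assumes y: "0 \<le> y" "0 < \<epsilon>" "y + \<epsilon> \<le> 1"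
begin

lemma avg_H_space: "avg \<theta>1 \<theta>2 y \<epsilon> \<in> H_space \<theta>1 \<theta>2"
proof (rule H_space_bounded)
  show "avg \<theta>1 \<theta>2 y \<epsilon> \<in> borel_measurable borel" unfolding avg_def[abs_def] by measurable
  fix z :: real assume z: "0 \<le> z" "z \<le> 1"
  \<comment> \<open>The instance \<open>\<theta>2 / 2\<close> turns the root of the weight into the
    full weight.\<close>
  have "exp (z * (- \<theta>1) / (2 * (\<theta>2 / 2))) \<le> exp (\<bar>(- \<theta>1) / (2 * (\<theta>2 / 2))\<bar>)" by (rule wt_weight_le[OF z])
  then have "exp (- (z * \<theta>1 / \<theta>2)) \<le> exp (\<bar>\<theta>1 / \<theta>2\<bar>)" by simp
  then have "exp (- (z * \<theta>1 / \<theta>2)) / \<epsilon> \<le> exp (\<bar>\<theta>1 / \<theta>2\<bar>) / \<epsilon>" using y by (intro divide_right_mono) auto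
  then show "\<bar>avg \<theta>1 \<theta>2 y \<epsilon> z\<bar> \<le> exp (\<bar>\<theta>1 / \<theta>2\<bar>) / \<epsilon>"
    using y by (simp add: avg_def abs_mult split: split_indicator)
qed

lemma H_inner_avg: "H_inner \<theta>1 \<theta>2 f (avg \<theta>1 \<theta>2 y \<epsilon>) = (LINT z:{y..y + \<epsilon>}|lborel. f z) / \<epsilon>"
proof -
  have "H_inner \<theta>1 \<theta>2 f (avg \<theta>1 \<theta>2 y \<epsilon>) = (\<integral>z. (indicator {y..y + \<epsilon>} z *\<^sub>R f z) / \<epsilon> \<partial>lborel)"
    unfolding H_inner_def set_lebesgue_integral_def
  proof (intro Bochner_Integration.integral_cong refl)
    fix z
    show "indicator {0..1} z *\<^sub>R (exp (z * \<theta>1 / \<theta>2) * f z * avg \<theta>1 \<theta>2 y \<epsilon> z) = (indicator {y..y + \<epsilon>} z *\<^sub>R f z) / \<epsilon>"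
      using y by (auto simp: avg_def exp_minus split: split_indicator)
  qed
  then show ?thesis by (simp add: set_lebesgue_integral_def)
qed

lemma avg_near:
  assumes i: "set_integrable lborel {y..y + \<epsilon>} f" and d: "\<And>z. y \<le> z \<Longrightarrow> z \<le> y + \<epsilon> \<Longrightarrow> \<bar>f z - c\<bar> \<le> \<eta>"
  shows "\<bar>H_inner \<theta>1 \<theta>2 f (avg \<theta>1 \<theta>2 y \<epsilon>) - c\<bar> \<le> \<eta>"
proof -
  have ci: "set_integrable lborel {y..y + \<epsilon>} (\<lambda>_. c)" for c :: real
    unfolding set_integrable_def by (rule borel_integrable_compact) auto
  have cv: "(LINT z:{y..y + \<epsilon>}|lborel. c) = c * \<epsilon>" for c :: real
    using y by (simp add: set_lebesgue_integral_def)
  have "\<bar>(LINT z:{y..y + \<epsilon>}|lborel. f z - c)\<bar> \<le> (LINT z:{y..y + \<epsilon>}|lborel. \<eta>)"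
    by (rule set_integral_bound[OF set_integral_diff(1)[OF i ci] ci]) (use d in auto)
  then have "\<bar>(LINT z:{y..y + \<epsilon>}|lborel. f z) - c * \<epsilon>\<bar> \<le> \<eta> * \<epsilon>"
    unfolding set_integral_diff(2)[OF i ci] cv .
  then have "\<bar>(LINT z:{y..y + \<epsilon>}|lborel. f z) - c * \<epsilon>\<bar> / \<epsilon> \<le> \<eta>" using y by (simp add: pos_divide_le_eq)
  moreover have "\<bar>(LINT z:{y..y + \<epsilon>}|lborel. f z) - c * \<epsilon>\<bar> / \<epsilon> = \<bar>(LINT z:{y..y + \<epsilon>}|lborel. f z) / \<epsilon> - c\<bar>"
  proof -
    have "(LINT z:{y..y + \<epsilon>}|lborel. f z) / \<epsilon> - c = ((LINT z:{y..y + \<epsilon>}|lborel. f z) - c * \<epsilon>) / \<epsilon>" using y by (simp add: diff_divide_distrib)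
    then show ?thesis using y by (simp add: abs_divide)
  qed
  ultimately show ?thesis unfolding H_inner_avg by simp
qed

text \<open>The bound is the same for all modes and all windows, so averaging leaves the tail
  estimate by the series of \<open>1 / lam\<close> intact.\<close>

lemma eigfun_avg_bound: "\<bar>H_inner \<theta>1 \<theta>2 (eigfun \<theta>1 \<theta>2 k) (avg \<theta>1 \<theta>2 y \<epsilon>)\<bar> \<le> sqrt 2 * exp (\<bar>\<theta>1 / (2 * \<theta>2)\<bar>)"
proof -
  have c: "continuous_on {y..y+\<epsilon>} (eigfun \<theta>1 \<theta>2 k)" unfolding eigfun_def[abs_def] by (intro continuous_intros)
  have "\<bar>H_inner \<theta>1 \<theta>2 (eigfun \<theta>1 \<theta>2 k) (avg \<theta>1 \<theta>2 y \<epsilon>) - 0\<bar> \<le> sqrt 2 * exp (\<bar>\<theta>1 / (2 * \<theta>2)\<bar>)"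
  proof (rule avg_near)
    show "set_integrable lborel {y..y+\<epsilon>} (eigfun \<theta>1 \<theta>2 k)" by (rule borel_integrable_compact[OF _ c, folded set_integrable_def]) simp
    fix z assume "y \<le> z" "z \<le> y + \<epsilon>"
    then show "\<bar>eigfun \<theta>1 \<theta>2 k z - 0\<bar> \<le> sqrt 2 * exp (\<bar>\<theta>1 / (2 * \<theta>2)\<bar>)"
      using eigfun_bound[of z \<theta>1 \<theta>2 k] y by simp
  qed
  then show ?thesis by simp
qed

end

lemma avg_tendsto:
  assumes y: "0 \<le> y" "y < 1" and f: "continuous_on {0..1} f"
    and e: "\<And>l::nat. 0 < \<epsilon> l" "\<And>l. y + \<epsilon> l \<le> 1" "\<epsilon> \<longlonglongrightarrow> 0"
  shows "(\<lambda>l. H_inner \<theta>1 \<theta>2 f (avg \<theta>1 \<theta>2 y (\<epsilon> l))) \<longlonglongrightarrow> f y"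
proof (rule LIMSEQ_I)
  fix \<eta> :: real assume \<eta>: "0 < \<eta>"
  have "y \<in> {0..1}" "0 < \<eta> / 2" using y \<eta> by auto
  then obtain d where d: "d > 0" "\<And>z. z \<in> {0..1} \<Longrightarrow> dist z y < d \<Longrightarrow> dist (f z) (f y) < \<eta> / 2"
    using f unfolding continuous_on_iff by meson
  obtain N where N: "\<And>l. N \<le> l \<Longrightarrow> norm (\<epsilon> l - 0) < d" using LIMSEQ_D[OF e(3) d(1)] by blast
  show "\<exists>no. \<forall>n\<ge>no. norm (H_inner \<theta>1 \<theta>2 f (avg \<theta>1 \<theta>2 y (\<epsilon> n)) - f y) < \<eta>"
  proof (intro exI[of _ N] allI impI)
    fix l assume l: "N \<le> l"
    have el: "\<epsilon> l < d" using N[OF l] by simp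
    have c: "continuous_on {y..y + \<epsilon> l} f" by (rule continuous_on_subset[OF f]) (use y e(2)[of l] in auto)
    have "\<bar>H_inner \<theta>1 \<theta>2 f (avg \<theta>1 \<theta>2 y (\<epsilon> l)) - f y\<bar> \<le> \<eta> / 2"
    proof (rule avg_near[OF y(1) e(1) e(2)])
      show "set_integrable lborel {y..y + \<epsilon> l} f" by (rule borel_integrable_compact[OF _ c, folded set_integrable_def]) simp
      fix z assume z: "y \<le> z" "z \<le> y + \<epsilon> l"
      have "dist (f z) (f y) < \<eta> / 2" by (rule d(2)) (use z el y e(2)[of l] in \<open>auto simp: dist_real_def\<close>)
      then show "\<bar>f z - f y\<bar> \<le> \<eta> / 2" by (simp add: dist_real_def)
    qed
    then show "norm (H_inner \<theta>1 \<theta>2 f (avg \<theta>1 \<theta>2 y (\<epsilon> l)) - f y) < \<eta>" using \<eta> by simp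
  qed
qed

section \<open>Second moments of the modes\<close>

lemma (in prob_space) orthogonal_sum_inner:
  fixes V V' :: "'i \<Rightarrow> 'a \<Rightarrow> real"
  assumes F: "finite F" and L: "\<And>k. k \<in> F \<Longrightarrow> L2 M (V k)" "\<And>k. k \<in> F \<Longrightarrow> L2 M (V' k)"
    and o: "\<And>k l. k \<in> F \<Longrightarrow> l \<in> F \<Longrightarrow> k \<noteq> l \<Longrightarrow> expectation (\<lambda>\<omega>. V k \<omega> * V' l \<omega>) = 0"
  shows "expectation (\<lambda>\<omega>. (\<Sum>k\<in>F. d k * V k \<omega>) * (\<Sum>k\<in>F. d' k * V' k \<omega>)) = (\<Sum>k\<in>F. d k * d' k * expectation (\<lambda>\<omega>. V k \<omega> * V' k \<omega>))"
proof -
  have "expectation (\<lambda>\<omega>. (\<Sum>k\<in>F. d k * V k \<omega>) * (\<Sum>k\<in>F. d' k * V' k \<omega>))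
    = expectation (\<lambda>\<omega>. (\<Sum>k\<in>F. \<Sum>l\<in>F. (d k * d' l) * (V k \<omega> * V' l \<omega>)))"
    unfolding sum_product by (simp add: mult_ac)
  also have "\<dots> = (\<Sum>k\<in>F. \<Sum>l\<in>F. (d k * d' l) * expectation (\<lambda>\<omega>. V k \<omega> * V' l \<omega>))"
    by (rule integral_double_sum) (intro L2_mult_integrable L)
  also have "\<dots> = (\<Sum>k\<in>F. d k * d' k * expectation (\<lambda>\<omega>. V k \<omega> * V' k \<omega>))"
  proof (rule sum.cong[OF refl])
    fix k assume k: "k \<in> F"
    have "(\<Sum>l\<in>F. (d k * d' l) * expectation (\<lambda>\<omega>. V k \<omega> * V' l \<omega>)) = (\<Sum>l\<in>F. if k = l then d k * d' k * expectation (\<lambda>\<omega>. V k \<omega> * V' k \<omega>) else 0)"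
      using o[OF k] by (intro sum.cong refl) auto
    then show "(\<Sum>l\<in>F. (d k * d' l) * expectation (\<lambda>\<omega>. V k \<omega> * V' l \<omega>)) = d k * d' k * expectation (\<lambda>\<omega>. V k \<omega> * V' k \<omega>)"
      using F k by simp
  qed
  finally show ?thesis .
qed

lemma L2_nn_integral:
  assumes "f \<in> borel_measurable M" "(\<integral>\<^sup>+ x. ennreal ((f x)\<^sup>2) \<partial>M) \<le> ennreal B" "0 \<le> B"
  shows "L2 M f" "(\<integral>x. (f x)\<^sup>2 \<partial>M) \<le> B"
proof -
  have "(\<integral>\<^sup>+ x. ennreal (norm ((f x)\<^sup>2)) \<partial>M) < \<infinity>" using assms(2) by (simp add: le_less_trans)
  then have "integrable M (\<lambda>x. (f x)\<^sup>2)" using assms(1) by (intro integrableI_bounded) auto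
  then show "L2 M f" using assms(1) by (simp add: L2_def)
  have "(\<integral>x. (f x)\<^sup>2 \<partial>M) = enn2real (\<integral>\<^sup>+ x. ennreal ((f x)\<^sup>2) \<partial>M)" using assms(1) by (intro integral_eq_nn_integral) auto
  also have "\<dots> \<le> enn2real (ennreal B)" using assms(2) by (intro enn2real_mono) auto
  finally show "(\<integral>x. (f x)\<^sup>2 \<partial>M) \<le> B" using assms(3) by simp
qed

lemma nn_integral_square_eq: "L2 M f \<Longrightarrow> (\<integral>\<^sup>+ x. ennreal ((f x)\<^sup>2) \<partial>M) = ennreal (\<integral>x. (f x)\<^sup>2 \<partial>M)"
  by (rule nn_integral_eq_integral) (auto dest: L2_square)

locale spde = brownian_family M W + positive_theta_series c0 a
  for M :: "'w measure" and W and c0 a :: real +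
  fixes \<theta>0 \<theta>1 \<theta>2 \<sigma> :: real and \<xi> :: "'w \<Rightarrow> real \<Rightarrow> real" and X :: "real \<Rightarrow> real \<Rightarrow> 'w \<Rightarrow> real"
  assumes c0: "c0 = - \<theta>0 + \<theta>1\<^sup>2 / (4 * \<theta>2)" and a: "a = pi\<^sup>2 * \<theta>2" and \<sigma>_pos: "\<sigma> > 0"
    and \<xi>_indep: "independent_rvs M (H_borel \<theta>1 \<theta>2) \<xi>
           (PiM {1..} (\<lambda>_. PiM {0..} (\<lambda>_. borel))) (\<lambda>\<omega>. \<lambda>k\<in>{1..}. \<lambda>t\<in>{0..}. W k t \<omega>)"
    and mild: "continuous_mild_solution M \<theta>0 \<theta>1 \<theta>2 \<sigma> W \<xi> X"
    and initial: "initial_condition M \<theta>0 \<theta>1 \<theta>2 \<xi>"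
begin

lemma eigval_lam: "eigval \<theta>0 \<theta>1 \<theta>2 k = lam (real k)" unfolding eigval_def lam_def by (simp add: c0 a)

lemma \<theta>2_pos: "0 < \<theta>2" using a_pos by (simp add: a zero_less_mult_iff)

definition noise_modes :: "(nat \<Rightarrow> real \<Rightarrow> 'w \<Rightarrow> real) \<Rightarrow> bool" where
  "noise_modes Z \<longleftrightarrow> (\<forall>k\<ge>1. \<forall>t\<in>{0..1}.
           has_wiener_integral M (W k) (\<lambda>s. exp (- lam (real k) * (t - s)) * \<sigma>) t (Z k t)) \<and>
        (\<forall>t\<in>{0..1}. AE \<omega> in M.
           (\<lambda>y. X t y \<omega>) \<in> H_space \<theta>1 \<theta>2 \<and>
           (\<lambda>K. H_norm \<theta>1 \<theta>2 (\<lambda>y. X t y \<omega> -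
              (\<Sum>k=1..K. (exp (- lam (real k) * t) * H_inner \<theta>1 \<theta>2 (\<xi> \<omega>) (eigfun \<theta>1 \<theta>2 k)
                          + Z k t \<omega>) * eigfun \<theta>1 \<theta>2 k y))) \<longlonglongrightarrow> 0)"

definition Z :: "nat \<Rightarrow> real \<Rightarrow> 'w \<Rightarrow> real" where "Z = (SOME Z. noise_modes Z)"
definition ak :: "nat \<Rightarrow> 'w \<Rightarrow> real" where "ak k \<omega> = H_inner \<theta>1 \<theta>2 (\<xi> \<omega>) (eigfun \<theta>1 \<theta>2 k)"
definition xk :: "nat \<Rightarrow> real \<Rightarrow> 'w \<Rightarrow> real" where "xk k t \<omega> = exp (- lam (real k) * t) * ak k \<omega> + Z k t \<omega>"

lemma Z_noise_modes: "noise_modes Z"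
proof -
  have "\<exists>Z. noise_modes Z" using mild unfolding continuous_mild_solution_def noise_modes_def eigval_lam by blast
  then show ?thesis unfolding Z_def by (rule someI_ex)
qed

lemma Z_wiener: "1 \<le> k \<Longrightarrow> t \<in> {0..1} \<Longrightarrow> has_wiener_integral M (W k) (\<lambda>s. exp (- lam (real k) * (t - s)) * \<sigma>) t (Z k t)"
  using Z_noise_modes by (simp add: noise_modes_def)

lemma X_expansion: assumes "t \<in> {0..1}"
  shows "AE \<omega> in M. (\<lambda>y. X t y \<omega>) \<in> H_space \<theta>1 \<theta>2 \<and>
    (\<lambda>K. H_norm \<theta>1 \<theta>2 (\<lambda>y. X t y \<omega> - (\<Sum>k=1..K. xk k t \<omega> * eigfun \<theta>1 \<theta>2 k y))) \<longlonglongrightarrow> 0"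
  using Z_noise_modes assms by (simp add: noise_modes_def xk_def ak_def)

lemma kernel_continuous: "continuous_on UNIV (\<lambda>s. exp (- lam (real k) * (t - s)) * \<sigma>)"
  by (intro continuous_intros)

lemma Z_L2: assumes "1 \<le> k" "t \<in> {0..1}" shows "L2 M (Z k t)"
  by (rule wiener_L2[OF bm[OF assms(1)] Z_wiener[OF assms] kernel_continuous])

lemma Z_cross: assumes "1 \<le> k" "1 \<le> l" "k \<noteq> l" "s \<in> {0..1}" "t \<in> {0..1}"
  shows "expectation (\<lambda>\<omega>. Z k s \<omega> * Z l t \<omega>) = 0"
  by (rule wiener_cross[OF assms(1-3) Z_wiener[OF assms(1,4)] kernel_continuous Z_wiener[OF assms(2,5)] kernel_continuous])

text \<open>The Ito isometry gives \<open>\<sigma>^2 / (2 lam)\<close> times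
  \<open>exp (- lam \<bar>t - s\<bar>) - exp (- lam (s + t))\<close>. In terms of \<open>wk\<close>,
  the dependence on the lag and on the sum of the times is separated, and each becomes a second
  difference in \<open>dZ_cov\<close>.\<close>

lemma Z_cov: assumes "1 \<le> k" "s \<in> {0..1}" "t \<in> {0..1}"
  shows "expectation (\<lambda>\<omega>. Z k s \<omega> * Z k t \<omega>) = \<sigma>\<^sup>2 / 2 * (wk (s + t) k - wk \<bar>t - s\<bar> k)"
proof -
  let ?l = "lam (real k)"
  define u where "u = min s t"
  have u: "0 \<le> u" using assms by (auto simp: u_def)
  have l: "0 < ?l" using lam_pos[OF assms(1)] .
  let ?F = "\<lambda>r. \<sigma>\<^sup>2 / (2 * ?l) * exp (2 * ?l * r - ?l * (s + t))"
  have "expectation (\<lambda>\<omega>. Z k s \<omega> * Z k t \<omega>) = (\<integral>r. (exp (- ?l * (s - r)) * \<sigma> * indicator {0..s} r) * (exp (- ?l * (t - r)) * \<sigma> * indicator {0..t} r) \<partial>lborel)"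
    by (rule wiener_cov[OF bm[OF assms(1)] Z_wiener[OF assms(1,2)] kernel_continuous Z_wiener[OF assms(1,3)] kernel_continuous])
  also have "\<dots> = (\<integral>r. (\<sigma>\<^sup>2 * exp (2 * ?l * r - ?l * (s + t))) * indicator {0..u} r \<partial>lborel)"
  proof (intro Bochner_Integration.integral_cong refl)
    fix r
    have "exp (- ?l * (s - r)) * exp (- ?l * (t - r)) = exp (2 * ?l * r - ?l * (s + t))"
      by (simp add: algebra_simps flip: exp_add)
    then show "(exp (- ?l * (s - r)) * \<sigma> * indicator {0..s} r) * (exp (- ?l * (t - r)) * \<sigma> * indicator {0..t} r) = (\<sigma>\<^sup>2 * exp (2 * ?l * r - ?l * (s + t))) * indicator {0..u} r"
      by (simp add: u_def power2_eq_square split: split_indicator)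
  qed
  also have "\<dots> = ?F u - ?F 0"
  proof (rule integral_FTC_Icc_real[OF u])
    show "(?F has_real_derivative \<sigma>\<^sup>2 * exp (2 * ?l * r - ?l * (s + t))) (at r)" for r
      using l by (auto intro!: derivative_eq_intros)
  qed (intro continuous_intros)
  also have "\<dots> = \<sigma>\<^sup>2 / 2 * (wk (s + t) k - wk \<bar>t - s\<bar> k)"
  proof -
    have "2 * ?l * u - ?l * (s + t) = - ?l * \<bar>t - s\<bar>" by (auto simp: u_def min_def algebra_simps)
    then have e: "?F u = \<sigma>\<^sup>2 / (2 * ?l) * exp (- ?l * \<bar>t - s\<bar>)" by (simp only:)
    have e0: "?F 0 = \<sigma>\<^sup>2 / (2 * ?l) * exp (- ?l * (s + t))" by simp
    have "wk (s + t) k - wk \<bar>t - s\<bar> k = (exp (- ?l * \<bar>t - s\<bar>) - exp (- ?l * (s + t))) / ?l"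
      unfolding wk_def by (simp flip: diff_divide_distrib)
    then show ?thesis unfolding e e0 by (simp add: right_diff_distrib diff_divide_distrib)
  qed
  finally show ?thesis .
qed

lemma Z_square_le: assumes "1 \<le> k" "t \<in> {0..1}" shows "expectation (\<lambda>\<omega>. (Z k t \<omega>)\<^sup>2) \<le> \<sigma>\<^sup>2 / 2 * (1 / lam (real k))"
proof -
  have "expectation (\<lambda>\<omega>. (Z k t \<omega>)\<^sup>2) = \<sigma>\<^sup>2 / 2 * wk (t + t) k"
    using Z_cov[OF assms assms(2)] by (simp add: power2_eq_square[of "Z k t _"] wk_def)
  also have "\<dots> \<le> \<sigma>\<^sup>2 / 2 * (1 / lam (real k))" using assms by (intro mult_left_mono wk_bounds) auto
  finally show ?thesis .
qed

lemma Z_sum_bound: assumes "finite F" "F \<subseteq> {1..}" "t \<in> {0..1}"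
  shows "expectation (\<lambda>\<omega>. (\<Sum>k\<in>F. d k * Z k t \<omega>)\<^sup>2) \<le> \<sigma>\<^sup>2 / 2 * (\<Sum>k\<in>F. (d k)\<^sup>2 / lam (real k))"
proof -
  have "expectation (\<lambda>\<omega>. (\<Sum>k\<in>F. d k * Z k t \<omega>)\<^sup>2) = (\<Sum>k\<in>F. d k * d k * expectation (\<lambda>\<omega>. Z k t \<omega> * Z k t \<omega>))"
    unfolding power2_eq_square using assms by (intro orthogonal_sum_inner Z_L2 Z_cross) auto
  also have "\<dots> \<le> (\<Sum>k\<in>F. (d k)\<^sup>2 * (\<sigma>\<^sup>2 / 2 * (1 / lam (real k))))"
    unfolding power2_eq_square[symmetric] using assms by (intro sum_mono mult_left_mono Z_square_le) auto
  also have "\<dots> = \<sigma>\<^sup>2 / 2 * (\<Sum>k\<in>F. (d k)\<^sup>2 / lam (real k))" by (simp add: sum_distrib_left mult_ac)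
  finally show ?thesis .
qed

lemma ak_indep: "indep_vars (\<lambda>_. borel) ak {1..}"
  using initial by (simp add: initial_condition_def Let_def ak_def[abs_def])

lemma ak_measurable: "1 \<le> k \<Longrightarrow> ak k \<in> borel_measurable M"
  using ak_indep by (simp add: indep_vars_def)

lemma ak_path: "(\<lambda>f. H_inner \<theta>1 \<theta>2 f (eigfun \<theta>1 \<theta>2 k)) \<in> borel_measurable (H_borel \<theta>1 \<theta>2)"
  by (rule H_inner_measurable[OF eigfun_H_space])

text \<open>One bound for both alternatives of the initial condition. Centred independent
  coefficients are orthogonal with second moments of order \<open>1 / lam\<close>; otherwise
  Cauchy-Schwarz uses that the sum of \<open>lam * (ak k)^2\<close> has finite mean.\<close>

lemma ak_bounds:
  "\<exists>C\<ge>0. (\<forall>k\<ge>1. L2 M (ak k)) \<and> (\<forall>F d. finite F \<longrightarrow> F \<subseteq> {1..} \<longrightarrow>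
     expectation (\<lambda>\<omega>. (\<Sum>k\<in>F. d k * ak k \<omega>)\<^sup>2) \<le> C * (\<Sum>k\<in>F. (d k)\<^sup>2 / lam (real k)))"
proof -
  have m: "ak k \<in> borel_measurable M" if "1 \<le> k" for k by (rule ak_measurable[OF that])
  consider (centred) "\<forall>k\<ge>1. expectation (ak k) = 0" "(SUP k\<in>{1..}. ennreal (lam (real k)) * (\<integral>\<^sup>+ \<omega>. ennreal ((ak k \<omega>)\<^sup>2) \<partial>M)) < \<infinity>"
    | (smooth) "(\<integral>\<^sup>+ \<omega>. (\<Sum>k. ennreal (lam (real (Suc k)) * (ak (Suc k) \<omega>)\<^sup>2)) \<partial>M) < \<infinity>"
    using initial unfolding initial_condition_def Let_def eigval_lam ak_def[symmetric] by blast
  then show ?thesis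
  proof cases
    case centred
    define B where "B = enn2real (SUP k\<in>{1..}. ennreal (lam (real k)) * (\<integral>\<^sup>+ \<omega>. ennreal ((ak k \<omega>)\<^sup>2) \<partial>M))"
    have B0: "0 \<le> B" by (simp add: B_def)
    have B: "ennreal (lam (real k)) * (\<integral>\<^sup>+ \<omega>. ennreal ((ak k \<omega>)\<^sup>2) \<partial>M) \<le> ennreal B" if "1 \<le> k" for k
    proof -
      have "ennreal B = (SUP k\<in>{1..}. ennreal (lam (real k)) * (\<integral>\<^sup>+ \<omega>. ennreal ((ak k \<omega>)\<^sup>2) \<partial>M))"
        unfolding B_def using centred(2) by (intro ennreal_enn2real) simp
      then show ?thesis using that by (simp only:) (rule SUP_upper, simp)
    qed
    have nn: "(\<integral>\<^sup>+ \<omega>. ennreal ((ak k \<omega>)\<^sup>2) \<partial>M) \<le> ennreal (B / lam (real k))" if k: "1 \<le> k" for k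
    proof -
      have l: "0 < lam (real k)" by (rule lam_pos[OF k])
      have "(\<integral>\<^sup>+ \<omega>. ennreal ((ak k \<omega>)\<^sup>2) \<partial>M) = ennreal (1 / lam (real k)) * (ennreal (lam (real k)) * (\<integral>\<^sup>+ \<omega>. ennreal ((ak k \<omega>)\<^sup>2) \<partial>M))"
        using l by (simp add: mult.assoc[symmetric] flip: ennreal_mult')
      also have "\<dots> \<le> ennreal (1 / lam (real k)) * ennreal B" by (intro mult_left_mono B[OF k]) simp
      also have "\<dots> = ennreal (B / lam (real k))" using l B0 by (simp flip: ennreal_mult')
      finally show ?thesis .
    qed
    have L: "L2 M (ak k)" and sq: "expectation (\<lambda>\<omega>. (ak k \<omega>)\<^sup>2) \<le> B / lam (real k)" if "1 \<le> k" for k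
      using L2_nn_integral[OF m nn, OF that that] B0 lam_pos[OF that] by auto
    have cross: "expectation (\<lambda>\<omega>. ak k \<omega> * ak l \<omega>) = 0" if "1 \<le> k" "1 \<le> l" "k \<noteq> l" for k l
    proof -
      have ind: "indep_vars (\<lambda>_. borel) ak {k, l}" by (rule indep_vars_subset[OF ak_indep]) (use that in auto)
      have "expectation (\<lambda>\<omega>. \<Prod>j\<in>{k, l}. ak j \<omega>) = (\<Prod>j\<in>{k, l}. expectation (ak j))"
        by (rule indep_vars_lebesgue_integral[OF _ ind]) (use that L2_abs_le(1)[OF prob_space_axioms L] in auto)
      then show ?thesis using that centred(1) by simp
    qed
    show ?thesis
    proof (intro exI[of _ B] conjI allI impI B0 L)
      fix F :: "nat set" and d :: "nat \<Rightarrow> real" assume F: "finite F" "F \<subseteq> {1..}"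
      have "expectation (\<lambda>\<omega>. (\<Sum>k\<in>F. d k * ak k \<omega>)\<^sup>2) = (\<Sum>k\<in>F. d k * d k * expectation (\<lambda>\<omega>. ak k \<omega> * ak k \<omega>))"
        unfolding power2_eq_square using F by (intro orthogonal_sum_inner L cross) auto
      also have "\<dots> \<le> (\<Sum>k\<in>F. (d k)\<^sup>2 * (B / lam (real k)))"
        unfolding power2_eq_square[symmetric] using F by (intro sum_mono mult_left_mono sq) auto
      also have "\<dots> = B * (\<Sum>k\<in>F. (d k)\<^sup>2 / lam (real k))" by (simp add: sum_distrib_left mult_ac)
      finally show "expectation (\<lambda>\<omega>. (\<Sum>k\<in>F. d k * ak k \<omega>)\<^sup>2) \<le> B * (\<Sum>k\<in>F. (d k)\<^sup>2 / lam (real k))" .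
    qed
  next
    case smooth
    define G where "G \<omega> = (\<Sum>k. ennreal (lam (real (Suc k)) * (ak (Suc k) \<omega>)\<^sup>2))" for \<omega>
    define B where "B = enn2real (\<integral>\<^sup>+ \<omega>. G \<omega> \<partial>M)"
    have B0: "0 \<le> B" by (simp add: B_def)
    have GB: "(\<integral>\<^sup>+ \<omega>. G \<omega> \<partial>M) = ennreal B" unfolding B_def using smooth by (intro ennreal_enn2real[symmetric]) (simp add: G_def)
    have fin: "(\<Sum>k\<in>F. ennreal (lam (real k) * (ak k \<omega>)\<^sup>2)) \<le> G \<omega>" if F: "finite F" "F \<subseteq> {1..}" for F \<omega>
    proof -
      have FS: "F = Suc ` ((\<lambda>k. k - 1) ` F)" using F(2) by (auto simp: image_image intro!: image_eqI)
      have "(\<Sum>k\<in>F. ennreal (lam (real k) * (ak k \<omega>)\<^sup>2)) = (\<Sum>k\<in>(\<lambda>k. k - 1) ` F. ennreal (lam (real (Suc k)) * (ak (Suc k) \<omega>)\<^sup>2))"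
        by (subst FS, subst sum.reindex) auto
      also have "\<dots> \<le> G \<omega>" unfolding G_def using F(1) by (intro sum_le_suminf) auto
      finally show ?thesis .
    qed
    have bound: "(\<integral>\<^sup>+ \<omega>. ennreal ((\<Sum>k\<in>F. d k * ak k \<omega>)\<^sup>2) \<partial>M) \<le> ennreal (B * (\<Sum>k\<in>F. (d k)\<^sup>2 / lam (real k)))"
      if F: "finite F" "F \<subseteq> {1..}" for F d
    proof -
      let ?D = "\<Sum>k\<in>F. (d k)\<^sup>2 / lam (real k)"
      have lp: "0 < lam (real k)" if "k \<in> F" for k using F that by (intro lam_pos) auto
      have D0: "0 \<le> ?D" using lp by (intro sum_nonneg divide_nonneg_nonneg) (auto intro: less_imp_le)
      have "ennreal ((\<Sum>k\<in>F. d k * ak k \<omega>)\<^sup>2) \<le> ennreal ?D * G \<omega>" for \<omega>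
      proof -
        \<comment> \<open>A factor \<open>sqrt lam\<close> is moved from \<open>d\<close> to
          \<open>ak\<close>, whose weighted squares add up to at most \<open>G\<close>.\<close>
        have "(\<Sum>k\<in>F. d k * ak k \<omega>)\<^sup>2 = (\<Sum>k\<in>F. (d k / sqrt (lam (real k))) * (sqrt (lam (real k)) * ak k \<omega>))\<^sup>2"
          using lp by (intro arg_cong[of _ _ "\<lambda>x. x\<^sup>2"] sum.cong refl) (fastforce simp: less_imp_neq)
        also have "\<dots> \<le> (\<Sum>k\<in>F. (d k / sqrt (lam (real k)))\<^sup>2) * (\<Sum>k\<in>F. (sqrt (lam (real k)) * ak k \<omega>)\<^sup>2)"
          by (rule Cauchy_Schwarz_ineq_sum)
        also have "\<dots> = ?D * (\<Sum>k\<in>F. lam (real k) * (ak k \<omega>)\<^sup>2)"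
          using lp by (intro arg_cong2[of _ _ _ _ "(*)"] sum.cong refl) (auto simp: power_divide power_mult_distrib less_imp_le)
        finally have "ennreal ((\<Sum>k\<in>F. d k * ak k \<omega>)\<^sup>2) \<le> ennreal (?D * (\<Sum>k\<in>F. lam (real k) * (ak k \<omega>)\<^sup>2))" by (rule ennreal_leI)
        also have "\<dots> = ennreal ?D * (\<Sum>k\<in>F. ennreal (lam (real k) * (ak k \<omega>)\<^sup>2))"
          using D0 lp by (subst ennreal_mult') (auto simp: less_imp_le sum_ennreal)
        also have "\<dots> \<le> ennreal ?D * G \<omega>" by (intro mult_left_mono fin[OF F]) simp
        finally show ?thesis .
      qed
      then have "(\<integral>\<^sup>+ \<omega>. ennreal ((\<Sum>k\<in>F. d k * ak k \<omega>)\<^sup>2) \<partial>M) \<le> (\<integral>\<^sup>+ \<omega>. ennreal ?D * G \<omega> \<partial>M)" by (intro nn_integral_mono)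
      also have "\<dots> = ennreal ?D * ennreal B"
        unfolding GB[symmetric] by (rule nn_integral_cmult) (use m in \<open>simp add: G_def[abs_def]\<close>)
      also have "\<dots> = ennreal (B * ?D)" by (simp add: ennreal_mult[OF B0 D0] mult.commute)
      finally show ?thesis .
    qed
    have L: "L2 M (ak k)" if k: "1 \<le> k" for k
    proof (rule L2_nn_integral(1)[OF m[OF k]])
      show "(\<integral>\<^sup>+ \<omega>. ennreal ((ak k \<omega>)\<^sup>2) \<partial>M) \<le> ennreal (B / lam (real k))" using bound[of "{k}" "\<lambda>_. 1"] k by simp
      show "0 \<le> B / lam (real k)" using B0 lam_pos[OF k] by simp
    qed
    show ?thesis
    proof (intro exI[of _ B] conjI allI impI B0 L)
      fix F :: "nat set" and d :: "nat \<Rightarrow> real" assume F: "finite F" "F \<subseteq> {1..}"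
      show "expectation (\<lambda>\<omega>. (\<Sum>k\<in>F. d k * ak k \<omega>)\<^sup>2) \<le> B * (\<Sum>k\<in>F. (d k)\<^sup>2 / lam (real k))"
      proof (rule L2_nn_integral(2)[OF _ bound[OF F]])
        show "(\<lambda>\<omega>. \<Sum>k\<in>F. d k * ak k \<omega>) \<in> borel_measurable M" using m F by (intro borel_measurable_sum borel_measurable_times) auto
        show "0 \<le> B * (\<Sum>k\<in>F. (d k)\<^sup>2 / lam (real k))" using B0 F lam_pos by (intro mult_nonneg_nonneg sum_nonneg divide_nonneg_nonneg) (auto intro: less_imp_le)
      qed
    qed
  qed
qed

lemma ak_L2: "1 \<le> k \<Longrightarrow> L2 M (ak k)" using ak_bounds by blast

lemma xk_L2: "1 \<le> k \<Longrightarrow> t \<in> {0..1} \<Longrightarrow> L2 M (xk k t)"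
  unfolding xk_def[abs_def] by (intro L2_add L2_cmult ak_L2 Z_L2)

lemma xk_sum_bound:
  "\<exists>C\<ge>0. \<forall>F d t. finite F \<longrightarrow> F \<subseteq> {1..} \<longrightarrow> t \<in> {0..1} \<longrightarrow>
     expectation (\<lambda>\<omega>. (\<Sum>k\<in>F. d k * xk k t \<omega>)\<^sup>2) \<le> C * (\<Sum>k\<in>F. (d k)\<^sup>2 / lam (real k))"
proof -
  obtain C where C: "0 \<le> C" and b: "\<And>F d. finite F \<Longrightarrow> F \<subseteq> {1..} \<Longrightarrow>
     expectation (\<lambda>\<omega>. (\<Sum>k\<in>F. d k * ak k \<omega>)\<^sup>2) \<le> C * (\<Sum>k\<in>F. (d k)\<^sup>2 / lam (real k))"
    using ak_bounds by blast
  show ?thesis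
  proof (intro exI[of _ "2 * C + \<sigma>\<^sup>2"] conjI allI impI)
    show "0 \<le> 2 * C + \<sigma>\<^sup>2" using C by simp
    fix F :: "nat set" and d :: "nat \<Rightarrow> real" and t :: real assume F: "finite F" "F \<subseteq> {1..}" and t: "t \<in> {0..1}"
    let ?D = "\<Sum>k\<in>F. (d k)\<^sup>2 / lam (real k)"
    let ?e = "\<lambda>k. exp (- lam (real k) * t)"
    have lp: "0 < lam (real k)" if "k \<in> F" for k using F that by (intro lam_pos) auto
    have L: "L2 M (\<lambda>\<omega>. \<Sum>k\<in>F. (d k * ?e k) * ak k \<omega>)" "L2 M (\<lambda>\<omega>. \<Sum>k\<in>F. d k * Z k t \<omega>)"
      using F t by (auto intro!: L2_sum L2_cmult ak_L2 Z_L2)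
    have "expectation (\<lambda>\<omega>. (\<Sum>k\<in>F. d k * xk k t \<omega>)\<^sup>2) = expectation (\<lambda>\<omega>. ((\<Sum>k\<in>F. (d k * ?e k) * ak k \<omega>) + (\<Sum>k\<in>F. d k * Z k t \<omega>))\<^sup>2)"
      by (simp add: xk_def distrib_left sum.distrib mult.assoc)
    also have "\<dots> \<le> 2 * expectation (\<lambda>\<omega>. (\<Sum>k\<in>F. (d k * ?e k) * ak k \<omega>)\<^sup>2) + 2 * expectation (\<lambda>\<omega>. (\<Sum>k\<in>F. d k * Z k t \<omega>)\<^sup>2)"
      by (rule L2_add_square_le[OF L])
    also have "\<dots> \<le> 2 * (C * ?D) + 2 * (\<sigma>\<^sup>2 / 2 * ?D)"
    proof (intro add_mono mult_left_mono Z_sum_bound[OF F t])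
      have "expectation (\<lambda>\<omega>. (\<Sum>k\<in>F. (d k * ?e k) * ak k \<omega>)\<^sup>2) \<le> C * (\<Sum>k\<in>F. (d k * ?e k)\<^sup>2 / lam (real k))" by (rule b[OF F])
      also have "\<dots> \<le> C * ?D"
      proof (intro mult_left_mono C sum_mono divide_right_mono)
        fix k assume k: "k \<in> F"
        have "0 \<le> lam (real k) * t" using lp[OF k] t by simp
        then have "(?e k)\<^sup>2 \<le> 1" by (simp add: power_le_one)
        then have "(d k)\<^sup>2 * (?e k)\<^sup>2 \<le> (d k)\<^sup>2 * 1" by (rule mult_left_mono) simp
        then show "(d k * ?e k)\<^sup>2 \<le> (d k)\<^sup>2" by (simp add: power_mult_distrib)
        show "0 \<le> lam (real k)" using lp[OF k] by simp
      qed
      finally show "expectation (\<lambda>\<omega>. (\<Sum>k\<in>F. (d k * ?e k) * ak k \<omega>)\<^sup>2) \<le> C * ?D" .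
    qed auto
    also have "\<dots> = (2 * C + \<sigma>\<^sup>2) * ?D" by (simp add: algebra_simps)
    finally show "expectation (\<lambda>\<omega>. (\<Sum>k\<in>F. d k * xk k t \<omega>)\<^sup>2) \<le> (2 * C + \<sigma>\<^sup>2) * ?D" .
  qed
qed

end

text \<open>Fatou's lemma, first in \<open>K\<close> and then in \<open>l\<close>: second moments
  bounded uniformly survive an iterated almost sure limit.\<close>

lemma double_limit_square_bound:
  fixes D :: "nat \<Rightarrow> nat \<Rightarrow> 'a \<Rightarrow> real"
  assumes m: "\<And>l K. D l K \<in> borel_measurable M" and b: "\<And>l K. (\<integral>\<^sup>+ x. ennreal ((D l K x)\<^sup>2) \<partial>M) \<le> B"
    and lim: "AE x in M. \<exists>L. (\<forall>l. (\<lambda>K. D l K x) \<longlonglongrightarrow> L l) \<and> L \<longlonglongrightarrow> f x"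
  shows "(\<integral>\<^sup>+ x. ennreal ((f x)\<^sup>2) \<partial>M) \<le> B"
proof -
  define u where "u l x = liminf (\<lambda>K. ennreal ((D l K x)\<^sup>2))" for l x
  have ms: "(\<lambda>x. ennreal ((D l K x)\<^sup>2)) \<in> borel_measurable M" for l K using m[of l K] by measurable
  have mu: "u l \<in> borel_measurable M" for l unfolding u_def[abs_def] using ms by measurable
  have ub: "(\<integral>\<^sup>+ x. u l x \<partial>M) \<le> B" for l
  proof -
    have "(\<integral>\<^sup>+ x. u l x \<partial>M) \<le> liminf (\<lambda>K. \<integral>\<^sup>+ x. ennreal ((D l K x)\<^sup>2) \<partial>M)" unfolding u_def by (rule nn_integral_liminf[OF ms])
    also have "\<dots> \<le> limsup (\<lambda>K. \<integral>\<^sup>+ x. ennreal ((D l K x)\<^sup>2) \<partial>M)" by (rule Liminf_le_Limsup) simp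
    also have "\<dots> \<le> B" by (rule Limsup_bounded) (use b in simp)
    finally show ?thesis .
  qed
  have "(\<integral>\<^sup>+ x. ennreal ((f x)\<^sup>2) \<partial>M) \<le> (\<integral>\<^sup>+ x. liminf (\<lambda>l. u l x) \<partial>M)"
  proof (rule nn_integral_mono_AE)
    show "AE x in M. ennreal ((f x)\<^sup>2) \<le> liminf (\<lambda>l. u l x)" using lim
    proof eventually_elim
      case (elim x)
      then obtain L where L: "\<And>l. (\<lambda>K. D l K x) \<longlonglongrightarrow> L l" "L \<longlonglongrightarrow> f x" by blast
      have "u l x = ennreal ((L l)\<^sup>2)" for l
        unfolding u_def by (rule lim_imp_Liminf) (auto intro!: tendsto_intros L)
      moreover have "liminf (\<lambda>l. ennreal ((L l)\<^sup>2)) = ennreal ((f x)\<^sup>2)"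
        by (rule lim_imp_Liminf) (auto intro!: tendsto_intros L)
      ultimately show ?case by simp
    qed
  qed
  also have "\<dots> \<le> liminf (\<lambda>l. \<integral>\<^sup>+ x. u l x \<partial>M)" by (rule nn_integral_liminf[OF mu])
  also have "\<dots> \<le> limsup (\<lambda>l. \<integral>\<^sup>+ x. u l x \<partial>M)" by (rule Liminf_le_Limsup) simp
  also have "\<dots> \<le> B" by (rule Limsup_bounded) (use ub in simp)
  finally show ?thesis .
qed

section \<open>Point values of the solution and partial sums of the expansion\<close>

context spde
begin

lemma lam_tail: "\<exists>r. r \<longlonglongrightarrow> 0 \<and> (\<forall>q K. 0 \<le> r q \<and> (\<Sum>k\<in>{Suc q..K}. 1 / lam (real k)) \<le> r q)"
proof -
  let ?f = "\<lambda>k. 1 / lam (real (Suc k))"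
  have f0: "0 \<le> ?f k" for k using lam_pos[of "Suc k"] by simp
  define r where "r q = suminf ?f - (\<Sum>k<q. ?f k)" for q
  have "r \<longlonglongrightarrow> suminf ?f - suminf ?f" unfolding r_def by (intro tendsto_intros summable_LIMSEQ lam_inverse_summable)
  then have "r \<longlonglongrightarrow> 0" by simp
  moreover have r0: "0 \<le> r q" for q unfolding r_def using sum_le_suminf[OF lam_inverse_summable, of "{..<q}"] f0 by simp
  moreover have "(\<Sum>k\<in>{Suc q..K}. 1 / lam (real k)) \<le> r q" for q K
  proof (cases "q \<le> K")
    case True
    have "(\<Sum>k\<in>{Suc q..K}. 1 / lam (real k)) = (\<Sum>k\<in>{q..<K}. ?f k)"
      by (rule sum.reindex_bij_witness[of _ Suc "\<lambda>k. k - 1"]) auto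
    also have "\<dots> = (\<Sum>k<K. ?f k) - (\<Sum>k<q. ?f k)" using True sum_diff_nat_ivl[of 0 q K ?f] by (simp add: atLeast0LessThan)
    also have "\<dots> \<le> r q" unfolding r_def using sum_le_suminf[OF lam_inverse_summable, of "{..<K}"] f0 by simp
    finally show ?thesis .
  next
    case False
    then have "{Suc q..K} = {}" by simp
    then show ?thesis using r0[of q] by (simp only: sum.empty)
  qed
  ultimately show ?thesis by blast
qed

lemma X_measurable: "t \<in> {0..1} \<Longrightarrow> y \<in> {0..1} \<Longrightarrow> X t y \<in> borel_measurable M"
  using mild by (simp add: continuous_mild_solution_def)

definition partial :: "nat \<Rightarrow> real \<Rightarrow> real \<Rightarrow> 'w \<Rightarrow> real" where
  "partial q t y \<omega> = (\<Sum>k=1..q. eigfun \<theta>1 \<theta>2 k y * xk k t \<omega>)"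

lemma partial_L2: "t \<in> {0..1} \<Longrightarrow> L2 M (partial q t y)"
  unfolding partial_def[abs_def] by (intro L2_sum L2_cmult xk_L2) auto

lemma X_path_continuous: assumes "t \<in> {0..1}" shows "AE \<omega> in M. continuous_on {0..1} (\<lambda>y. X t y \<omega>)"
proof -
  have "AE \<omega> in M. continuous_on ({0..1} \<times> {0..1}) (\<lambda>(t, y). X t y \<omega>)" using mild by (simp add: continuous_mild_solution_def)
  then show ?thesis
  proof eventually_elim
    case (elim \<omega>)
    have "continuous_on {0..1} (\<lambda>y. (\<lambda>(t, y). X t y \<omega>) (t, y))"
      by (rule continuous_on_compose2[OF elim]) (use assms in \<open>auto intro!: continuous_intros\<close>)
    then show ?case by simp
  qed
qed

text \<open>A point value is reached by two limits: pairing with \<open>avg\<close> makes the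
  averaged series converge in \<open>K\<close>, and path continuity lets the window shrink in
  \<open>l\<close>. Beyond the mode \<open>q\<close> the second moments are bounded, uniformly in
  both, by the tail of the series of \<open>1 / lam\<close>. The condition \<open>y < 1\<close>
  leaves room for a window to the right of \<open>y\<close>.\<close>

lemma X_partial_bound:
  "\<exists>R. R \<longlonglongrightarrow> 0 \<and> (\<forall>q t y. t \<in> {0..1} \<longrightarrow> 0 \<le> y \<longrightarrow> y < 1 \<longrightarrow>
     L2 M (X t y) \<and> expectation (\<lambda>\<omega>. (X t y \<omega> - partial q t y \<omega>)\<^sup>2) \<le> R q)"
proof -
  obtain r where r: "r \<longlonglongrightarrow> 0" "\<And>q. 0 \<le> r q" "\<And>q K. (\<Sum>k\<in>{Suc q..K}. 1 / lam (real k)) \<le> r q"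
    using lam_tail by blast
  obtain C where C: "0 \<le> C" and xb: "\<And>F d t. finite F \<Longrightarrow> F \<subseteq> {1..} \<Longrightarrow> t \<in> {0..1} \<Longrightarrow>
     expectation (\<lambda>\<omega>. (\<Sum>k\<in>F. d k * xk k t \<omega>)\<^sup>2) \<le> C * (\<Sum>k\<in>F. (d k)\<^sup>2 / lam (real k))"
    using xk_sum_bound by blast
  define Me where "Me = sqrt 2 * exp (\<bar>\<theta>1 / (2 * \<theta>2)\<bar>)"
  define R where "R q = C * (Me\<^sup>2 * r q)" for q
  have R0: "0 \<le> R q" for q unfolding R_def using C r(2) by (intro mult_nonneg_nonneg) auto
  have "R \<longlonglongrightarrow> C * (Me\<^sup>2 * 0)" unfolding R_def by (intro tendsto_intros r)
  then have Rlim: "R \<longlonglongrightarrow> 0" by simp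
  have key: "L2 M (\<lambda>\<omega>. X t y \<omega> - partial q t y \<omega>)" "expectation (\<lambda>\<omega>. (X t y \<omega> - partial q t y \<omega>)\<^sup>2) \<le> R q"
    if t: "t \<in> {0..1}" and y: "0 \<le> y" "y < 1" for q t y
  proof -
    have yy: "y \<in> {0..1}" using y by simp
    define \<epsilon> where "\<epsilon> l = (1 - y) / real (Suc l)" for l
    have e0: "0 < \<epsilon> l" for l using y by (simp add: \<epsilon>_def)
    have e1: "y + \<epsilon> l \<le> 1" for l
    proof -
      have "(1 - y) / real (Suc l) \<le> (1 - y) / 1" using y by (intro divide_left_mono) auto
      then show ?thesis by (simp add: \<epsilon>_def)
    qed
    have e2: "\<epsilon> \<longlonglongrightarrow> 0" unfolding \<epsilon>_def by (rule LIMSEQ_Suc[OF lim_const_over_n])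
    define g where "g l k = H_inner \<theta>1 \<theta>2 (eigfun \<theta>1 \<theta>2 k) (avg \<theta>1 \<theta>2 y (\<epsilon> l))" for l k
    have gb: "\<bar>g l k\<bar> \<le> Me" for l k unfolding g_def Me_def by (rule eigfun_avg_bound[OF y(1) e0 e1])
    \<comment> \<open>The averaged modes beyond \<open>q\<close>: as \<open>K\<close> grows they
      approach the mean of the solution minus the averaged partial sum.\<close>
    define D where "D l K \<omega> = (\<Sum>k\<in>{Suc q..K}. g l k * xk k t \<omega>)" for l K \<omega>
    have DL: "L2 M (D l K)" for l K unfolding D_def[abs_def] using t by (intro L2_sum L2_cmult xk_L2) auto
    have Db: "expectation (\<lambda>\<omega>. (D l K \<omega>)\<^sup>2) \<le> R q" for l K
    proof -
      have "expectation (\<lambda>\<omega>. (D l K \<omega>)\<^sup>2) \<le> C * (\<Sum>k\<in>{Suc q..K}. (g l k)\<^sup>2 / lam (real k))"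
        unfolding D_def by (rule xb[OF _ _ t]) auto
      also have "\<dots> \<le> C * (\<Sum>k\<in>{Suc q..K}. Me\<^sup>2 * (1 / lam (real k)))"
      proof (intro mult_left_mono C sum_mono)
        fix k assume "k \<in> {Suc q..K}"
        then have "0 < lam (real k)" by (intro lam_pos) auto
        moreover have "(g l k)\<^sup>2 \<le> Me\<^sup>2" using power_mono[OF gb[of l k], of 2] by simp
        ultimately show "(g l k)\<^sup>2 / lam (real k) \<le> Me\<^sup>2 * (1 / lam (real k))" by (simp add: divide_right_mono)
      qed
      also have "\<dots> \<le> R q" unfolding R_def sum_distrib_left[symmetric] by (intro mult_left_mono C r(3)) auto
      finally show ?thesis .
    qed
    have "(\<integral>\<^sup>+ \<omega>. ennreal ((X t y \<omega> - partial q t y \<omega>)\<^sup>2) \<partial>M) \<le> ennreal (R q)"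
    proof (rule double_limit_square_bound[where D=D])
      show "D l K \<in> borel_measurable M" for l K by (rule L2_measurable[OF DL])
      show "(\<integral>\<^sup>+ \<omega>. ennreal ((D l K \<omega>)\<^sup>2) \<partial>M) \<le> ennreal (R q)" for l K
        unfolding nn_integral_square_eq[OF DL] by (rule ennreal_leI[OF Db])
      show "AE \<omega> in M. \<exists>L. (\<forall>l. (\<lambda>K. D l K \<omega>) \<longlonglongrightarrow> L l) \<and> L \<longlonglongrightarrow> X t y \<omega> - partial q t y \<omega>"
        using X_path_continuous[OF t] X_expansion[OF t]
      proof eventually_elim
        case (elim \<omega>)
        define h where "h l = H_inner \<theta>1 \<theta>2 (\<lambda>y. X t y \<omega>) (avg \<theta>1 \<theta>2 y (\<epsilon> l))" for l
        have hs: "(\<lambda>K. \<Sum>k=1..K. g l k * xk k t \<omega>) \<longlonglongrightarrow> h l" for l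
        proof -
          let ?\<psi> = "avg \<theta>1 \<theta>2 y (\<epsilon> l)"
          let ?f = "\<lambda>K y. X t y \<omega> - (\<Sum>k=1..K. xk k t \<omega> * eigfun \<theta>1 \<theta>2 k y)"
          have \<psi>: "?\<psi> \<in> H_space \<theta>1 \<theta>2" by (rule avg_H_space[OF y(1) e0 e1])
          have XH: "(\<lambda>y. X t y \<omega>) \<in> H_space \<theta>1 \<theta>2" using elim by blast
          have SH: "(\<lambda>y. \<Sum>k=1..K. xk k t \<omega> * eigfun \<theta>1 \<theta>2 k y) \<in> H_space \<theta>1 \<theta>2" for K
            by (intro H_space_sum eigfun_H_space)
          have e: "H_inner \<theta>1 \<theta>2 (?f K) ?\<psi> = h l - (\<Sum>k=1..K. g l k * xk k t \<omega>)" for K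
            unfolding H_inner_diff[OF XH SH \<psi>] H_inner_sum[OF eigfun_H_space \<psi>] h_def g_def by (simp add: mult.commute)
          have "(\<lambda>K. H_inner \<theta>1 \<theta>2 (?f K) ?\<psi>) \<longlonglongrightarrow> 0"
          proof (rule Lim_null_comparison)
            show "\<forall>\<^sub>F K in sequentially. norm (H_inner \<theta>1 \<theta>2 (?f K) ?\<psi>) \<le> H_norm \<theta>1 \<theta>2 (?f K) * H_norm \<theta>1 \<theta>2 ?\<psi>"
              unfolding real_norm_def by (intro always_eventually allI H_inner_le H_space_diff XH SH \<psi>)
            show "(\<lambda>K. H_norm \<theta>1 \<theta>2 (?f K) * H_norm \<theta>1 \<theta>2 ?\<psi>) \<longlonglongrightarrow> 0"
              using elim by (intro tendsto_mult_left_zero) blast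
          qed
          then have "(\<lambda>K. h l - (h l - (\<Sum>k=1..K. g l k * xk k t \<omega>))) \<longlonglongrightarrow> h l - 0"
            unfolding e by (intro tendsto_diff tendsto_const)
          then show ?thesis by simp
        qed
        let ?L = "\<lambda>l. h l - (\<Sum>k=1..q. g l k * xk k t \<omega>)"
        show ?case
        proof (intro exI[of _ ?L] conjI allI)
          show "(\<lambda>K. D l K \<omega>) \<longlonglongrightarrow> ?L l" for l
          proof (rule Lim_transform_eventually)
            show "(\<lambda>K. (\<Sum>k=1..K. g l k * xk k t \<omega>) - (\<Sum>k=1..q. g l k * xk k t \<omega>)) \<longlonglongrightarrow> ?L l"
              by (intro tendsto_diff hs tendsto_const)
            show "\<forall>\<^sub>F K in sequentially. (\<Sum>k=1..K. g l k * xk k t \<omega>) - (\<Sum>k=1..q. g l k * xk k t \<omega>) = D l K \<omega>"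
              using eventually_ge_at_top[of q]
            proof eventually_elim
              case (elim K)
              have "{1..K} = {1..q} \<union> {Suc q..K}" using elim by auto
              then have "(\<Sum>k=1..K. g l k * xk k t \<omega>) = (\<Sum>k=1..q. g l k * xk k t \<omega>) + D l K \<omega>"
                unfolding D_def by (simp only:) (rule sum.union_disjoint, auto)
              then show ?case by simp
            qed
          qed
          have "h \<longlonglongrightarrow> X t y \<omega>" unfolding h_def by (rule avg_tendsto[OF y _ e0 e1 e2]) (use elim in blast)
          moreover have "(\<lambda>l. g l k) \<longlonglongrightarrow> eigfun \<theta>1 \<theta>2 k y" for k
            unfolding g_def by (rule avg_tendsto[OF y _ e0 e1 e2]) (unfold eigfun_def[abs_def], intro continuous_intros)
          ultimately show "?L \<longlonglongrightarrow> X t y \<omega> - partial q t y \<omega>" unfolding partial_def by (intro tendsto_intros)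
        qed
      qed
    qed
    note B = this
    have m: "(\<lambda>\<omega>. X t y \<omega> - partial q t y \<omega>) \<in> borel_measurable M"
      using X_measurable[OF t yy] L2_measurable[OF partial_L2[OF t]] by simp
    show "L2 M (\<lambda>\<omega>. X t y \<omega> - partial q t y \<omega>)" "expectation (\<lambda>\<omega>. (X t y \<omega> - partial q t y \<omega>)\<^sup>2) \<le> R q"
      by (rule L2_nn_integral[OF m B R0])+
  qed
  have XL: "L2 M (X t y)" if "t \<in> {0..1}" "0 \<le> y" "y < 1" for t y
    using L2_add[OF key(1)[OF that, of 0] partial_L2[OF that(1), of 0 y]] by simp
  show ?thesis using Rlim XL key(2) by (intro exI[of _ R]) blast
qed

end

section \<open>Gaussian approximation of the increments\<close>

text \<open>Each step of the monotone sequence \<open>q^i\<close> is at most \<open>1 - q\<close>,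
  and the steps add up to at most \<open>1\<close>. Hence the initial value costs, over all times
  together, no more than one step of the grid.\<close>

lemma sum_geometric_increments_square_le:
  fixes q :: real assumes "0 \<le> q" "q \<le> 1"
  shows "(\<Sum>i=1..n. (q ^ i - q ^ (i - 1))\<^sup>2) \<le> 1 - q"
proof -
  have "(\<Sum>i=1..n. (q ^ i - q ^ (i - 1))\<^sup>2) \<le> (1 - q) * (1 - q ^ n)"
  proof (induction n)
    case (Suc n)
    define p where "p = q ^ n"
    have p: "0 \<le> p" "p \<le> 1" using assms by (auto simp: p_def power_le_one)
    have "(q ^ Suc n - q ^ n)\<^sup>2 = (1 - q)\<^sup>2 * (p * p)" by (simp add: p_def power2_eq_square algebra_simps)
    also have "\<dots> \<le> (1 - q)\<^sup>2 * (p * 1)" using p by (intro mult_left_mono) auto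
    also have "\<dots> = (1 - q) * (1 - q ^ Suc n) - (1 - q) * (1 - q ^ n)" by (simp add: p_def power2_eq_square algebra_simps)
    finally show ?case using Suc by simp
  qed simp
  also have "\<dots> \<le> (1 - q) * 1" using assms by (intro mult_left_mono) auto
  finally show ?thesis by simp
qed

locale spde_observation = spde M W c0 a \<theta>0 \<theta>1 \<theta>2 \<sigma> \<xi> X + scheme_covariance c0 a \<sigma> \<delta> m y
  for M :: "'w measure" and W and c0 a \<theta>0 \<theta>1 \<theta>2 \<sigma> :: real and \<xi> X and \<delta> :: real and m y
begin

definition tt :: "nat \<Rightarrow> nat \<Rightarrow> real" where "tt n i = real i * (1 / real n)"
text \<open>Since \<open>n * sqrt (\<Delta> n) = sqrt n\<close>, the square of \<open>ww n\<close>
  is what remains of the normalisation of the estimator after multiplication by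
  \<open>sqrt (m n)\<close>. The exponential in \<open>wx\<close> cancels that of the
  eigenfunctions, so that \<open>bb\<close> is a pure sine.\<close>

definition ww :: "nat \<Rightarrow> real" where "ww n = sqrt (sqrt (pi * \<theta>2) / sqrt (real (m n)))"
definition wx :: "nat \<Rightarrow> nat \<Rightarrow> real" where "wx n j = ww n * exp (y n j * \<theta>1 / (2 * \<theta>2))"
definition bb :: "nat \<Rightarrow> nat \<Rightarrow> nat \<Rightarrow> real" where "bb n k j = ww n * (sqrt 2 * sin (pi * real k * y n j))"
definition XX :: "nat \<Rightarrow> nat \<times> nat \<Rightarrow> 'w \<Rightarrow> real" where "XX n p \<omega> = wx n (snd p) * increment X n (fst p) (y n (snd p)) \<omega>"
definition dZ :: "nat \<Rightarrow> nat \<Rightarrow> nat \<Rightarrow> 'w \<Rightarrow> real" where "dZ n k i \<omega> = Z k (tt n i) \<omega> - Z k (tt n (i - 1)) \<omega>"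
text \<open>The noise part with the exact Wiener integrals, whose covariances are explicit;
  \<open>GG\<close> below is its replacement inside \<open>span\<close>.\<close>

definition YY :: "nat \<Rightarrow> nat \<Rightarrow> nat \<times> nat \<Rightarrow> 'w \<Rightarrow> real" where
  "YY n q p \<omega> = (\<Sum>k=1..q. bb n k (snd p) * dZ n k (fst p) \<omega>)"
definition AA :: "nat \<Rightarrow> nat \<Rightarrow> nat \<times> nat \<Rightarrow> 'w \<Rightarrow> real" where
  "AA n q p \<omega> = (\<Sum>k=1..q. (bb n k (snd p) * (exp (- lam (real k) * tt n (fst p)) - exp (- lam (real k) * tt n (fst p - 1)))) * ak k \<omega>)"
text \<open>At stage \<open>q\<close> the expansion is cut off after \<open>q\<close> modes, and each Wiener integral is replaced by a
  finite combination of Brownian values: this makes the increments exactly Gaussian and measurable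
  functions of the Brownian paths.\<close>

definition SS :: "nat \<Rightarrow> nat \<Rightarrow> nat \<Rightarrow> nat \<Rightarrow> 'w \<Rightarrow> real" where
  "SS n q k i = (SOME S. S \<in> span \<and> expectation (\<lambda>\<omega>. (Z k (tt n i) \<omega> - S \<omega>)\<^sup>2) < 1 / (real (Suc q))^3)"
definition GG :: "nat \<Rightarrow> nat \<Rightarrow> nat \<times> nat \<Rightarrow> 'w \<Rightarrow> real" where
  "GG n q p \<omega> = (\<Sum>k=1..q. bb n k (snd p) * (SS n q k (fst p) \<omega> - SS n q k (fst p - 1) \<omega>))"

lemma scale_nonneg: "0 \<le> sqrt (pi * \<theta>2) / sqrt (real k)"
  by (intro divide_nonneg_nonneg real_sqrt_ge_zero) (use \<theta>2_pos in auto)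

lemma tt_range: "1 \<le> n \<Longrightarrow> i \<le> n \<Longrightarrow> tt n i \<in> {0..1}"
  by (simp add: tt_def)

lemma SS: assumes "1 \<le> n" "i \<le> n" "1 \<le> k"
  shows "SS n q k i \<in> span" "expectation (\<lambda>\<omega>. (Z k (tt n i) \<omega> - SS n q k i \<omega>)\<^sup>2) < 1 / (real (Suc q))^3"
proof -
  have "\<exists>S. S \<in> span \<and> expectation (\<lambda>\<omega>. (Z k (tt n i) \<omega> - S \<omega>)\<^sup>2) < 1 / (real (Suc q))^3"
    using wiener_span_approx[OF assms(3) Z_wiener[OF assms(3) tt_range[OF assms(1,2)]] kernel_continuous, of "1 / (real (Suc q))^3"] by auto
  from someI_ex[OF this] show "SS n q k i \<in> span" "expectation (\<lambda>\<omega>. (Z k (tt n i) \<omega> - SS n q k i \<omega>)\<^sup>2) < 1 / (real (Suc q))^3"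
    unfolding SS_def by auto
qed

context
  fixes n assumes n: "1 \<le> (n::nat)"
begin

lemma PP_D: assumes "p \<in> PP n"
  shows "fst p \<le> n" "fst p - 1 \<le> n" "1 \<le> fst p" "snd p \<in> {1..m n}" "tt n (fst p) \<in> {0..1}" "tt n (fst p - 1) \<in> {0..1}"
    "0 \<le> y n (snd p)" "y n (snd p) < 1"
  using assms tt_range[OF n, of "fst p"] tt_range[OF n, of "fst p - 1"] y_bounds[OF n, of "snd p"] delta_pos by (auto simp: PP_def)

lemma ww_nonneg: "0 \<le> ww n" by (simp only: ww_def real_sqrt_ge_zero scale_nonneg)

lemma ww_square: "(ww n)\<^sup>2 = sqrt (pi * \<theta>2) / sqrt (real (m n))"
  unfolding ww_def by (rule real_sqrt_pow2[OF scale_nonneg])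

lemma bb_abs: "\<bar>bb n k j\<bar> \<le> ww n * sqrt 2"
  using mult_left_mono[OF abs_sin_le_one[of "pi * real k * y n j"], of "ww n * sqrt 2"] ww_nonneg by (simp add: bb_def abs_mult)

lemma bb_square: "(bb n k j)\<^sup>2 \<le> 2 * (sqrt (pi * \<theta>2) / sqrt (real (m n)))"
proof -
  have "(bb n k j)\<^sup>2 \<le> (ww n * sqrt 2)\<^sup>2" using power_mono[OF bb_abs[of k j], of 2] by simp
  also have "\<dots> = 2 * (ww n)\<^sup>2" by (simp add: power_mult_distrib)
  finally show ?thesis unfolding ww_square .
qed

lemma bb_eigfun: "wx n j * eigfun \<theta>1 \<theta>2 k (y n j) = bb n k j"
proof -
  have "exp (y n j * \<theta>1 / (2 * \<theta>2)) * exp (- (\<theta>1 / (2 * \<theta>2)) * y n j) = 1" by (simp add: mult.commute flip: exp_add)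
  then show ?thesis by (simp add: wx_def bb_def eigfun_def)
qed

lemma bb_mult: "bb n k j * bb n k j' = (ww n)\<^sup>2 * (cos (real k * \<theta>d n j j') - cos (real k * \<theta>s n j j'))"
proof -
  have "cos (real k * \<theta>d n j j') - cos (real k * \<theta>s n j j') = 2 * (sin (pi * real k * y n j) * sin (pi * real k * y n j'))"
    unfolding \<theta>d_def \<theta>s_def by (simp add: cos_diff cos_add algebra_simps)
  moreover have "bb n k j * bb n k j' = (ww n)\<^sup>2 * ((sqrt 2 * sqrt 2) * (sin (pi * real k * y n j) * sin (pi * real k * y n j')))"
    unfolding bb_def power2_eq_square by (simp only: mult_ac)
  ultimately show ?thesis by simp
qed

lemma dZ_L2: assumes "1 \<le> k" "1 \<le> i" "i \<le> n" shows "L2 M (dZ n k i)"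
  unfolding dZ_def[abs_def] using assms by (intro L2_diff Z_L2 tt_range[OF n]) auto

text \<open>The product expands into four instances of \<open>Z_cov\<close>. The parts depending on
  the sum of the times form the second difference at \<open>i + i' - 1\<close>; those depending on
  the lag enter \<open>Z_cov\<close> with a minus sign, which makes the second difference at the lag
  appear with a plus sign.\<close>

lemma dZ_cov: assumes k: "1 \<le> k" and i: "1 \<le> i" "i \<le> n" and i': "1 \<le> i'" "i' \<le> n"
  shows "expectation (\<lambda>\<omega>. dZ n k i \<omega> * dZ n k i' \<omega>) = \<sigma>\<^sup>2 / 2 * (sw (1 / real n) (lag i i') k + sw (1 / real n) (i + i' - 1) k)"
proof -
  define h where "h = 1 / real n"
  have h0: "0 \<le> h" by (simp add: h_def)
  have tt: "tt n j = real j * h" for j by (simp add: tt_def h_def)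
  have I: "i - 1 \<le> n" "i' - 1 \<le> n" using i i' by auto
  note T = tt_range[OF n i(2)] tt_range[OF n I(1)] tt_range[OF n i'(2)] tt_range[OF n I(2)]
  note L = Z_L2[OF k T(1)] Z_L2[OF k T(2)] Z_L2[OF k T(3)] Z_L2[OF k T(4)]
  let ?c = "\<lambda>s t. expectation (\<lambda>\<omega>. Z k s \<omega> * Z k t \<omega>)"
  have e: "expectation (\<lambda>\<omega>. dZ n k i \<omega> * dZ n k i' \<omega>) = ?c (tt n i) (tt n i') - ?c (tt n i) (tt n (i' - 1)) - ?c (tt n (i - 1)) (tt n i') + ?c (tt n (i - 1)) (tt n (i' - 1))"
    unfolding dZ_def by (rule L2_inner_diff[OF L])
  have c: "?c (tt n p) (tt n q) = \<sigma>\<^sup>2 / 2 * (wk (real (p + q) * h) k - wk (real (lag p q) * h) k)" if "tt n p \<in> {0..1}" "tt n q \<in> {0..1}" for p q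
  proof -
    have "\<bar>real q * h - real p * h\<bar> = \<bar>real q - real p\<bar> * h" using h0 by (simp add: abs_mult flip: left_diff_distrib)
    also have "\<bar>real q - real p\<bar> = real (lag p q)" by (auto simp: lag_def)
    finally show ?thesis unfolding Z_cov[OF k that] unfolding tt by (simp add: distrib_right)
  qed
  obtain r s where r: "lag i i' = r" and s: "i + i' - 1 = Suc s" using i i' by (cases "i + i' - 1") auto
  have a1: "i + i' = Suc (Suc s)" "i + (i' - 1) = Suc s" "i - 1 + i' = Suc s" "i - 1 + (i' - 1) = s" using s i i' by auto
  have a2: "lag (i - 1) (i' - 1) = r" using r i i' by (auto simp: lag_def)
  \<comment> \<open>For \<open>i = i'\<close> both shifted lags are \<open>1\<close>, whence the
    value \<open>1\<close> in \<open>sw\<close> at \<open>r = 0\<close>.\<close>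
  have a3: "wk (real (lag i (i' - 1)) * h) k + wk (real (lag (i - 1) i') * h) k = wk (real (Suc r) * h) k + wk (real (if r = 0 then 1 else r - 1) * h) k"
  proof -
    consider "i = i'" | "i < i'" | "i' < i" by linarith
    then show ?thesis
    proof cases
      case 1
      then have "lag i (i' - 1) = 1" "lag (i - 1) i' = 1" "r = 0" using i r by (auto simp: lag_def)
      then show ?thesis by simp
    next
      case 2
      then have "lag i (i' - 1) = r - 1" "lag (i - 1) i' = Suc r" "r \<noteq> 0" using i i' r by (auto simp: lag_def)
      then show ?thesis by simp
    next
      case 3
      then have "lag i (i' - 1) = Suc r" "lag (i - 1) i' = r - 1" "r \<noteq> 0" using i i' r by (auto simp: lag_def)
      then show ?thesis by simp
    qed
  qed
  have sr: "sw h r k = (wk (real (lag i (i' - 1)) * h) k + wk (real (lag (i - 1) i') * h) k) - 2 * wk (real r * h) k"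
    unfolding a3 sw_def by simp
  have ss: "sw h (Suc s) k = wk (real (Suc (Suc s)) * h) k - 2 * wk (real (Suc s) * h) k + wk (real s * h) k"
    unfolding sw_def by simp
  show ?thesis
    unfolding e c[OF T(1) T(3)] c[OF T(1) T(4)] c[OF T(2) T(3)] c[OF T(2) T(4)] h_def[symmetric] r s ss
    unfolding a1 a2 sr
    by (simp add: algebra_simps)
qed

lemma dZ_cross: assumes "1 \<le> k" "1 \<le> l" "k \<noteq> l" "1 \<le> i" "i \<le> n" "1 \<le> i'" "i' \<le> n"
  shows "expectation (\<lambda>\<omega>. dZ n k i \<omega> * dZ n l i' \<omega>) = 0"
proof -
  have I: "i - 1 \<le> n" "i' - 1 \<le> n" using assms by auto
  note T = tt_range[OF n assms(5)] tt_range[OF n I(1)] tt_range[OF n assms(7)] tt_range[OF n I(2)]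
  note L = Z_L2[OF assms(1) T(1)] Z_L2[OF assms(1) T(2)] Z_L2[OF assms(2) T(3)] Z_L2[OF assms(2) T(4)]
  note c = Z_cross[OF assms(1-3)]
  show ?thesis unfolding dZ_def L2_inner_diff[OF L] c[OF T(1) T(3)] c[OF T(1) T(4)] c[OF T(2) T(3)] c[OF T(2) T(4)] by simp
qed

lemma YY_L2: "p \<in> PP n \<Longrightarrow> L2 M (YY n q p)"
  unfolding YY_def[abs_def] by (intro L2_sum L2_cmult dZ_L2) (auto simp: PP_def)

lemma AA_L2: "L2 M (AA n q p)"
  unfolding AA_def[abs_def] by (intro L2_sum L2_cmult ak_L2) auto

lemma GG_span: "p \<in> PP n \<Longrightarrow> GG n q p \<in> span"
  unfolding GG_def[abs_def] using PP_D(1,2)[of p] by (intro span_sum span_cmult span_diff SS(1)[OF n]) auto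

lemma GG_L2: "p \<in> PP n \<Longrightarrow> L2 M (GG n q p)" by (rule span_L2[OF GG_span])

lemma YY_cov_tendsto: assumes p: "p \<in> PP n" "r \<in> PP n"
  shows "(\<lambda>q. expectation (\<lambda>\<omega>. YY n q p \<omega> * YY n q r \<omega>)) \<longlonglongrightarrow> cc n p r"
proof -
  let ?h = "1 / real n" and ?l = "lag (fst p) (fst r)" and ?s = "fst p + fst r - 1"
  let ?d = "\<lambda>k. cos (real k * \<theta>d n (snd p) (snd r)) - cos (real k * \<theta>s n (snd p) (snd r))"
  have h: "0 \<le> ?h" by simp
  have e: "expectation (\<lambda>\<omega>. YY n q p \<omega> * YY n q r \<omega>) = K0 / sqrt (real (m n)) * (\<Sum>k<q. sw ?h ?l (Suc k) * ?d (Suc k) + sw ?h ?s (Suc k) * ?d (Suc k))" for q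
  proof -
    have "expectation (\<lambda>\<omega>. YY n q p \<omega> * YY n q r \<omega>) = (\<Sum>k=1..q. bb n k (snd p) * bb n k (snd r) * expectation (\<lambda>\<omega>. dZ n k (fst p) \<omega> * dZ n k (fst r) \<omega>))"
      unfolding YY_def using PP_D[OF p(1)] PP_D[OF p(2)] by (intro orthogonal_sum_inner dZ_L2 dZ_cross) auto
    also have "\<dots> = (\<Sum>k=1..q. K0 / sqrt (real (m n)) * (sw ?h ?l k * ?d k + sw ?h ?s k * ?d k))"
    proof (rule sum.cong[OF refl])
      fix k assume "k \<in> {1..q}"
      then have k: "1 \<le> k" by simp
      \<comment> \<open>Here the constant \<open>K0\<close> meets the normalisation of the
        estimator.\<close>
      have "a / pi = pi * \<theta>2" by (simp add: a power2_eq_square)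
      then have K: "K0 / sqrt (real (m n)) = (ww n)\<^sup>2 * (\<sigma>\<^sup>2 / 2)" unfolding K0_def ww_square by simp
      show "bb n k (snd p) * bb n k (snd r) * expectation (\<lambda>\<omega>. dZ n k (fst p) \<omega> * dZ n k (fst r) \<omega>) = K0 / sqrt (real (m n)) * (sw ?h ?l k * ?d k + sw ?h ?s k * ?d k)"
        unfolding bb_mult K dZ_cov[OF k PP_D(3,1)[OF p(1)] PP_D(3,1)[OF p(2)]] by (simp only: distrib_left distrib_right mult_ac)
    qed
    also have "\<dots> = (\<Sum>k<q. K0 / sqrt (real (m n)) * (sw ?h ?l (Suc k) * ?d (Suc k) + sw ?h ?s (Suc k) * ?d (Suc k)))"
      by (rule sum.reindex_bij_witness[of _ Suc "\<lambda>k. k - 1"]) auto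
    finally show ?thesis unfolding sum_distrib_left .
  qed
  have "(\<lambda>k. sw ?h ?l (Suc k) * ?d (Suc k) + sw ?h ?s (Suc k) * ?d (Suc k)) sums (Sn n ?l (snd p) (snd r) + Sn n ?s (snd p) (snd r))"
    unfolding Sn_def S_series(2)[OF h] by (intro sums_add summable_sums S_series(1)[OF h])
  then have "(\<lambda>q. K0 / sqrt (real (m n)) * (\<Sum>k<q. sw ?h ?l (Suc k) * ?d (Suc k) + sw ?h ?s (Suc k) * ?d (Suc k)))
     \<longlonglongrightarrow> K0 / sqrt (real (m n)) * (Sn n ?l (snd p) (snd r) + Sn n ?s (snd p) (snd r))"
    unfolding sums_def by (rule tendsto_mult_left)
  then show ?thesis unfolding e cc_def .
qed

lemma YY_GG_tendsto: assumes p: "p \<in> PP n"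
  shows "(\<lambda>q. expectation (\<lambda>\<omega>. (YY n q p \<omega> - GG n q p \<omega>)\<^sup>2)) \<longlonglongrightarrow> 0"
proof (rule Lim_null_comparison)
  let ?B = "2 * (sqrt (pi * \<theta>2) / sqrt (real (m n)))"
  \<comment> \<open>One factor \<open>q\<close> comes from the square of a sum of \<open>q\<close>
    terms and one from adding up their second moments; the tolerance in \<open>SS\<close> has been
    chosen to beat both.\<close>
  show "(\<lambda>q. ?B * 4 * (real q * real q / (real (Suc q))^3)) \<longlonglongrightarrow> 0"
    by (rule tendsto_mult_right_zero) real_asymp
  have "expectation (\<lambda>\<omega>. (YY n q p \<omega> - GG n q p \<omega>)\<^sup>2) \<le> ?B * 4 * (real q * real q / (real (Suc q))^3)" for q
  proof -
    define u where "u k i \<omega> = Z k (tt n i) \<omega> - SS n q k i \<omega>" for k i \<omega>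
    have uL: "L2 M (u k i)" if "1 \<le> k" "i \<le> n" for k i
      unfolding u_def[abs_def] using that by (intro L2_diff Z_L2 tt_range[OF n] span_L2 SS(1)[OF n])
    have e: "YY n q p \<omega> - GG n q p \<omega> = (\<Sum>k=1..q. bb n k (snd p) * (u k (fst p) \<omega> - u k (fst p - 1) \<omega>))" for \<omega>
      unfolding YY_def GG_def dZ_def u_def sum_subtractf[symmetric] by (intro sum.cong refl) (simp add: algebra_simps)
    have dL: "L2 M (\<lambda>\<omega>. u k (fst p) \<omega> - u k (fst p - 1) \<omega>)" if "1 \<le> k" for k
      using that PP_D(1,2)[OF p] by (intro L2_diff uL)
    have "expectation (\<lambda>\<omega>. (YY n q p \<omega> - GG n q p \<omega>)\<^sup>2) \<le> real (card {1..q}) * (\<Sum>k=1..q. expectation (\<lambda>\<omega>. (bb n k (snd p) * (u k (fst p) \<omega> - u k (fst p - 1) \<omega>))\<^sup>2))"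
      unfolding e by (intro L2_sum_square_le L2_cmult dL) auto
    also have "\<dots> \<le> real (card {1..q}) * (\<Sum>k=1..q. ?B * (4 / (real (Suc q))^3))"
    proof (intro mult_left_mono sum_mono)
      fix k assume "k \<in> {1..q}"
      then have k: "1 \<le> k" by simp
      have "expectation (\<lambda>\<omega>. (u k (fst p) \<omega> + (- 1) * u k (fst p - 1) \<omega>)\<^sup>2) \<le> 2 * expectation (\<lambda>\<omega>. (u k (fst p) \<omega>)\<^sup>2) + 2 * expectation (\<lambda>\<omega>. ((- 1) * u k (fst p - 1) \<omega>)\<^sup>2)"
        using k PP_D(1,2)[OF p] by (intro L2_add_square_le L2_cmult uL)
      also have "expectation (\<lambda>\<omega>. ((- 1) * u k (fst p - 1) \<omega>)\<^sup>2) = expectation (\<lambda>\<omega>. (u k (fst p - 1) \<omega>)\<^sup>2)" by simp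
      also have "2 * expectation (\<lambda>\<omega>. (u k (fst p) \<omega>)\<^sup>2) + 2 * expectation (\<lambda>\<omega>. (u k (fst p - 1) \<omega>)\<^sup>2) \<le> 2 * (1 / (real (Suc q))^3) + 2 * (1 / (real (Suc q))^3)"
        using SS(2)[OF n PP_D(1)[OF p] k, of q] SS(2)[OF n PP_D(2)[OF p] k, of q]
        by (intro add_mono mult_left_mono) (auto simp: u_def)
      finally have v: "expectation (\<lambda>\<omega>. (u k (fst p) \<omega> - u k (fst p - 1) \<omega>)\<^sup>2) \<le> 4 / (real (Suc q))^3" by simp
      have "expectation (\<lambda>\<omega>. (bb n k (snd p) * (u k (fst p) \<omega> - u k (fst p - 1) \<omega>))\<^sup>2) = (bb n k (snd p))\<^sup>2 * expectation (\<lambda>\<omega>. (u k (fst p) \<omega> - u k (fst p - 1) \<omega>)\<^sup>2)"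
        by (simp add: power_mult_distrib)
      also have "\<dots> \<le> ?B * (4 / (real (Suc q))^3)"
        using scale_nonneg[of "m n"] by (intro mult_mono bb_square v) auto
      finally show "expectation (\<lambda>\<omega>. (bb n k (snd p) * (u k (fst p) \<omega> - u k (fst p - 1) \<omega>))\<^sup>2) \<le> ?B * (4 / (real (Suc q))^3)" .
    qed auto
    also have "\<dots> = ?B * 4 * (real q * real q / (real (Suc q))^3)" by simp
    finally show ?thesis .
  qed
  then show "\<forall>\<^sub>F q in sequentially. norm (expectation (\<lambda>\<omega>. (YY n q p \<omega> - GG n q p \<omega>)\<^sup>2)) \<le> ?B * 4 * (real q * real q / (real (Suc q))^3)"
    by (intro always_eventually allI) simp
qed

lemma GG_cov_tendsto: assumes "p \<in> PP n" "r \<in> PP n"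
  shows "(\<lambda>q. expectation (\<lambda>\<omega>. GG n q p \<omega> * GG n q r \<omega>)) \<longlonglongrightarrow> cc n p r"
proof (rule L2_inner_perturb[where Y="\<lambda>q. YY n q p" and Y'="\<lambda>q. YY n q r"])
  show "(\<lambda>q. expectation (\<lambda>\<omega>. YY n q p \<omega> * YY n q r \<omega>)) \<longlonglongrightarrow> cc n p r" by (rule YY_cov_tendsto[OF assms])
  show "(\<lambda>q. expectation (\<lambda>\<omega>. (YY n q p \<omega>)\<^sup>2)) \<longlonglongrightarrow> cc n p p" "(\<lambda>q. expectation (\<lambda>\<omega>. (YY n q r \<omega>)\<^sup>2)) \<longlonglongrightarrow> cc n r r"
    unfolding power2_eq_square by (intro YY_cov_tendsto assms)+
qed (intro YY_L2 GG_L2 YY_GG_tendsto assms)+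

lemma increment_tt: "increment X n i z \<omega> = X (tt n i) z \<omega> - X (tt n (i - 1)) z \<omega>"
  by (simp add: increment_def tt_def \<Delta>_def)

lemma XX_L2: assumes "p \<in> PP n" shows "L2 M (XX n p)"
  unfolding XX_def[abs_def] increment_tt using X_partial_bound PP_D[OF assms] by (intro L2_cmult L2_diff) blast+

lemma XX_YY_AA: "XX n p \<omega> - (YY n q p \<omega> + AA n q p \<omega>) = wx n (snd p) * ((X (tt n (fst p)) (y n (snd p)) \<omega> - partial q (tt n (fst p)) (y n (snd p)) \<omega>)
    - (X (tt n (fst p - 1)) (y n (snd p)) \<omega> - partial q (tt n (fst p - 1)) (y n (snd p)) \<omega>))"
proof -
  let ?t = "tt n (fst p)" and ?t' = "tt n (fst p - 1)" and ?z = "y n (snd p)"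
  have "wx n (snd p) * (partial q ?t ?z \<omega> - partial q ?t' ?z \<omega>) = (\<Sum>k=1..q. (wx n (snd p) * eigfun \<theta>1 \<theta>2 k ?z) * (xk k ?t \<omega> - xk k ?t' \<omega>))"
    unfolding partial_def sum_subtractf[symmetric] sum_distrib_left by (intro sum.cong refl) (simp add: algebra_simps)
  also have "\<dots> = YY n q p \<omega> + AA n q p \<omega>"
    unfolding bb_eigfun YY_def AA_def sum.distrib[symmetric] by (intro sum.cong refl) (simp add: xk_def dZ_def algebra_simps)
  finally show ?thesis unfolding XX_def increment_tt by (simp add: algebra_simps)
qed

text \<open>The error consists of the tail of the expansion at two successive times, controlled by
  \<open>X_partial_bound\<close>, and of the difference of \<open>YY\<close> and
  \<open>GG\<close>.\<close>

lemma XX_tendsto: assumes p: "p \<in> PP n"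
  shows "(\<lambda>q. expectation (\<lambda>\<omega>. (XX n p \<omega> - (GG n q p \<omega> + AA n q p \<omega>))\<^sup>2)) \<longlonglongrightarrow> 0"
proof -
  obtain R where R: "R \<longlonglongrightarrow> 0" and Rb: "\<And>q t y. t \<in> {0..1} \<Longrightarrow> 0 \<le> y \<Longrightarrow> y < 1 \<Longrightarrow> L2 M (X t y) \<and> expectation (\<lambda>\<omega>. (X t y \<omega> - partial q t y \<omega>)\<^sup>2) \<le> R q"
    using X_partial_bound by blast
  let ?t = "tt n (fst p)" and ?t' = "tt n (fst p - 1)" and ?z = "y n (snd p)"
  let ?w = "(wx n (snd p))\<^sup>2"
  let ?D = "\<lambda>q. expectation (\<lambda>\<omega>. (YY n q p \<omega> - GG n q p \<omega>)\<^sup>2)"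
  have "(\<lambda>q. 2 * (?w * (4 * R q)) + 2 * ?D q) \<longlonglongrightarrow> 2 * (?w * (4 * 0)) + 2 * 0" by (intro tendsto_intros R YY_GG_tendsto p)
  then have lim: "(\<lambda>q. 2 * (?w * (4 * R q)) + 2 * ?D q) \<longlonglongrightarrow> 0" by simp
  have "expectation (\<lambda>\<omega>. (XX n p \<omega> - (GG n q p \<omega> + AA n q p \<omega>))\<^sup>2) \<le> 2 * (?w * (4 * R q)) + 2 * ?D q" for q
  proof -
    define f f' where "f \<omega> = X ?t ?z \<omega> - partial q ?t ?z \<omega>" and "f' \<omega> = X ?t' ?z \<omega> - partial q ?t' ?z \<omega>" for \<omega>
    have fL: "L2 M f" "L2 M f'" unfolding f_def[abs_def] f'_def[abs_def] using Rb PP_D[OF p] by (intro L2_diff partial_L2; blast)+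
    have e: "XX n p \<omega> - (YY n q p \<omega> + AA n q p \<omega>) = wx n (snd p) * (f \<omega> + (- 1) * f' \<omega>)" for \<omega>
      unfolding XX_YY_AA f_def f'_def by simp
    have "expectation (\<lambda>\<omega>. (f \<omega> + (- 1) * f' \<omega>)\<^sup>2) \<le> 2 * expectation (\<lambda>\<omega>. (f \<omega>)\<^sup>2) + 2 * expectation (\<lambda>\<omega>. ((- 1) * f' \<omega>)\<^sup>2)"
      by (intro L2_add_square_le L2_cmult fL)
    also have "expectation (\<lambda>\<omega>. ((- 1) * f' \<omega>)\<^sup>2) = expectation (\<lambda>\<omega>. (f' \<omega>)\<^sup>2)" by simp
    also have "2 * expectation (\<lambda>\<omega>. (f \<omega>)\<^sup>2) + 2 * expectation (\<lambda>\<omega>. (f' \<omega>)\<^sup>2) \<le> 2 * R q + 2 * R q"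
      using Rb[OF PP_D(5)[OF p] PP_D(7,8)[OF p], of q] Rb[OF PP_D(6)[OF p] PP_D(7,8)[OF p], of q]
      by (intro add_mono mult_left_mono) (auto simp: f_def f'_def)
    finally have "expectation (\<lambda>\<omega>. (f \<omega> + (- 1) * f' \<omega>)\<^sup>2) \<le> 4 * R q" by simp
    then have "?w * expectation (\<lambda>\<omega>. (f \<omega> + (- 1) * f' \<omega>)\<^sup>2) \<le> ?w * (4 * R q)" by (rule mult_left_mono) simp
    then have b: "expectation (\<lambda>\<omega>. (XX n p \<omega> - (YY n q p \<omega> + AA n q p \<omega>))\<^sup>2) \<le> ?w * (4 * R q)"
      unfolding e power_mult_distrib by simp
    have "expectation (\<lambda>\<omega>. (XX n p \<omega> - (GG n q p \<omega> + AA n q p \<omega>))\<^sup>2) = expectation (\<lambda>\<omega>. ((XX n p \<omega> - (YY n q p \<omega> + AA n q p \<omega>)) + (YY n q p \<omega> - GG n q p \<omega>))\<^sup>2)"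
      by (intro Bochner_Integration.integral_cong refl arg_cong[of _ _ "\<lambda>x. x\<^sup>2"]) simp
    also have "\<dots> \<le> 2 * expectation (\<lambda>\<omega>. (XX n p \<omega> - (YY n q p \<omega> + AA n q p \<omega>))\<^sup>2) + 2 * ?D q"
      by (intro L2_add_square_le L2_diff L2_add XX_L2 YY_L2 AA_L2 GG_L2 p)
    finally show ?thesis using b by linarith
  qed
  then show ?thesis by (intro Lim_null_comparison[OF _ lim] always_eventually allI) simp
qed

text \<open>\<open>GG\<close> is a functional of the Brownian paths and \<open>AA\<close> one of
  \<open>\<xi>\<close>, so products of the former are independent of products of the latter. This is
  the factorisation that tames the cross terms in \<open>gaussian_stage_bound\<close>.\<close>

lemma GG_AA_factor: assumes p: "p \<in> PP n" "r \<in> PP n"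
  shows "integrable M (\<lambda>\<omega>. (GG n q p \<omega> * GG n q r \<omega>) * (AA n q p \<omega> * AA n q r \<omega>)) \<and>
    expectation (\<lambda>\<omega>. (GG n q p \<omega> * GG n q r \<omega>) * (AA n q p \<omega> * AA n q r \<omega>)) = expectation (\<lambda>\<omega>. GG n q p \<omega> * GG n q r \<omega>) * expectation (\<lambda>\<omega>. AA n q p \<omega> * AA n q r \<omega>)"
proof -
  obtain g1 where g1: "g1 \<in> borel_measurable (PiM {1..} (\<lambda>_. PiM {0..} (\<lambda>_. borel)))" "\<And>\<omega>. GG n q p \<omega> = g1 (\<lambda>k\<in>{1..}. \<lambda>t\<in>{0..}. W k t \<omega>)"
    using span_path_functional[OF GG_span[OF p(1)]] by blast
  obtain g2 where g2: "g2 \<in> borel_measurable (PiM {1..} (\<lambda>_. PiM {0..} (\<lambda>_. borel)))" "\<And>\<omega>. GG n q r \<omega> = g2 (\<lambda>k\<in>{1..}. \<lambda>t\<in>{0..}. W k t \<omega>)"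
    using span_path_functional[OF GG_span[OF p(2)]] by blast
  define f where "f p x = (\<Sum>k=1..q. (bb n k (snd p) * (exp (- lam (real k) * tt n (fst p)) - exp (- lam (real k) * tt n (fst p - 1)))) * H_inner \<theta>1 \<theta>2 x (eigfun \<theta>1 \<theta>2 k))" for p x
  have fm: "f p \<in> borel_measurable (H_borel \<theta>1 \<theta>2)" for p
    unfolding f_def[abs_def] by (intro borel_measurable_sum borel_measurable_times borel_measurable_const ak_path)
  have fA: "AA n q p \<omega> = f p (\<xi> \<omega>)" for p \<omega> by (simp add: f_def AA_def ak_def)
  have "indep_var borel (\<lambda>\<omega>. f p (\<xi> \<omega>) * f r (\<xi> \<omega>)) borel (\<lambda>\<omega>. g1 (\<lambda>k\<in>{1..}. \<lambda>t\<in>{0..}. W k t \<omega>) * g2 (\<lambda>k\<in>{1..}. \<lambda>t\<in>{0..}. W k t \<omega>))"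
    by (rule independent_rvs_indep_var[OF \<xi>_indep, of "\<lambda>x. f p x * f r x" borel "\<lambda>x. g1 x * g2 x" borel])
      (intro borel_measurable_times fm g1 g2)+
  then have i: "indep_var borel (\<lambda>\<omega>. AA n q p \<omega> * AA n q r \<omega>) borel (\<lambda>\<omega>. GG n q p \<omega> * GG n q r \<omega>)" unfolding fA g1(2) g2(2) .
  have I: "integrable M (\<lambda>\<omega>. AA n q p \<omega> * AA n q r \<omega>)" "integrable M (\<lambda>\<omega>. GG n q p \<omega> * GG n q r \<omega>)"
    by (intro L2_mult_integrable AA_L2 GG_L2 p)+
  show ?thesis
    using indep_var_integrable[OF i I] indep_var_lebesgue_integral[OF i I] by (simp add: mult.commute)
qed

end

text \<open>For each mode the squared increments of \<open>exp (- lam t)\<close> over the grid add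
  up to at most \<open>1 - exp (- lam h)\<close>; divided by \<open>lam\<close> this is
  \<open>wk h\<close>. The sum over the modes is of order \<open>sqrt h\<close>, and
  \<open>m\<close> points with weight \<open>1 / sqrt m\<close> give the bound.\<close>

lemma AA_bound: "\<exists>C\<ge>0. \<forall>n\<ge>1. \<forall>q. (\<Sum>p\<in>PP n. expectation (\<lambda>\<omega>. (AA n q p \<omega>)\<^sup>2)) \<le> C * sqrt (real (m n) / real n)"
proof -
  obtain Ca where Ca: "0 \<le> Ca" and ab: "\<And>F d. finite F \<Longrightarrow> F \<subseteq> {1..} \<Longrightarrow>
     expectation (\<lambda>\<omega>. (\<Sum>k\<in>F. d k * ak k \<omega>)\<^sup>2) \<le> Ca * (\<Sum>k\<in>F. (d k)\<^sup>2 / lam (real k))"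
    using ak_bounds by blast
  obtain C where C: "0 < C" "\<And>t N. 0 < t \<Longrightarrow> (\<Sum>k=1..N. wk t k) \<le> C * sqrt t" using sum_wk_bound by blast
  let ?s = "sqrt (pi * \<theta>2)"
  show ?thesis
  proof (intro exI[of _ "2 * Ca * ?s * C"] conjI allI impI)
    show "0 \<le> 2 * Ca * ?s * C" using Ca C \<theta>2_pos by simp
    fix n q assume n: "1 \<le> (n::nat)"
    let ?B = "2 * (?s / sqrt (real (m n)))" and ?h = "1 / real n"
    have B0: "0 \<le> ?B" using scale_nonneg[of "m n"] by simp
    let ?d = "\<lambda>i k. exp (- lam (real k) * tt n i) - exp (- lam (real k) * tt n (i - 1))"
    have "(\<Sum>p\<in>PP n. expectation (\<lambda>\<omega>. (AA n q p \<omega>)\<^sup>2)) \<le> (\<Sum>p\<in>PP n. Ca * (\<Sum>k=1..q. ?B * ((?d (fst p) k)\<^sup>2 / lam (real k))))"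
    proof (rule sum_mono)
      fix p assume p: "p \<in> PP n"
      have "expectation (\<lambda>\<omega>. (AA n q p \<omega>)\<^sup>2) \<le> Ca * (\<Sum>k=1..q. (bb n k (snd p) * ?d (fst p) k)\<^sup>2 / lam (real k))"
        unfolding AA_def by (rule ab) auto
      also have "\<dots> \<le> Ca * (\<Sum>k=1..q. ?B * ((?d (fst p) k)\<^sup>2 / lam (real k)))"
      proof (intro mult_left_mono Ca sum_mono)
        fix k assume "k \<in> {1..q}"
        then have l: "0 < lam (real k)" by (intro lam_pos) simp
        have "(bb n k (snd p))\<^sup>2 * ((?d (fst p) k)\<^sup>2 / lam (real k)) \<le> ?B * ((?d (fst p) k)\<^sup>2 / lam (real k))"
          using l by (intro mult_right_mono bb_square[OF n]) simp
        then show "(bb n k (snd p) * ?d (fst p) k)\<^sup>2 / lam (real k) \<le> ?B * ((?d (fst p) k)\<^sup>2 / lam (real k))"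
          by (simp only: power_mult_distrib times_divide_eq_right)
      qed
      finally show "expectation (\<lambda>\<omega>. (AA n q p \<omega>)\<^sup>2) \<le> Ca * (\<Sum>k=1..q. ?B * ((?d (fst p) k)\<^sup>2 / lam (real k)))" .
    qed
    also have "\<dots> = Ca * ?B * (\<Sum>j=1..m n. \<Sum>k=1..q. (\<Sum>i=1..n. (?d i k)\<^sup>2) / lam (real k))"
    proof -
      have "(\<Sum>p\<in>PP n. Ca * (\<Sum>k=1..q. ?B * ((?d (fst p) k)\<^sup>2 / lam (real k)))) = (\<Sum>j=1..m n. \<Sum>i=1..n. \<Sum>k=1..q. Ca * ?B * ((?d i k)\<^sup>2 / lam (real k)))"
        unfolding sum_PP fst_conv sum_distrib_left by (simp only: mult.assoc)
      also have "\<dots> = (\<Sum>j=1..m n. \<Sum>k=1..q. \<Sum>i=1..n. Ca * ?B * ((?d i k)\<^sup>2 / lam (real k)))"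
        by (intro sum.cong refl sum.swap)
      finally show ?thesis unfolding sum_distrib_left sum_divide_distrib .
    qed
    also have "\<dots> \<le> Ca * ?B * (\<Sum>j=1..m n. C * sqrt ?h)"
    proof (intro mult_left_mono[OF _ mult_nonneg_nonneg[OF Ca B0]] sum_mono)
      have "(\<Sum>k=1..q. (\<Sum>i=1..n. (?d i k)\<^sup>2) / lam (real k)) \<le> (\<Sum>k=1..q. wk ?h k)"
      proof (rule sum_mono)
        fix k assume "k \<in> {1..q}"
        then have l: "0 < lam (real k)" by (intro lam_pos) simp
        define g where "g = exp (- lam (real k) * ?h)"
        have g: "0 \<le> g" "g \<le> 1" using l by (auto simp: g_def)
        have e: "exp (- lam (real k) * tt n i) = g ^ i" for i
          unfolding g_def tt_def by (simp add: mult_ac flip: exp_of_nat_mult)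
        have "(\<Sum>i=1..n. (?d i k)\<^sup>2) \<le> 1 - g" unfolding e by (rule sum_geometric_increments_square_le[OF g])
        then show "(\<Sum>i=1..n. (?d i k)\<^sup>2) / lam (real k) \<le> wk ?h k" unfolding wk_def g_def using l by (intro divide_right_mono) auto
      qed
      also have "\<dots> \<le> C * sqrt ?h" using n by (intro C) simp
      finally show "(\<Sum>k=1..q. (\<Sum>i=1..n. (?d i k)\<^sup>2) / lam (real k)) \<le> C * sqrt ?h" .
    qed
    also have "\<dots> = 2 * Ca * ?s * C * sqrt (real (m n) / real n)"
    proof -
      have mp: "0 < real (m n)" using m_ge1[OF n] by simp
      have "real (m n) / sqrt (real (m n)) = sqrt (real (m n))" using mp by (simp add: real_div_sqrt)
      moreover have "Ca * ?B * (\<Sum>j=1..m n. C * sqrt ?h) = 2 * Ca * ?s * C * ((real (m n) / sqrt (real (m n))) * sqrt ?h)" by simp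
      ultimately show ?thesis by (simp add: real_sqrt_divide)
    qed
    finally show "(\<Sum>p\<in>PP n. expectation (\<lambda>\<omega>. (AA n q p \<omega>)\<^sup>2)) \<le> 2 * Ca * ?s * C * sqrt (real (m n) / real n)" .
  qed
qed

lemma XX_square_sum: assumes n: "1 \<le> n"
  shows "(\<Sum>p\<in>PP n. (XX n p \<omega>)\<^sup>2) = sqrt (real (m n) * real n) * vol_estimator \<theta>1 \<theta>2 X n (m n) (y n) \<omega>"
proof -
  let ?I = "\<lambda>j i. (increment X n i (y n j) \<omega>)\<^sup>2 * exp (y n j * \<theta>1 / \<theta>2)"
  have wx: "(wx n j)\<^sup>2 = (ww n)\<^sup>2 * exp (y n j * \<theta>1 / \<theta>2)" for j
    unfolding wx_def power_mult_distrib by (simp add: power2_eq_square flip: exp_add)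
  have "(\<Sum>p\<in>PP n. (XX n p \<omega>)\<^sup>2) = (\<Sum>j=1..m n. \<Sum>i=1..n. (ww n)\<^sup>2 * ?I j i)"
    unfolding sum_PP XX_def fst_conv snd_conv power_mult_distrib wx by (simp only: mult_ac)
  also have "\<dots> = (ww n)\<^sup>2 * (\<Sum>j=1..m n. \<Sum>i=1..n. ?I j i)" unfolding sum_distrib_left ..
  also have "(ww n)\<^sup>2 = sqrt (real (m n) * real n) * (sqrt (pi * \<theta>2) / (real (m n) * real n * sqrt (\<Delta> n)))"
  proof -
    define u v where "u = sqrt (real (m n))" and "v = sqrt (real n)"
    have uv: "0 < u" "0 < v" "real (m n) = u * u" "real n = v * v" using m_ge1[OF n] n by (auto simp: u_def v_def)
    show ?thesis unfolding ww_square[OF n] \<Delta>_def real_sqrt_mult real_sqrt_divide u_def[symmetric] v_def[symmetric] uv(3,4)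
      using uv(1,2) by (simp add: real_sqrt_mult_self)
  qed
  finally show ?thesis unfolding vol_estimator_def by (simp only: mult.assoc)
qed

end

section \<open>The central limit theorem\<close>

lemma normal_distribution: assumes "0 < s"
  shows "real_distribution (density lborel (normal_density 0 s))" "char (density lborel (normal_density 0 s)) t = exp (- t\<^sup>2 * s\<^sup>2 / 2)"
proof -
  interpret N: real_distribution std_normal_distribution by (rule real_dist_normal_dist)
  show "real_distribution (density lborel (normal_density 0 s))"
    using prob_space_normal_density[OF assms] by (auto simp: real_distribution_def real_distribution_axioms_def)
  have "distributed std_normal_distribution lborel (\<lambda>x. x) std_normal_density"
    unfolding distributed_def by (auto intro!: measure_eqI simp: emeasure_distr)
  then have "distributed std_normal_distribution lborel (\<lambda>x. 0 + s * x) (normal_density (0 + s * 0) (\<bar>s\<bar> * 1))"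
    by (rule N.normal_density_affine) (use assms in auto)
  then have "distr std_normal_distribution lborel (\<lambda>x. s * x) = density lborel (normal_density 0 s)"
    using assms by (simp add: distributed_def)
  then have "char (density lborel (normal_density 0 s)) t = char (distr std_normal_distribution lborel (\<lambda>x. s * x)) t" by simp
  also have "\<dots> = char std_normal_distribution (t * s)"
    unfolding char_def by (subst integral_distr) (auto simp: mult.assoc)
  also have "\<dots> = exp (- t\<^sup>2 * s\<^sup>2 / 2)" by (simp add: char_std_normal_distribution power_mult_distrib)
  finally show "char (density lborel (normal_density 0 s)) t = exp (- t\<^sup>2 * s\<^sup>2 / 2)" .
qed

text \<open>The phase \<open>- pi / 2\<close> turns the cosine into a sine, so real limits of
  cosines determine the limit of the characteristic function.\<close>

lemma (in prob_space) char_distr_cos: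
  assumes [measurable]: "T \<in> borel_measurable M"
  shows "char (distr M borel T) t = Complex (expectation (\<lambda>\<omega>. cos (t * T \<omega> + 0))) (expectation (\<lambda>\<omega>. cos (t * T \<omega> + (- pi / 2))))"
proof -
  have c: "char (distr M borel T) t = (\<integral>\<omega>. iexp (t * T \<omega>) \<partial>M)" unfolding char_def by (subst integral_distr) auto
  have i: "integrable M (\<lambda>\<omega>. iexp (t * T \<omega>))" by (rule integrable_const_bound[where B=1]) auto
  have e: "Re (iexp x) = cos (x + 0)" "Im (iexp x) = cos (x + (- pi / 2))" for x
    by (simp_all add: Re_exp Im_exp cos_diff)
  show ?thesis
    unfolding c complex_eq_iff complex.sel integral_Re[OF i, symmetric] integral_Im[OF i, symmetric] e by (intro conjI refl)
qed

section \<open>Convergence of the characteristic functions\<close>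

context spde_observation
begin

definition TT :: "nat \<Rightarrow> 'w \<Rightarrow> real" where
  "TT n \<omega> = sqrt (real (m n) * real n) * (vol_estimator \<theta>1 \<theta>2 X n (m n) (y n) \<omega> - \<sigma>\<^sup>2)"

lemma TT_XX: "1 \<le> n \<Longrightarrow> TT n \<omega> = (\<Sum>p\<in>PP n. (XX n p \<omega>)\<^sup>2) - sqrt (real (m n) * real n) * \<sigma>\<^sup>2"
  unfolding TT_def by (simp add: XX_square_sum right_diff_distrib)

lemma TT_measurable: "TT n \<in> borel_measurable M"
proof (cases "1 \<le> n")
  case True
  have "(\<lambda>\<omega>. (\<Sum>p\<in>PP n. (XX n p \<omega>)\<^sup>2) - sqrt (real (m n) * real n) * \<sigma>\<^sup>2) \<in> borel_measurable M"
    by (intro borel_measurable_diff borel_measurable_sum borel_measurable_power L2_measurable[OF XX_L2[OF True]]) auto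
  then show ?thesis by (simp add: TT_XX[OF True, symmetric])
next
  case False
  \<comment> \<open>At \<open>n = 0\<close> the factor \<open>sqrt (m n * n)\<close> vanishes; weak
    convergence is stated for a sequence that includes this member.\<close>
  then have "TT n = (\<lambda>_. 0)" by (auto simp: TT_def)
  then show ?thesis by simp
qed

lemma cos_TT_tendsto: "(\<lambda>n. expectation (\<lambda>\<omega>. cos (t * TT n \<omega> + b))) \<longlonglongrightarrow> cos b * exp (- t\<^sup>2 * (\<sigma>^4 * (2 + (\<Sum>r. (I_coeff r)\<^sup>2))) / 2)"
proof -
  obtain R where R: "R \<longlonglongrightarrow> 0" and Rb: "\<And>n. 1 \<le> n \<Longrightarrow> 0 \<le> R n" "\<And>n p. 1 \<le> n \<Longrightarrow> p \<in> PP n \<Longrightarrow> (\<Sum>q\<in>PP n. \<bar>cc n p q\<bar>) < R n"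
    using row_sums_tendsto by blast
  obtain C where C: "0 \<le> C" and Cb: "\<And>n q. 1 \<le> n \<Longrightarrow> (\<Sum>p\<in>PP n. expectation (\<lambda>\<omega>. (AA n q p \<omega>)\<^sup>2)) \<le> C * sqrt (real (m n) / real n)"
    using AA_bound by blast
  let ?V = "\<sigma>^4 * (2 + (\<Sum>r. (I_coeff r)\<^sup>2))"
  define V where "V n = 2 * (\<Sum>p\<in>PP n. \<Sum>q\<in>PP n. (cc n p q)\<^sup>2)" for n
  \<comment> \<open>The bound \<open>sqrt (m / n)\<close> of \<open>AA_bound\<close> is enlarged to
    the root of \<open>m^2 / n\<close>, for which \<open>observation_scheme_growth\<close> supplies
    the limit.\<close>
  define \<alpha> where "\<alpha> n = C * sqrt ((real (m n))\<^sup>2 / real n)" for n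
  define B where "B n = 2 * t\<^sup>2 * (R n * sqrt (V n)) + \<bar>t\<bar> * (\<alpha> n + 2 * sqrt (R n * \<alpha> n) + \<bar>(\<Sum>p\<in>PP n. cc n p p) - sqrt (real (m n) * real n) * \<sigma>\<^sup>2\<bar>)" for n
  have V: "V \<longlonglongrightarrow> ?V" unfolding V_def by (rule variance_tendsto)
  have "\<alpha> \<longlonglongrightarrow> C * sqrt 0" unfolding \<alpha>_def by (intro tendsto_intros observation_scheme_growth[OF scheme])
  then have \<alpha>: "\<alpha> \<longlonglongrightarrow> 0" by simp
  have "B \<longlonglongrightarrow> 2 * t\<^sup>2 * (0 * sqrt ?V) + \<bar>t\<bar> * (0 + 2 * sqrt (0 * 0) + \<bar>0\<bar>)"
    unfolding B_def by (intro tendsto_intros R V \<alpha> trace_tendsto)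
  then have B: "B \<longlonglongrightarrow> 0" by simp
  have bound: "\<bar>expectation (\<lambda>\<omega>. cos (t * TT n \<omega> + b)) - cos b * exp (- t\<^sup>2 * V n / 2)\<bar> \<le> B n" if n: "1 \<le> n" for n
  proof -
    have "finite (PP n)" by (simp add: PP_def)
    moreover have "(\<Sum>p\<in>PP n. expectation (\<lambda>\<omega>. (AA n q p \<omega>)\<^sup>2)) \<le> \<alpha> n" for q
    proof -
      have "real (m n) \<le> (real (m n))\<^sup>2" using m_ge1[OF n] by (simp add: self_le_power)
      then have "C * sqrt (real (m n) / real n) \<le> \<alpha> n" unfolding \<alpha>_def using C by (intro mult_left_mono real_sqrt_le_mono divide_right_mono) auto
      then show ?thesis using Cb[OF n, of q] by linarith
    qed
    ultimately show ?thesis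
      unfolding TT_XX[OF n] B_def V_def
      by (intro gaussian_limit_bound[where G="GG n" and A="AA n"] prob_space_axioms XX_L2 GG_L2 AA_L2 span_gaussian_family GG_span
          GG_AA_factor XX_tendsto GG_cov_tendsto Rb n)
  qed
  have "(\<lambda>n. expectation (\<lambda>\<omega>. cos (t * TT n \<omega> + b)) - cos b * exp (- t\<^sup>2 * V n / 2)) \<longlonglongrightarrow> 0"
    by (rule Lim_null_comparison[OF _ B]) (use eventually_ge_at_top[of 1] in \<open>eventually_elim, use bound in auto\<close>)
  moreover have "(\<lambda>n. cos b * exp (- t\<^sup>2 * V n / 2)) \<longlonglongrightarrow> cos b * exp (- t\<^sup>2 * ?V / 2)" by (intro tendsto_intros V) simp
  ultimately have "(\<lambda>n. (expectation (\<lambda>\<omega>. cos (t * TT n \<omega> + b)) - cos b * exp (- t\<^sup>2 * V n / 2)) + cos b * exp (- t\<^sup>2 * V n / 2))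
     \<longlonglongrightarrow> 0 + cos b * exp (- t\<^sup>2 * ?V / 2)" by (rule tendsto_add)
  then show ?thesis by simp
qed

lemma estimator_clt:
  "weak_conv_m (\<lambda>n. distr M borel (TT n)) (density lborel (normal_density 0 (sqrt (pi * Gamma_const * \<sigma> ^ 4))))"
proof -
  let ?V = "\<sigma>^4 * (2 + (\<Sum>r. (I_coeff r)\<^sup>2))"
  \<comment> \<open>Multiplication by \<open>pi\<close> clears both denominators of
    \<open>Gamma_const\<close>. The summand \<open>2\<close> makes the variance positive, so the
    limit law has a density.\<close>
  have G: "pi * Gamma_const * \<sigma>^4 = ?V" by (simp add: Gamma_const_def field_simps)
  have "0 \<le> (\<Sum>r. (I_coeff r)\<^sup>2)" by (rule suminf_nonneg[OF I_coeff_square_summable]) simp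
  then have V: "0 < ?V" using \<sigma>_pos by (intro mult_pos_pos) auto
  then have s: "0 < sqrt ?V" by simp
  have v: "(sqrt ?V)\<^sup>2 = ?V" using V by simp
  show ?thesis unfolding G
  proof (rule levy_continuity)
    show "real_distribution (distr M borel (TT n))" for n by (rule real_distribution_distr[OF TT_measurable])
    show "real_distribution (density lborel (normal_density 0 (sqrt ?V)))" by (rule normal_distribution(1)[OF s])
    fix t
    have "(\<lambda>n. char (distr M borel (TT n)) t) \<longlonglongrightarrow> Complex (cos 0 * exp (- t\<^sup>2 * ?V / 2)) (cos (- pi / 2) * exp (- t\<^sup>2 * ?V / 2))"
      unfolding char_distr_cos[OF TT_measurable] by (intro tendsto_Complex cos_TT_tendsto)
    moreover have "Complex (cos 0 * exp (- t\<^sup>2 * ?V / 2)) (cos (- pi / 2) * exp (- t\<^sup>2 * ?V / 2)) = char (density lborel (normal_density 0 (sqrt ?V))) t"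
      unfolding normal_distribution(2)[OF s] v by (simp add: complex_eq_iff)
    ultimately show "(\<lambda>n. char (distr M borel (TT n)) t) \<longlonglongrightarrow> char (density lborel (normal_density 0 (sqrt ?V))) t" by simp
  qed
qed

end

theorem theorem3p4:
  fixes M :: "'w measure"
    and \<theta>0 \<theta>1 \<theta>2 \<sigma> \<delta> :: real
    and W :: "nat \<Rightarrow> real \<Rightarrow> 'w \<Rightarrow> real"
    and \<xi> :: "'w \<Rightarrow> real \<Rightarrow> real"
    and X :: "real \<Rightarrow> real \<Rightarrow> 'w \<Rightarrow> real"
    and m :: "nat \<Rightarrow> nat"
    and y :: "nat \<Rightarrow> nat \<Rightarrow> real"
  assumes "prob_space M"
    and "\<theta>2 > 0"
    and "\<sigma> > 0"
    and "\<forall>k\<ge>1. eigval \<theta>0 \<theta>1 \<theta>2 k > 0"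
    and "independent_brownian_motions M W"
    and "\<xi> \<in> measurable M (H_borel \<theta>1 \<theta>2)"
    and "independent_rvs M (H_borel \<theta>1 \<theta>2) \<xi>
           (PiM {1..} (\<lambda>_. PiM {0..} (\<lambda>_. borel))) (\<lambda>\<omega>. \<lambda>k\<in>{1..}. \<lambda>t\<in>{0..}. W k t \<omega>)"
    and "continuous_mild_solution M \<theta>0 \<theta>1 \<theta>2 \<sigma> W \<xi> X"
    and "initial_condition M \<theta>0 \<theta>1 \<theta>2 \<xi>"
    and "observation_scheme m y \<delta>"
  shows "weak_conv_m
           (\<lambda>n. distr M borel (\<lambda>\<omega>. sqrt (real (m n) * real n) *
                  (vol_estimator \<theta>1 \<theta>2 X n (m n) (y n) \<omega> - \<sigma>\<^sup>2)))
           (density lborel (normal_density 0 (sqrt (pi * Gamma_const * \<sigma> ^ 4))))"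
proof -
  define c0 a where "c0 = - \<theta>0 + \<theta>1\<^sup>2 / (4 * \<theta>2)" and "a = pi\<^sup>2 * \<theta>2"
  interpret prob_space M by fact
  interpret theta_series c0 a by standard (use assms(2) in \<open>simp add: a_def\<close>)
  have lam: "eigval \<theta>0 \<theta>1 \<theta>2 k = lam (real k)" for k
    unfolding eigval_def lam_def by (simp add: c0_def a_def)
  interpret spde_observation M W c0 a \<theta>0 \<theta>1 \<theta>2 \<sigma> \<xi> X \<delta> m y
    by standard (use assms in \<open>auto simp: lam c0_def a_def\<close>)
  show ?thesis using estimator_clt unfolding TT_def[abs_def] .
qed

end
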